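(* Let $\Omega\subset\mathbb{R}^2$ be a bounded domain with smooth boundary and let $s\in(0,2]$. Let $\{\nu_n\}$ be a sequence of positive numbers converging to $0$, and let $\{\theta_0^{\nu_n}\}$ be a bounded sequence in $L^2(\Omega)$. For each $n$ let $\theta^{\nu_n}$ be a Leray-Hopf weak solution of the dissipative SQG equation with viscosity $\nu_n$ and initial data $\theta_0^{\nu_n}$. Let $T>0$ and let $\theta$ be the weak limit in $L^2(0,T;L^2(\Omega))$ of some subsequence of $\{\theta^{\nu_n}\}$. Then $\theta$ is a weak solution of the inviscid SQG equation on $[0,T]$, i.e., with $u=\nabla^\perp\Lambda^{-1}\theta$, $$\int_0^T\!\int_\Omega\theta\,\partial_t\varphi\,dx\,dt+\int_0^T\!\int_\Omega u\theta\cdot\nabla\varphi\,dx\,dt=0\qquad\text{for all }\varphi\in C_c^\infty(\Omega\times(0,T)).$$ Moreover, $\theta\in C([0,T];D(\Lambda^{-\varepsilon}))$ for every $\varepsilon>0$, and when $s\in(0,1]$ the Hamiltonian $H(t)=\|\theta(t)\|_{D(\Lambda^{-1/2})}^2$ is constant on $[0,T]$.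
   Context: All functions are real-valued. $-\Delta$ is the Dirichlet Laplacian on $\Omega$ with domain $H^2(\Omega)\cap H^1_0(\Omega)$; $\{w_j\}_{j\ge1}$ is an orthonormal basis of $L^2(\Omega)$ of eigenfunctions, $-\Delta w_j=\lambda_jw_j$, $0<\lambda_1<\lambda_2\le\dots\to\infty$. $\Lambda=\sqrt{-\Delta}$ and, for $\sigma\ge0$, $\Lambda^\sigma f=\sum_j\lambda_j^{\sigma/2}f_jw_j$ for $f=\sum_jf_jw_j$, $f_j=\int_\Omega fw_j\,dx$, with domain $D(\Lambda^\sigma)=\{f\in L^2(\Omega):(\lambda_j^{\sigma/2}f_j)_j\in\ell^2\}$ and norm $\|f\|_{D(\Lambda^\sigma)}=\|(\lambda_j^{\sigma/2}f_j)_j\|_{\ell^2}$. For $\sigma>0$, $D(\Lambda^{-\sigma})$ is the space of series $f=\sum_jf_jw_j$ with $f_j\in\mathbb{R}$ and $\|f\|_{D(\Lambda^{-\sigma})}^2=\sum_j\lambda_j^{-\sigma}f_j^2<\infty$; it is the dual of $D(\Lambda^\sigma)$ with pivot space $L^2(\Omega)$, and $\Lambda^{-\sigma}f=\sum_j\lambda_j^{-\sigma/2}f_jw_j$. $\nabla^\perp=(-\partial_2,\partial_1)$. $C_w(0,\infty;L^2(\Omega))$ denotes functions of $t\in[0,\infty)$ with values in $L^2(\Omega)$ that are weakly continuous. The dissipative SQG equation with viscosity $\nu>0$ is $\partial_t\theta+u\cdot\nabla\theta+\nu\Lambda^s\theta=0$, $u=\nabla^\perp\Lambda^{-1}\theta$,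 in $\Omega\times[0,\infty)$. A Leray-Hopf weak solution of it with initial data $\theta_0\in L^2(\Omega)$ is a function $\theta\in C_w(0,\infty;L^2(\Omega))\cap L^2(0,\infty;D(\Lambda^{\frac s2}))$ such that: (1) for every $\phi\in C_c^\infty((0,\infty))$ and $\varphi\in D(\Lambda^2)$, $$\int_0^\infty\!\int_\Omega\theta\,\varphi(x)\,dx\,\partial_t\phi(t)\,dt+\int_0^\infty\!\int_\Omega u\theta\cdot\nabla\varphi(x)\,dx\,\phi(t)\,dt-\nu\int_0^\infty\!\int_\Omega\Lambda^{\frac s2}\theta\,\Lambda^{\frac s2}\varphi(x)\,dx\,\phi(t)\,dt=0;$$ (2) for a.e. $t>0$, $\tfrac12\|\theta(\cdot,t)\|_{L^2(\Omega)}^2+\nu\int_0^t\int_\Omega|\Lambda^{\frac s2}\theta|^2\,dx\,dr\le\tfrac12\|\theta_0\|_{L^2(\Omega)}^2$; (3) for a.e. $t>0$, $\tfrac12\|\theta(\cdot,t)\|_{D(\Lambda^{-1/2})}^2+\nu\int_0^t\int_\Omega|\Lambda^{\frac{s-1}2}\theta|^2\,dx\,dr=\tfrac12\|\theta_0\|_{D(\Lambda^{-1/2})}^2$. The inviscid SQG equation is $\partial_t\theta+u\cdot\nabla\theta=0$, $u=\nabla^\perp\Lambda^{-1}\theta$. The statement $\theta\in C([0,T];D(\Lambda^{-\varepsilon}))$ means that $\theta$ has a representative (equal to it for a.e. $t$) with this continuity; $H(t)$ is computed with this representative. *)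

theory Defs
  imports "HOL-Analysis.Analysis"
begin

section \<open>Smooth functions, test functions, smooth bounded domains\<close>

text \<open>Intended for open \<open>S\<close>. On an open set, \<open>C\<^sup>m\<^sup>+\<^sup>1\<close> means differentiable with all directional
  derivatives along the standard basis (the partial derivatives) of class \<open>C\<^sup>m\<close>.\<close>

primrec Ck_on :: "nat \<Rightarrow> 'a::euclidean_space set \<Rightarrow> ('a \<Rightarrow> real) \<Rightarrow> bool" where
  "Ck_on 0 S f \<longleftrightarrow> continuous_on S f"
| "Ck_on (Suc m) S f \<longleftrightarrow>
     (\<forall>x\<in>S. f differentiable (at x)) \<and>
     (\<forall>b\<in>Basis. Ck_on m S (\<lambda>x. frechet_derivative f (at x) b))"

definition smooth_on :: "'a::euclidean_space set \<Rightarrow> ('a \<Rightarrow> real) \<Rightarrow> bool" where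
  "smooth_on S f \<longleftrightarrow> (\<forall>m. Ck_on m S f)"

text \<open>\<open>C\<^sub>c\<^sup>\<infinity>(U)\<close> for open \<open>U\<close>, its elements being extended by zero to the whole space.\<close>

definition test_functions :: "'a::euclidean_space set \<Rightarrow> ('a \<Rightarrow> real) set" where
  "test_functions U = {f. smooth_on UNIV f \<and> (\<exists>K. compact K \<and> K \<subseteq> U \<and> (\<forall>x. x \<notin> K \<longrightarrow> f x = 0))}"

text \<open>Near each boundary point the domain is, in suitable Cartesian coordinates, the region above
  the graph of a smooth function.\<close>

definition smooth_bounded_domain :: "(real^2) set \<Rightarrow> bool" where
  "smooth_bounded_domain \<Omega> \<longleftrightarrow>
     open \<Omega> \<and> connected \<Omega> \<and> \<Omega> \<noteq> {} \<and> bounded \<Omega> \<and>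
     (\<forall>p\<in>frontier \<Omega>. \<exists>r>0. \<exists>Q :: real^2 \<Rightarrow> real^2. \<exists>\<gamma> :: real \<Rightarrow> real.
        orthogonal_transformation Q \<and> smooth_on UNIV \<gamma> \<and>
        \<Omega> \<inter> ball p r = {x \<in> ball p r. Q x $ 2 > \<gamma> (Q x $ 1)})"

section \<open>The space \<open>L\<^sup>2(\<Omega>)\<close>\<close>

text \<open>Elements are represented by functions on the whole plane; only their values on \<open>\<Omega>\<close> up to null
  sets matter.\<close>

definition L2 :: "(real^2) set \<Rightarrow> (real^2 \<Rightarrow> real) set" where
  "L2 \<Omega> = {f. f \<in> borel_measurable (lebesgue_on \<Omega>) \<and> integrable (lebesgue_on \<Omega>) (\<lambda>x. (f x)\<^sup>2)}"

definition L2_inner :: "(real^2) set \<Rightarrow> (real^2 \<Rightarrow> real) \<Rightarrow> (real^2 \<Rightarrow> real) \<Rightarrow> real" where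
  "L2_inner \<Omega> f g = (LINT x|lebesgue_on \<Omega>. f x * g x)"

definition L2_norm :: "(real^2) set \<Rightarrow> (real^2 \<Rightarrow> real) \<Rightarrow> real" where
  "L2_norm \<Omega> f = sqrt (LINT x|lebesgue_on \<Omega>. (f x)\<^sup>2)"

section \<open>Weak derivatives, Sobolev spaces and the Dirichlet Laplacian\<close>

definition locally_integrable :: "(real^2) set \<Rightarrow> (real^2 \<Rightarrow> real) \<Rightarrow> bool" where
  "locally_integrable \<Omega> f \<longleftrightarrow> (\<forall>K. compact K \<and> K \<subseteq> \<Omega> \<longrightarrow> integrable (lebesgue_on K) f)"

definition is_weak_pderiv :: "(real^2) set \<Rightarrow> 2 \<Rightarrow> (real^2 \<Rightarrow> real) \<Rightarrow> (real^2 \<Rightarrow> real) \<Rightarrow> bool" where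
  "is_weak_pderiv \<Omega> i f g \<longleftrightarrow>
     locally_integrable \<Omega> f \<and> locally_integrable \<Omega> g \<and>
     (\<forall>\<eta> \<in> test_functions \<Omega>.
        (LINT x|lebesgue_on \<Omega>. f x * frechet_derivative \<eta> (at x) (axis i 1))
          = - (LINT x|lebesgue_on \<Omega>. g x * \<eta> x))"

text \<open>A weak derivative is unique up to null sets; the choice below picks a representative, and it is
  meaningful only when a weak derivative exists.\<close>

definition weak_pderiv :: "(real^2) set \<Rightarrow> 2 \<Rightarrow> (real^2 \<Rightarrow> real) \<Rightarrow> real^2 \<Rightarrow> real" where
  "weak_pderiv \<Omega> i f = (SOME g. is_weak_pderiv \<Omega> i f g)"

definition weak_grad :: "(real^2) set \<Rightarrow> (real^2 \<Rightarrow> real) \<Rightarrow> real^2 \<Rightarrow> real^2" where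
  "weak_grad \<Omega> f x = (\<chi> i. weak_pderiv \<Omega> i f x)"

definition weak_perp_grad :: "(real^2) set \<Rightarrow> (real^2 \<Rightarrow> real) \<Rightarrow> real^2 \<Rightarrow> real^2" where
  "weak_perp_grad \<Omega> f x = vector [- weak_pderiv \<Omega> 2 f x, weak_pderiv \<Omega> 1 f x]"

definition H1 :: "(real^2) set \<Rightarrow> (real^2 \<Rightarrow> real) set" where
  "H1 \<Omega> = {f \<in> L2 \<Omega>. \<forall>i. \<exists>g \<in> L2 \<Omega>. is_weak_pderiv \<Omega> i f g}"

definition H2 :: "(real^2) set \<Rightarrow> (real^2 \<Rightarrow> real) set" where
  "H2 \<Omega> = {f \<in> H1 \<Omega>. \<forall>i. weak_pderiv \<Omega> i f \<in> H1 \<Omega>}"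

text \<open>\<open>H\<^sup>1\<^sub>0(\<Omega>)\<close> is the closure of \<open>C\<^sub>c\<^sup>\<infinity>(\<Omega>)\<close> in \<open>H\<^sup>1(\<Omega>)\<close>.\<close>

definition H10 :: "(real^2) set \<Rightarrow> (real^2 \<Rightarrow> real) set" where
  "H10 \<Omega> = {f \<in> H1 \<Omega>. \<exists>\<eta> :: nat \<Rightarrow> real^2 \<Rightarrow> real.
     (\<forall>k. \<eta> k \<in> test_functions \<Omega>) \<and>
     (\<lambda>k. L2_norm \<Omega> (\<lambda>x. \<eta> k x - f x)) \<longlonglongrightarrow> 0 \<and>
     (\<forall>i. (\<lambda>k. L2_norm \<Omega> (\<lambda>x. frechet_derivative (\<eta> k) (at x) (axis i 1) - weak_pderiv \<Omega> i f x))
            \<longlonglongrightarrow> 0)}"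

definition weak_laplacian :: "(real^2) set \<Rightarrow> (real^2 \<Rightarrow> real) \<Rightarrow> real^2 \<Rightarrow> real" where
  "weak_laplacian \<Omega> f x = (\<Sum>i\<in>UNIV. weak_pderiv \<Omega> i (weak_pderiv \<Omega> i f) x)"

text \<open>The enumeration starts at \<open>0\<close>, so \<open>w 0, lam 0\<close> are the first eigenfunction and eigenvalue.\<close>

definition dirichlet_eigenbasis ::
  "(real^2) set \<Rightarrow> (nat \<Rightarrow> real^2 \<Rightarrow> real) \<Rightarrow> (nat \<Rightarrow> real) \<Rightarrow> bool" where
  "dirichlet_eigenbasis \<Omega> w lam \<longleftrightarrow>
     (\<forall>j. w j \<in> H2 \<Omega> \<inter> H10 \<Omega>) \<and>
     (\<forall>j. AE x in lebesgue_on \<Omega>. - weak_laplacian \<Omega> (w j) x = lam j * w j x) \<and>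
     (\<forall>i j. L2_inner \<Omega> (w i) (w j) = (if i = j then 1 else 0)) \<and>
     (\<forall>f \<in> L2 \<Omega>. (\<lambda>N. L2_norm \<Omega> (\<lambda>x. f x - (\<Sum>j<N. L2_inner \<Omega> f (w j) * w j x))) \<longlonglongrightarrow> 0) \<and>
     0 < lam 0 \<and> lam 0 < lam 1 \<and> mono lam \<and> filterlim lam at_top sequentially"

section \<open>Fractional powers of the Dirichlet Laplacian\<close>

definition coef :: "(real^2) set \<Rightarrow> (nat \<Rightarrow> real^2 \<Rightarrow> real) \<Rightarrow> (real^2 \<Rightarrow> real) \<Rightarrow> nat \<Rightarrow> real" where
  "coef \<Omega> w f j = L2_inner \<Omega> f (w j)"

text \<open>For a real number \<open>\<sigma>\<close> of either sign, \<open>D(\<Lambda>\<^sup>\<sigma>)\<close> is described by sequences of coefficients.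
  For \<open>\<sigma> < 0\<close> these sequences are the elements themselves (formal series \<open>\<Sum>\<^sub>j a\<^sub>j w\<^sub>j\<close>).\<close>

definition D_seq :: "(nat \<Rightarrow> real) \<Rightarrow> real \<Rightarrow> (nat \<Rightarrow> real) set" where
  "D_seq lam \<sigma> = {a. summable (\<lambda>j. (lam j powr (\<sigma> / 2) * a j)\<^sup>2)}"

definition D_norm :: "(nat \<Rightarrow> real) \<Rightarrow> real \<Rightarrow> (nat \<Rightarrow> real) \<Rightarrow> real" where
  "D_norm lam \<sigma> a = sqrt (\<Sum>j. (lam j powr (\<sigma> / 2) * a j)\<^sup>2)"

text \<open>\<open>D(\<Lambda>\<^sup>\<sigma>)\<close> as a space of functions, for \<open>\<sigma> \<ge> 0\<close>.\<close>

definition D_fun :: "(real^2) set \<Rightarrow> (nat \<Rightarrow> real^2 \<Rightarrow> real) \<Rightarrow> (nat \<Rightarrow> real) \<Rightarrow> real \<Rightarrow> (real^2 \<Rightarrow> real) set" where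
  "D_fun \<Omega> w lam \<sigma> = {f \<in> L2 \<Omega>. coef \<Omega> w f \<in> D_seq lam \<sigma>}"

text \<open>The function \<open>\<Lambda>\<^sup>\<sigma> f = \<Sum>\<^sub>j \<lambda>\<^sub>j\<^sup>\<sigma>\<^sup>/\<^sup>2 f\<^sub>j w\<^sub>j\<close>, the series converging in \<open>L\<^sup>2(\<Omega>)\<close>, for
  \<open>f \<in> L\<^sup>2(\<Omega>)\<close> if \<open>\<sigma> \<le> 0\<close> and for \<open>f \<in> D(\<Lambda>\<^sup>\<sigma>)\<close> if \<open>\<sigma> > 0\<close>; it is determined up to null sets.\<close>

definition Lam ::
  "(real^2) set \<Rightarrow> (nat \<Rightarrow> real^2 \<Rightarrow> real) \<Rightarrow> (nat \<Rightarrow> real) \<Rightarrow> real \<Rightarrow> (real^2 \<Rightarrow> real) \<Rightarrow> real^2 \<Rightarrow> real" where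
  "Lam \<Omega> w lam \<sigma> f = (SOME g. g \<in> L2 \<Omega> \<and>
     (\<lambda>N. L2_norm \<Omega> (\<lambda>x. g x - (\<Sum>j<N. lam j powr (\<sigma> / 2) * coef \<Omega> w f j * w j x))) \<longlonglongrightarrow> 0)"

definition sqg_velocity ::
  "(real^2) set \<Rightarrow> (nat \<Rightarrow> real^2 \<Rightarrow> real) \<Rightarrow> (nat \<Rightarrow> real) \<Rightarrow> (real^2 \<Rightarrow> real) \<Rightarrow> real^2 \<Rightarrow> real^2" where
  "sqg_velocity \<Omega> w lam f = weak_perp_grad \<Omega> (Lam \<Omega> w lam (-1) f)"

section \<open>Functions of time with values in function spaces\<close>

text \<open>The Bochner space \<open>L\<^sup>2(I; X)\<close> for a function space \<open>X\<close> with norm \<open>N\<close>: strongly measurable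
  functions (a.e. limits of finitely valued measurable functions) with square integrable norm.\<close>

definition bochner_L2 ::
  "real set \<Rightarrow> (real^2 \<Rightarrow> real) set \<Rightarrow> ((real^2 \<Rightarrow> real) \<Rightarrow> real) \<Rightarrow> (real \<Rightarrow> real^2 \<Rightarrow> real) set" where
  "bochner_L2 I X N = {f.
     (AE t in lebesgue_on I. f t \<in> X) \<and>
     (\<exists>\<sigma> :: nat \<Rightarrow> real \<Rightarrow> real^2 \<Rightarrow> real.
        (\<forall>k. finite (\<sigma> k ` I) \<and> \<sigma> k ` I \<subseteq> X \<and>
             (\<forall>v. {t \<in> I. \<sigma> k t = v} \<in> sets (lebesgue_on I))) \<and>
        (AE t in lebesgue_on I. (\<lambda>k. N (\<lambda>x. \<sigma> k t x - f t x)) \<longlonglongrightarrow> 0)) \<and>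
     (\<integral>\<^sup>+ t. ennreal ((N (f t))\<^sup>2) \<partial>lebesgue_on I) < \<infinity>}"

abbreviation L2_L2 :: "real \<Rightarrow> (real^2) set \<Rightarrow> (real \<Rightarrow> real^2 \<Rightarrow> real) set" where
  "L2_L2 T \<Omega> \<equiv> bochner_L2 {0<..<T} (L2 \<Omega>) (L2_norm \<Omega>)"

definition weakly_converges_L2_L2 ::
  "real \<Rightarrow> (real^2) set \<Rightarrow> (nat \<Rightarrow> real \<Rightarrow> real^2 \<Rightarrow> real) \<Rightarrow> (real \<Rightarrow> real^2 \<Rightarrow> real) \<Rightarrow> bool" where
  "weakly_converges_L2_L2 T \<Omega> f g \<longleftrightarrow>
     (\<forall>k. f k \<in> L2_L2 T \<Omega>) \<and> g \<in> L2_L2 T \<Omega> \<and>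
     (\<forall>h \<in> L2_L2 T \<Omega>.
        (\<lambda>k. LINT t|lebesgue_on {0<..<T}. L2_inner \<Omega> (f k t) (h t))
          \<longlonglongrightarrow> (LINT t|lebesgue_on {0<..<T}. L2_inner \<Omega> (g t) (h t)))"

definition weakly_continuous_L2 :: "(real^2) set \<Rightarrow> (real \<Rightarrow> real^2 \<Rightarrow> real) \<Rightarrow> bool" where
  "weakly_continuous_L2 \<Omega> f \<longleftrightarrow>
     (\<forall>t\<ge>0. f t \<in> L2 \<Omega>) \<and> (\<forall>g \<in> L2 \<Omega>. continuous_on {0..} (\<lambda>t. L2_inner \<Omega> (f t) g))"

definition continuous_D :: "(nat \<Rightarrow> real) \<Rightarrow> real \<Rightarrow> real \<Rightarrow> (real \<Rightarrow> nat \<Rightarrow> real) \<Rightarrow> bool" where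
  "continuous_D lam \<sigma> T a \<longleftrightarrow>
     (\<forall>t\<in>{0..T}. a t \<in> D_seq lam \<sigma>) \<and>
     (\<forall>t\<in>{0..T}. ((\<lambda>r. D_norm lam \<sigma> (\<lambda>j. a r j - a t j)) \<longlongrightarrow> 0) (at t within {0..T}))"

section \<open>Weak solutions of the SQG equations\<close>

definition leray_hopf_solution ::
  "(real^2) set \<Rightarrow> (nat \<Rightarrow> real^2 \<Rightarrow> real) \<Rightarrow> (nat \<Rightarrow> real) \<Rightarrow> real \<Rightarrow> real \<Rightarrow>
   (real^2 \<Rightarrow> real) \<Rightarrow> (real \<Rightarrow> real^2 \<Rightarrow> real) \<Rightarrow> bool" where
  "leray_hopf_solution \<Omega> w lam s \<nu> \<theta>0 \<theta> \<longleftrightarrow>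
     \<theta>0 \<in> L2 \<Omega> \<and>
     weakly_continuous_L2 \<Omega> \<theta> \<and>
     \<theta> \<in> bochner_L2 {0<..} (D_fun \<Omega> w lam (s / 2)) (\<lambda>f. D_norm lam (s / 2) (coef \<Omega> w f)) \<and>
     (\<forall>\<phi> \<in> test_functions {0<..}. \<forall>\<psi> \<in> D_fun \<Omega> w lam 2.
        (LINT t|lebesgue_on {0<..}. (LINT x|lebesgue_on \<Omega>. \<theta> t x * \<psi> x) * deriv \<phi> t)
        + (LINT t|lebesgue_on {0<..}. (LINT x|lebesgue_on \<Omega>.
              (\<theta> t x *\<^sub>R sqg_velocity \<Omega> w lam (\<theta> t) x) \<bullet> weak_grad \<Omega> \<psi> x) * \<phi> t)
        - \<nu> * (LINT t|lebesgue_on {0<..}. (LINT x|lebesgue_on \<Omega>.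
              Lam \<Omega> w lam (s / 2) (\<theta> t) x * Lam \<Omega> w lam (s / 2) \<psi> x) * \<phi> t) = 0) \<and>
     (AE t in lebesgue_on {0<..}.
        (L2_norm \<Omega> (\<theta> t))\<^sup>2 / 2
        + \<nu> * (LINT r|lebesgue_on {0<..<t}. LINT x|lebesgue_on \<Omega>. (Lam \<Omega> w lam (s / 2) (\<theta> r) x)\<^sup>2)
        \<le> (L2_norm \<Omega> \<theta>0)\<^sup>2 / 2) \<and>
     (AE t in lebesgue_on {0<..}.
        (D_norm lam (- 1 / 2) (coef \<Omega> w (\<theta> t)))\<^sup>2 / 2
        + \<nu> * (LINT r|lebesgue_on {0<..<t}. LINT x|lebesgue_on \<Omega>.
              (Lam \<Omega> w lam ((s - 1) / 2) (\<theta> r) x)\<^sup>2)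
        = (D_norm lam (- 1 / 2) (coef \<Omega> w \<theta>0))\<^sup>2 / 2)"

text \<open>Test functions \<open>\<phi>\<close> on space-time take the pair \<open>(x, t)\<close>.\<close>

definition inviscid_weak_solution ::
  "(real^2) set \<Rightarrow> (nat \<Rightarrow> real^2 \<Rightarrow> real) \<Rightarrow> (nat \<Rightarrow> real) \<Rightarrow> real \<Rightarrow>
   (real \<Rightarrow> real^2 \<Rightarrow> real) \<Rightarrow> bool" where
  "inviscid_weak_solution \<Omega> w lam T \<theta> \<longleftrightarrow>
     (\<forall>\<phi> \<in> test_functions (\<Omega> \<times> {0<..<T}).
        (LINT t|lebesgue_on {0<..<T}. LINT x|lebesgue_on \<Omega>.
            \<theta> t x * frechet_derivative \<phi> (at (x, t)) (0, 1))
        + (LINT t|lebesgue_on {0<..<T}. LINT x|lebesgue_on \<Omega>.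
            (\<theta> t x *\<^sub>R sqg_velocity \<Omega> w lam (\<theta> t) x)
              \<bullet> (\<chi> i. frechet_derivative \<phi> (at (x, t)) (axis i 1, 0))) = 0)"

end

(*
  For a test function phi on Omega put b_jk = int w_j grad^perp w_k . grad phi. This array is
  antisymmetric, and (lambda_j - lambda_k) b_jk is a bounded form in the gradients of w_j and w_k,
  as in the weak formulation of the Euler equations in terms of u (x) u. Symmetrizing, the nonlinear
  term int theta u . grad phi becomes an integral over z > 0 of such forms evaluated at exp(-z Lambda) Lambda^(-1) theta, hence is bounded by a multiple of
  |theta|^2 in D(Lambda^(-1/2)). It is therefore continuous along weakly convergent bounded sequences
  in L^2(Omega), with no compactness up to the boundary needed.

  The equation tested with functions in C_c^oo(Omega), which are dense in L^2(Omega), gives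
  equicontinuity in time, so that the weak limit in L^2(0,T; L^2(Omega)) is attained weakly in
  L^2(Omega) at every single time. This yields the limit equation, and, since D(Lambda^(-1/2)) norms
  converge along weakly convergent sequences, the Hamiltonian of the limit is constant: for s <= 1
  the dissipation in the balance (3) is O(nu).
*)
theory Submission imports Defs begin

section \<open>The Hilbert space \<open>L\<^sup>2(\<Omega>)\<close>\<close>

text \<open>The obstacle: the nonlinear term is quadratic in theta, convergence is only weak, and
  the dissipation gives no uniform smoothing as the viscosity vanishes, so compactness must come
  from the form itself. With mu_j the square root of lambda_j, the symmetrised coefficient b_jk /
  mu_k + b_kj / mu_j equals E_jk / (mu_j mu_k (mu_j + mu_k)), where E is a form in two gradients.
  Three powers of mu against two derivatives gain half a derivative for each factor theta, and
  L^2(Omega) embeds compactly into D(Lambda^(-1/2)) because the eigenvalues tend to infinity. The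
  weight 1 / (mu_j + mu_k) is not a product; as an integral of exponentials in z it separates for
  each z. Weak convergence in space-time would not suffice, since the quadratic term has to be
  evaluated at fixed times. Elements of L^2 are plain functions, and weak derivatives, powers of
  Lambda and the velocity are picked by choice; identities are therefore carried by coefficients and
  by integrals against test functions.\<close>

lemma L2_measurable: "f \<in> L2 \<Omega> \<Longrightarrow> f \<in> borel_measurable (lebesgue_on \<Omega>)"
  and L2_integrable_square: "f \<in> L2 \<Omega> \<Longrightarrow> integrable (lebesgue_on \<Omega>) (\<lambda>x. (f x)\<^sup>2)"
  by (auto simp: L2_def)

lemma L2_mult_integrable:
  assumes "f \<in> L2 \<Omega>" "g \<in> L2 \<Omega>"
  shows "integrable (lebesgue_on \<Omega>) (\<lambda>x. f x * g x)"
proof (rule Bochner_Integration.integrable_bound)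
  show "integrable (lebesgue_on \<Omega>) (\<lambda>x. (f x)\<^sup>2 + (g x)\<^sup>2)"
    using assms by (simp add: L2_integrable_square)
  show "(\<lambda>x. f x * g x) \<in> borel_measurable (lebesgue_on \<Omega>)"
    using assms[THEN L2_measurable] by measurable
  have "\<bar>a * b\<bar> \<le> a\<^sup>2 + b\<^sup>2" for a b :: real
  proof -
    have "0 \<le> (\<bar>a\<bar> - \<bar>b\<bar>)\<^sup>2" by simp
    then have "2 * (\<bar>a\<bar> * \<bar>b\<bar>) \<le> a\<^sup>2 + b\<^sup>2" by (simp add: power2_diff)
    then show ?thesis unfolding abs_mult using mult_nonneg_nonneg[of "\<bar>a\<bar>" "\<bar>b\<bar>"] by linarith
  qed
  then show "AE x in lebesgue_on \<Omega>. norm (f x * g x) \<le> norm ((f x)\<^sup>2 + (g x)\<^sup>2)"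
    by (auto intro!: AE_I2)
qed

lemma L2_zero [simp]: "(\<lambda>x. 0) \<in> L2 \<Omega>"
  by (simp add: L2_def)

lemma L2_cmult: "f \<in> L2 \<Omega> \<Longrightarrow> (\<lambda>x. c * f x) \<in> L2 \<Omega>"
  by (auto simp: L2_def power_mult_distrib)

lemma L2_add:
  assumes "f \<in> L2 \<Omega>" "g \<in> L2 \<Omega>"
  shows "(\<lambda>x. f x + g x) \<in> L2 \<Omega>"
proof -
  have "integrable (lebesgue_on \<Omega>) (\<lambda>x. (f x)\<^sup>2 + 2 * (f x * g x) + (g x)\<^sup>2)"
    using assms L2_mult_integrable[OF assms] by (simp add: L2_integrable_square)
  then show ?thesis
    using assms[THEN L2_measurable] by (auto simp: L2_def power2_sum algebra_simps)
qed

lemma L2_diff: "f \<in> L2 \<Omega> \<Longrightarrow> g \<in> L2 \<Omega> \<Longrightarrow> (\<lambda>x. f x - g x) \<in> L2 \<Omega>"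
  using L2_add[of f \<Omega> "\<lambda>x. (-1) * g x"] L2_cmult[of g \<Omega> "-1"] by simp

lemma L2_sum: "(\<And>i. i \<in> I \<Longrightarrow> f i \<in> L2 \<Omega>) \<Longrightarrow> (\<lambda>x. \<Sum>i\<in>I. f i x) \<in> L2 \<Omega>"
  by (induction I rule: infinite_finite_induct) (auto intro: L2_add)

lemma L2_sum_cmult: "(\<And>i. i \<in> I \<Longrightarrow> f i \<in> L2 \<Omega>) \<Longrightarrow> (\<lambda>x. \<Sum>i\<in>I. c i * f i x) \<in> L2 \<Omega>"
  by (intro L2_sum L2_cmult)

lemma L2_mult_bounded:
  assumes f: "f \<in> L2 \<Omega>" and g: "g \<in> borel_measurable (lebesgue_on \<Omega>)"
    and B: "\<And>x. x \<in> \<Omega> \<Longrightarrow> \<bar>g x\<bar> \<le> B"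
  shows "(\<lambda>x. f x * g x) \<in> L2 \<Omega>"
proof -
  have "integrable (lebesgue_on \<Omega>) (\<lambda>x. (f x * g x)\<^sup>2)"
  proof (rule Bochner_Integration.integrable_bound)
    show "integrable (lebesgue_on \<Omega>) (\<lambda>x. B\<^sup>2 * (f x)\<^sup>2)"
      using f by (simp add: L2_integrable_square)
    show "(\<lambda>x. (f x * g x)\<^sup>2) \<in> borel_measurable (lebesgue_on \<Omega>)"
      using f[THEN L2_measurable] g by measurable
    have "(f x * g x)\<^sup>2 \<le> B\<^sup>2 * (f x)\<^sup>2" if "x \<in> \<Omega>" for x
    proof -
      have "(g x)\<^sup>2 \<le> B\<^sup>2" using B[OF that] by (metis abs_ge_zero power2_abs power_mono)
      then show ?thesis by (simp add: power_mult_distrib mult.commute[of _ "(g x)\<^sup>2"] mult_right_mono)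
    qed
    then show "AE x in lebesgue_on \<Omega>. norm ((f x * g x)\<^sup>2) \<le> norm (B\<^sup>2 * (f x)\<^sup>2)"
      by (intro AE_I2) (auto simp: space_lebesgue_on abs_mult)
  qed
  then show ?thesis using f[THEN L2_measurable] g by (auto simp: L2_def)
qed

lemma L2_cong_AE:
  assumes f: "f \<in> L2 \<Omega>" and g: "g \<in> borel_measurable (lebesgue_on \<Omega>)"
    and eq: "AE x in lebesgue_on \<Omega>. f x = g x"
  shows "g \<in> L2 \<Omega>"
proof -
  have "integrable (lebesgue_on \<Omega>) (\<lambda>x. (g x)\<^sup>2)"
  proof (rule integrable_cong_AE_imp[OF L2_integrable_square[OF f]])
    show "(\<lambda>x. (g x)\<^sup>2) \<in> borel_measurable (lebesgue_on \<Omega>)" using g by measurable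
    show "AE x in lebesgue_on \<Omega>. (f x)\<^sup>2 = (g x)\<^sup>2" using eq by eventually_elim simp
  qed
  then show ?thesis using g by (simp add: L2_def)
qed

lemma L2_inner_commute: "L2_inner \<Omega> f g = L2_inner \<Omega> g f"
  by (simp add: L2_inner_def mult.commute)

lemma L2_inner_add_left:
  "f \<in> L2 \<Omega> \<Longrightarrow> g \<in> L2 \<Omega> \<Longrightarrow> h \<in> L2 \<Omega> \<Longrightarrow>
    L2_inner \<Omega> (\<lambda>x. f x + g x) h = L2_inner \<Omega> f h + L2_inner \<Omega> g h"
  by (simp add: L2_inner_def distrib_right L2_mult_integrable)

lemma L2_inner_diff_left:
  "f \<in> L2 \<Omega> \<Longrightarrow> g \<in> L2 \<Omega> \<Longrightarrow> h \<in> L2 \<Omega> \<Longrightarrow>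
    L2_inner \<Omega> (\<lambda>x. f x - g x) h = L2_inner \<Omega> f h - L2_inner \<Omega> g h"
  by (simp add: L2_inner_def left_diff_distrib L2_mult_integrable)

lemma L2_inner_add_right:
  "f \<in> L2 \<Omega> \<Longrightarrow> g \<in> L2 \<Omega> \<Longrightarrow> h \<in> L2 \<Omega> \<Longrightarrow>
    L2_inner \<Omega> h (\<lambda>x. f x + g x) = L2_inner \<Omega> h f + L2_inner \<Omega> h g"
  by (simp add: L2_inner_commute[of _ h] L2_inner_add_left)

lemma L2_inner_diff_right:
  "f \<in> L2 \<Omega> \<Longrightarrow> g \<in> L2 \<Omega> \<Longrightarrow> h \<in> L2 \<Omega> \<Longrightarrow>
    L2_inner \<Omega> h (\<lambda>x. f x - g x) = L2_inner \<Omega> h f - L2_inner \<Omega> h g"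
  by (simp add: L2_inner_commute[of _ h] L2_inner_diff_left)

lemma L2_inner_cmult_left: "L2_inner \<Omega> (\<lambda>x. c * f x) g = c * L2_inner \<Omega> f g"
  by (simp add: L2_inner_def mult.assoc)

lemma L2_inner_cmult_right: "L2_inner \<Omega> g (\<lambda>x. c * f x) = c * L2_inner \<Omega> g f"
  by (simp add: L2_inner_commute[of _ g] L2_inner_cmult_left)

lemma L2_inner_sum_left:
  assumes "\<And>i. i \<in> I \<Longrightarrow> f i \<in> L2 \<Omega>" "g \<in> L2 \<Omega>"
  shows "L2_inner \<Omega> (\<lambda>x. \<Sum>i\<in>I. c i * f i x) g = (\<Sum>i\<in>I. c i * L2_inner \<Omega> (f i) g)"
proof -
  have "integrable (lebesgue_on \<Omega>) (\<lambda>x. c i * (f i x * g x))" if "i \<in> I" for i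
    using assms that by (intro integrable_mult_right L2_mult_integrable)
  then show ?thesis
    by (simp add: L2_inner_def sum_distrib_right mult.assoc Bochner_Integration.integral_sum)
qed

lemma L2_inner_cong_AE:
  assumes "f \<in> L2 \<Omega>" "f' \<in> L2 \<Omega>" "g \<in> L2 \<Omega>" "g' \<in> L2 \<Omega>"
    "AE x in lebesgue_on \<Omega>. f x = f' x" "AE x in lebesgue_on \<Omega>. g x = g' x"
  shows "L2_inner \<Omega> f g = L2_inner \<Omega> f' g'"
  unfolding L2_inner_def
proof (rule integral_cong_AE)
  show "AE x in lebesgue_on \<Omega>. f x * g x = f' x * g' x"
    using assms(5,6) by eventually_elim simp
qed (use assms in \<open>auto intro!: borel_measurable_times dest: L2_measurable\<close>)

lemma L2_norm_nonneg [simp]: "0 \<le> L2_norm \<Omega> f"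
  by (simp add: L2_norm_def integral_nonneg_AE)

lemma L2_norm_square: "(L2_norm \<Omega> f)\<^sup>2 = L2_inner \<Omega> f f"
  by (simp add: L2_norm_def L2_inner_def power2_eq_square integral_nonneg_AE)

lemma L2_norm_square_integral: "(L2_norm \<Omega> f)\<^sup>2 = (LINT x|lebesgue_on \<Omega>. (f x)\<^sup>2)"
  by (simp add: L2_norm_def integral_nonneg_AE)

lemma L2_Cauchy_Schwarz:
  assumes f: "f \<in> L2 \<Omega>" and g: "g \<in> L2 \<Omega>"
  shows "\<bar>L2_inner \<Omega> f g\<bar> \<le> L2_norm \<Omega> f * L2_norm \<Omega> g"
proof -
  define A B I where "A = L2_inner \<Omega> f f" and "B = L2_inner \<Omega> g g" and "I = L2_inner \<Omega> f g"
  have AB: "A \<ge> 0" "B \<ge> 0" using L2_norm_square[of \<Omega>] by (metis A_def B_def zero_le_power2)+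
  have q: "0 \<le> A + 2 * t * I + t\<^sup>2 * B" for t
  proof -
    have tg: "(\<lambda>x. t * g x) \<in> L2 \<Omega>" using g by (rule L2_cmult)
    have "0 \<le> L2_inner \<Omega> (\<lambda>x. f x + t * g x) (\<lambda>x. f x + t * g x)"
      using L2_norm_square[of \<Omega>] by (metis zero_le_power2)
    also have "\<dots> = A + 2 * t * I + t\<^sup>2 * B"
      using f g tg L2_inner_commute[of \<Omega> g f] unfolding A_def B_def I_def
      by (simp add: L2_inner_add_left L2_inner_add_right L2_add L2_inner_cmult_left L2_inner_cmult_right
            power2_eq_square algebra_simps)
    finally show ?thesis .
  qed
  have "I\<^sup>2 \<le> A * B"
  proof (cases "B = 0")
    case True
    have "I = 0"
    proof (rule ccontr)
      assume "I \<noteq> 0"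
      \<comment> \<open>With \<open>B = 0\<close> the quadratic is affine in \<open>t\<close>, and
        at this \<open>t\<close> its value is -1.\<close>
      with q[of "-(A+1)/(2*I)"] True show False by (simp add: field_simps)
    qed
    then show ?thesis by (simp add: AB)
  next
    case False
    \<comment> \<open>The minimiser of the quadratic in \<open>t\<close>.\<close>
    with q[of "-I/B"] AB show ?thesis
      by (simp add: field_simps power2_eq_square)
  qed
  then have "sqrt (I\<^sup>2) \<le> sqrt (A * B)" by (rule real_sqrt_le_mono)
  then show ?thesis
    unfolding A_def B_def I_def L2_norm_square[symmetric] by (simp add: real_sqrt_mult)
qed

lemma L2_norm_triangle:
  assumes f: "f \<in> L2 \<Omega>" and g: "g \<in> L2 \<Omega>"
  shows "L2_norm \<Omega> (\<lambda>x. f x + g x) \<le> L2_norm \<Omega> f + L2_norm \<Omega> g"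
proof (rule power2_le_imp_le)
  have "(L2_norm \<Omega> (\<lambda>x. f x + g x))\<^sup>2 = (L2_norm \<Omega> f)\<^sup>2 + 2 * L2_inner \<Omega> f g + (L2_norm \<Omega> g)\<^sup>2"
    using f g L2_inner_commute[of \<Omega> g f] unfolding L2_norm_square
    by (simp add: L2_inner_add_left L2_inner_add_right L2_add)
  also have "\<dots> \<le> (L2_norm \<Omega> f + L2_norm \<Omega> g)\<^sup>2"
    using L2_Cauchy_Schwarz[OF f g] by (simp add: power2_sum)
  finally show "(L2_norm \<Omega> (\<lambda>x. f x + g x))\<^sup>2 \<le> (L2_norm \<Omega> f + L2_norm \<Omega> g)\<^sup>2" .
qed simp

lemma L2_norm_cmult: "L2_norm \<Omega> (\<lambda>x. c * f x) = \<bar>c\<bar> * L2_norm \<Omega> f"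
  by (simp add: L2_norm_def power_mult_distrib real_sqrt_mult)

lemma L2_norm_minus_commute: "L2_norm \<Omega> (\<lambda>x. f x - g x) = L2_norm \<Omega> (\<lambda>x. g x - f x)"
  by (simp add: L2_norm_def power2_commute)

lemma L2_norm_triangle_diff:
  assumes f: "f \<in> L2 \<Omega>" and g: "g \<in> L2 \<Omega>" and h: "h \<in> L2 \<Omega>"
  shows "L2_norm \<Omega> (\<lambda>x. f x - h x) \<le> L2_norm \<Omega> (\<lambda>x. f x - g x) + L2_norm \<Omega> (\<lambda>x. g x - h x)"
  using L2_norm_triangle[of "\<lambda>x. f x - g x" \<Omega> "\<lambda>x. g x - h x"] assms by (simp add: L2_diff)

lemma L2_norm_le_add_diff:
  assumes f: "f \<in> L2 \<Omega>" and g: "g \<in> L2 \<Omega>"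
  shows "L2_norm \<Omega> f \<le> L2_norm \<Omega> (\<lambda>x. f x - g x) + L2_norm \<Omega> g"
  using L2_norm_triangle[of "\<lambda>x. f x - g x" \<Omega> g] assms by (simp add: L2_diff)

lemma L2_norm_cong_AE:
  assumes "f \<in> L2 \<Omega>" "g \<in> L2 \<Omega>" "AE x in lebesgue_on \<Omega>. f x = g x"
  shows "L2_norm \<Omega> f = L2_norm \<Omega> g"
proof -
  have "L2_inner \<Omega> f f = L2_inner \<Omega> g g" by (rule L2_inner_cong_AE) (use assms in auto)
  then show ?thesis by (metis L2_norm_square L2_norm_nonneg power2_eq_iff_nonneg)
qed

lemma L2_norm_diff_tendsto:
  assumes "\<And>k. f k \<in> L2 \<Omega>" "g \<in> L2 \<Omega>" "(\<lambda>k. L2_norm \<Omega> (\<lambda>x. f k x - g x)) \<longlonglongrightarrow> 0"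
  shows "(\<lambda>k. L2_norm \<Omega> (f k)) \<longlonglongrightarrow> L2_norm \<Omega> g"
proof -
  have "\<bar>L2_norm \<Omega> (f k) - L2_norm \<Omega> g\<bar> \<le> L2_norm \<Omega> (\<lambda>x. f k x - g x)" for k
    using L2_norm_le_add_diff[OF assms(1)[of k] assms(2)] L2_norm_le_add_diff[OF assms(2) assms(1)[of k]]
      L2_norm_minus_commute[of \<Omega> "f k" g] by linarith
  then have "(\<lambda>k. L2_norm \<Omega> (f k) - L2_norm \<Omega> g) \<longlonglongrightarrow> 0"
    by (intro Lim_null_comparison[OF _ assms(3)]) auto
  then show ?thesis by (simp add: LIM_zero_iff)
qed

lemma L2_inner_tendsto:
  assumes f: "\<And>k. f k \<in> L2 \<Omega>" "f' \<in> L2 \<Omega>" "(\<lambda>k. L2_norm \<Omega> (\<lambda>x. f k x - f' x)) \<longlonglongrightarrow> 0"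
    and g: "\<And>k. g k \<in> L2 \<Omega>" "g' \<in> L2 \<Omega>" "(\<lambda>k. L2_norm \<Omega> (\<lambda>x. g k x - g' x)) \<longlonglongrightarrow> 0"
  shows "(\<lambda>k. L2_inner \<Omega> (f k) (g k)) \<longlonglongrightarrow> L2_inner \<Omega> f' g'"
proof -
  have *: "\<bar>L2_inner \<Omega> (f k) (g k) - L2_inner \<Omega> f' g'\<bar>
      \<le> L2_norm \<Omega> (\<lambda>x. f k x - f' x) * L2_norm \<Omega> (g k) + L2_norm \<Omega> f' * L2_norm \<Omega> (\<lambda>x. g k x - g' x)" for k
  proof -
    have "L2_inner \<Omega> (f k) (g k) - L2_inner \<Omega> f' g' =
        L2_inner \<Omega> (\<lambda>x. f k x - f' x) (g k) + L2_inner \<Omega> f' (\<lambda>x. g k x - g' x)"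
      by (simp add: L2_inner_diff_left L2_inner_diff_right f g)
    then show ?thesis
      using L2_Cauchy_Schwarz[OF L2_diff[OF f(1)[of k] f(2)] g(1)[of k]]
        L2_Cauchy_Schwarz[OF f(2) L2_diff[OF g(1)[of k] g(2)]] by linarith
  qed
  have "(\<lambda>k. L2_norm \<Omega> (\<lambda>x. f k x - f' x) * L2_norm \<Omega> (g k) + L2_norm \<Omega> f' * L2_norm \<Omega> (\<lambda>x. g k x - g' x))
      \<longlonglongrightarrow> 0 * L2_norm \<Omega> g' + L2_norm \<Omega> f' * 0"
    by (intro tendsto_intros f g L2_norm_diff_tendsto)
  then have "(\<lambda>k. L2_inner \<Omega> (f k) (g k) - L2_inner \<Omega> f' g') \<longlonglongrightarrow> 0"
    unfolding mult_zero_left mult_zero_right add_0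
    by (rule Lim_null_comparison[rotated]) (simp add: *)
  then show ?thesis by (simp add: LIM_zero_iff)
qed

lemma L2_inner_tendsto_left:
  assumes f: "\<And>k. f k \<in> L2 \<Omega>" "f' \<in> L2 \<Omega>" "(\<lambda>k. L2_norm \<Omega> (\<lambda>x. f k x - f' x)) \<longlonglongrightarrow> 0"
    and g: "g \<in> L2 \<Omega>"
  shows "(\<lambda>k. L2_inner \<Omega> (f k) g) \<longlonglongrightarrow> L2_inner \<Omega> f' g"
  by (rule L2_inner_tendsto[OF f]) (use g in \<open>auto simp: L2_norm_def\<close>)

lemma L2_tendsto_AE_subseq:
  assumes "\<And>k. f k \<in> L2 \<Omega>" "g \<in> L2 \<Omega>" "(\<lambda>k. L2_norm \<Omega> (\<lambda>x. f k x - g x)) \<longlonglongrightarrow> 0"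
  obtains r :: "nat \<Rightarrow> nat" where "strict_mono r" "AE x in lebesgue_on \<Omega>. (\<lambda>k. f (r k) x) \<longlonglongrightarrow> g x"
proof -
  have "(\<lambda>k. (L2_norm \<Omega> (\<lambda>x. f k x - g x))\<^sup>2) \<longlonglongrightarrow> 0\<^sup>2" by (intro tendsto_power assms)
  then have "(\<lambda>k. LINT x|lebesgue_on \<Omega>. norm ((f k x - g x)\<^sup>2)) \<longlonglongrightarrow> 0"
    by (simp add: L2_norm_square_integral)
  moreover have "integrable (lebesgue_on \<Omega>) (\<lambda>x. (f k x - g x)\<^sup>2)" for k
    by (intro L2_integrable_square L2_diff assms)
  ultimately obtain r where r: "strict_mono r" "AE x in lebesgue_on \<Omega>. (\<lambda>k. (f (r k) x - g x)\<^sup>2) \<longlonglongrightarrow> 0"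
    using tendsto_L1_AE_subseq[of "lebesgue_on \<Omega>" "\<lambda>k x. (f k x - g x)\<^sup>2"] by blast
  have "AE x in lebesgue_on \<Omega>. (\<lambda>k. f (r k) x) \<longlonglongrightarrow> g x"
    using r(2)
  proof (rule AE_mp, intro AE_I2 impI)
    fix x assume "(\<lambda>k. (f (r k) x - g x)\<^sup>2) \<longlonglongrightarrow> 0"
    then have "(\<lambda>k. sqrt ((f (r k) x - g x)\<^sup>2)) \<longlonglongrightarrow> sqrt 0" by (rule tendsto_real_sqrt)
    then have "(\<lambda>k. f (r k) x - g x) \<longlonglongrightarrow> 0"
      by (simp add: tendsto_rabs_zero_iff)
    then show "(\<lambda>k. f (r k) x) \<longlonglongrightarrow> g x" by (simp add: LIM_zero_iff)
  qed
  with r show thesis using that by blast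
qed

text \<open>Riesz-Fischer on raw functions: a fast subsequence converges almost everywhere, and
  Fatou's lemma turns the Cauchy property into convergence to the pointwise limit. Increments of
  norm below 4^(-k) leave room for the weight 4^k in the sum of squares, and this weight forces
  geometric decay of the increments at almost every point.\<close>

lemma L2_complete:
  assumes f: "\<And>k. f k \<in> L2 \<Omega>"
    and C: "\<And>e. e > 0 \<Longrightarrow> \<exists>N. \<forall>m\<ge>N. \<forall>n\<ge>N. L2_norm \<Omega> (\<lambda>x. f m x - f n x) < e"
  obtains g where "g \<in> L2 \<Omega>" "(\<lambda>k. L2_norm \<Omega> (\<lambda>x. f k x - g x)) \<longlonglongrightarrow> 0"
proof -
  let ?M = "lebesgue_on \<Omega>"
  have [measurable]: "f k \<in> borel_measurable ?M" for k using f[THEN L2_measurable] .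
  have "\<exists>R. \<forall>k. (\<forall>m\<ge>R k. \<forall>n\<ge>R k. L2_norm \<Omega> (\<lambda>x. f m x - f n x) < (1/4)^k)"
    using C by (intro choice) (auto)
  then obtain R where R: "\<And>k m n. m \<ge> R k \<Longrightarrow> n \<ge> R k \<Longrightarrow> L2_norm \<Omega> (\<lambda>x. f m x - f n x) < (1/4)^k"
    by blast
  \<comment> \<open>The sum makes both \<open>r k\<close> and \<open>r (Suc k)\<close> at least
    \<open>R k\<close>; the added \<open>k\<close> sends \<open>r\<close> to infinity, which the
    Fatou step uses.\<close>
  define r where "r k = (\<Sum>i\<le>k. R i) + k" for k
  have rR: "r k \<ge> R k" "r (Suc k) \<ge> R k" for k
  proof -
    have "R k \<le> (\<Sum>i\<le>k. R i)" by (rule member_le_sum) auto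
    then show "r k \<ge> R k" "r (Suc k) \<ge> R k" by (auto simp: r_def)
  qed
  have r_ge: "r k \<ge> k" for k by (simp add: r_def)
  define d where "d k x = f (r (Suc k)) x - f (r k) x" for k x
  have dL2: "d k \<in> L2 \<Omega>" for k unfolding d_def by (intro L2_diff f)
  have [measurable]: "d k \<in> borel_measurable ?M" for k using dL2[THEN L2_measurable] .
  have "(\<integral>\<^sup>+x. (\<Sum>k. ennreal (4^k * (d k x)\<^sup>2)) \<partial>?M) = (\<Sum>k. \<integral>\<^sup>+x. ennreal (4^k * (d k x)\<^sup>2) \<partial>?M)"
    by (rule nn_integral_suminf) measurable
  also have "\<dots> \<le> (\<Sum>k. ennreal ((1/4)^k))"
  proof (rule suminf_le)
    fix k
    have "(\<integral>\<^sup>+x. ennreal (4^k * (d k x)\<^sup>2) \<partial>?M) = ennreal (LINT x|?M. 4^k * (d k x)\<^sup>2)"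
      using L2_integrable_square[OF dL2] by (intro nn_integral_eq_integral) auto
    also have "(LINT x|?M. 4^k * (d k x)\<^sup>2) = 4^k * (L2_norm \<Omega> (d k))\<^sup>2"
      by (simp add: L2_norm_square_integral)
    also have "\<dots> \<le> 4^k * ((1/4)^k)\<^sup>2"
      using R[OF rR(2) rR(1), of k] unfolding d_def
      by (intro mult_left_mono power_mono) auto
    also have "4^k * ((1/4)^k)\<^sup>2 = (1/4::real)^k"
      by (simp add: power2_eq_square power_divide)
    finally show "(\<integral>\<^sup>+x. ennreal (4^k * (d k x)\<^sup>2) \<partial>?M) \<le> ennreal ((1/4)^k)" by (simp add: ennreal_leI)
  qed auto
  also have "\<dots> < \<infinity>"
    by (subst suminf_ennreal2) (auto intro!: summable_geometric)
  finally have "AE x in ?M. (\<Sum>k. ennreal (4^k * (d k x)\<^sup>2)) \<noteq> \<infinity>"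
    by (intro nn_integral_PInf_AE) auto
  then have conv: "AE x in ?M. convergent (\<lambda>k. f (r k) x)"
  proof (rule AE_mp, intro AE_I2 impI)
    fix x assume "(\<Sum>k. ennreal (4^k * (d k x)\<^sup>2)) \<noteq> \<infinity>"
    then have sm: "summable (\<lambda>k. 4^k * (d k x)\<^sup>2)"
      by (intro summable_suminf_not_top) (auto simp: infinity_ennreal_def)
    obtain B where B: "\<And>k. norm (4^k * (d k x)\<^sup>2) \<le> B"
      using BseqE[OF summable_imp_Bseq[OF sm]] by blast
    have dB: "norm (d k x) \<le> sqrt B * (1/2)^k" for k
    proof -
      have "(2^k * \<bar>d k x\<bar>)\<^sup>2 \<le> B"
      proof -
        have "(4::real)^k = (2^k)\<^sup>2" by (simp add: power2_eq_square flip: power_mult_distrib)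
        then show ?thesis using B[of k] by (simp add: power_mult_distrib)
      qed
      then have "2^k * \<bar>d k x\<bar> \<le> sqrt B" by (rule real_le_rsqrt)
      then show ?thesis by (simp add: field_simps power_divide)
    qed
    have "summable (\<lambda>k. d k x)"
      by (rule summable_comparison_test'[OF summable_mult[OF summable_geometric]]) (use dB in auto)
    then have "convergent (\<lambda>n. \<Sum>k<n. d k x)" by (simp add: summable_iff_convergent)
    also have "(\<lambda>n. \<Sum>k<n. d k x) = (\<lambda>n. f (r n) x - f (r 0) x)"
      unfolding d_def by (rule ext) (rule sum_lessThan_telescope[of "\<lambda>k. f (r k) x"])
    finally show "convergent (\<lambda>k. f (r k) x)"
      by (simp add: convergent_diff_const_right_iff)
  qed
  define g where "g x = lim (\<lambda>k. f (r k) x)" for x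
  have [measurable]: "g \<in> borel_measurable ?M" unfolding g_def by measurable
  have key: "integrable ?M (\<lambda>x. (f n x - g x)\<^sup>2) \<and> L2_norm \<Omega> (\<lambda>x. f n x - g x) \<le> e"
    if e: "e > 0" and N: "\<And>m. m \<ge> N \<Longrightarrow> L2_norm \<Omega> (\<lambda>x. f n x - f m x) < e" for n N e
  proof -
    have "(\<integral>\<^sup>+x. ennreal ((f n x - g x)\<^sup>2) \<partial>?M) = (\<integral>\<^sup>+x. liminf (\<lambda>k. ennreal ((f n x - f (r k) x)\<^sup>2)) \<partial>?M)"
    proof (rule nn_integral_cong_AE, use conv in \<open>rule AE_mp\<close>, intro AE_I2 impI)
      fix x assume "convergent (\<lambda>k. f (r k) x)"
      then have "(\<lambda>k. f (r k) x) \<longlonglongrightarrow> g x" unfolding g_def by (simp add: convergent_LIMSEQ_iff)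
      then have "(\<lambda>k. ennreal ((f n x - f (r k) x)\<^sup>2)) \<longlonglongrightarrow> ennreal ((f n x - g x)\<^sup>2)"
        by (intro tendsto_intros)
      then show "ennreal ((f n x - g x)\<^sup>2) = liminf (\<lambda>k. ennreal ((f n x - f (r k) x)\<^sup>2))"
        by (rule lim_imp_Liminf[OF trivial_limit_sequentially, symmetric])
    qed
    also have "\<dots> \<le> liminf (\<lambda>k. \<integral>\<^sup>+x. ennreal ((f n x - f (r k) x)\<^sup>2) \<partial>?M)"
      by (rule nn_integral_liminf) measurable
    also have "\<dots> \<le> liminf (\<lambda>k::nat. ennreal (e\<^sup>2))"
    proof (rule Liminf_mono, rule eventually_sequentiallyI)
      fix k assume "k \<ge> N"
      then have "r k \<ge> N" using r_ge[of k] by linarith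
      have "(\<integral>\<^sup>+x. ennreal ((f n x - f (r k) x)\<^sup>2) \<partial>?M) = ennreal (LINT x|?M. (f n x - f (r k) x)\<^sup>2)"
        by (intro nn_integral_eq_integral L2_integrable_square L2_diff f) auto
      also have "(LINT x|?M. (f n x - f (r k) x)\<^sup>2) = (L2_norm \<Omega> (\<lambda>x. f n x - f (r k) x))\<^sup>2"
        by (simp add: L2_norm_square_integral)
      also have "\<dots> \<le> e\<^sup>2" using N[OF \<open>r k \<ge> N\<close>] by (intro power_mono) auto
      finally show "(\<integral>\<^sup>+x. ennreal ((f n x - f (r k) x)\<^sup>2) \<partial>?M) \<le> ennreal (e\<^sup>2)" by (simp add: ennreal_leI)
    qed
    finally have le: "(\<integral>\<^sup>+x. ennreal ((f n x - g x)\<^sup>2) \<partial>?M) \<le> ennreal (e\<^sup>2)"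
      by (simp add: Liminf_const)
    have int: "integrable ?M (\<lambda>x. (f n x - g x)\<^sup>2)"
      using le by (intro integrableI_bounded) (auto intro: le_less_trans)
    have "ennreal (LINT x|?M. (f n x - g x)\<^sup>2) \<le> ennreal (e\<^sup>2)"
      using le by (subst (asm) nn_integral_eq_integral[OF int]) auto
    then have "(LINT x|?M. (f n x - g x)\<^sup>2) \<le> e\<^sup>2" by (simp add: ennreal_le_iff)
    then have "L2_norm \<Omega> (\<lambda>x. f n x - g x) \<le> e"
      unfolding L2_norm_def using e by (simp add: real_le_lsqrt)
    with int show ?thesis by simp
  qed
  obtain N where N: "\<forall>m\<ge>N. \<forall>n\<ge>N. L2_norm \<Omega> (\<lambda>x. f m x - f n x) < 1" using C[of 1] by auto
  have fg: "(\<lambda>x. f N x - g x) \<in> L2 \<Omega>"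
    using key[of 1 N N] N by (auto simp: L2_def)
  have gL2: "g \<in> L2 \<Omega>" using L2_diff[OF f[of N] fg] by simp
  moreover have "(\<lambda>k. L2_norm \<Omega> (\<lambda>x. f k x - g x)) \<longlonglongrightarrow> 0"
  proof (rule LIMSEQ_I)
    fix e :: real assume "e > 0"
    then obtain N where N: "\<forall>m\<ge>N. \<forall>n\<ge>N. L2_norm \<Omega> (\<lambda>x. f m x - f n x) < e/2" using C[of "e/2"] by auto
    then have "L2_norm \<Omega> (\<lambda>x. f n x - g x) < e" if "n \<ge> N" for n
      using key[of "e/2" N n] that \<open>e > 0\<close> by fastforce
    then show "\<exists>no. \<forall>n\<ge>no. norm (L2_norm \<Omega> (\<lambda>x. f n x - g x) - 0) < e"
      by (intro exI[of _ N]) auto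
  qed
  ultimately show thesis using that by blast
qed

section \<open>Smooth functions and test functions\<close>

abbreviation pd :: "'a::euclidean_space \<Rightarrow> ('a \<Rightarrow> real) \<Rightarrow> 'a \<Rightarrow> real" where
  "pd b f \<equiv> (\<lambda>x. frechet_derivative f (at x) b)"

lemma has_derivative_imp_pd: "(f has_derivative D) (at x) \<Longrightarrow> frechet_derivative f (at x) b = D b"
  by (drule frechet_derivative_at) simp

lemma Ck_on_Suc_imp: "Ck_on (Suc m) UNIV f \<Longrightarrow> Ck_on m UNIV f"
proof (induction m arbitrary: f)
  case 0
  then show ?case by (auto intro!: continuous_at_imp_continuous_on differentiable_imp_continuous_within)
next
  case (Suc m)
  then show ?case by (metis Ck_on.simps(2))
qed

text \<open>Peels off one derivative without counting orders, so that later arguments can pass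
  freely from a function to its partial derivatives. The converse goes through the classes of order
  \<open>Suc m\<close> and recovers order 0 from \<open>Ck_on_Suc_imp\<close>.\<close>

lemma smooth_on_UNIV_iff:
  "smooth_on UNIV f \<longleftrightarrow> (\<forall>x. f differentiable (at x)) \<and> (\<forall>b\<in>Basis. smooth_on UNIV (pd b f))"
proof
  assume *: "smooth_on UNIV f"
  then have "Ck_on (Suc m) UNIV f" for m unfolding smooth_on_def by blast
  then show "(\<forall>x. f differentiable (at x)) \<and> (\<forall>b\<in>Basis. smooth_on UNIV (pd b f))"
    unfolding smooth_on_def by auto
next
  assume *: "(\<forall>x. f differentiable (at x)) \<and> (\<forall>b\<in>Basis. smooth_on UNIV (pd b f))"
  have "Ck_on (Suc m) UNIV f" for m using * by (auto simp: smooth_on_def)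
  then show "smooth_on UNIV f" unfolding smooth_on_def using Ck_on_Suc_imp by blast
qed

lemma smooth_on_differentiable: "smooth_on UNIV f \<Longrightarrow> f differentiable (at x)"
  using smooth_on_UNIV_iff by blast

lemma smooth_on_has_derivative: "smooth_on UNIV f \<Longrightarrow> (f has_derivative frechet_derivative f (at x)) (at x)"
  using smooth_on_differentiable frechet_derivative_works by blast

lemma smooth_on_pd: "smooth_on UNIV f \<Longrightarrow> b \<in> Basis \<Longrightarrow> smooth_on UNIV (pd b f)"
  using smooth_on_UNIV_iff by blast

lemma smooth_on_continuous: "smooth_on UNIV f \<Longrightarrow> continuous_on S f"
  by (meson smooth_on_differentiable continuous_at_imp_continuous_on differentiable_imp_continuous_within)

lemma Ck_on_const: "Ck_on m UNIV (\<lambda>x. c)"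
  by (induction m arbitrary: c) auto

lemma Ck_on_add: "Ck_on m UNIV f \<Longrightarrow> Ck_on m UNIV g \<Longrightarrow> Ck_on m UNIV (\<lambda>x. f x + g x)"
proof (induction m arbitrary: f g)
  case 0
  then show ?case by (auto intro: continuous_intros)
next
  case (Suc m)
  have "frechet_derivative (\<lambda>x. f x + g x) (at x) b = frechet_derivative f (at x) b + frechet_derivative g (at x) b" for x b
    by (rule has_derivative_imp_pd)
       (use Suc.prems in \<open>auto intro!: has_derivative_add simp: frechet_derivative_works\<close>)
  then show ?case using Suc by auto
qed

lemma Ck_on_mult: "Ck_on m UNIV f \<Longrightarrow> Ck_on m UNIV g \<Longrightarrow> Ck_on m UNIV (\<lambda>x. f x * g x)"
proof (induction m arbitrary: f g)
  case 0
  then show ?case by (auto intro: continuous_intros)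
next
  case (Suc m)
  have "frechet_derivative (\<lambda>x. f x * g x) (at x) b
      = f x * frechet_derivative g (at x) b + frechet_derivative f (at x) b * g x" for x b
    by (rule has_derivative_imp_pd)
       (use Suc.prems in \<open>auto intro!: has_derivative_mult simp: frechet_derivative_works\<close>)
  moreover have "Ck_on m UNIV f" "Ck_on m UNIV g" using Suc.prems Ck_on_Suc_imp by blast+
  ultimately show ?case using Suc by (auto intro!: Ck_on_add)
qed

text \<open>Since \<open>L\<close> maps basis vectors to multiples of basis vectors, each partial
  derivative of the composite is a multiple of a single partial derivative of \<open>f\<close>, and
  the induction stays within one composite. This covers dilations, translations, reflections, and
  the embedding of lines and time slices.\<close>

lemma Ck_on_affine:
  fixes L :: "'a::euclidean_space \<Rightarrow> 'b::euclidean_space"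
  assumes "Ck_on m UNIV f" "linear L" "\<And>b. b \<in> Basis \<Longrightarrow> \<exists>c. \<exists>b'\<in>Basis. L b = c *\<^sub>R b'"
  shows "Ck_on m UNIV (\<lambda>x. f (a + L x))"
  using assms(1)
proof (induction m arbitrary: f)
  have bl: "bounded_linear L" using assms(2) by (simp add: linear_conv_bounded_linear)
  case 0
  have "continuous_on UNIV (\<lambda>x. a + L x)"
    by (intro continuous_intros linear_continuous_on bl)
  with 0 show ?case using continuous_on_compose2[of UNIV f UNIV "\<lambda>x. a + L x"] by simp
next
  case (Suc m)
  have bl: "bounded_linear L" using assms(2) by (simp add: linear_conv_bounded_linear)
  have D: "((\<lambda>x. f (a + L x)) has_derivative (\<lambda>h. frechet_derivative f (at (a + L x)) (L h))) (at x)" for x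
  proof -
    have "(f has_derivative frechet_derivative f (at (a + L x))) (at (a + L x))"
      using Suc.prems by (auto simp: frechet_derivative_works[symmetric])
    moreover have "((\<lambda>x. a + L x) has_derivative L) (at x)"
      using bl by (auto intro!: derivative_eq_intros bounded_linear.has_derivative[OF bl])
    ultimately show ?thesis by (rule has_derivative_compose[rotated])
  qed
  have "Ck_on m UNIV (pd b (\<lambda>x. f (a + L x)))" if b: "b \<in> Basis" for b
  proof -
    obtain c b' where b': "b' \<in> Basis" "L b = c *\<^sub>R b'" using assms(3) b by blast
    have "frechet_derivative (\<lambda>x. f (a + L x)) (at x) b = c * frechet_derivative f (at (a + L x)) b'" for x
      using Suc.prems unfolding has_derivative_imp_pd[OF D] b'
      by (simp add: linear_cmul[OF linear_frechet_derivative])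
    moreover have "Ck_on m UNIV (\<lambda>x. frechet_derivative f (at (a + L x)) b')"
      by (rule Suc.IH) (use Suc.prems b' in auto)
    ultimately show ?thesis by (simp add: Ck_on_mult Ck_on_const)
  qed
  then show ?case using D by (auto simp: differentiable_def)
qed

lemma smooth_on_const: "smooth_on UNIV (\<lambda>x. c)"
  and smooth_on_add: "smooth_on UNIV f \<Longrightarrow> smooth_on UNIV g \<Longrightarrow> smooth_on UNIV (\<lambda>x. f x + g x)"
  and smooth_on_mult: "smooth_on UNIV f \<Longrightarrow> smooth_on UNIV g \<Longrightarrow> smooth_on UNIV (\<lambda>x. f x * g x)"
  by (auto simp: smooth_on_def Ck_on_const Ck_on_add Ck_on_mult)

lemma smooth_on_cmult: "smooth_on UNIV f \<Longrightarrow> smooth_on UNIV (\<lambda>x. c * f x)"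
  by (intro smooth_on_mult smooth_on_const)

lemma smooth_on_diff: "smooth_on UNIV f \<Longrightarrow> smooth_on UNIV g \<Longrightarrow> smooth_on UNIV (\<lambda>x. f x - g x)"
  using smooth_on_add[of f "\<lambda>x. (-1) * g x"] smooth_on_cmult[of g "-1"] by simp

lemma smooth_on_affine:
  fixes L :: "'a::euclidean_space \<Rightarrow> 'b::euclidean_space"
  assumes "smooth_on UNIV f" "linear L" "\<And>b. b \<in> Basis \<Longrightarrow> \<exists>c. \<exists>b'\<in>Basis. L b = c *\<^sub>R b'"
  shows "smooth_on UNIV (\<lambda>x. f (a + L x))"
  using assms Ck_on_affine unfolding smooth_on_def by blast

lemma smooth_on_scale: "smooth_on UNIV f \<Longrightarrow> smooth_on UNIV (\<lambda>x. f (a + c *\<^sub>R x))"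
  by (rule smooth_on_affine) (auto simp: linear_iff algebra_simps)

lemma smooth_on_translate: "smooth_on UNIV f \<Longrightarrow> smooth_on UNIV (\<lambda>x. f (x + a))"
  using smooth_on_scale[of f a 1] by (simp add: add.commute)

lemma pd_diff: "f differentiable (at x) \<Longrightarrow> g differentiable (at x) \<Longrightarrow>
    pd b (\<lambda>x. f x - g x) x = pd b f x - pd b g x"
  by (rule has_derivative_imp_pd) (auto intro!: has_derivative_diff simp: frechet_derivative_works)

lemma pd_mult: "f differentiable (at x) \<Longrightarrow> g differentiable (at x) \<Longrightarrow>
    pd b (\<lambda>x. f x * g x) x = f x * pd b g x + pd b f x * g x"
  by (rule has_derivative_imp_pd) (auto intro!: has_derivative_mult simp: frechet_derivative_works)

lemma pd_cmult: "f differentiable (at x) \<Longrightarrow> pd b (\<lambda>x. c * f x) x = c * pd b f x"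
  by (rule has_derivative_imp_pd) (auto intro!: has_derivative_mult_right simp: frechet_derivative_works)

lemma pd_scale:
  assumes "\<And>x. f differentiable (at x)"
  shows "pd b (\<lambda>x. f (a + c *\<^sub>R x)) x = c * pd b f (a + c *\<^sub>R x)"
proof -
  have "(f has_derivative frechet_derivative f (at (a + c *\<^sub>R x))) (at (a + c *\<^sub>R x))"
    using assms frechet_derivative_works by blast
  moreover have "((\<lambda>x. a + c *\<^sub>R x) has_derivative (\<lambda>h. c *\<^sub>R h)) (at x)"
    by (auto intro!: derivative_eq_intros)
  ultimately have "((\<lambda>x. f (a + c *\<^sub>R x)) has_derivative
      (\<lambda>h. frechet_derivative f (at (a + c *\<^sub>R x)) (c *\<^sub>R h))) (at x)"
    by (rule has_derivative_compose[rotated])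
  then show ?thesis using assms
    by (simp add: has_derivative_imp_pd linear_cmul[OF linear_frechet_derivative])
qed

lemma pd_translate: "(\<And>x. f differentiable (at x)) \<Longrightarrow> pd b (\<lambda>x. f (x + a)) x = pd b f (x + a)"
  using pd_scale[of f a 1 x b] by (simp add: add.commute)

section \<open>Test functions: closure properties and uniform estimates\<close>

lemma test_functions_smooth: "f \<in> test_functions U \<Longrightarrow> smooth_on UNIV f"
  by (auto simp: test_functions_def)

lemma test_functions_differentiable: "f \<in> test_functions U \<Longrightarrow> f differentiable (at x)"
  using test_functions_smooth smooth_on_differentiable by blast

lemma test_functions_mono: "f \<in> test_functions U \<Longrightarrow> U \<subseteq> V \<Longrightarrow> f \<in> test_functions V"
  by (auto simp: test_functions_def)

lemma test_functionsE:
  assumes "f \<in> test_functions U"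
  obtains K where "compact K" "K \<subseteq> U" "\<And>x. x \<notin> K \<Longrightarrow> f x = 0"
  using assms by (auto simp: test_functions_def)

lemma test_functions_eq_0: "f \<in> test_functions U \<Longrightarrow> x \<notin> U \<Longrightarrow> f x = 0"
  by (auto simp: test_functions_def)

lemma pd_eq_0:
  assumes "closed K" "\<And>x. x \<notin> K \<Longrightarrow> f x = 0" "x \<notin> K"
  shows "pd b f x = 0"
proof -
  have "(f has_derivative (\<lambda>h. 0)) (at x)"
    by (rule has_derivative_transform_within_open[of "\<lambda>x. 0" _ _ _ "- K"]) (use assms in auto)
  then show ?thesis by (simp add: has_derivative_imp_pd)
qed

lemma test_functions_pd:
  assumes f: "f \<in> test_functions U" and b: "b \<in> Basis"
  shows "pd b f \<in> test_functions U"
proof -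
  obtain K where K: "compact K" "K \<subseteq> U" "\<And>x. x \<notin> K \<Longrightarrow> f x = 0" using test_functionsE[OF f] by blast
  have "pd b f x = 0" if "x \<notin> K" for x
    by (rule pd_eq_0[OF compact_imp_closed[OF K(1)]]) (use K that in auto)
  then show ?thesis
    using K smooth_on_pd[OF test_functions_smooth[OF f] b] by (auto simp: test_functions_def)
qed

lemma test_functions_mult:
  assumes f: "f \<in> test_functions U" and g: "smooth_on UNIV g"
  shows "(\<lambda>x. f x * g x) \<in> test_functions U"
proof -
  obtain K where K: "compact K" "K \<subseteq> U" "\<And>x. x \<notin> K \<Longrightarrow> f x = 0" using test_functionsE[OF f] by blast
  then show ?thesis
    using smooth_on_mult[OF test_functions_smooth[OF f] g] by (auto simp: test_functions_def)
qed

lemma test_functions_cmult: "f \<in> test_functions U \<Longrightarrow> (\<lambda>x. c * f x) \<in> test_functions U"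
  using test_functions_mult[OF _ smooth_on_const, of f U c] by (simp add: mult.commute)

lemma test_functions_add:
  assumes f: "f \<in> test_functions U" and g: "g \<in> test_functions U"
  shows "(\<lambda>x. f x + g x) \<in> test_functions U"
proof -
  obtain K where K: "compact K" "K \<subseteq> U" "\<And>x. x \<notin> K \<Longrightarrow> f x = 0" using test_functionsE[OF f] by blast
  obtain K' where K': "compact K'" "K' \<subseteq> U" "\<And>x. x \<notin> K' \<Longrightarrow> g x = 0" using test_functionsE[OF g] by blast
  have "compact (K \<union> K') \<and> K \<union> K' \<subseteq> U \<and> (\<forall>x. x \<notin> K \<union> K' \<longrightarrow> f x + g x = 0)"
    using K K' by (auto intro: compact_Un)
  then show ?thesis
    using smooth_on_add[OF test_functions_smooth[OF f] test_functions_smooth[OF g]]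
    unfolding test_functions_def by blast
qed

lemma test_functions_diff:
  "f \<in> test_functions U \<Longrightarrow> g \<in> test_functions U \<Longrightarrow> (\<lambda>x. f x - g x) \<in> test_functions U"
  using test_functions_add[of f U "\<lambda>x. (-1) * g x"] test_functions_cmult[of g U "-1"] by simp

lemma test_functions_translate:
  assumes f: "f \<in> test_functions UNIV"
  shows "(\<lambda>x. f (x + a)) \<in> test_functions UNIV"
proof -
  obtain K where K: "compact K" "\<And>x. x \<notin> K \<Longrightarrow> f x = 0"
    using f unfolding test_functions_def by auto
  have "f (x + a) = 0" if "x \<notin> (+) (- a) ` K" for x
  proof (rule K(2))
    show "x + a \<notin> K" using that image_eqI[of x "(+) (- a)" "x + a" K] by auto
  qed
  then show ?thesis
    using compact_translation[OF K(1), of "-a"] smooth_on_translate[OF test_functions_smooth[OF f]]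
    by (auto simp: test_functions_def)
qed

lemma test_functions_borel: "f \<in> test_functions U \<Longrightarrow> f \<in> borel_measurable borel"
  using smooth_on_continuous[OF test_functions_smooth, of f U UNIV] borel_measurable_continuous_onI by blast

lemma test_functions_integrable:
  assumes f: "f \<in> test_functions U"
  shows "integrable lborel f"
proof -
  obtain K where K: "compact K" "K \<subseteq> U" "\<And>x. x \<notin> K \<Longrightarrow> f x = 0" using test_functionsE[OF f] by blast
  have "integrable lborel (\<lambda>x. indicator K x *\<^sub>R f x)"
    by (rule borel_integrable_compact[OF K(1) smooth_on_continuous[OF test_functions_smooth[OF f]]])
  also have "(\<lambda>x. indicator K x *\<^sub>R f x) = f" using K(3) by (intro ext) (auto simp: indicator_def)
  finally show ?thesis .
qed

lemma test_functions_bounded: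
  assumes f: "f \<in> test_functions U"
  obtains B where "B \<ge> 0" "\<And>x. \<bar>f x\<bar> \<le> B"
proof -
  obtain K where K: "compact K" "K \<subseteq> U" "\<And>x. x \<notin> K \<Longrightarrow> f x = 0" using test_functionsE[OF f] by blast
  have "bounded (f ` K)"
    by (intro compact_imp_bounded compact_continuous_image K smooth_on_continuous[OF test_functions_smooth[OF f]])
  then obtain B where B: "\<And>x. x \<in> K \<Longrightarrow> \<bar>f x\<bar> \<le> B" unfolding bounded_iff by auto
  have "\<bar>f x\<bar> \<le> max B 0" for x using B[of x] K(3)[of x] by (cases "x \<in> K") auto
  then show thesis by (intro that[of "max B 0"]) auto
qed

lemma test_functions_uniformly_continuous:
  assumes f: "f \<in> test_functions U" and e: "e > 0"
  obtains d where "d > 0" "\<And>x y. norm (x - y) < d \<Longrightarrow> \<bar>f x - f y\<bar> < e"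
proof -
  obtain K where K: "compact K" "K \<subseteq> U" "\<And>x. x \<notin> K \<Longrightarrow> f x = 0" using test_functionsE[OF f] by blast
  obtain R where R: "\<And>x. x \<in> K \<Longrightarrow> norm x \<le> R"
    using compact_imp_bounded[OF K(1)] unfolding bounded_iff by auto
  have "uniformly_continuous_on (cball 0 (R + 1)) f"
    by (intro compact_uniformly_continuous smooth_on_continuous[OF test_functions_smooth[OF f]]) simp
  then obtain d where d: "d > 0" "\<And>x y. x \<in> cball 0 (R+1) \<Longrightarrow> y \<in> cball 0 (R+1) \<Longrightarrow> dist y x < d \<Longrightarrow> dist (f y) (f x) < e"
    using e unfolding uniformly_continuous_on_def by metis
  \<comment> \<open>At distance below 1, a point outside radius \<open>R + 1\<close> forces both
    points out of \<open>K\<close>, where \<open>f\<close> vanishes. Otherwise both lie in the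
    compact ball.\<close>
  have "\<bar>f x - f y\<bar> < e" if xy: "norm (x - y) < min d 1" for x y
  proof (cases "x \<in> cball 0 (R+1) \<and> y \<in> cball 0 (R+1)")
    case True
    then show ?thesis using d(2)[of y x] xy by (auto simp: dist_norm)
  next
    case False
    have "norm x \<le> norm y + norm (x - y)" "norm y \<le> norm x + norm (x - y)"
      by norm+
    then have "x \<notin> K" "y \<notin> K" using False R[of x] R[of y] xy by auto
    then show ?thesis using K(3) e by simp
  qed
  then show thesis using d(1) by (intro that[of "min d 1"]) auto
qed

lemma linear_bound_Basis:
  fixes L :: "'a::euclidean_space \<Rightarrow> real"
  assumes "linear L" "\<And>b. b \<in> Basis \<Longrightarrow> \<bar>L b\<bar> \<le> e" "e \<ge> 0"
  shows "\<bar>L v\<bar> \<le> real DIM('a) * e * norm v"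
proof -
  have "L v = L (\<Sum>b\<in>Basis. (v \<bullet> b) *\<^sub>R b)" by (simp add: euclidean_representation)
  also have "\<dots> = (\<Sum>b\<in>Basis. (v \<bullet> b) * L b)" by (simp add: linear_sum[OF assms(1)] linear_cmul[OF assms(1)])
  finally have "\<bar>L v\<bar> \<le> (\<Sum>b\<in>Basis. \<bar>(v \<bullet> b) * L b\<bar>)" by (simp add: sum_abs)
  also have "\<dots> \<le> (\<Sum>b\<in>(Basis::'a set). norm v * e)"
    unfolding abs_mult by (intro sum_mono mult_mono assms) (auto simp: Basis_le_norm assms)
  finally show ?thesis by (simp add: mult_ac)
qed

text \<open>The radius \<open>d\<close> is independent of the base point, because the partial
  derivatives are uniformly continuous and the mean value inequality controls the remainder. This
  uniformity is what allows difference quotients to be replaced by derivatives under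
  integrals.\<close>

lemma test_functions_linearization:
  fixes f :: "'a::euclidean_space \<Rightarrow> real"
  assumes f: "f \<in> test_functions U" and e: "e > 0"
  obtains d where "d > 0" "\<And>x v. norm v < d \<Longrightarrow> \<bar>f (x + v) - f x - frechet_derivative f (at x) v\<bar> \<le> e * norm v"
proof -
  let ?D = "\<lambda>x. frechet_derivative f (at x)"
  define n where "n = real DIM('a)"
  have n: "n > 0" by (simp add: n_def)
  have "\<exists>d>0. \<forall>x y. norm (x - y) < d \<longrightarrow> \<bar>?D x b - ?D y b\<bar> < e / n" if "b \<in> Basis" for b
    using test_functions_uniformly_continuous[OF test_functions_pd[OF f that], of "e / n"] e n by (metis divide_pos_pos)
  then obtain d where d: "\<And>b. b \<in> Basis \<Longrightarrow> d b > 0"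
    "\<And>b x y. b \<in> Basis \<Longrightarrow> norm (x - y) < d b \<Longrightarrow> \<bar>?D x b - ?D y b\<bar> < e / n"
    by metis
  define d0 where "d0 = Min (d ` Basis)"
  have d0: "d0 > 0" unfolding d0_def using d(1) by (subst Min_gr_iff) auto
  have d0': "d0 \<le> d b" if "b \<in> Basis" for b unfolding d0_def using that by auto
  have "\<bar>f (x + v) - f x - ?D x v\<bar> \<le> e * norm v" if v: "norm v < d0" for x v
  proof -
    have lin: "linear (?D y)" for y
      by (rule linear_frechet_derivative[OF test_functions_differentiable[OF f]])
    have "norm (f (x + v) - f x - ?D x ((x + v) - x)) \<le> norm ((x + v) - x) * e"
    proof (rule differentiable_bound_linearization[where S="cball x (norm v)" and f'="?D"])
      show "x + t *\<^sub>R (x + v - x) \<in> cball x (norm v)" if "t \<in> {0..1}" for t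
        using that by (auto simp: dist_norm abs_mult mult_left_le_one_le)
      show "(f has_derivative ?D y) (at y within cball x (norm v))" for y
        using smooth_on_has_derivative[OF test_functions_smooth[OF f]] has_derivative_at_withinI by blast
      show "onorm (?D y - ?D x) \<le> e" if "y \<in> cball x (norm v)" for y
      proof (rule onorm_le)
        fix h
        have "norm (y - x) < d0" using that v by (simp add: dist_norm norm_minus_commute)
        then have *: "\<bar>(?D y - ?D x) b\<bar> \<le> e / n" if "b \<in> Basis" for b
          using d(2)[of b y x] d0'[OF that] that by (auto intro: less_imp_le)
        have "linear (?D y - ?D x)"
          using linear_compose_sub[OF lin[of y] lin[of x]] by (simp add: fun_diff_def)
        then have "\<bar>(?D y - ?D x) h\<bar> \<le> real DIM('a) * (e / n) * norm h"
          using linear_bound_Basis[of "?D y - ?D x" "e / n" h] * e n by auto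
        then show "norm ((?D y - ?D x) h) \<le> e * norm h" using n by (simp add: n_def)
      qed
    qed simp
    then show ?thesis by (simp add: mult.commute)
  qed
  with d0 show thesis by (rule that)
qed

section \<open>Integration by parts and equality of mixed derivatives\<close>

lemma lborel_integral_translate:
  fixes f :: "'a::euclidean_space \<Rightarrow> real"
  assumes "f \<in> borel_measurable borel"
  shows "(LINT x|lborel. f (x + a)) = (LINT x|lborel. f x)"
proof -
  have "(LINT x|lborel. f x) = (LINT x|distr lborel borel ((+) a). f x)"
    by (simp add: lborel_distr_plus)
  also have "\<dots> = (LINT x|lborel. f (a + x))"
    using assms by (intro integral_distr) auto
  finally show ?thesis by (simp add: add.commute)
qed

lemma eq_0_if_abs_le_mult:
  fixes x m :: real
  assumes "\<And>e. e > 0 \<Longrightarrow> \<bar>x\<bar> \<le> e * m"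
  shows "x = 0"
proof (rule ccontr)
  assume "x \<noteq> 0"
  moreover have "\<bar>x\<bar> \<le> 1 * m" by (rule assms) simp
  ultimately have m: "m > 0" by linarith
  have "\<bar>x\<bar> \<le> \<bar>x\<bar> / (2 * m) * m" by (rule assms) (use m \<open>x \<noteq> 0\<close> in simp)
  with m \<open>x \<noteq> 0\<close> show False by (simp add: field_simps)
qed

text \<open>The difference quotients converge uniformly to the derivative, and their integrals vanish by
  translation invariance.\<close>

lemma integral_pd_test:
  fixes f :: "'a::euclidean_space \<Rightarrow> real"
  assumes f: "f \<in> test_functions UNIV" and b: "b \<in> Basis"
  shows "(LINT x|lborel. pd b f x) = 0"
proof -
  obtain K where K: "compact K" "\<And>x. x \<notin> K \<Longrightarrow> f x = 0"
    using f unfolding test_functions_def by auto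
  obtain R where R: "\<And>x. x \<in> K \<Longrightarrow> norm x \<le> R"
    using compact_imp_bounded[OF K(1)] unfolding bounded_iff by auto
  let ?I = "LINT x|lborel. pd b f x"
  let ?m = "measure lborel (cball (0::'a) (R + 1))"
  have le: "\<bar>?I\<bar> \<le> e * ?m" if e: "e > 0" for e
  proof -
    obtain d where d: "d > 0" "\<And>x v. norm v < d \<Longrightarrow> \<bar>f (x + v) - f x - frechet_derivative f (at x) v\<bar> \<le> e * norm v"
      using test_functions_linearization[OF f e] by blast
    \<comment> \<open>A step of length at most 1 keeps the difference quotient supported in the ball
      of radius \<open>R + 1\<close>, whose measure does not depend on \<open>e\<close>.\<close>
    define h where "h = min (d / 2) 1"
    have h: "h > 0" "norm (h *\<^sub>R b) < d" "norm (h *\<^sub>R b) = h" "h \<le> 1" using d b by (auto simp: h_def)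
    let ?q = "\<lambda>x. (f (x + h *\<^sub>R b) - f x) / h"
    have tr: "(\<lambda>x. f (x + h *\<^sub>R b)) \<in> test_functions UNIV" by (rule test_functions_translate[OF f])
    have q: "?q \<in> test_functions UNIV"
      using test_functions_cmult[OF test_functions_diff[OF tr f], of "1/h"] by simp
    have "(LINT x|lborel. ?q x) = ((LINT x|lborel. f (x + h *\<^sub>R b)) - (LINT x|lborel. f x)) / h"
      using test_functions_integrable[OF tr] test_functions_integrable[OF f] by simp
    then have q0: "(LINT x|lborel. ?q x) = 0"
      by (simp add: lborel_integral_translate test_functions_borel[OF f])
    have D: "pd b f \<in> test_functions UNIV" by (rule test_functions_pd[OF f b])
    have "?I = (LINT x|lborel. pd b f x - ?q x)"
      using q0 test_functions_integrable[OF D] test_functions_integrable[OF q] by simp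
    also have "\<bar>\<dots>\<bar> \<le> (LINT x|lborel. e * indicator (cball (0::'a) (R + 1)) x)"
    proof (rule integral_abs_bound_integral)
      show "integrable lborel (\<lambda>x. pd b f x - ?q x)"
        by (rule test_functions_integrable[OF test_functions_diff[OF D q]])
      show "integrable lborel (\<lambda>x. e * indicator (cball (0::'a) (R + 1)) x)"
        using emeasure_lborel_cball_finite[of "0::'a" "R + 1"]
        by (intro integrable_mult_right integrable_real_indicator) auto
      fix x :: 'a
      show "\<bar>pd b f x - ?q x\<bar> \<le> e * indicator (cball 0 (R + 1)) x"
      proof (cases "x \<in> cball 0 (R + 1)")
        case True
        have "frechet_derivative f (at x) (h *\<^sub>R b) = h * pd b f x"
          by (simp add: linear_cmul[OF linear_frechet_derivative[OF test_functions_differentiable[OF f]]])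
        then have "\<bar>f (x + h *\<^sub>R b) - f x - h * pd b f x\<bar> \<le> e * h" using d(2)[OF h(2), of x] h(3) by simp
        moreover have "pd b f x - ?q x = - (f (x + h *\<^sub>R b) - f x - h * pd b f x) / h"
          using h by (simp add: field_simps)
        ultimately show ?thesis using h True by (simp add: abs_divide divide_le_eq)
      next
        case False
        have "norm x \<le> norm (x + h *\<^sub>R b) + norm (h *\<^sub>R b)"
          using norm_triangle_ineq4[of "x + h *\<^sub>R b" "h *\<^sub>R b"] by simp
        then have out: "x + h *\<^sub>R b \<notin> K" "x \<notin> K" using R[of x] R[of "x + h *\<^sub>R b"] False h by auto
        have "pd b f x = 0"
          by (rule pd_eq_0[OF compact_imp_closed[OF K(1)]]) (use K out in auto)
        then show ?thesis using K out False by auto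
      qed
    qed
    also have "\<dots> = e * ?m" by simp
    finally show ?thesis .
  qed
  show ?thesis by (rule eq_0_if_abs_le_mult[OF le])
qed

lemma integral_by_parts_test:
  fixes f :: "'a::euclidean_space \<Rightarrow> real"
  assumes f: "f \<in> test_functions UNIV" and g: "smooth_on UNIV g" and b: "b \<in> Basis"
  shows "(LINT x|lborel. g x * pd b f x) = - (LINT x|lborel. pd b g x * f x)"
proof -
  have "pd b (\<lambda>x. f x * g x) = (\<lambda>x. pd b g x * f x + g x * pd b f x)"
    using pd_mult[OF test_functions_differentiable[OF f] smooth_on_differentiable[OF g]] by (auto simp: mult_ac)
  then have "0 = (LINT x|lborel. pd b g x * f x + g x * pd b f x)"
    using integral_pd_test[OF test_functions_mult[OF f g] b] by simp
  also have "\<dots> = (LINT x|lborel. pd b g x * f x) + (LINT x|lborel. g x * pd b f x)"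
    using test_functions_integrable[OF test_functions_mult[OF f smooth_on_pd[OF g b]]]
      test_functions_integrable[OF test_functions_mult[OF test_functions_pd[OF f b] g]]
    by (intro Bochner_Integration.integral_add) (auto simp: mult_ac)
  finally show ?thesis by simp
qed

lemma continuous_AE_zero:
  fixes f :: "'a::euclidean_space \<Rightarrow> real"
  assumes "continuous_on UNIV f" "AE x in lborel. f x = 0"
  shows "f x = 0"
proof (rule ccontr)
  assume "f x \<noteq> 0"
  have op: "open {x. f x \<noteq> 0}" using assms(1) by (intro open_Collect_neq) auto
  have "{x. f x \<noteq> 0} \<in> null_sets lborel"
    using assms(2) op by (subst (asm) AE_iff_null) auto
  then have "negligible {x. f x \<noteq> 0}"
    by (simp add: negligible_iff_null_sets null_sets_completionI)
  moreover obtain e where "e > 0" "ball x e \<subseteq> {x. f x \<noteq> 0}"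
    using op \<open>f x \<noteq> 0\<close> open_contains_ball by blast
  ultimately have "negligible (ball x e)" using negligible_subset by blast
  then show False using \<open>e > 0\<close> by (simp add: negligible_convex_interior)
qed

lemma integral_square_test_eq_0:
  fixes f :: "'a::euclidean_space \<Rightarrow> real"
  assumes f: "f \<in> test_functions U" and "(LINT x|lborel. f x * f x) = 0"
  shows "f x = 0"
proof -
  have "integrable lborel (\<lambda>x. f x * f x)"
    by (rule test_functions_integrable[OF test_functions_mult[OF f test_functions_smooth[OF f]]])
  then have "AE x in lborel. f x * f x = 0"
    using assms(2) by (subst (asm) integral_nonneg_eq_0_iff_AE) auto
  then have "AE x in lborel. f x = 0" by simp
  then show ?thesis
    using continuous_AE_zero smooth_on_continuous[OF test_functions_smooth[OF f]] by blast
qed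

text \<open>The square of the commutator \<open>?g\<close> integrates to \<open>- (?X + ?Y)\<close>.
  A difference quotient in direction \<open>c\<close> commutes exactly with \<open>pd b\<close>, so
  integration by parts gives zero when it replaces the derivative in direction \<open>c\<close>, and
  the error of the replacement is uniformly small. A continuous function whose square has integral
  zero vanishes everywhere.\<close>

lemma pd_commute_test:
  fixes f :: "'a::euclidean_space \<Rightarrow> real"
  assumes f: "f \<in> test_functions UNIV" and b: "b \<in> Basis" and c: "c \<in> Basis"
  shows "pd b (pd c f) x = pd c (pd b f) x"
proof -
  let ?g = "\<lambda>x. pd b (pd c f) x - pd c (pd b f) x"
  have g: "?g \<in> test_functions UNIV" by (intro test_functions_diff test_functions_pd f b c)
  have bg: "pd b ?g \<in> test_functions UNIV" by (intro test_functions_pd g b)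
  have int: "integrable lborel (\<lambda>x. \<bar>z x\<bar>)" if "z \<in> test_functions UNIV" for z :: "'a \<Rightarrow> real"
    using test_functions_integrable[OF that] by simp
  let ?A = "LINT x|lborel. \<bar>pd b ?g x\<bar>" and ?B = "LINT x|lborel. \<bar>?g x\<bar>"
  let ?X = "LINT x|lborel. pd c f x * pd b ?g x" and ?Y = "LINT x|lborel. pd c (pd b f) x * ?g x"
  have small: "\<bar>?X + ?Y\<bar> \<le> e * (?A + ?B)" if e: "e > 0" for e
  proof -
    obtain d where d: "d > 0" "\<And>x v. norm v < d \<Longrightarrow> \<bar>f (x + v) - f x - frechet_derivative f (at x) v\<bar> \<le> e * norm v"
      using test_functions_linearization[OF f e] by blast
    obtain d' where d': "d' > 0" "\<And>x v. norm v < d' \<Longrightarrow> \<bar>pd b f (x + v) - pd b f x - frechet_derivative (pd b f) (at x) v\<bar> \<le> e * norm v"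
      using test_functions_linearization[OF test_functions_pd[OF f b] e] by blast
    define h where "h = min d d' / 2"
    have h: "h > 0" "norm (h *\<^sub>R c) < d" "norm (h *\<^sub>R c) < d'" "norm (h *\<^sub>R c) = h"
      using d d' c by (auto simp: h_def)
    let ?q = "\<lambda>x. (1/h) * (f (x + h *\<^sub>R c) - f x)"
    have tr: "(\<lambda>x. f (x + h *\<^sub>R c)) \<in> test_functions UNIV" by (rule test_functions_translate[OF f])
    have q: "?q \<in> test_functions UNIV"
      using test_functions_cmult[OF test_functions_diff[OF tr f], of "1/h"] by simp
    have pq: "pd b ?q x = (pd b f (x + h *\<^sub>R c) - pd b f x) / h" for x
      using test_functions_differentiable[OF f] test_functions_differentiable[OF tr]
      by (subst pd_cmult) (auto simp: pd_diff pd_translate)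
    have b1: "\<bar>?q x - pd c f x\<bar> \<le> e" for x
    proof -
      have "frechet_derivative f (at x) (h *\<^sub>R c) = h * pd c f x"
        by (simp add: linear_cmul[OF linear_frechet_derivative[OF test_functions_differentiable[OF f]]])
      then have "\<bar>f (x + h *\<^sub>R c) - f x - h * pd c f x\<bar> \<le> e * h" using d(2)[OF h(2), of x] h(4) by simp
      moreover have "?q x - pd c f x = (f (x + h *\<^sub>R c) - f x - h * pd c f x) / h"
        using h by (simp add: field_simps)
      ultimately show ?thesis using h by (simp add: abs_divide divide_le_eq)
    qed
    have b2: "\<bar>pd b ?q x - pd c (pd b f) x\<bar> \<le> e" for x
    proof -
      have "frechet_derivative (pd b f) (at x) (h *\<^sub>R c) = h * pd c (pd b f) x"
        by (simp add: linear_cmul[OF linear_frechet_derivative[OF test_functions_differentiable[OF test_functions_pd[OF f b]]]])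
      then have "\<bar>pd b f (x + h *\<^sub>R c) - pd b f x - h * pd c (pd b f) x\<bar> \<le> e * h" using d'(2)[OF h(3), of x] h(4) by simp
      moreover have "pd b ?q x - pd c (pd b f) x = (pd b f (x + h *\<^sub>R c) - pd b f x - h * pd c (pd b f) x) / h"
        unfolding pq using h by (simp add: field_simps)
      ultimately show ?thesis using h by (simp add: abs_divide divide_le_eq)
    qed
    have ibp: "(LINT x|lborel. ?q x * pd b ?g x) = - (LINT x|lborel. pd b ?q x * ?g x)"
      by (rule integral_by_parts_test[OF g test_functions_smooth[OF q] b])
    have i1: "integrable lborel (\<lambda>x. ?q x * pd b ?g x)" 
      using test_functions_integrable[OF test_functions_mult[OF q test_functions_smooth[OF bg]]] by simp
    have i2: "integrable lborel (\<lambda>x. pd c f x * pd b ?g x)" 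
      using test_functions_integrable[OF test_functions_mult[OF test_functions_pd[OF f c] test_functions_smooth[OF bg]]] by simp
    have i3: "integrable lborel (\<lambda>x. pd b ?q x * ?g x)" 
      using test_functions_integrable[OF test_functions_mult[OF test_functions_pd[OF q b] test_functions_smooth[OF g]]] by simp
    have i4: "integrable lborel (\<lambda>x. pd c (pd b f) x * ?g x)" 
      using test_functions_integrable[OF test_functions_mult[OF test_functions_pd[OF test_functions_pd[OF f b] c] test_functions_smooth[OF g]]] by simp
    have "\<bar>(LINT x|lborel. ?q x * pd b ?g x - pd c f x * pd b ?g x)\<bar> \<le> (LINT x|lborel. e * \<bar>pd b ?g x\<bar>)"
    proof (rule integral_abs_bound_integral)
      show "\<bar>?q x * pd b ?g x - pd c f x * pd b ?g x\<bar> \<le> e * \<bar>pd b ?g x\<bar>" for x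
        using mult_right_mono[OF b1[of x], of "\<bar>pd b ?g x\<bar>"] by (simp add: left_diff_distrib flip: abs_mult)
    qed (use i1 i2 int[OF bg] in auto)
    then have B1: "\<bar>(LINT x|lborel. ?q x * pd b ?g x) - ?X\<bar> \<le> e * ?A"
      using i1 i2 by simp
    have "\<bar>(LINT x|lborel. pd b ?q x * ?g x - pd c (pd b f) x * ?g x)\<bar> \<le> (LINT x|lborel. e * \<bar>?g x\<bar>)"
    proof (rule integral_abs_bound_integral)
      show "\<bar>pd b ?q x * ?g x - pd c (pd b f) x * ?g x\<bar> \<le> e * \<bar>?g x\<bar>" for x
        using mult_right_mono[OF b2[of x], of "\<bar>?g x\<bar>"] by (simp only: left_diff_distrib flip: abs_mult)
    qed (use i3 i4 int[OF g] in auto)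
    then have B2: "\<bar>(LINT x|lborel. pd b ?q x * ?g x) - ?Y\<bar> \<le> e * ?B"
      using i3 i4 by simp
    show ?thesis using B1 B2 ibp unfolding distrib_left by linarith
  qed
  have "?X + ?Y = 0" by (rule eq_0_if_abs_le_mult[OF small])
  moreover have "?X = - (LINT x|lborel. pd b (pd c f) x * ?g x)"
    by (rule integral_by_parts_test[OF g test_functions_smooth[OF test_functions_pd[OF f c]] b])
  moreover have "(LINT x|lborel. ?g x * ?g x) = (LINT x|lborel. pd b (pd c f) x * ?g x - pd c (pd b f) x * ?g x)"
    by (simp add: left_diff_distrib)
  moreover have "\<dots> = (LINT x|lborel. pd b (pd c f) x * ?g x) - ?Y"
    using test_functions_integrable[OF test_functions_mult[OF test_functions_pd[OF test_functions_pd[OF f c] b] test_functions_smooth[OF g]]]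
      test_functions_integrable[OF test_functions_mult[OF test_functions_pd[OF test_functions_pd[OF f b] c] test_functions_smooth[OF g]]]
    by (intro Bochner_Integration.integral_diff) auto
  ultimately have "(LINT x|lborel. ?g x * ?g x) = 0" by linarith
  then have "?g x = 0" by (rule integral_square_test_eq_0[OF g])
  then show ?thesis by simp
qed

text \<open>No explicit bump function is written down: any test function with a nonzero value is
  recentred at that point, contracted, squared to become nonnegative, and normalised.\<close>

lemma mollifier_exists:
  fixes f :: "'a::euclidean_space \<Rightarrow> real"
  assumes f: "f \<in> test_functions U" and x0: "f x0 \<noteq> 0" and d: "d > 0"
  obtains \<rho> where "\<rho> \<in> test_functions (ball (0::'a) d)" "\<And>x. \<rho> x \<ge> 0" "(LINT x|lborel. \<rho> x) = 1"
proof -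
  obtain K where K: "compact K" "K \<subseteq> U" "\<And>x. x \<notin> K \<Longrightarrow> f x = 0" using test_functionsE[OF f] by blast
  obtain R0 where R0: "\<And>x. x \<in> K \<Longrightarrow> norm (x - x0) \<le> R0"
    using compact_imp_bounded[OF compact_translation_subtract[OF K(1), of x0]] unfolding bounded_iff by auto
  define R where "R = max R0 1"
  have R: "R > 0" "\<And>x. x \<in> K \<Longrightarrow> norm (x - x0) \<le> R" using R0 by (force simp: R_def)+
  \<comment> \<open>Contracts a support of radius \<open>R\<close> to radius \<open>d / 2\<close>,
    so that a compact ball inside the open ball of radius \<open>d\<close> carries it.\<close>
  define c where "c = 2 * R / d"
  have c: "c > 0" using R d by (simp add: c_def)
  define g where "g x = f (x0 + c *\<^sub>R x)" for x
  have gs: "smooth_on UNIV g" unfolding g_def by (rule smooth_on_scale[OF test_functions_smooth[OF f]])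
  have "g x = 0" if "x \<notin> cball 0 (d / 2)" for x
  proof -
    have "R < c * norm x" using that d R by (simp add: c_def field_simps)
    then have "R < norm ((x0 + c *\<^sub>R x) - x0)" using c by simp
    then have "x0 + c *\<^sub>R x \<notin> K" using R(2) by force
    then show ?thesis using K(3) by (simp add: g_def)
  qed
  then have g: "g \<in> test_functions (ball 0 d)"
    unfolding test_functions_def using gs d by (auto intro!: exI[of _ "cball 0 (d/2)"])
  let ?I = "LINT x|lborel. g x * g x"
  have g2: "(\<lambda>x. g x * g x) \<in> test_functions (ball 0 d)" by (rule test_functions_mult[OF g gs])
  have "?I \<noteq> 0" using integral_square_test_eq_0[OF g, of 0] x0 by (auto simp: g_def)
  moreover have "?I \<ge> 0" by simp
  ultimately have I: "?I > 0" by linarith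
  show thesis
  proof (rule that[of "\<lambda>x. (1 / ?I) * (g x * g x)"])
    show "(\<lambda>x. (1 / ?I) * (g x * g x)) \<in> test_functions (ball 0 d)" by (rule test_functions_cmult[OF g2])
    show "(1 / ?I) * (g x * g x) \<ge> 0" for x using I by simp
    show "(LINT x|lborel. (1 / ?I) * (g x * g x)) = 1" using I by simp
  qed
qed

section \<open>Mollification and weak derivatives\<close>

lemma locally_integrable_measurable:
  assumes "open \<Omega>" "locally_integrable \<Omega> f"
  shows "f \<in> borel_measurable (lebesgue_on \<Omega>)"
proof -
  obtain D where D: "countable D" "\<And>X. X \<in> D \<Longrightarrow> X \<subseteq> \<Omega> \<and> (\<exists>a b. X = cbox a b)" "\<Union>D = \<Omega>"
    using open_countable_Union_open_cbox[OF assms(1)] by (metis Pow_iff subsetD)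
  show ?thesis
  proof (rule measurable_piecewise_restrict[OF D(1)])
    fix X assume X: "X \<in> D"
    then obtain a b where ab: "X = cbox a b" "X \<subseteq> \<Omega>" using D(2) by blast
    show "X \<inter> space (lebesgue_on \<Omega>) \<in> sets (lebesgue_on \<Omega>)"
      using ab assms(1) by (auto simp: sets_restrict_space)
    have "restrict_space (lebesgue_on \<Omega>) X = lebesgue_on X"
      using ab by (simp add: restrict_restrict_space Int_absorb1 assms(1))
    moreover have "f \<in> borel_measurable (lebesgue_on X)"
      using assms(2) ab compact_cbox unfolding locally_integrable_def
      by (metis borel_measurable_integrable)
    ultimately show "f \<in> measurable (restrict_space (lebesgue_on \<Omega>) X) borel" by simp
  qed (use D(3) in auto)
qed

text \<open>Convolution of the extension of \<open>P\<close> by zero: only the values of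
  \<open>P\<close> on the domain enter, although the result is defined on the whole plane.\<close>

definition conv :: "(real^2) set \<Rightarrow> (real^2 \<Rightarrow> real) \<Rightarrow> (real^2 \<Rightarrow> real) \<Rightarrow> real^2 \<Rightarrow> real" where
  "conv \<Omega> P \<rho> x = (LINT y|lebesgue_on \<Omega>. P y * \<rho> (x - y))"

locale dirichlet =
  fixes \<Omega> :: "(real^2) set" and w :: "nat \<Rightarrow> real^2 \<Rightarrow> real" and lam :: "nat \<Rightarrow> real"
  assumes domain: "smooth_bounded_domain \<Omega>" and eigenbasis: "dirichlet_eigenbasis \<Omega> w lam"
begin

lemma open_domain: "open \<Omega>" and bounded_domain: "bounded \<Omega>"
  using domain by (auto simp: smooth_bounded_domain_def)

lemma lmeasurable_domain: "\<Omega> \<in> lmeasurable"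
  using open_domain bounded_domain by (rule lmeasurable_open[rotated])

lemma sets_domain [measurable, simp]: "\<Omega> \<in> sets lebesgue"
  using lmeasurable_domain by (rule fmeasurableD)

lemma finite_measure_domain: "finite_measure (lebesgue_on \<Omega>)"
  by (rule finite_measure_lebesgue_on[OF lmeasurable_domain])

abbreviation inner where "inner \<equiv> L2_inner \<Omega>"
abbreviation nrm where "nrm \<equiv> L2_norm \<Omega>"
abbreviation MO where "MO \<equiv> lebesgue_on \<Omega>"

lemma borel_measurable_domain:
  fixes f :: "real^2 \<Rightarrow> real"
  shows "f \<in> borel_measurable borel \<Longrightarrow> f \<in> borel_measurable MO"
  by (intro measurable_restrict_space1 measurable_completion) simp

lemma bounded_in_L2:
  assumes "f \<in> borel_measurable MO" "\<And>x. x \<in> \<Omega> \<Longrightarrow> \<bar>f x\<bar> \<le> B"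
  shows "f \<in> L2 \<Omega>"
proof -
  have "(\<lambda>x. 1) \<in> L2 \<Omega>"
    using finite_measure.integrable_const[OF finite_measure_domain] by (simp add: L2_def)
  from L2_mult_bounded[OF this assms] show ?thesis by simp
qed

lemma const_in_L2: "(\<lambda>x. c) \<in> L2 \<Omega>"
  by (rule bounded_in_L2[of _ "\<bar>c\<bar>"]) auto

lemma L2_integrable: "f \<in> L2 \<Omega> \<Longrightarrow> integrable MO f"
  using L2_mult_integrable[OF _ const_in_L2[of 1]] by simp

lemma nrm_bounded_le:
  assumes "f \<in> borel_measurable MO" "\<And>x. x \<in> \<Omega> \<Longrightarrow> \<bar>f x\<bar> \<le> B" "B \<ge> 0"
  shows "nrm f \<le> B * sqrt (measure lebesgue \<Omega>)"
proof -
  have "(LINT x|MO. (f x)\<^sup>2) \<le> (LINT x|MO. B\<^sup>2)"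
  proof (rule integral_mono)
    show "integrable MO (\<lambda>x. (f x)\<^sup>2)" by (rule L2_integrable_square[OF bounded_in_L2[OF assms(1,2)]])
    show "integrable MO (\<lambda>x. B\<^sup>2)" by (rule finite_measure.integrable_const[OF finite_measure_domain])
    show "(f x)\<^sup>2 \<le> B\<^sup>2" if "x \<in> space MO" for x
      using assms(2)[of x] that by (metis abs_ge_zero power2_abs power_mono space_lebesgue_on)
  qed
  also have "\<dots> = B\<^sup>2 * measure lebesgue \<Omega>"
    by (simp add: measure_restrict_space mult.commute)
  finally have "sqrt (LINT x|MO. (f x)\<^sup>2) \<le> sqrt (B\<^sup>2 * measure lebesgue \<Omega>)"
    by (rule real_sqrt_le_mono)
  then show ?thesis using assms(3) by (simp add: L2_norm_def real_sqrt_mult)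
qed

lemma smooth_measurable: "smooth_on UNIV f \<Longrightarrow> f \<in> borel_measurable MO"
  by (intro borel_measurable_domain borel_measurable_continuous_onI smooth_on_continuous)

lemma test_measurable: "f \<in> test_functions U \<Longrightarrow> f \<in> borel_measurable MO"
  by (intro borel_measurable_domain test_functions_borel)

lemma test_in_L2:
  assumes "f \<in> test_functions U"
  shows "f \<in> L2 \<Omega>"
proof -
  obtain B where "\<And>x. \<bar>f x\<bar> \<le> B" using test_functions_bounded[OF assms] by blast
  then show ?thesis using bounded_in_L2[OF test_measurable[OF assms]] by blast
qed

lemma L2_mult_test:
  assumes "g \<in> L2 \<Omega>" "f \<in> test_functions U"
  shows "(\<lambda>x. g x * f x) \<in> L2 \<Omega>"
proof -
  obtain B where "\<And>x. \<bar>f x\<bar> \<le> B" using test_functions_bounded[OF assms(2)] by blast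
  then show ?thesis using L2_mult_bounded[OF assms(1) test_measurable[OF assms(2)]] by blast
qed

lemma integral_domain_eq_lborel:
  fixes f :: "real^2 \<Rightarrow> real"
  assumes "f \<in> borel_measurable borel" "\<And>x. x \<notin> \<Omega> \<Longrightarrow> f x = 0"
  shows "(LINT x|MO. f x) = (LINT x|lborel. f x)"
proof -
  have "(LINT x|MO. f x) = (LINT x|lebesgue. indicator \<Omega> x *\<^sub>R f x)"
    by (rule integral_restrict_space) simp
  also have "(\<lambda>x. indicator \<Omega> x *\<^sub>R f x) = f"
    using assms(2) by (intro ext) (auto simp: indicator_def)
  also have "(LINT x|lebesgue. f x) = (LINT x|lborel. f x)"
    by (rule integral_completion) (use assms(1) in simp)
  finally show ?thesis .
qed

lemma integral_le_lborel:
  assumes "f \<in> test_functions U" "\<And>x. f x \<ge> 0"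
  shows "(LINT x|MO. f x) \<le> (LINT x|lborel. f x)"
proof -
  have [measurable]: "f \<in> borel_measurable borel" by (rule test_functions_borel[OF assms(1)])
  have int: "integrable lebesgue f"
    using test_functions_integrable[OF assms(1)] by (subst integrable_completion) auto
  have "(LINT x|MO. f x) = (LINT x|lebesgue. indicator \<Omega> x *\<^sub>R f x)"
    by (rule integral_restrict_space) simp
  also have "\<dots> \<le> (LINT x|lebesgue. f x)"
    using int assms(2) by (intro integral_mono integrable_mult_indicator) (auto simp: indicator_def)
  also have "\<dots> = (LINT x|lborel. f x)"
    by (rule integral_completion) simp
  finally show ?thesis .
qed

lemma reflect_test:
  assumes "\<rho> \<in> test_functions (ball (0::real^2) d)"
  shows "(\<lambda>y. \<rho> (x - y)) \<in> test_functions (ball x d)"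
proof -
  obtain K where K: "compact K" "K \<subseteq> ball 0 d" "\<And>x. x \<notin> K \<Longrightarrow> \<rho> x = 0"
    using test_functionsE[OF assms] by blast
  have "compact ((\<lambda>y. x - y) ` K)" by (intro compact_continuous_image K continuous_intros)
  moreover have "(\<lambda>y. x - y) ` K \<subseteq> ball x d" using K(2) by (auto simp: dist_norm)
  moreover have "\<rho> (x - y) = 0" if "y \<notin> (\<lambda>y. x - y) ` K" for y
    using K(3)[of "x - y"] that image_eqI[of y "\<lambda>y. x - y" "x - y" K] by auto
  moreover have "smooth_on UNIV (\<lambda>y. \<rho> (x - y))"
    using smooth_on_scale[OF test_functions_smooth[OF assms], of x "-1"] by simp
  ultimately show ?thesis unfolding test_functions_def by blast
qed

lemma reflect_test_UNIV:
  assumes "\<rho> \<in> test_functions UNIV"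
  shows "(\<lambda>y. \<rho> (x - y)) \<in> test_functions (UNIV :: (real^2) set)"
proof -
  obtain K where K: "compact K" "K \<subseteq> UNIV" "\<And>x. x \<notin> K \<Longrightarrow> \<rho> x = 0"
    using test_functionsE[OF assms] by blast
  obtain d where "K \<subseteq> ball 0 d" using compact_imp_bounded[OF K(1)] bounded_subset_ballD by blast
  then have "\<rho> \<in> test_functions (ball 0 d)"
    using K test_functions_smooth[OF assms] unfolding test_functions_def by blast
  from test_functions_mono[OF reflect_test[OF this]] show ?thesis by blast
qed

lemma integral_reflect:
  fixes \<rho> :: "real^2 \<Rightarrow> real"
  assumes "\<rho> \<in> borel_measurable (borel :: (real^2) measure)"
  shows "(LINT y|lborel. \<rho> (x - y)) = (LINT y|lborel. \<rho> y)"
proof -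
  have "(lborel :: (real^2) measure) = density (distr lborel borel (\<lambda>y. x + (-1) *\<^sub>R y)) (\<lambda>_. ennreal (\<bar>-1\<bar> ^ DIM(real^2)))"
    by (rule lborel_affine) simp
  then have eq: "distr lborel borel (\<lambda>y. x - y) = (lborel :: (real^2) measure)"
    by (simp add: density_1)
  have "(LINT y|lborel. \<rho> y) = (LINT y|distr lborel borel (\<lambda>y. x - y). \<rho> y)" by (simp add: eq)
  also have "\<dots> = (LINT y|lborel. \<rho> (x - y))" using assms by (intro integral_distr) auto
  finally show ?thesis by simp
qed

lemma nn_integral_reflect:
  assumes "\<rho> \<in> borel_measurable (borel :: (real^2) measure)"
  shows "(\<integral>\<^sup>+x. \<rho> (x - y) \<partial>lborel) = (\<integral>\<^sup>+x. \<rho> x \<partial>lborel)"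
proof -
  have "(\<integral>\<^sup>+x. \<rho> x \<partial>lborel) = (\<integral>\<^sup>+x. \<rho> x \<partial>distr lborel borel ((+) (-y)))"
    by (simp add: lborel_distr_plus)
  also have "\<dots> = (\<integral>\<^sup>+x. \<rho> (- y + x) \<partial>lborel)" using assms by (intro nn_integral_distr) auto
  finally show ?thesis by simp
qed

lemma conv_integrand:
  assumes "P \<in> L2 \<Omega>" "\<rho> \<in> test_functions UNIV"
  shows "integrable MO (\<lambda>y. P y * \<rho> (x - y))"
  by (rule L2_mult_integrable[OF assms(1) test_in_L2[OF reflect_test_UNIV[OF assms(2)]]])

text \<open>Differentiation under the integral sign. The linearization error of the kernel is
  uniform in its base point, so after integration it is at most \<open>e' * norm ?h\<close> times
  the L^1 norm \<open>A\<close> of \<open>P\<close>. The denominator \<open>A + 1\<close> of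
  \<open>e'\<close> covers \<open>A = 0\<close>.\<close>

lemma conv_has_derivative:
  assumes P: "P \<in> L2 \<Omega>" and \<rho>: "\<rho> \<in> test_functions UNIV"
  shows "(conv \<Omega> P \<rho> has_derivative (\<lambda>h. \<Sum>b\<in>Basis. (h \<bullet> b) * conv \<Omega> P (pd b \<rho>) x)) (at x)"
    (is "(_ has_derivative ?D) _")
  unfolding has_derivative_at_alt
proof (intro conjI allI impI)
  show "bounded_linear ?D"
    by (intro bounded_linear_sum bounded_linear_mult_left[THEN bounded_linear_compose] bounded_linear_inner_left)
  fix e :: real assume e: "e > 0"
  define A where "A = (LINT y|MO. \<bar>P y\<bar>)"
  have A: "A \<ge> 0" by (simp add: A_def)
  define e' where "e' = e / (A + 1)"
  have e': "e' > 0" "e' * A \<le> e" using e A by (auto simp: e'_def field_simps)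
  obtain d where d: "d > 0" "\<And>x v. norm v < d \<Longrightarrow> \<bar>\<rho> (x + v) - \<rho> x - frechet_derivative \<rho> (at x) v\<bar> \<le> e' * norm v"
    using test_functions_linearization[OF \<rho> e'(1)] by blast
  show "\<exists>d>0. \<forall>z. norm (z - x) < d \<longrightarrow> norm (conv \<Omega> P \<rho> z - conv \<Omega> P \<rho> x - ?D (z - x)) \<le> e * norm (z - x)"
  proof (intro exI[of _ d] conjI d(1) allI impI)
    fix z assume z: "norm (z - x) < d"
    let ?h = "z - x"
    have D: "frechet_derivative \<rho> (at u) ?h = (\<Sum>b\<in>Basis. (?h \<bullet> b) * pd b \<rho> u)" for u
    proof -
      have lin: "linear (frechet_derivative \<rho> (at u))"
        by (rule linear_frechet_derivative[OF test_functions_differentiable[OF \<rho>]])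
      have "frechet_derivative \<rho> (at u) ?h = frechet_derivative \<rho> (at u) (\<Sum>b\<in>Basis. (?h \<bullet> b) *\<^sub>R b)"
        by (simp only: euclidean_representation)
      also have "\<dots> = (\<Sum>b\<in>Basis. (?h \<bullet> b) * pd b \<rho> u)"
        by (simp add: linear_sum[OF lin] linear_cmul[OF lin])
      finally show ?thesis .
    qed
    have int: "integrable MO (\<lambda>y. P y * pd b \<rho> (x - y))" if "b \<in> Basis" for b
      by (rule conv_integrand[OF P test_functions_pd[OF \<rho> that]])
    note i = conv_integrand[OF P \<rho>]
    have int': "integrable MO (\<lambda>y. \<Sum>b\<in>Basis. (?h \<bullet> b) * (P y * pd b \<rho> (x - y)))"
      by (intro Bochner_Integration.integrable_sum integrable_mult_right int)
    have "?D ?h = (LINT y|MO. (\<Sum>b\<in>Basis. (?h \<bullet> b) * (P y * pd b \<rho> (x - y))))"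
      unfolding conv_def using int by (simp add: Bochner_Integration.integral_sum)
    then have "conv \<Omega> P \<rho> z - conv \<Omega> P \<rho> x - ?D ?h
        = (LINT y|MO. P y * \<rho> (z - y) - P y * \<rho> (x - y) - (\<Sum>b\<in>Basis. (?h \<bullet> b) * (P y * pd b \<rho> (x - y))))"
      unfolding conv_def
      by (simp only: Bochner_Integration.integral_diff[OF Bochner_Integration.integrable_diff[OF i i] int']
            Bochner_Integration.integral_diff[OF i i])
    also have "norm \<dots> \<le> (LINT y|MO. (e' * norm ?h) * \<bar>P y\<bar>)"
      unfolding real_norm_def
    proof (rule integral_abs_bound_integral)
      fix y
      have "P y * \<rho> (z - y) - P y * \<rho> (x - y) - (\<Sum>b\<in>Basis. (?h \<bullet> b) * (P y * pd b \<rho> (x - y)))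
          = P y * (\<rho> ((x - y) + ?h) - \<rho> (x - y) - frechet_derivative \<rho> (at (x - y)) ?h)"
        unfolding D by (simp add: algebra_simps sum_distrib_left)
      then show "\<bar>P y * \<rho> (z - y) - P y * \<rho> (x - y) - (\<Sum>b\<in>Basis. (?h \<bullet> b) * (P y * pd b \<rho> (x - y)))\<bar>
          \<le> (e' * norm ?h) * \<bar>P y\<bar>"
        using mult_left_mono[OF d(2)[OF z, of "x - y"], of "\<bar>P y\<bar>"] by (simp add: abs_mult mult.commute)
    qed (use conv_integrand[OF P \<rho>] int' L2_integrable[OF P] in auto)
    also have "\<dots> = (e' * A) * norm ?h" by (simp add: A_def)
    also have "\<dots> \<le> e * norm ?h" using e'(2) by (intro mult_right_mono) auto
    finally show "norm (conv \<Omega> P \<rho> z - conv \<Omega> P \<rho> x - ?D ?h) \<le> e * norm ?h" .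
  qed
qed

lemma pd_conv:
  assumes P: "P \<in> L2 \<Omega>" and \<rho>: "\<rho> \<in> test_functions UNIV" and b: "b \<in> Basis"
  shows "pd b (conv \<Omega> P \<rho>) x = conv \<Omega> P (pd b \<rho>) x"
proof -
  have "pd b (conv \<Omega> P \<rho>) x = (\<Sum>c\<in>Basis. (b \<bullet> c) * conv \<Omega> P (pd c \<rho>) x)"
    by (rule has_derivative_imp_pd[OF conv_has_derivative[OF P \<rho>]])
  also have "\<dots> = (\<Sum>c\<in>Basis. if c = b then conv \<Omega> P (pd c \<rho>) x else 0)"
    by (rule sum.cong) (use b in \<open>auto simp: inner_Basis\<close>)
  finally show ?thesis using b by simp
qed

lemma smooth_conv:
  assumes P: "P \<in> L2 \<Omega>" and \<rho>: "\<rho> \<in> test_functions UNIV"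
  shows "smooth_on UNIV (conv \<Omega> P \<rho>)"
proof -
  have "Ck_on m UNIV (conv \<Omega> P \<rho>)" for m
    using \<rho>
  proof (induction m arbitrary: \<rho>)
    case 0
    show ?case
      using conv_has_derivative[OF P 0]
      by (auto intro!: continuous_at_imp_continuous_on has_derivative_continuous)
  next
    case (Suc m)
    have "pd b (conv \<Omega> P \<rho>) = conv \<Omega> P (pd b \<rho>)" if "b \<in> Basis" for b
      using pd_conv[OF P Suc.prems that] by blast
    then show ?case
      using conv_has_derivative[OF P Suc.prems] Suc.IH[OF test_functions_pd[OF Suc.prems]]
      by (auto simp: differentiable_def)
  qed
  then show ?thesis by (simp add: smooth_on_def)
qed

lemma conv_eq_0:
  assumes "\<And>y. y \<in> \<Omega> \<Longrightarrow> y \<notin> K \<Longrightarrow> P y = 0" "\<rho> \<in> test_functions (ball 0 d)"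
    and "\<And>y. y \<in> K \<Longrightarrow> x \<notin> cball y d"
  shows "conv \<Omega> P \<rho> x = 0"
proof -
  have "P y * \<rho> (x - y) = 0" if "y \<in> \<Omega>" for y
  proof (cases "y \<in> K")
    case True
    then have "x - y \<notin> ball 0 d" using assms(3)[OF True] by (auto simp: dist_norm norm_minus_commute)
    then show ?thesis using test_functions_eq_0[OF assms(2)] by simp
  qed (use assms(1) that in auto)
  then show ?thesis unfolding conv_def
    by (subst Bochner_Integration.integral_cong[OF refl, where g="\<lambda>_. 0"]) auto
qed

lemma compact_thickening:
  fixes K :: "(real^2) set"
  assumes "compact K"
  shows "compact (\<Union>y\<in>K. cball y d)"
proof -
  have "(\<Union>y\<in>K. cball y d) = {y + z |y z. y \<in> K \<and> z \<in> cball 0 d}"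
  proof (intro equalityI subsetI)
    fix x assume "x \<in> (\<Union>y\<in>K. cball y d)"
    then obtain y where "y \<in> K" "dist y x \<le> d" by auto
    then show "x \<in> {y + z |y z. y \<in> K \<and> z \<in> cball 0 d}"
      by (intro CollectI exI[of _ y] exI[of _ "x - y"]) (auto simp: dist_norm norm_minus_commute)
  next
    fix x assume "x \<in> {y + z |y z. y \<in> K \<and> z \<in> cball 0 d}"
    then obtain y z where "x = y + z" "y \<in> K" "norm z \<le> d" by auto
    then show "x \<in> (\<Union>y\<in>K. cball y d)" by (auto intro!: bexI[of _ y] simp: dist_norm)
  qed
  then show ?thesis using compact_sums[OF assms compact_cball[of 0 d]] by simp
qed

lemma conv_test:
  assumes P: "P \<in> L2 \<Omega>" "\<And>y. y \<in> \<Omega> \<Longrightarrow> y \<notin> K \<Longrightarrow> P y = 0" and K: "compact K" "(\<Union>y\<in>K. cball y d) \<subseteq> \<Omega>"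
    and \<rho>: "\<rho> \<in> test_functions (ball 0 d)"
  shows "conv \<Omega> P \<rho> \<in> test_functions \<Omega>"
proof -
  have "conv \<Omega> P \<rho> x = 0" if "x \<notin> (\<Union>y\<in>K. cball y d)" for x
    using conv_eq_0[of K P \<rho> d x] P(2) \<rho> that by auto
  then show ?thesis
    using smooth_conv[OF P(1) test_functions_mono[OF \<rho>]] compact_thickening[OF K(1), of d] K(2)
    unfolding test_functions_def by blast
qed

lemma conv_bound:
  assumes P: "P \<in> L2 \<Omega>" and \<rho>: "\<rho> \<in> test_functions UNIV" "\<And>x. \<rho> x \<ge> 0" "(LINT x|lborel. \<rho> x) = 1"
    and B: "\<And>y. y \<in> \<Omega> \<Longrightarrow> \<bar>P y\<bar> \<le> B" "B \<ge> 0"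
  shows "\<bar>conv \<Omega> P \<rho> x\<bar> \<le> B"
proof -
  note r = reflect_test_UNIV[OF \<rho>(1), of x]
  have "\<bar>conv \<Omega> P \<rho> x\<bar> \<le> (LINT y|MO. B * \<rho> (x - y))"
    unfolding conv_def
  proof (rule integral_abs_bound_integral)
    show "\<bar>P y * \<rho> (x - y)\<bar> \<le> B * \<rho> (x - y)" if "y \<in> space MO" for y
      using B(1)[of y] that \<rho>(2)[of "x - y"] by (simp add: abs_mult mult_right_mono)
  qed (use conv_integrand[OF P \<rho>(1)] L2_integrable[OF test_in_L2[OF r]] in auto)
  also have "\<dots> = B * (LINT y|MO. \<rho> (x - y))" by simp
  also have "\<dots> \<le> B * (LINT y|lborel. \<rho> (x - y))"
    by (intro mult_left_mono integral_le_lborel[OF r] B(2)) (simp add: \<rho>(2))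
  also have "\<dots> = B" by (simp add: integral_reflect test_functions_borel[OF \<rho>(1)] \<rho>(3))
  finally show ?thesis .
qed

text \<open>Jensen's inequality for a kernel of mass at most 1 on the domain, obtained from
  Cauchy-Schwarz by splitting the kernel into two square roots and attaching one of them to
  \<open>P\<close>.\<close>

lemma conv_square_le:
  assumes P: "P \<in> L2 \<Omega>" and \<rho>: "\<rho> \<in> test_functions UNIV" "\<And>x. \<rho> x \<ge> 0" "(LINT x|lborel. \<rho> x) = 1"
  shows "(conv \<Omega> P \<rho> x)\<^sup>2 \<le> (LINT y|MO. (P y)\<^sup>2 * \<rho> (x - y))"
proof -
  note r = reflect_test_UNIV[OF \<rho>(1), of x]
  let ?s = "\<lambda>y. sqrt (\<rho> (x - y))"
  obtain B where B: "B \<ge> 0" "\<And>y. \<bar>\<rho> y\<bar> \<le> B" using test_functions_bounded[OF \<rho>(1)] by blast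
  have sm: "?s \<in> borel_measurable MO" using test_measurable[OF r] by measurable
  have sB: "\<bar>?s y\<bar> \<le> sqrt B" for y using B(2)[of "x - y"] \<rho>(2)[of "x - y"] by simp
  have s: "?s \<in> L2 \<Omega>" using bounded_in_L2[OF sm sB] .
  have Ps: "(\<lambda>y. P y * ?s y) \<in> L2 \<Omega>" using L2_mult_bounded[OF P sm sB] .
  have "conv \<Omega> P \<rho> x = inner (\<lambda>y. P y * ?s y) ?s"
    unfolding conv_def L2_inner_def using \<rho>(2) by (simp add: mult.assoc)
  then have "(conv \<Omega> P \<rho> x)\<^sup>2 \<le> (nrm (\<lambda>y. P y * ?s y) * nrm ?s)\<^sup>2"
    using power_mono[OF L2_Cauchy_Schwarz[OF Ps s], of 2] by simp
  also have "\<dots> = (LINT y|MO. (P y)\<^sup>2 * \<rho> (x - y)) * (LINT y|MO. \<rho> (x - y))"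
    using \<rho>(2) by (simp add: power_mult_distrib L2_norm_square_integral)
  also have "\<dots> \<le> (LINT y|MO. (P y)\<^sup>2 * \<rho> (x - y)) * 1"
  proof (intro mult_left_mono)
    have "(LINT y|MO. \<rho> (x - y)) \<le> (LINT y|lborel. \<rho> (x - y))"
      by (intro integral_le_lborel[OF r]) (simp add: \<rho>(2))
    then show "(LINT y|MO. \<rho> (x - y)) \<le> 1"
      by (simp add: integral_reflect test_functions_borel[OF \<rho>(1)] \<rho>(3))
  qed (auto intro!: integral_nonneg_AE simp: \<rho>(2))
  finally show ?thesis by simp
qed

text \<open>The bound of \<open>conv_square_le\<close> is integrated in \<open>x\<close> and the
  order of integration exchanged by Tonelli; the kernel has mass 1 in \<open>x\<close> for each
  fixed \<open>y\<close>.\<close>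

lemma nrm_conv_le:
  assumes P: "P \<in> L2 \<Omega>" and \<rho>: "\<rho> \<in> test_functions UNIV" "\<And>x. \<rho> x \<ge> 0" "(LINT x|lborel. \<rho> x) = 1"
  shows "conv \<Omega> P \<rho> \<in> L2 \<Omega>" "nrm (conv \<Omega> P \<rho>) \<le> nrm P"
proof -
  have [measurable]: "\<rho> \<in> borel_measurable borel" by (rule test_functions_borel[OF \<rho>(1)])
  have "(\<lambda>y. if y \<in> \<Omega> then (P y)\<^sup>2 else 0) \<in> borel_measurable lebesgue"
    using L2_measurable[OF P] by (intro borel_measurable_if_I) auto
  \<comment> \<open>Tonelli is applied to \<open>lborel\<close>, while \<open>P\<close> is only
    Lebesgue measurable. A Borel function that agrees almost everywhere with the zero extension of
    the square of \<open>P\<close> takes its place.\<close>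
  then obtain q where q[measurable]: "q \<in> borel_measurable lborel"
    and qAE: "AE y in lborel. (if y \<in> \<Omega> then (P y)\<^sup>2 else 0) = q y"
    using completion_ex_borel_measurable_real by blast
  have qAE': "AE y in lebesgue. (if y \<in> \<Omega> then (P y)\<^sup>2 else 0) = q y" using AE_completion[OF qAE] .
  have [measurable]: "P \<in> borel_measurable MO" using L2_measurable[OF P] .
  have conv_q: "(\<integral>\<^sup>+y. ennreal ((P y)\<^sup>2 * \<rho> (x - y)) \<partial>MO) = (\<integral>\<^sup>+y. ennreal (q y * \<rho> (x - y)) \<partial>lborel)" for x
  proof -
    have "(\<integral>\<^sup>+y. ennreal ((P y)\<^sup>2 * \<rho> (x - y)) \<partial>MO)
        = (\<integral>\<^sup>+y. ennreal ((P y)\<^sup>2 * \<rho> (x - y)) * indicator \<Omega> y \<partial>lebesgue)"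
      by (rule nn_integral_restrict_space) simp
    also have "\<dots> = (\<integral>\<^sup>+y. ennreal (q y * \<rho> (x - y)) \<partial>lebesgue)"
      by (rule nn_integral_cong_AE, use qAE' in eventually_elim) (auto simp: indicator_def split: if_splits)
    finally show ?thesis by (simp add: nn_integral_completion)
  qed
  have le: "ennreal ((conv \<Omega> P \<rho> x)\<^sup>2) \<le> (\<integral>\<^sup>+y. ennreal (q y * \<rho> (x - y)) \<partial>lborel)" for x
  proof -
    have "integrable MO (\<lambda>y. (P y)\<^sup>2 * \<rho> (x - y))"
    proof -
      obtain B where B: "B \<ge> 0" "\<And>y. \<bar>\<rho> y\<bar> \<le> B" using test_functions_bounded[OF \<rho>(1)] by blast
      show ?thesis
      proof (rule Bochner_Integration.integrable_bound)
        show "integrable MO (\<lambda>y. B * (P y)\<^sup>2)" using L2_integrable_square[OF P] by simp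
        show "(\<lambda>y. (P y)\<^sup>2 * \<rho> (x - y)) \<in> borel_measurable MO"
          using test_measurable[OF reflect_test_UNIV[OF \<rho>(1)]] by measurable
        show "AE y in MO. norm ((P y)\<^sup>2 * \<rho> (x - y)) \<le> norm (B * (P y)\<^sup>2)"
          using B by (intro AE_I2) (auto simp: abs_mult mult.commute intro!: mult_right_mono)
      qed
    qed
    then have "(\<integral>\<^sup>+y. ennreal ((P y)\<^sup>2 * \<rho> (x - y)) \<partial>MO) = ennreal (LINT y|MO. (P y)\<^sup>2 * \<rho> (x - y))"
      by (intro nn_integral_eq_integral) (auto simp: \<rho>(2))
    then show ?thesis using conv_square_le[OF P \<rho>, of x] conv_q[of x] by (simp add: ennreal_leI)
  qed
  have conv_meas: "conv \<Omega> P \<rho> \<in> borel_measurable MO"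
    by (rule smooth_measurable[OF smooth_conv[OF P \<rho>(1)]])
  have \<rho>1: "(\<integral>\<^sup>+x. ennreal (\<rho> x) \<partial>lborel) = 1"
    using nn_integral_eq_integral[OF test_functions_integrable[OF \<rho>(1)]] \<rho> by simp
  have "(\<integral>\<^sup>+x. ennreal ((conv \<Omega> P \<rho> x)\<^sup>2) \<partial>MO) \<le> (\<integral>\<^sup>+x. ennreal ((conv \<Omega> P \<rho> x)\<^sup>2) \<partial>lebesgue)"
    by (subst nn_integral_restrict_space) (auto intro!: nn_integral_mono simp: indicator_def)
  also have "\<dots> \<le> (\<integral>\<^sup>+x. (\<integral>\<^sup>+y. ennreal (q y * \<rho> (x - y)) \<partial>lborel) \<partial>lebesgue)"
    by (intro nn_integral_mono le)
  also have "\<dots> = (\<integral>\<^sup>+x. (\<integral>\<^sup>+y. ennreal (q y * \<rho> (x - y)) \<partial>lborel) \<partial>lborel)"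
    by (rule nn_integral_completion)
  also have "\<dots> = (\<integral>\<^sup>+y. (\<integral>\<^sup>+x. ennreal (q y * \<rho> (x - y)) \<partial>lborel) \<partial>lborel)"
    by (rule lborel_pair.Fubini') measurable
  also have "\<dots> = (\<integral>\<^sup>+y. ennreal (q y) \<partial>lborel)"
  proof (rule nn_integral_cong_AE, use qAE in eventually_elim)
    fix y assume "(if y \<in> \<Omega> then (P y)\<^sup>2 else 0) = q y"
    then have qy: "q y \<ge> 0" by (metis order_refl zero_le_power2)
    have "(\<integral>\<^sup>+x. ennreal (q y * \<rho> (x - y)) \<partial>lborel) = ennreal (q y) * (\<integral>\<^sup>+x. ennreal (\<rho> (x - y)) \<partial>lborel)"
      by (simp add: ennreal_mult' qy nn_integral_cmult)
    also have "(\<integral>\<^sup>+x. ennreal (\<rho> (x - y)) \<partial>lborel) = 1"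
      using nn_integral_reflect[of "\<lambda>x. ennreal (\<rho> x)" y] \<rho>1 by simp
    finally show "(\<integral>\<^sup>+x. ennreal (q y * \<rho> (x - y)) \<partial>lborel) = ennreal (q y)" by simp
  qed
  also have "\<dots> = (\<integral>\<^sup>+y. ennreal (q y) \<partial>lebesgue)" by (simp add: nn_integral_completion)
  also have "\<dots> = (\<integral>\<^sup>+y. ennreal ((P y)\<^sup>2) * indicator \<Omega> y \<partial>lebesgue)"
    by (rule nn_integral_cong_AE, use qAE' in eventually_elim) (auto simp: indicator_def split: if_splits)
  also have "\<dots> = (\<integral>\<^sup>+y. ennreal ((P y)\<^sup>2) \<partial>MO)"
    by (rule nn_integral_restrict_space[symmetric]) simp
  also have "\<dots> = ennreal (LINT y|MO. (P y)\<^sup>2)"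
    by (intro nn_integral_eq_integral L2_integrable_square P) auto
  finally have fin: "(\<integral>\<^sup>+x. ennreal ((conv \<Omega> P \<rho> x)\<^sup>2) \<partial>MO) \<le> ennreal (LINT y|MO. (P y)\<^sup>2)" .
  have int: "integrable MO (\<lambda>x. (conv \<Omega> P \<rho> x)\<^sup>2)"
    using conv_meas fin by (intro integrableI_bounded) (auto intro: le_less_trans)
  show "conv \<Omega> P \<rho> \<in> L2 \<Omega>" using int conv_meas by (simp add: L2_def)
  have "ennreal (LINT x|MO. (conv \<Omega> P \<rho> x)\<^sup>2) \<le> ennreal (LINT y|MO. (P y)\<^sup>2)"
    using fin by (subst (asm) nn_integral_eq_integral[OF int]) auto
  then have "(LINT x|MO. (conv \<Omega> P \<rho> x)\<^sup>2) \<le> (LINT y|MO. (P y)\<^sup>2)"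
    by (simp add: ennreal_le_iff integral_nonneg_AE)
  then show "nrm (conv \<Omega> P \<rho>) \<le> nrm P" unfolding L2_norm_def by simp
qed

end

context dirichlet
begin

section \<open>Eigenfunctions and the density of test functions\<close>

abbreviation ex where "ex i \<equiv> (axis i 1 :: real^2)"

lemma ex_Basis [simp]: "ex i \<in> Basis"
  by (simp add: axis_in_Basis_iff)

lemma w_H1: "w j \<in> H1 \<Omega>" and w_H2: "w j \<in> H2 \<Omega>" and w_H10: "w j \<in> H10 \<Omega>"
  using eigenbasis unfolding dirichlet_eigenbasis_def H2_def by auto

lemma w_L2 [simp]: "w j \<in> L2 \<Omega>"
  using w_H1 by (simp add: H1_def)

lemma w_orthonormal: "inner (w i) (w j) = (if i = j then 1 else 0)"
  using eigenbasis unfolding dirichlet_eigenbasis_def by blast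

lemma expansion_tendsto:
  "f \<in> L2 \<Omega> \<Longrightarrow> (\<lambda>N. nrm (\<lambda>x. f x - (\<Sum>j<N. coef \<Omega> w f j * w j x))) \<longlonglongrightarrow> 0"
  using eigenbasis by (simp add: dirichlet_eigenbasis_def coef_def)

definition approximable :: "(real^2 \<Rightarrow> real) \<Rightarrow> bool" where
  "approximable f \<longleftrightarrow> (\<forall>e>0. \<exists>\<eta>\<in>test_functions \<Omega>. nrm (\<lambda>x. \<eta> x - f x) < e)"

lemma approximable_limit:
  assumes f: "f \<in> L2 \<Omega>" and "\<And>e. e > 0 \<Longrightarrow> \<exists>g\<in>L2 \<Omega>. approximable g \<and> nrm (\<lambda>x. g x - f x) < e"
  shows "approximable f"
  unfolding approximable_def
proof (intro allI impI)
  fix e :: real assume e: "e > 0"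
  obtain g where g: "g \<in> L2 \<Omega>" "approximable g" "nrm (\<lambda>x. g x - f x) < e / 2"
    using assms(2)[of "e / 2"] e by auto
  obtain \<eta> where \<eta>: "\<eta> \<in> test_functions \<Omega>" "nrm (\<lambda>x. \<eta> x - g x) < e / 2"
    using g(2) e unfolding approximable_def by (metis half_gt_zero)
  have "nrm (\<lambda>x. \<eta> x - f x) < e"
    using L2_norm_triangle_diff[OF test_in_L2[OF \<eta>(1)] g(1) f] \<eta>(2) g(3) by linarith
  with \<eta>(1) show "\<exists>\<eta>\<in>test_functions \<Omega>. nrm (\<lambda>x. \<eta> x - f x) < e" by blast
qed

lemma approximable_w: "approximable (w j)"
  unfolding approximable_def
proof (intro allI impI)
  fix e :: real assume e: "e > 0"
  obtain \<eta> :: "nat \<Rightarrow> real^2 \<Rightarrow> real" where \<eta>: "\<And>k. \<eta> k \<in> test_functions \<Omega>" "(\<lambda>k. nrm (\<lambda>x. \<eta> k x - w j x)) \<longlonglongrightarrow> 0"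
    using w_H10[of j] unfolding H10_def by auto
  then have "\<forall>\<^sub>F k in sequentially. nrm (\<lambda>x. \<eta> k x - w j x) < e" using e by (intro order_tendstoD(2))
  then obtain k where "nrm (\<lambda>x. \<eta> k x - w j x) < e" by (auto simp: eventually_sequentially)
  with \<eta>(1) show "\<exists>\<eta>\<in>test_functions \<Omega>. nrm (\<lambda>x. \<eta> x - w j x) < e" by blast
qed

lemma approximable_add_cmult:
  assumes f: "f \<in> L2 \<Omega>" "approximable f" and g: "g \<in> L2 \<Omega>" "approximable g"
  shows "approximable (\<lambda>x. f x + c * g x)"
  unfolding approximable_def
proof (intro allI impI)
  fix e :: real assume e: "e > 0"
  define e' where "e' = e / (2 * (\<bar>c\<bar> + 1))"
  have e': "e' > 0" "\<bar>c\<bar> * e' \<le> e / 2" using e by (auto simp: e'_def field_simps add_pos_nonneg)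
  obtain \<eta> where \<eta>: "\<eta> \<in> test_functions \<Omega>" "nrm (\<lambda>x. \<eta> x - f x) < e / 2"
    using f(2) e unfolding approximable_def by (metis half_gt_zero)
  obtain \<zeta> where \<zeta>: "\<zeta> \<in> test_functions \<Omega>" "nrm (\<lambda>x. \<zeta> x - g x) < e'"
    using g(2) e'(1) unfolding approximable_def by blast
  have eq: "(\<lambda>x. (\<eta> x + c * \<zeta> x) - (f x + c * g x)) = (\<lambda>x. (\<eta> x - f x) + c * (\<zeta> x - g x))"
    by (auto simp: algebra_simps)
  have "nrm (\<lambda>x. (\<eta> x + c * \<zeta> x) - (f x + c * g x)) \<le> nrm (\<lambda>x. \<eta> x - f x) + \<bar>c\<bar> * nrm (\<lambda>x. \<zeta> x - g x)"
    unfolding eq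
    using L2_norm_triangle[OF L2_diff[OF test_in_L2[OF \<eta>(1)] f(1)] L2_cmult[OF L2_diff[OF test_in_L2[OF \<zeta>(1)] g(1)], of c]]
    by (simp add: L2_norm_cmult)
  also have "\<bar>c\<bar> * nrm (\<lambda>x. \<zeta> x - g x) \<le> \<bar>c\<bar> * e'" using \<zeta>(2) by (intro mult_left_mono) auto
  finally have "nrm (\<lambda>x. (\<eta> x + c * \<zeta> x) - (f x + c * g x)) < e" using \<eta>(2) e'(2) by linarith
  moreover have "(\<lambda>x. \<eta> x + c * \<zeta> x) \<in> test_functions \<Omega>"
    by (intro test_functions_add \<eta>(1) test_functions_cmult \<zeta>(1))
  ultimately show "\<exists>\<eta>\<in>test_functions \<Omega>. nrm (\<lambda>x. \<eta> x - (f x + c * g x)) < e"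
    by (intro bexI[of _ "\<lambda>x. \<eta> x + c * \<zeta> x"]) auto
qed

text \<open>Density is read off the eigenbasis: each \<open>w j\<close> lies in \<open>H10\<close>
  and so is a limit of test functions, and finite combinations of the \<open>w j\<close> are dense
  by \<open>expansion_tendsto\<close>. It comes before the convergence of mollifications, which is
  deduced from it.\<close>

lemma test_functions_dense:
  assumes f: "f \<in> L2 \<Omega>"
  shows "approximable f"
proof (rule approximable_limit[OF f])
  let ?S = "\<lambda>N x. \<Sum>j<N. coef \<Omega> w f j * w j x"
  have SL2: "?S N \<in> L2 \<Omega>" for N by (intro L2_sum_cmult) auto
  have S: "approximable (?S N)" for N
  proof (induction N)
    case 0
    have "(\<lambda>x. 0) \<in> test_functions \<Omega>"
      by (auto simp: test_functions_def smooth_on_const intro: exI[of _ "{}"])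
    then show ?case unfolding approximable_def by (auto intro!: bexI[of _ "\<lambda>x. 0"] simp: L2_norm_def)
  next
    case (Suc N)
    then show ?case
      using approximable_add_cmult[OF SL2[of N] Suc w_L2 approximable_w, of "coef \<Omega> w f N" N] by simp
  qed
  fix e :: real assume "e > 0"
  then have "\<forall>\<^sub>F N in sequentially. nrm (\<lambda>x. f x - ?S N x) < e"
    using expansion_tendsto[OF f] by (intro order_tendstoD(2))
  then obtain N where "nrm (\<lambda>x. f x - ?S N x) < e" by (auto simp: eventually_sequentially)
  then show "\<exists>g\<in>L2 \<Omega>. approximable g \<and> nrm (\<lambda>x. g x - f x) < e"
    using S[of N] SL2[of N] by (intro bexI[of _ "?S N"]) (auto simp: L2_norm_minus_commute)
qed

lemma L2_approx_test:
  assumes "f \<in> L2 \<Omega>" "e > 0"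
  obtains \<eta> where "\<eta> \<in> test_functions \<Omega>" "nrm (\<lambda>x. \<eta> x - f x) < e"
proof -
  have "\<exists>\<eta>\<in>test_functions \<Omega>. nrm (\<lambda>x. \<eta> x - f x) < e"
    using test_functions_dense[OF assms(1)] assms(2) by (simp add: approximable_def)
  then show thesis using that by auto
qed

text \<open>The eigenfunctions are limits of test functions.\<close>

lemma test_function_nonzero: "\<exists>\<eta>\<in>test_functions \<Omega>. \<exists>x. \<eta> x \<noteq> 0"
proof -
  obtain \<eta> where \<eta>: "\<eta> \<in> test_functions \<Omega>" "nrm (\<lambda>x. \<eta> x - w 0 x) < 1"
    using L2_approx_test[OF w_L2, of 1 0] by auto
  have "nrm (w 0) = 1"
    using L2_norm_square[of \<Omega> "w 0"] w_orthonormal[of 0 0] by (simp add: power2_eq_1_iff) (metis L2_norm_nonneg le_minus_one_simps(3))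
  then have "\<eta> \<noteq> (\<lambda>x. 0)" using \<eta>(2) by (auto simp: L2_norm_def)
  then show ?thesis using \<eta>(1) by blast
qed

lemma mollifier:
  assumes "d > 0"
  obtains \<rho> where "\<rho> \<in> test_functions (ball (0::real^2) d)" "\<And>x. \<rho> x \<ge> 0" "(LINT x|lborel. \<rho> x) = 1"
proof -
  obtain \<eta> x where \<eta>: "\<eta> \<in> test_functions \<Omega>" "\<eta> x \<noteq> 0" using test_function_nonzero by auto
  show thesis by (rule mollifier_exists[OF \<eta> assms]) (rule that)
qed

text \<open>A fixed approximate identity. The radius \<open>1 / Suc k\<close> is positive already at
  \<open>k = 0\<close>.\<close>

definition mol :: "nat \<Rightarrow> real^2 \<Rightarrow> real" where
  "mol k = (SOME \<rho>. \<rho> \<in> test_functions (ball (0::real^2) (1 / Suc k)) \<and> (\<forall>x. \<rho> x \<ge> 0) \<and> (LINT x|lborel. \<rho> x) = 1)"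

lemma mol: "mol k \<in> test_functions (ball 0 (1 / Suc k))" "mol k x \<ge> 0" "(LINT x|lborel. mol k x) = 1"
proof -
  obtain \<rho> where "\<rho> \<in> test_functions (ball (0::real^2) (1 / Suc k))" "\<And>x. \<rho> x \<ge> 0" "(LINT x|lborel. \<rho> x) = 1"
    using mollifier[of "1 / Suc k"] by auto
  then have "mol k \<in> test_functions (ball (0::real^2) (1 / Suc k)) \<and> (\<forall>x. mol k x \<ge> 0) \<and> (LINT x|lborel. mol k x) = 1"
    unfolding mol_def by (intro someI_ex[where P="\<lambda>\<rho>. \<rho> \<in> test_functions (ball (0::real^2) (1 / Suc k)) \<and> (\<forall>x. \<rho> x \<ge> 0) \<and> (LINT x|lborel. \<rho> x) = 1"]) blast
  then show "mol k \<in> test_functions (ball 0 (1 / Suc k))" "mol k x \<ge> 0" "(LINT x|lborel. mol k x) = 1"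
    by auto
qed

lemma mol_UNIV: "mol k \<in> test_functions UNIV"
  using test_functions_mono[OF mol(1)] by blast

lemma mol_ball:
  assumes "d > 0"
  shows "\<forall>\<^sub>F k in sequentially. mol k \<in> test_functions (ball 0 d)"
proof -
  obtain N where N: "inverse (real (Suc N)) < d" using reals_Archimedean[OF assms] by blast
  show ?thesis
  proof (rule eventually_sequentiallyI)
    fix k assume "k \<ge> N"
    then have "1 / real (Suc k) \<le> inverse (real (Suc N))" by (simp add: field_simps)
    with N have "ball (0::real^2) (1 / Suc k) \<subseteq> ball 0 d" by (intro subset_ball) simp
    then show "mol k \<in> test_functions (ball 0 d)" using mol(1) test_functions_mono by blast
  qed
qed

lemma conv_diff:
  assumes "P \<in> L2 \<Omega>" "Q \<in> L2 \<Omega>" "\<rho> \<in> test_functions UNIV"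
  shows "conv \<Omega> (\<lambda>x. P x - Q x) \<rho> x = conv \<Omega> P \<rho> x - conv \<Omega> Q \<rho> x"
  unfolding conv_def left_diff_distrib
  by (rule Bochner_Integration.integral_diff[OF conv_integrand[OF assms(1,3)] conv_integrand[OF assms(2,3)]])

lemma conv_mol_L2: "P \<in> L2 \<Omega> \<Longrightarrow> conv \<Omega> P (mol k) \<in> L2 \<Omega>"
  by (rule nrm_conv_le(1)[OF _ mol_UNIV mol(2) mol(3)])

lemma conv_mol_test_tendsto:
  assumes \<eta>: "\<eta> \<in> test_functions \<Omega>"
  shows "(\<lambda>k. nrm (\<lambda>x. conv \<Omega> \<eta> (mol k) x - \<eta> x)) \<longlonglongrightarrow> 0"
proof (rule LIMSEQ_I)
  fix e :: real assume e: "e > 0"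
  define e' where "e' = e / (sqrt (measure lebesgue \<Omega>) + 1)"
  have sp: "sqrt (measure lebesgue \<Omega>) + 1 > 0" by (simp add: add_nonneg_pos)
  have e': "e' > 0" using e sp by (simp add: e'_def)
  have lt: "e' * sqrt (measure lebesgue \<Omega>) < e"
    using e sp by (simp add: e'_def field_simps)
  obtain d where d: "d > 0" "\<And>x y. norm (x - y) < d \<Longrightarrow> \<bar>\<eta> x - \<eta> y\<bar> < e'"
    using test_functions_uniformly_continuous[OF \<eta> e'] by blast
  have *: "nrm (\<lambda>x. conv \<Omega> \<eta> (mol k) x - \<eta> x) < e" if k: "mol k \<in> test_functions (ball 0 d)" for k
  proof -
    have \<eta>b: "\<eta> \<in> borel_measurable borel" by (rule test_functions_borel[OF \<eta>])
    have "\<bar>conv \<Omega> \<eta> (mol k) x - \<eta> x\<bar> \<le> e'" for x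
    proof -
      note r = reflect_test_UNIV[OF mol_UNIV[of k], of x]
      have rb: "(\<lambda>y. mol k (x - y)) \<in> borel_measurable borel" by (rule test_functions_borel[OF r])
      \<comment> \<open>As \<open>\<eta>\<close> vanishes off the domain, the integral may be taken
        over the whole plane, where the kernel has mass exactly 1 for every \<open>x\<close>, also
        near the boundary.\<close>
      have "conv \<Omega> \<eta> (mol k) x = (LINT y|lborel. \<eta> y * mol k (x - y))"
        unfolding conv_def by (rule integral_domain_eq_lborel) (use \<eta>b rb test_functions_eq_0[OF \<eta>] in auto)
      moreover have "\<eta> x = (LINT y|lborel. \<eta> x * mol k (x - y))"
        using mol(3)[of k] by (simp add: integral_reflect test_functions_borel[OF mol_UNIV])
      moreover have i1: "integrable lborel (\<lambda>y. \<eta> y * mol k (x - y))"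
        by (rule test_functions_integrable[OF test_functions_mult[OF \<eta> test_functions_smooth[OF r]]])
      moreover have i2: "integrable lborel (\<lambda>y. \<eta> x * mol k (x - y))"
        using test_functions_integrable[OF r] by simp
      ultimately have "conv \<Omega> \<eta> (mol k) x - \<eta> x = (LINT y|lborel. \<eta> y * mol k (x - y) - \<eta> x * mol k (x - y))"
        by simp
      also have "\<bar>\<dots>\<bar> \<le> (LINT y|lborel. e' * mol k (x - y))"
      proof (rule integral_abs_bound_integral)
        fix y
        show "\<bar>\<eta> y * mol k (x - y) - \<eta> x * mol k (x - y)\<bar> \<le> e' * mol k (x - y)"
        proof (cases "norm (x - y) < d")
          case True
          then have "\<bar>\<eta> y - \<eta> x\<bar> \<le> e'" using d(2)[of x y] by simp
          then show ?thesis using mol(2)[of k "x - y"]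
            by (simp add: abs_mult mult_right_mono flip: left_diff_distrib)
        next
          case False
          then have "mol k (x - y) = 0" using test_functions_eq_0[OF k] by auto
          then show ?thesis by simp
        qed
      qed (use i1 i2 test_functions_integrable[OF r] in auto)
      also have "\<dots> = e'" using mol(3)[of k] by (simp add: integral_reflect test_functions_borel[OF mol_UNIV])
      finally show ?thesis .
    qed
    moreover have "(\<lambda>x. conv \<Omega> \<eta> (mol k) x - \<eta> x) \<in> borel_measurable MO"
      by (intro L2_measurable L2_diff conv_mol_L2 test_in_L2[OF \<eta>])
    ultimately have "nrm (\<lambda>x. conv \<Omega> \<eta> (mol k) x - \<eta> x) \<le> e' * sqrt (measure lebesgue \<Omega>)"
      using e' by (intro nrm_bounded_le) auto
    with lt show ?thesis by simp
  qed
  from mol_ball[OF d(1)] obtain N where "\<forall>k\<ge>N. mol k \<in> test_functions (ball 0 d)"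
    by (auto simp: eventually_sequentially)
  with * show "\<exists>N. \<forall>k\<ge>N. norm (nrm (\<lambda>x. conv \<Omega> \<eta> (mol k) x - \<eta> x) - 0) < e"
    by auto
qed

text \<open>For a test function the convergence is uniform, hence in L^2 on a domain of finite
  measure. For general \<open>P\<close> the error of an approximating test function is carried
  along, because mollification does not increase the norm.\<close>

lemma conv_mol_tendsto:
  assumes P: "P \<in> L2 \<Omega>"
  shows "(\<lambda>k. nrm (\<lambda>x. conv \<Omega> P (mol k) x - P x)) \<longlonglongrightarrow> 0"
proof (rule LIMSEQ_I)
  fix e :: real assume e: "e > 0"
  obtain \<eta> where \<eta>: "\<eta> \<in> test_functions \<Omega>" "nrm (\<lambda>x. \<eta> x - P x) < e / 3"
    using L2_approx_test[OF P, of "e / 3"] e by auto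
  note \<eta>L = test_in_L2[OF \<eta>(1)]
  have "\<forall>\<^sub>F k in sequentially. nrm (\<lambda>x. conv \<Omega> \<eta> (mol k) x - \<eta> x) < e / 3"
    using conv_mol_test_tendsto[OF \<eta>(1)] e by (intro order_tendstoD(2)) auto
  then obtain N where N: "\<And>k. k \<ge> N \<Longrightarrow> nrm (\<lambda>x. conv \<Omega> \<eta> (mol k) x - \<eta> x) < e / 3"
    by (auto simp: eventually_sequentially)
  have "nrm (\<lambda>x. conv \<Omega> P (mol k) x - P x) < e" if k: "k \<ge> N" for k
  proof -
    have "nrm (\<lambda>x. conv \<Omega> P (mol k) x - conv \<Omega> \<eta> (mol k) x) \<le> nrm (\<lambda>x. P x - \<eta> x)"
    proof -
      have "conv \<Omega> (\<lambda>x. P x - \<eta> x) (mol k) = (\<lambda>x. conv \<Omega> P (mol k) x - conv \<Omega> \<eta> (mol k) x)"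
        by (rule ext) (rule conv_diff[OF P \<eta>L mol_UNIV])
      then show ?thesis
        using nrm_conv_le(2)[OF L2_diff[OF P \<eta>L] mol_UNIV mol(2) mol(3), of k] by simp
    qed
    moreover have "nrm (\<lambda>x. conv \<Omega> P (mol k) x - P x) \<le> nrm (\<lambda>x. conv \<Omega> P (mol k) x - conv \<Omega> \<eta> (mol k) x)
        + nrm (\<lambda>x. conv \<Omega> \<eta> (mol k) x - P x)"
      by (rule L2_norm_triangle_diff[OF conv_mol_L2[OF P] conv_mol_L2[OF \<eta>L] P])
    moreover have "nrm (\<lambda>x. conv \<Omega> \<eta> (mol k) x - P x) \<le> nrm (\<lambda>x. conv \<Omega> \<eta> (mol k) x - \<eta> x) + nrm (\<lambda>x. \<eta> x - P x)"
      by (rule L2_norm_triangle_diff[OF conv_mol_L2[OF \<eta>L] \<eta>L P])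
    ultimately show ?thesis using N[OF k] \<eta>(2) L2_norm_minus_commute[of \<Omega> P \<eta>] by linarith
  qed
  then show "\<exists>N. \<forall>k\<ge>N. norm (nrm (\<lambda>x. conv \<Omega> P (mol k) x - P x) - 0) < e" by auto
qed

lemma conv_mol_test:
  assumes P: "P \<in> L2 \<Omega>" "\<And>y. y \<in> \<Omega> \<Longrightarrow> y \<notin> K \<Longrightarrow> P y = 0" and K: "compact K" "K \<subseteq> \<Omega>"
  obtains K' where "compact K'" "K' \<subseteq> \<Omega>"
    "\<forall>\<^sub>F k in sequentially. conv \<Omega> P (mol k) \<in> test_functions \<Omega> \<and> (\<forall>x. x \<notin> K' \<longrightarrow> conv \<Omega> P (mol k) x = 0)"
proof -
  obtain d where d: "d > 0" "(\<Union>y\<in>K. cball y d) \<subseteq> \<Omega>"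
    using compact_subset_open_imp_cball_epsilon_subset[OF K(1) open_domain K(2)] by blast
  show thesis
  proof (rule that[OF compact_thickening[OF K(1)] d(2)])
    show "\<forall>\<^sub>F k in sequentially. conv \<Omega> P (mol k) \<in> test_functions \<Omega> \<and>
        (\<forall>x. x \<notin> (\<Union>y\<in>K. cball y d) \<longrightarrow> conv \<Omega> P (mol k) x = 0)"
      using mol_ball[OF d(1)]
    proof eventually_elim
      case (elim k)
      then show ?case using conv_test[OF P K(1) d(2) elim] conv_eq_0[of K P "mol k" d] P(2) by auto
    qed
  qed
qed

section \<open>The fundamental lemma and weak derivatives in L^2\<close>

lemma restrict_lebesgue_on: "K \<subseteq> \<Omega> \<Longrightarrow> compact K \<Longrightarrow> restrict_space MO K = lebesgue_on K"
  by (simp add: restrict_restrict_space Int_absorb1 fmeasurableD[OF lmeasurable_compact])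

lemma compact_sets_MO: "K \<subseteq> \<Omega> \<Longrightarrow> compact K \<Longrightarrow> K \<in> sets MO"
  by (simp add: sets_restrict_space_iff fmeasurableD[OF lmeasurable_compact])

lemma integrable_on_compact_iff:
  fixes f :: "real^2 \<Rightarrow> real"
  assumes "K \<subseteq> \<Omega>" "compact K"
  shows "integrable (lebesgue_on K) f \<longleftrightarrow> integrable MO (\<lambda>x. indicator K x *\<^sub>R f x)"
proof -
  have "K \<inter> space MO \<in> sets MO" using compact_sets_MO[OF assms] assms by (simp add: Int_absorb2)
  from integrable_restrict_space[OF this, of f] show ?thesis
    by (simp add: restrict_lebesgue_on[OF assms])
qed

text \<open>Testing with mollifications of the sign of \<open>d\<close> on a compact set
  \<open>K\<close> produces the integral of the absolute value of \<open>d\<close> over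
  \<open>K\<close>. The mollifications are bounded by 1 and eventually supported in one fixed
  compact \<open>K'\<close>, so local integrability of \<open>d\<close> suffices for dominated
  convergence. Countably many boxes exhaust the domain.\<close>

lemma fundamental_lemma:
  assumes d: "locally_integrable \<Omega> d" and 0: "\<And>\<eta>. \<eta> \<in> test_functions \<Omega> \<Longrightarrow> (LINT x|MO. d x * \<eta> x) = 0"
  shows "AE x in MO. d x = 0"
proof -
  have dm[measurable]: "d \<in> borel_measurable MO" by (rule locally_integrable_measurable[OF open_domain d])
  have K0: "AE x in MO. x \<in> K \<longrightarrow> d x = 0" if K: "compact K" "K \<subseteq> \<Omega>" for K
  proof -
    have KM[measurable]: "K \<in> sets MO" using compact_sets_MO K by blast
    define P where "P x = sgn (d x) * indicator K x" for x
    have Pm: "P \<in> borel_measurable MO"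
      unfolding P_def by measurable
    have PB: "\<bar>P x\<bar> \<le> 1" for x unfolding P_def by (auto simp: indicator_def sgn_if)
    have P: "P \<in> L2 \<Omega>" using bounded_in_L2[OF Pm PB] .
    have P0: "P y = 0" if "y \<notin> K" for y using that by (simp add: P_def)
    obtain K' where K': "compact K'" "K' \<subseteq> \<Omega>"
      "\<forall>\<^sub>F k in sequentially. conv \<Omega> P (mol k) \<in> test_functions \<Omega> \<and> (\<forall>x. x \<notin> K' \<longrightarrow> conv \<Omega> P (mol k) x = 0)"
      using conv_mol_test[OF P _ K] P0 by blast
    obtain r where r: "strict_mono r" "AE x in MO. (\<lambda>k. conv \<Omega> P (mol (r k)) x) \<longlonglongrightarrow> P x"
      using L2_tendsto_AE_subseq[OF conv_mol_L2[OF P] P conv_mol_tendsto[OF P]] by blast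
    from K'(3) obtain N where N: "\<And>k. k \<ge> N \<Longrightarrow> conv \<Omega> P (mol k) \<in> test_functions \<Omega>"
      "\<And>k x. k \<ge> N \<Longrightarrow> x \<notin> K' \<Longrightarrow> conv \<Omega> P (mol k) x = 0"
      by (auto simp: eventually_sequentially)
    \<comment> \<open>The shift by \<open>N\<close> makes every term of the subsequence an
      admissible test function supported in \<open>K'\<close>.\<close>
    let ?c = "\<lambda>k. conv \<Omega> P (mol (r (k + N)))"
    have rN: "r (k + N) \<ge> N" for k using seq_suble[OF r(1), of "k + N"] by linarith
    have "(\<lambda>k. LINT x|MO. d x * ?c k x) \<longlonglongrightarrow> (LINT x|MO. d x * P x)"
    proof (rule integral_dominated_convergence)
      show "integrable MO (\<lambda>x. \<bar>indicator K' x *\<^sub>R d x\<bar>)"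
        using d K'(1,2) integrable_on_compact_iff[OF K'(2,1), of d]
        unfolding locally_integrable_def by (intro integrable_abs) auto
      show "AE x in MO. (\<lambda>k. d x * ?c k x) \<longlonglongrightarrow> d x * P x"
        using r(2)
      proof eventually_elim
        case (elim x)
        then have "(\<lambda>k. ?c k x) \<longlonglongrightarrow> P x" by (rule LIMSEQ_ignore_initial_segment)
        then show ?case by (intro tendsto_intros)
      qed
      show "AE x in MO. norm (d x * ?c k x) \<le> \<bar>indicator K' x *\<^sub>R d x\<bar>" for k
      proof (rule AE_I2)
        fix x
        show "norm (d x * ?c k x) \<le> \<bar>indicator K' x *\<^sub>R d x\<bar>"
        proof (cases "x \<in> K'")
          case True
          have "\<bar>?c k x\<bar> \<le> 1" by (rule conv_bound[OF P mol_UNIV mol(2) mol(3) PB]) auto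
          then show ?thesis using True by (simp add: abs_mult mult_left_le)
        qed (simp add: N(2)[OF rN])
      qed
    qed (use Pm L2_measurable[OF conv_mol_L2[OF P]] in measurable)
    moreover have "(LINT x|MO. d x * ?c k x) = 0" for k by (rule 0[OF N(1)[OF rN]])
    ultimately have "(LINT x|MO. d x * P x) = 0" by (simp add: LIMSEQ_const_iff)
    moreover have eq: "(\<lambda>x. d x * P x) = (\<lambda>x. \<bar>indicator K x *\<^sub>R d x\<bar>)"
      by (auto simp: P_def indicator_def sgn_if abs_if)
    moreover have "integrable MO (\<lambda>x. \<bar>indicator K x *\<^sub>R d x\<bar>)"
      using d K integrable_on_compact_iff[OF K(2,1), of d]
      unfolding locally_integrable_def by (intro integrable_abs) auto
    ultimately have "AE x in MO. \<bar>indicator K x *\<^sub>R d x\<bar> = 0"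
      by (subst (asm) eq) (simp add: integral_nonneg_eq_0_iff_AE)
    then show ?thesis by eventually_elim (auto simp: indicator_def)
  qed
  obtain D where D: "countable D" "\<And>X. X \<in> D \<Longrightarrow> X \<subseteq> \<Omega> \<and> (\<exists>a b. X = cbox a b)" "\<Union>D = \<Omega>"
    using open_countable_Union_open_cbox[OF open_domain] by (metis Pow_iff subsetD)
  have "AE x in MO. \<forall>X\<in>D. x \<in> X \<longrightarrow> d x = 0"
    unfolding AE_ball_countable[OF D(1)]
  proof
    show "AE x in MO. x \<in> X \<longrightarrow> d x = 0" if "X \<in> D" for X
      using K0[of X] D(2)[OF that] compact_cbox by auto
  qed
  then show ?thesis
  proof (rule AE_mp, intro AE_I2 impI)
    fix x assume "x \<in> space MO" "\<forall>X\<in>D. x \<in> X \<longrightarrow> d x = 0"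
    then show "d x = 0" using D(3) by auto
  qed
qed

lemma L2_locally_integrable:
  assumes "f \<in> L2 \<Omega>"
  shows "locally_integrable \<Omega> f"
  unfolding locally_integrable_def
proof (intro allI impI)
  fix K assume K: "compact K \<and> K \<subseteq> \<Omega>"
  then have "K \<in> sets MO" using compact_sets_MO by blast
  then show "integrable (lebesgue_on K) f"
    using K L2_integrable[OF assms] integrable_mult_indicator[of K MO f]
    by (subst integrable_on_compact_iff) auto
qed

lemma locally_integrable_diff:
  "locally_integrable \<Omega> f \<Longrightarrow> locally_integrable \<Omega> g \<Longrightarrow> locally_integrable \<Omega> (\<lambda>x. f x - g x)"
  by (auto simp: locally_integrable_def)

lemma locally_integrable_mult_test:
  assumes f: "locally_integrable \<Omega> f" and \<eta>: "\<eta> \<in> test_functions \<Omega>"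
  shows "integrable MO (\<lambda>x. f x * \<eta> x)"
proof -
  obtain K where K: "compact K" "K \<subseteq> \<Omega>" "\<And>x. x \<notin> K \<Longrightarrow> \<eta> x = 0" using test_functionsE[OF \<eta>] by blast
  obtain B where B: "B \<ge> 0" "\<And>x. \<bar>\<eta> x\<bar> \<le> B" using test_functions_bounded[OF \<eta>] by blast
  show ?thesis
  proof (rule Bochner_Integration.integrable_bound)
    show "integrable MO (\<lambda>x. B * \<bar>indicator K x *\<^sub>R f x\<bar>)"
      using f K integrable_on_compact_iff[OF K(2,1), of f]
      unfolding locally_integrable_def by (intro integrable_mult_right integrable_abs) auto
    show "(\<lambda>x. f x * \<eta> x) \<in> borel_measurable MO"
      using locally_integrable_measurable[OF open_domain f] test_measurable[OF \<eta>] by measurable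
    show "AE x in MO. norm (f x * \<eta> x) \<le> norm (B * \<bar>indicator K x *\<^sub>R f x\<bar>)"
    proof (rule AE_I2)
      fix x
      show "norm (f x * \<eta> x) \<le> norm (B * \<bar>indicator K x *\<^sub>R f x\<bar>)"
        using B(1) mult_right_mono[OF B(2)[of x], of "\<bar>f x\<bar>"] K(3)[of x]
        by (cases "x \<in> K") (auto simp: abs_mult mult.commute)
    qed
  qed
qed

text \<open>Weak differentiation as a relation between L^2 functions. It is linear and closed under
  L^2 limits, neither of which can be said directly of the representative chosen in
  \<open>weak_pderiv\<close>.\<close>

definition wd :: "2 \<Rightarrow> (real^2 \<Rightarrow> real) \<Rightarrow> (real^2 \<Rightarrow> real) \<Rightarrow> bool" where
  "wd i f g \<longleftrightarrow> f \<in> L2 \<Omega> \<and> g \<in> L2 \<Omega> \<and> (\<forall>\<eta>\<in>test_functions \<Omega>. inner f (pd (ex i) \<eta>) = - inner g \<eta>)"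

lemma wdD: "wd i f g \<Longrightarrow> \<eta> \<in> test_functions \<Omega> \<Longrightarrow> inner f (pd (ex i) \<eta>) = - inner g \<eta>"
  and wd_L2: "wd i f g \<Longrightarrow> f \<in> L2 \<Omega>" "wd i f g \<Longrightarrow> g \<in> L2 \<Omega>"
  by (auto simp: wd_def)

lemma wd_iff_is_weak_pderiv: "f \<in> L2 \<Omega> \<Longrightarrow> g \<in> L2 \<Omega> \<Longrightarrow> wd i f g \<longleftrightarrow> is_weak_pderiv \<Omega> i f g"
  by (simp add: wd_def is_weak_pderiv_def L2_locally_integrable L2_inner_def)

text \<open>Makes the choice in \<open>weak_pderiv\<close> harmless: two weak derivatives have the
  same pairings with test functions, so by \<open>fundamental_lemma\<close> the chosen one agrees
  almost everywhere with any known one and inherits square integrability.\<close>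

lemma wd_weak_pderiv:
  assumes "wd i f g"
  shows "AE x in MO. weak_pderiv \<Omega> i f x = g x" "wd i f (weak_pderiv \<Omega> i f)"
proof -
  have g: "is_weak_pderiv \<Omega> i f g" using assms wd_iff_is_weak_pderiv wd_L2 by blast
  let ?h = "weak_pderiv \<Omega> i f"
  have h: "is_weak_pderiv \<Omega> i f ?h" unfolding weak_pderiv_def by (rule someI[of "is_weak_pderiv \<Omega> i f", OF g])
  have "AE x in MO. ?h x - g x = 0"
  proof (rule fundamental_lemma)
    show "locally_integrable \<Omega> (\<lambda>x. ?h x - g x)"
      using g h by (intro locally_integrable_diff) (auto simp: is_weak_pderiv_def)
    fix \<eta> assume \<eta>: "\<eta> \<in> test_functions \<Omega>"
    have "integrable MO (\<lambda>x. ?h x * \<eta> x)" "integrable MO (\<lambda>x. g x * \<eta> x)"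
      using g h by (auto intro!: locally_integrable_mult_test \<eta> simp: is_weak_pderiv_def)
    moreover have "(LINT x|MO. ?h x * \<eta> x) = (LINT x|MO. g x * \<eta> x)"
      using g h \<eta> unfolding is_weak_pderiv_def by force
    ultimately show "(LINT x|MO. (?h x - g x) * \<eta> x) = 0" by (simp add: left_diff_distrib)
  qed
  then show ae: "AE x in MO. ?h x = g x" by simp
  have "?h \<in> borel_measurable MO"
    using h locally_integrable_measurable[OF open_domain] by (auto simp: is_weak_pderiv_def)
  then have "?h \<in> L2 \<Omega>"
    using ae by (intro L2_cong_AE[OF wd_L2(2)[OF assms]]) auto
  then show "wd i f ?h" using h wd_iff_is_weak_pderiv wd_L2(1)[OF assms] by blast
qed

lemma H1_wd: "f \<in> H1 \<Omega> \<Longrightarrow> wd i f (weak_pderiv \<Omega> i f)"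
  unfolding H1_def using wd_weak_pderiv(2) wd_iff_is_weak_pderiv by blast

lemma integral_mult_test_lborel:
  assumes "f \<in> test_functions \<Omega>" "smooth_on UNIV g"
  shows "(LINT x|MO. g x * f x) = (LINT x|lborel. g x * f x)"
  by (rule integral_domain_eq_lborel)
     (use test_functions_borel[OF test_functions_mult[OF assms]] test_functions_eq_0[OF assms(1)]
       in \<open>auto simp: mult.commute\<close>)

lemma wd_test:
  assumes f: "f \<in> test_functions \<Omega>"
  shows "wd i f (pd (ex i) f)"
  unfolding wd_def
proof (intro conjI ballI)
  show "f \<in> L2 \<Omega>" "pd (ex i) f \<in> L2 \<Omega>" using test_in_L2 f test_functions_pd[OF f ex_Basis] by blast+
  fix \<eta> assume \<eta>: "\<eta> \<in> test_functions \<Omega>"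
  have "(LINT x|lborel. f x * pd (ex i) \<eta> x) = - (LINT x|lborel. pd (ex i) f x * \<eta> x)"
    by (rule integral_by_parts_test[OF test_functions_mono[OF \<eta>] test_functions_smooth[OF f]]) auto
  then show "inner f (pd (ex i) \<eta>) = - inner (pd (ex i) f) \<eta>"
    unfolding L2_inner_def
    using integral_mult_test_lborel[OF test_functions_pd[OF \<eta> ex_Basis] test_functions_smooth[OF f], of i]
      integral_mult_test_lborel[OF \<eta> test_functions_smooth[OF test_functions_pd[OF f ex_Basis]], of i] by simp
qed

lemma wd_mult_test:
  assumes G: "wd i G G'" and \<phi>: "\<phi> \<in> test_functions \<Omega>" and \<rho>: "smooth_on UNIV \<rho>"
  shows "(LINT y|MO. G y * \<phi> y * pd (ex i) \<rho> y) = - (LINT y|MO. (G' y * \<phi> y + G y * pd (ex i) \<phi> y) * \<rho> y)"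
proof -
  note L = wd_L2[OF G]
  have t: "(\<lambda>y. \<phi> y * \<rho> y) \<in> test_functions \<Omega>" by (rule test_functions_mult[OF \<phi> \<rho>])
  have t1: "(\<lambda>y. \<phi> y * pd (ex i) \<rho> y) \<in> test_functions \<Omega>" by (rule test_functions_mult[OF \<phi> smooth_on_pd[OF \<rho> ex_Basis]])
  have t2: "(\<lambda>y. pd (ex i) \<phi> y * \<rho> y) \<in> test_functions \<Omega>" by (rule test_functions_mult[OF test_functions_pd[OF \<phi> ex_Basis] \<rho>])
  have p: "pd (ex i) (\<lambda>y. \<phi> y * \<rho> y) = (\<lambda>y. \<phi> y * pd (ex i) \<rho> y + pd (ex i) \<phi> y * \<rho> y)"
    using pd_mult[OF test_functions_differentiable[OF \<phi>] smooth_on_differentiable[OF \<rho>]] by auto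
  have "inner G (\<lambda>y. \<phi> y * pd (ex i) \<rho> y) + inner G (\<lambda>y. pd (ex i) \<phi> y * \<rho> y) = - inner G' (\<lambda>y. \<phi> y * \<rho> y)"
    using wdD[OF G t] unfolding p by (simp add: L2_inner_add_right L test_in_L2[OF t1] test_in_L2[OF t2])
  moreover have "(LINT y|MO. (G' y * \<phi> y + G y * pd (ex i) \<phi> y) * \<rho> y)
      = inner G' (\<lambda>y. \<phi> y * \<rho> y) + inner G (\<lambda>y. pd (ex i) \<phi> y * \<rho> y)"
    using L2_mult_integrable[OF L(2) test_in_L2[OF t]] L2_mult_integrable[OF L(1) test_in_L2[OF t2]]
    by (simp add: L2_inner_def distrib_right mult.assoc)
  ultimately show ?thesis by (simp add: L2_inner_def mult.assoc)
qed

text \<open>\<open>G \<phi>\<close> has compact support in \<open>\<Omega>\<close>, so that its mollifications are admissible test functions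
  for the weak derivative of \<open>F\<close>.\<close>

lemma weak_product_rule:
  assumes F: "wd i F F'" and G: "wd i G G'" and \<phi>: "\<phi> \<in> test_functions \<Omega>"
  shows "inner F' (\<lambda>x. G x * \<phi> x) + inner F (\<lambda>x. G' x * \<phi> x) = - inner F (\<lambda>x. G x * pd (ex i) \<phi> x)"
proof -
  note LF = wd_L2[OF F] and LG = wd_L2[OF G]
  note \<phi>' = test_functions_pd[OF \<phi> ex_Basis, of i]
  obtain K where K: "compact K" "K \<subseteq> \<Omega>" "\<And>x. x \<notin> K \<Longrightarrow> \<phi> x = 0" using test_functionsE[OF \<phi>] by blast
  let ?P = "\<lambda>x. G x * \<phi> x" and ?P' = "\<lambda>x. G' x * \<phi> x + G x * pd (ex i) \<phi> x"
  have P: "?P \<in> L2 \<Omega>" by (rule L2_mult_test[OF LG(1) \<phi>])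
  have P'12: "(\<lambda>x. G' x * \<phi> x) \<in> L2 \<Omega>" "(\<lambda>x. G x * pd (ex i) \<phi> x) \<in> L2 \<Omega>"
    by (rule L2_mult_test[OF LG(2) \<phi>], rule L2_mult_test[OF LG(1) \<phi>'])
  then have P': "?P' \<in> L2 \<Omega>" by (rule L2_add)
  obtain K' where K': "\<forall>\<^sub>F k in sequentially. conv \<Omega> ?P (mol k) \<in> test_functions \<Omega> \<and> (\<forall>x. x \<notin> K' \<longrightarrow> conv \<Omega> ?P (mol k) x = 0)"
    using conv_mol_test[OF P _ K(1,2)] K(3) by force
  have pdc: "pd (ex i) (conv \<Omega> ?P (mol k)) = conv \<Omega> ?P' (mol k)" for k
  proof
    fix x
    have s: "smooth_on UNIV (\<lambda>y. mol k (x - y))" by (rule test_functions_smooth[OF reflect_test_UNIV[OF mol_UNIV]])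
    have "pd (ex i) (\<lambda>y. mol k (x - y)) y = - pd (ex i) (mol k) (x - y)" for y
      using pd_scale[of "mol k" x "-1" y "ex i"] test_functions_differentiable[OF mol_UNIV[of k]] by simp
    then show "pd (ex i) (conv \<Omega> ?P (mol k)) x = conv \<Omega> ?P' (mol k) x"
      using wd_mult_test[OF G \<phi> s] unfolding pd_conv[OF P mol_UNIV ex_Basis] conv_def by simp
  qed
  have ev: "\<forall>\<^sub>F k in sequentially. inner F (conv \<Omega> ?P' (mol k)) = - inner F' (conv \<Omega> ?P (mol k))"
    using K'
  proof eventually_elim
    case (elim k)
    then show ?case using wdD[OF F, of "conv \<Omega> ?P (mol k)"] by (simp add: pdc)
  qed
  have l1: "(\<lambda>k. inner F (conv \<Omega> ?P' (mol k))) \<longlonglongrightarrow> inner F ?P'"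
    using L2_inner_tendsto_left[OF conv_mol_L2[OF P'] P' conv_mol_tendsto[OF P'] LF(1)] by (simp add: L2_inner_commute)
  have l2: "(\<lambda>k. - inner F' (conv \<Omega> ?P (mol k))) \<longlonglongrightarrow> - inner F' ?P"
    using L2_inner_tendsto_left[OF conv_mol_L2[OF P] P conv_mol_tendsto[OF P] LF(2)]
    by (intro tendsto_minus) (simp add: L2_inner_commute)
  have "inner F ?P' = - inner F' ?P"
    using LIMSEQ_unique l2 tendsto_cong[OF ev] l1 by blast
  then show ?thesis by (simp add: L2_inner_add_right P'12 LF)
qed

end

section \<open>Spectral expansions\<close>

context dirichlet
begin

lemma lam_0_pos: "0 < lam 0" and lam_mono: "mono lam" and lam_at_top: "filterlim lam at_top sequentially"
  using eigenbasis unfolding dirichlet_eigenbasis_def by auto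

lemma lam_ge_0: "lam 0 \<le> lam j"
  using lam_mono by (simp add: mono_def)

lemma lam_pos: "0 < lam j"
  using lam_0_pos lam_ge_0[of j] by linarith

abbreviation cf where "cf \<equiv> coef \<Omega> w"

lemma cf_diff: "f \<in> L2 \<Omega> \<Longrightarrow> g \<in> L2 \<Omega> \<Longrightarrow> cf (\<lambda>x. f x - g x) j = cf f j - cf g j"
  by (simp add: coef_def L2_inner_diff_left)

lemma wsum_L2: "(\<lambda>x. \<Sum>j\<in>A. a j * w j x) \<in> L2 \<Omega>"
  by (intro L2_sum_cmult) auto

lemma Parseval:
  assumes f: "f \<in> L2 \<Omega>" and g: "g \<in> L2 \<Omega>"
  shows "(\<lambda>j. cf f j * cf g j) sums inner f g"
proof -
  have e: "(\<lambda>N. nrm (\<lambda>x. (\<Sum>j<N. cf f j * w j x) - f x)) \<longlonglongrightarrow> 0"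
    using expansion_tendsto[OF f] by (simp add: L2_norm_minus_commute)
  have "(\<lambda>N. inner (\<lambda>x. \<Sum>j<N. cf f j * w j x) g) \<longlonglongrightarrow> inner f g"
    by (rule L2_inner_tendsto_left[OF wsum_L2 f e g])
  also have "(\<lambda>N. inner (\<lambda>x. \<Sum>j<N. cf f j * w j x) g) = (\<lambda>N. \<Sum>j<N. cf f j * cf g j)"
  proof
    fix N
    have "inner (\<lambda>x. \<Sum>j<N. cf f j * w j x) g = (\<Sum>j<N. cf f j * inner (w j) g)"
      by (rule L2_inner_sum_left) (use g in auto)
    then show "inner (\<lambda>x. \<Sum>j<N. cf f j * w j x) g = (\<Sum>j<N. cf f j * cf g j)"
      by (simp add: coef_def L2_inner_commute[of _ _ g])
  qed
  finally show ?thesis by (simp add: sums_def)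
qed

lemma Parseval_square: "f \<in> L2 \<Omega> \<Longrightarrow> (\<lambda>j. (cf f j)\<^sup>2) sums (nrm f)\<^sup>2"
  unfolding L2_norm_square using Parseval[of f f] by (simp add: power2_eq_square)

lemma summable_cf_square: "f \<in> L2 \<Omega> \<Longrightarrow> summable (\<lambda>j. (cf f j)\<^sup>2)"
  using Parseval_square sums_summable by blast

lemma cf_wsum:
  assumes "finite A"
  shows "cf (\<lambda>x. \<Sum>j\<in>A. a j * w j x) k = (if k \<in> A then a k else 0)"
proof -
  have "cf (\<lambda>x. \<Sum>j\<in>A. a j * w j x) k = (\<Sum>j\<in>A. a j * inner (w j) (w k))"
    unfolding coef_def by (rule L2_inner_sum_left) auto
  also have "\<dots> = (\<Sum>j\<in>A. if j = k then a k else 0)" by (rule sum.cong) (auto simp: w_orthonormal)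
  finally show ?thesis using assms by simp
qed

lemma nrm_wsum_square:
  assumes "finite A"
  shows "(nrm (\<lambda>x. \<Sum>j\<in>A. a j * w j x))\<^sup>2 = (\<Sum>j\<in>A. (a j)\<^sup>2)"
proof -
  let ?f = "\<lambda>x. \<Sum>j\<in>A. a j * w j x"
  have "(nrm ?f)\<^sup>2 = (\<Sum>j\<in>A. a j * inner (w j) ?f)"
    unfolding L2_norm_square by (rule L2_inner_sum_left) (auto simp: wsum_L2)
  also have "\<dots> = (\<Sum>j\<in>A. a j * cf ?f j)" by (simp add: coef_def L2_inner_commute[of _ "w _"])
  also have "\<dots> = (\<Sum>j\<in>A. (a j)\<^sup>2)" by (rule sum.cong) (auto simp: cf_wsum assms power2_eq_square)
  finally show ?thesis .
qed

lemma sum_lessThan_diff_real: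
  fixes f :: "nat \<Rightarrow> real"
  assumes "n \<le> m"
  shows "(\<Sum>j<m. f j) - (\<Sum>j<n. f j) = (\<Sum>j\<in>{n..<m}. f j)"
  using sum_diff[of "{..<m}" "{..<n}" f] assms by (simp add: lessThan_minus_lessThan)

text \<open>Orthogonality enters only as a bound on the blocks of the series. An inequality is asked
  for because the lemma also serves a single component of the gradients of the \<open>w j\<close>,
  which are orthogonal only after both components are added.\<close>

lemma L2_orthogonal_series:
  assumes v: "\<And>j. v j \<in> L2 \<Omega>" and q: "summable q"
    and le: "\<And>m n. n \<le> m \<Longrightarrow> (nrm (\<lambda>x. \<Sum>j\<in>{n..<m}. v j x))\<^sup>2 \<le> (\<Sum>j\<in>{n..<m}. q j)"
  obtains g where "g \<in> L2 \<Omega>" "(\<lambda>N. nrm (\<lambda>x. (\<Sum>j<N. v j x) - g x)) \<longlonglongrightarrow> 0"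
proof (rule L2_complete[where f="\<lambda>N x. \<Sum>j<N. v j x"])
  show "(\<lambda>x. \<Sum>j<N. v j x) \<in> L2 \<Omega>" for N by (intro L2_sum v)
  fix e :: real assume e: "e > 0"
  have "Cauchy (\<lambda>N. \<Sum>j<N. q j)" using q by (simp add: summable_iff_convergent Cauchy_convergent_iff)
  then obtain N where N: "\<And>m n. m \<ge> N \<Longrightarrow> n \<ge> N \<Longrightarrow> norm ((\<Sum>j<m. q j) - (\<Sum>j<n. q j)) < e\<^sup>2"
    using e by (metis CauchyD zero_less_power)
  have *: "nrm (\<lambda>x. (\<Sum>j<m. v j x) - (\<Sum>j<n. v j x)) < e" if "n \<ge> N" "n \<le> m" for m n
  proof -
    have "(nrm (\<lambda>x. (\<Sum>j<m. v j x) - (\<Sum>j<n. v j x)))\<^sup>2 \<le> (\<Sum>j<m. q j) - (\<Sum>j<n. q j)"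
      using le[OF that(2)] by (simp add: sum_lessThan_diff_real[OF that(2)])
    also have "\<dots> < e\<^sup>2" using N[of m n] that by simp
    finally show ?thesis by (rule power2_less_imp_less) (use e in simp)
  qed
  show "\<exists>N. \<forall>m\<ge>N. \<forall>n\<ge>N. nrm (\<lambda>x. (\<Sum>j<m. v j x) - (\<Sum>j<n. v j x)) < e"
  proof (intro exI[of _ N] allI impI)
    fix m n assume "m \<ge> N" "n \<ge> N"
    then show "nrm (\<lambda>x. (\<Sum>j<m. v j x) - (\<Sum>j<n. v j x)) < e"
      using *[of n m] *[of m n] L2_norm_minus_commute[of \<Omega> "\<lambda>x. \<Sum>j<m. v j x" "\<lambda>x. \<Sum>j<n. v j x"]
      by (cases "n \<le> m") auto
  qed
qed (rule that)

lemma Riesz_Fischer: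
  assumes "summable (\<lambda>j. (a j)\<^sup>2)"
  obtains f where "f \<in> L2 \<Omega>" "(\<lambda>N. nrm (\<lambda>x. f x - (\<Sum>j<N. a j * w j x))) \<longlonglongrightarrow> 0"
proof (rule L2_orthogonal_series[of "\<lambda>j x. a j * w j x", OF _ assms])
  show "(nrm (\<lambda>x. \<Sum>j\<in>{n..<m}. a j * w j x))\<^sup>2 \<le> (\<Sum>j\<in>{n..<m}. (a j)\<^sup>2)" for m n
    by (simp add: nrm_wsum_square)
qed (auto intro: L2_cmult that simp: L2_norm_minus_commute)

lemma cf_of_expansion:
  assumes f: "f \<in> L2 \<Omega>" and e: "(\<lambda>N. nrm (\<lambda>x. f x - (\<Sum>j<N. a j * w j x))) \<longlonglongrightarrow> 0"
  shows "cf f = a"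
proof
  fix k
  have "(\<lambda>N. inner (\<lambda>x. \<Sum>j<N. a j * w j x) (w k)) \<longlonglongrightarrow> inner f (w k)"
    by (rule L2_inner_tendsto_left[OF wsum_L2 f]) (use e in \<open>auto simp: L2_norm_minus_commute\<close>)
  then have "(\<lambda>N. cf (\<lambda>x. \<Sum>j<N. a j * w j x) k) \<longlonglongrightarrow> cf f k" by (simp add: coef_def)
  moreover have "(\<lambda>N. cf (\<lambda>x. \<Sum>j<N. a j * w j x) k) \<longlonglongrightarrow> a k"
    by (rule tendsto_eventually, rule eventually_sequentiallyI[of "Suc k"]) (auto simp: cf_wsum)
  ultimately show "cf f k = a k" by (rule LIMSEQ_unique)
qed

lemma Riesz_Fischer_cf:
  assumes "summable (\<lambda>j. (a j)\<^sup>2)"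
  obtains f where "f \<in> L2 \<Omega>" "cf f = a"
  by (rule Riesz_Fischer[OF assms]) (use cf_of_expansion that in blast)

text \<open>Whatever representative the choice picks, its coefficients are determined, and all later
  arguments about \<open>Lam\<close> use only these.\<close>

lemma Lam:
  assumes "summable (\<lambda>j. (lam j powr (\<sigma> / 2) * cf f j)\<^sup>2)"
  shows "Lam \<Omega> w lam \<sigma> f \<in> L2 \<Omega>" "cf (Lam \<Omega> w lam \<sigma> f) = (\<lambda>j. lam j powr (\<sigma> / 2) * cf f j)"
proof -
  let ?P = "\<lambda>g. g \<in> L2 \<Omega> \<and>
     (\<lambda>N. L2_norm \<Omega> (\<lambda>x. g x - (\<Sum>j<N. lam j powr (\<sigma> / 2) * coef \<Omega> w f j * w j x))) \<longlonglongrightarrow> 0"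
  obtain g where "?P g" using Riesz_Fischer[OF assms] by blast
  then have "?P (Lam \<Omega> w lam \<sigma> f)" unfolding Lam_def by (rule someI[of ?P])
  then show "Lam \<Omega> w lam \<sigma> f \<in> L2 \<Omega>" "cf (Lam \<Omega> w lam \<sigma> f) = (\<lambda>j. lam j powr (\<sigma> / 2) * cf f j)"
    using cf_of_expansion[of "Lam \<Omega> w lam \<sigma> f" "\<lambda>j. lam j powr (\<sigma> / 2) * cf f j"] by auto
qed

lemma powr_negative_le: "\<sigma> \<le> 0 \<Longrightarrow> lam j powr \<sigma> \<le> lam 0 powr \<sigma>"
  by (rule powr_mono2') (auto simp: lam_0_pos lam_ge_0)

lemma summable_powr_negative:
  assumes "\<sigma> \<le> 0" "summable (\<lambda>j. (a j)\<^sup>2)"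
  shows "summable (\<lambda>j. (lam j powr (\<sigma> / 2) * a j)\<^sup>2)"
    "(\<Sum>j. (lam j powr (\<sigma> / 2) * a j)\<^sup>2) \<le> (lam 0 powr (\<sigma> / 2))\<^sup>2 * (\<Sum>j. (a j)\<^sup>2)"
proof -
  have le: "(lam j powr (\<sigma> / 2) * a j)\<^sup>2 \<le> (lam 0 powr (\<sigma> / 2))\<^sup>2 * (a j)\<^sup>2" for j
    unfolding power_mult_distrib
    by (intro mult_right_mono power_mono powr_negative_le) (use assms in auto)
  have sm: "summable (\<lambda>j. (lam 0 powr (\<sigma> / 2))\<^sup>2 * (a j)\<^sup>2)" by (rule summable_mult[OF assms(2)])
  show 1: "summable (\<lambda>j. (lam j powr (\<sigma> / 2) * a j)\<^sup>2)"
    by (rule summable_comparison_test'[OF sm, of 0]) (use le in auto)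
  show "(\<Sum>j. (lam j powr (\<sigma> / 2) * a j)\<^sup>2) \<le> (lam 0 powr (\<sigma> / 2))\<^sup>2 * (\<Sum>j. (a j)\<^sup>2)"
    using suminf_le[OF le 1 sm] suminf_mult[OF assms(2)] by simp
qed

text \<open>The compact embedding of L^2 into D(Lambda^(-epsilon)) in sequential form: beyond some
  index \<open>J\<close> the weights are below \<open>\<delta>\<close>, so the tail is at most
  \<open>\<delta>\<close> times the uniform bound \<open>C\<close>, and the finite head tends to
  zero term by term.\<close>

lemma D_norm_tendsto_0:
  assumes \<epsilon>: "\<epsilon> > 0" and sm: "\<And>n. summable (\<lambda>j. (a n j)\<^sup>2)" and C: "\<And>n. (\<Sum>j. (a n j)\<^sup>2) \<le> C"
    and lim: "\<And>j. (\<lambda>n. a n j) \<longlonglongrightarrow> 0"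
  shows "(\<lambda>n. D_norm lam (- \<epsilon>) (a n)) \<longlonglongrightarrow> 0"
proof -
  let ?q = "\<lambda>n j. (lam j powr (- \<epsilon> / 2) * a n j)\<^sup>2"
  have smq: "summable (?q n)" for n using summable_powr_negative(1)[of "-\<epsilon>", OF _ sm] \<epsilon> by simp
  have C0: "C \<ge> 0" using suminf_nonneg[OF sm, of 0] C[of 0] by simp
  have "(\<lambda>n. \<Sum>j. ?q n j) \<longlonglongrightarrow> 0"
  proof (rule LIMSEQ_I)
    fix e :: real assume e: "e > 0"
    define \<delta> where "\<delta> = e / (2 * (C + 1))"
    have \<delta>: "\<delta> > 0" using e C0 by (auto simp: \<delta>_def)
    have \<delta>2: "\<delta> * C \<le> e / 2" using e C0 by (auto simp: \<delta>_def field_simps)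
    have "((\<lambda>j. lam j powr (- \<epsilon>)) \<longlongrightarrow> 0) sequentially"
      using lam_at_top \<epsilon> by (intro tendsto_neg_powr) auto
    then have "\<forall>\<^sub>F j in sequentially. lam j powr (- \<epsilon>) < \<delta>" using \<delta> by (rule order_tendstoD(2))
    then obtain J where J: "\<And>j. j \<ge> J \<Longrightarrow> lam j powr (- \<epsilon>) < \<delta>" by (auto simp: eventually_sequentially)
    have sq: "(lam j powr (- \<epsilon> / 2))\<^sup>2 = lam j powr (- \<epsilon>)" for j
      by (simp add: power2_eq_square flip: powr_add)
    have "(\<lambda>n. \<Sum>j<J. ?q n j) \<longlonglongrightarrow> (\<Sum>j<J. (lam j powr (- \<epsilon> / 2) * 0)\<^sup>2)"
      by (intro tendsto_intros lim)
    then have "(\<lambda>n. \<Sum>j<J. ?q n j) \<longlonglongrightarrow> 0" by simp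
    then have "\<forall>\<^sub>F n in sequentially. (\<Sum>j<J. ?q n j) < e / 2" using e by (intro order_tendstoD(2)) auto
    then obtain N where N: "\<And>n. n \<ge> N \<Longrightarrow> (\<Sum>j<J. ?q n j) < e / 2" by (auto simp: eventually_sequentially)
    have "(\<Sum>j. ?q n j) < e" if "n \<ge> N" for n
    proof -
      have "(\<Sum>j. ?q n j) = (\<Sum>j. ?q n (j + J)) + (\<Sum>j<J. ?q n j)" by (rule suminf_split_initial_segment[OF smq])
      also have "(\<Sum>j. ?q n (j + J)) \<le> (\<Sum>j. \<delta> * (a n (j + J))\<^sup>2)"
      proof (rule suminf_le)
        show "?q n (j + J) \<le> \<delta> * (a n (j + J))\<^sup>2" for j
          unfolding power_mult_distrib sq using J[of "j + J"] by (intro mult_right_mono) auto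
        show "summable (\<lambda>j. ?q n (j + J))" by (rule summable_ignore_initial_segment[OF smq])
        show "summable (\<lambda>j. \<delta> * (a n (j + J))\<^sup>2)" by (intro summable_mult summable_ignore_initial_segment[OF sm])
      qed
      also have "(\<Sum>j. \<delta> * (a n (j + J))\<^sup>2) = \<delta> * (\<Sum>j. (a n (j + J))\<^sup>2)"
        by (rule suminf_mult[OF summable_ignore_initial_segment[OF sm]])
      also have "(\<Sum>j. (a n (j + J))\<^sup>2) \<le> C"
        using suminf_split_initial_segment[OF sm, of n J] C[of n] sum_nonneg[of "{..<J}" "\<lambda>j. (a n j)\<^sup>2"] by simp
      finally show ?thesis using \<delta> \<delta>2 N[OF that] by (simp add: mult_left_mono)
    qed
    moreover have "(\<Sum>j. ?q n j) \<ge> 0" for n by (rule suminf_nonneg[OF smq]) simp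
    ultimately show "\<exists>N. \<forall>n\<ge>N. norm ((\<Sum>j. ?q n j) - 0) < e" by auto
  qed
  then have "(\<lambda>n. sqrt (\<Sum>j. ?q n j)) \<longlonglongrightarrow> sqrt 0" by (rule tendsto_real_sqrt)
  then show ?thesis by (simp add: D_norm_def)
qed

section \<open>Gradients of the eigenfunctions\<close>

abbreviation gw where "gw i j \<equiv> weak_pderiv \<Omega> i (w j)"
abbreviation hw where "hw i k j \<equiv> weak_pderiv \<Omega> i (weak_pderiv \<Omega> k (w j))"

lemma wd_w: "wd i (w j) (gw i j)"
  by (rule H1_wd[OF w_H1])

lemma wd_gw: "wd i (gw k j) (hw i k j)"
  using w_H2[of j] by (intro H1_wd) (auto simp: H2_def)

lemma gw_L2 [simp]: "gw i j \<in> L2 \<Omega>" and hw_L2 [simp]: "hw i k j \<in> L2 \<Omega>"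
  using wd_L2 wd_w wd_gw by blast+

lemma AE_eqI_test:
  assumes f: "f \<in> L2 \<Omega>" and g: "g \<in> L2 \<Omega>" and eq: "\<And>\<eta>. \<eta> \<in> test_functions \<Omega> \<Longrightarrow> inner f \<eta> = inner g \<eta>"
  shows "AE x in MO. f x = g x"
proof -
  have "AE x in MO. f x - g x = 0"
  proof (rule fundamental_lemma)
    show "locally_integrable \<Omega> (\<lambda>x. f x - g x)" by (intro L2_locally_integrable L2_diff f g)
    show "(LINT x|MO. (f x - g x) * \<eta> x) = 0" if "\<eta> \<in> test_functions \<Omega>" for \<eta>
      using L2_inner_diff_left[OF f g test_in_L2[OF that]] eq[OF that] by (simp add: L2_inner_def)
  qed
  then show ?thesis by simp
qed

text \<open>Pairing with a test function moves both derivatives onto it, where they commute.\<close>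

lemma hw_commute: "AE x in MO. hw i k j x = hw k i j x"
proof (rule AE_eqI_test)
  fix \<eta> assume \<eta>: "\<eta> \<in> test_functions \<Omega>"
  have *: "inner (hw a b j) \<eta> = inner (w j) (pd (ex b) (pd (ex a) \<eta>))" for a b
    using wdD[OF wd_gw[of a b j] \<eta>] wdD[OF wd_w[of b j] test_functions_pd[OF \<eta> ex_Basis[of a]]] by simp
  have "pd (ex k) (pd (ex i) \<eta>) = pd (ex i) (pd (ex k) \<eta>)"
    using pd_commute_test[OF test_functions_mono[OF \<eta>] ex_Basis ex_Basis] by auto
  then show "inner (hw i k j) \<eta> = inner (hw k i j) \<eta>" unfolding * by simp
qed auto

lemma eigen_equation: "AE x in MO. - (hw 1 1 j x + hw 2 2 j x) = lam j * w j x"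
  using eigenbasis unfolding dirichlet_eigenbasis_def weak_laplacian_def by (simp add: sum_2)

lemma gw_test:
  assumes \<eta>: "\<eta> \<in> test_functions \<Omega>"
  shows "inner (gw 1 j) (pd (ex 1) \<eta>) + inner (gw 2 j) (pd (ex 2) \<eta>) = lam j * inner (w j) \<eta>"
proof -
  have "lam j * inner (w j) \<eta> = inner (\<lambda>x. lam j * w j x) \<eta>" by (simp add: L2_inner_cmult_left)
  also have "\<dots> = inner (\<lambda>x. - 1 * (hw 1 1 j x + hw 2 2 j x)) \<eta>"
  proof (rule L2_inner_cong_AE)
    show "(\<lambda>x. lam j * w j x) \<in> L2 \<Omega>" "(\<lambda>x. - 1 * (hw 1 1 j x + hw 2 2 j x)) \<in> L2 \<Omega>"
      by (intro L2_cmult w_L2) (intro L2_cmult L2_add hw_L2)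
    show "AE x in MO. lam j * w j x = - 1 * (hw 1 1 j x + hw 2 2 j x)"
      using eigen_equation[of j] by eventually_elim simp
  qed (auto intro: test_in_L2[OF \<eta>])
  also have "\<dots> = - inner (hw 1 1 j) \<eta> - inner (hw 2 2 j) \<eta>"
    unfolding L2_inner_cmult_left by (simp add: L2_inner_add_left test_in_L2[OF \<eta>])
  finally show ?thesis using wdD[OF wd_gw[of 1 1 j] \<eta>] wdD[OF wd_gw[of 2 2 j] \<eta>] by simp
qed

text \<open>The weak eigenvalue equation \<open>gw_test\<close> extends from test functions to
  \<open>w k\<close>, because \<open>w k\<close> is their limit together with both first derivatives
  by membership in \<open>H10\<close>. This is where the Dirichlet condition enters.\<close>

lemma gw_orthogonal: "inner (gw 1 j) (gw 1 k) + inner (gw 2 j) (gw 2 k) = (if j = k then lam j else 0)"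
proof -
  obtain \<eta> :: "nat \<Rightarrow> real^2 \<Rightarrow> real" where \<eta>: "\<And>n. \<eta> n \<in> test_functions \<Omega>"
    "(\<lambda>n. nrm (\<lambda>x. \<eta> n x - w k x)) \<longlonglongrightarrow> 0"
    "\<And>i. (\<lambda>n. nrm (\<lambda>x. pd (ex i) (\<eta> n) x - gw i k x)) \<longlonglongrightarrow> 0"
    using w_H10[of k] unfolding H10_def by auto
  have l: "(\<lambda>n. inner (gw i j) (pd (ex i) (\<eta> n))) \<longlonglongrightarrow> inner (gw i j) (gw i k)" for i
    using L2_inner_tendsto_left[OF test_in_L2[OF test_functions_pd[OF \<eta>(1) ex_Basis]] gw_L2 \<eta>(3) gw_L2[of i j]]
    by (simp add: L2_inner_commute[of \<Omega> "gw i j"])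
  have "(\<lambda>n. lam j * inner (w j) (\<eta> n)) \<longlonglongrightarrow> lam j * inner (w j) (w k)"
    using L2_inner_tendsto_left[OF test_in_L2[OF \<eta>(1)] w_L2 \<eta>(2) w_L2[of j]]
    by (intro tendsto_mult_left) (simp add: L2_inner_commute[of \<Omega> "w j"])
  moreover have "(\<lambda>n. lam j * inner (w j) (\<eta> n)) \<longlonglongrightarrow> inner (gw 1 j) (gw 1 k) + inner (gw 2 j) (gw 2 k)"
    using tendsto_add[OF l[of 1] l[of 2]] gw_test[OF \<eta>(1)] by simp
  ultimately have "inner (gw 1 j) (gw 1 k) + inner (gw 2 j) (gw 2 k) = lam j * inner (w j) (w k)"
    by (rule LIMSEQ_unique[rotated])
  then show ?thesis by (simp add: w_orthonormal)
qed

lemma gsum_L2: "(\<lambda>x. \<Sum>j\<in>A. c j * gw i j x) \<in> L2 \<Omega>"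
  by (intro L2_sum_cmult) auto

lemma nrm_gsum_square:
  assumes "finite A"
  shows "(nrm (\<lambda>x. \<Sum>j\<in>A. c j * gw 1 j x))\<^sup>2 + (nrm (\<lambda>x. \<Sum>j\<in>A. c j * gw 2 j x))\<^sup>2 = (\<Sum>j\<in>A. lam j * (c j)\<^sup>2)"
proof -
  have e: "(nrm (\<lambda>x. \<Sum>j\<in>A. c j * gw i j x))\<^sup>2 = (\<Sum>j\<in>A. \<Sum>k\<in>A. c j * c k * inner (gw i j) (gw i k))" for i
  proof -
    have "(nrm (\<lambda>x. \<Sum>j\<in>A. c j * gw i j x))\<^sup>2 = (\<Sum>j\<in>A. c j * inner (\<lambda>x. \<Sum>k\<in>A. c k * gw i k x) (gw i j))"
      unfolding L2_norm_square by (subst L2_inner_sum_left) (auto simp: gsum_L2 L2_inner_commute)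
    also have "\<dots> = (\<Sum>j\<in>A. \<Sum>k\<in>A. c j * c k * inner (gw i j) (gw i k))"
      by (rule sum.cong[OF refl], subst L2_inner_sum_left)
         (auto simp: sum_distrib_left mult.assoc L2_inner_commute)
    finally show ?thesis .
  qed
  have "(nrm (\<lambda>x. \<Sum>j\<in>A. c j * gw 1 j x))\<^sup>2 + (nrm (\<lambda>x. \<Sum>j\<in>A. c j * gw 2 j x))\<^sup>2
      = (\<Sum>j\<in>A. \<Sum>k\<in>A. c j * c k * (inner (gw 1 j) (gw 1 k) + inner (gw 2 j) (gw 2 k)))"
    unfolding e by (simp add: sum.distrib distrib_left)
  also have "\<dots> = (\<Sum>j\<in>A. \<Sum>k\<in>A. if k = j then lam j * (c j)\<^sup>2 else 0)"
    unfolding gw_orthogonal by (intro sum.cong refl) (auto simp: power2_eq_square)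
  also have "\<dots> = (\<Sum>j\<in>A. lam j * (c j)\<^sup>2)" using assms by simp
  finally show ?thesis .
qed

lemma wd_sum: "(\<And>j. j \<in> A \<Longrightarrow> wd i (f j) (g j)) \<Longrightarrow> wd i (\<lambda>x. \<Sum>j\<in>A. c j * f j x) (\<lambda>x. \<Sum>j\<in>A. c j * g j x)"
  unfolding wd_def
proof (intro conjI ballI)
  assume *: "\<And>j. j \<in> A \<Longrightarrow> f j \<in> L2 \<Omega> \<and> g j \<in> L2 \<Omega> \<and> (\<forall>\<eta>\<in>test_functions \<Omega>. inner (f j) (pd (ex i) \<eta>) = - inner (g j) \<eta>)"
  show "(\<lambda>x. \<Sum>j\<in>A. c j * f j x) \<in> L2 \<Omega>" "(\<lambda>x. \<Sum>j\<in>A. c j * g j x) \<in> L2 \<Omega>"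
    using * by (auto intro!: L2_sum_cmult)
  fix \<eta> assume \<eta>: "\<eta> \<in> test_functions \<Omega>"
  have "inner (\<lambda>x. \<Sum>j\<in>A. c j * f j x) (pd (ex i) \<eta>) = (\<Sum>j\<in>A. c j * inner (f j) (pd (ex i) \<eta>))"
    by (rule L2_inner_sum_left) (use * test_in_L2[OF test_functions_pd[OF \<eta> ex_Basis]] in auto)
  also have "\<dots> = - (\<Sum>j\<in>A. c j * inner (g j) \<eta>)"
    unfolding sum_negf[symmetric] by (rule sum.cong) (use * \<eta> in auto)
  also have "(\<Sum>j\<in>A. c j * inner (g j) \<eta>) = inner (\<lambda>x. \<Sum>j\<in>A. c j * g j x) \<eta>"
    by (rule L2_inner_sum_left[symmetric]) (use * test_in_L2[OF \<eta>] in auto)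
  finally show "inner (\<lambda>x. \<Sum>j\<in>A. c j * f j x) (pd (ex i) \<eta>) = - inner (\<lambda>x. \<Sum>j\<in>A. c j * g j x) \<eta>" .
qed

lemma wd_limit:
  assumes fg: "\<And>n. wd i (f n) (g n)" and f: "f' \<in> L2 \<Omega>" "(\<lambda>n. nrm (\<lambda>x. f n x - f' x)) \<longlonglongrightarrow> 0"
    and g: "g' \<in> L2 \<Omega>" "(\<lambda>n. nrm (\<lambda>x. g n x - g' x)) \<longlonglongrightarrow> 0"
  shows "wd i f' g'"
  unfolding wd_def
proof (intro conjI ballI f(1) g(1))
  fix \<eta> assume \<eta>: "\<eta> \<in> test_functions \<Omega>"
  have "(\<lambda>n. inner (f n) (pd (ex i) \<eta>)) \<longlonglongrightarrow> inner f' (pd (ex i) \<eta>)"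
    by (rule L2_inner_tendsto_left[OF wd_L2(1)[OF fg] f test_in_L2[OF test_functions_pd[OF \<eta> ex_Basis]]])
  moreover have "(\<lambda>n. - inner (g n) \<eta>) \<longlonglongrightarrow> - inner g' \<eta>"
    by (intro tendsto_minus L2_inner_tendsto_left[OF wd_L2(2)[OF fg] g test_in_L2[OF \<eta>]])
  ultimately show "inner f' (pd (ex i) \<eta>) = - inner g' \<eta>"
    using wdD[OF fg \<eta>] by (simp add: LIMSEQ_unique)
qed

text \<open>Finite Dirichlet energy makes the partial sums of the gradient series Cauchy by
  \<open>nrm_gsum_square\<close>. Weak differentiation is closed, so their limit is the derivative
  of \<open>f\<close>, and it coincides almost everywhere with the chosen
  \<open>weak_pderiv\<close>.\<close>

lemma gradient_expansion:
  assumes sm: "summable (\<lambda>j. lam j * (c j)\<^sup>2)" and f: "f \<in> L2 \<Omega>" "cf f = c"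
  shows "wd i f (weak_pderiv \<Omega> i f)"
    "(\<lambda>N. nrm (\<lambda>x. (\<Sum>j<N. c j * gw i j x) - weak_pderiv \<Omega> i f x)) \<longlonglongrightarrow> 0"
proof -
  have le: "(nrm (\<lambda>x. \<Sum>j\<in>{n..<m}. c j * gw i j x))\<^sup>2 \<le> (\<Sum>j\<in>{n..<m}. lam j * (c j)\<^sup>2)" for m n
  proof -
    have eq: "(nrm (\<lambda>x. \<Sum>j\<in>{n..<m}. c j * gw 1 j x))\<^sup>2 + (nrm (\<lambda>x. \<Sum>j\<in>{n..<m}. c j * gw 2 j x))\<^sup>2
        = (\<Sum>j\<in>{n..<m}. lam j * (c j)\<^sup>2)" by (rule nrm_gsum_square) simp
    have "i = 1 \<or> i = 2" by (rule exhaust_2)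
    then show ?thesis
    proof
      assume "i = 1"
      then show ?thesis by (simp flip: eq)
    next
      assume "i = 2"
      then show ?thesis by (simp flip: eq)
    qed
  qed
  obtain g where g: "g \<in> L2 \<Omega>" "(\<lambda>N. nrm (\<lambda>x. (\<Sum>j<N. c j * gw i j x) - g x)) \<longlonglongrightarrow> 0"
    by (rule L2_orthogonal_series[of "\<lambda>j x. c j * gw i j x", OF L2_cmult[OF gw_L2] sm le])
  have wdg: "wd i f g"
  proof (rule wd_limit[OF _ f(1) _ g])
    show "wd i (\<lambda>x. \<Sum>j<N. c j * w j x) (\<lambda>x. \<Sum>j<N. c j * gw i j x)" for N
      by (rule wd_sum) (rule wd_w)
    show "(\<lambda>N. nrm (\<lambda>x. (\<Sum>j<N. c j * w j x) - f x)) \<longlonglongrightarrow> 0"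
      using expansion_tendsto[OF f(1)] by (simp add: f(2) L2_norm_minus_commute)
  qed
  show 1: "wd i f (weak_pderiv \<Omega> i f)" by (rule wd_weak_pderiv(2)[OF wdg])
  have "nrm (\<lambda>x. (\<Sum>j<N. c j * gw i j x) - weak_pderiv \<Omega> i f x) = nrm (\<lambda>x. (\<Sum>j<N. c j * gw i j x) - g x)" for N
    by (rule L2_norm_cong_AE) (use wd_weak_pderiv(1)[OF wdg] in \<open>auto intro!: L2_diff gsum_L2 g wd_L2(2)[OF 1]\<close>)
  then show "(\<lambda>N. nrm (\<lambda>x. (\<Sum>j<N. c j * gw i j x) - weak_pderiv \<Omega> i f x)) \<longlonglongrightarrow> 0"
    using g(2) by simp
qed

end

section \<open>The nonlinear term\<close>

context dirichlet
begin

text \<open>The weight is a separate argument because every nonlinear term below is the integral of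
  a product of two L^2 functions against a derivative of a fixed test function; the boundedness of
  that weight makes the form continuous on pairs of L^2 functions.\<close>

definition T :: "(real^2 \<Rightarrow> real) \<Rightarrow> (real^2 \<Rightarrow> real) \<Rightarrow> (real^2 \<Rightarrow> real) \<Rightarrow> real" where
  "T u v \<phi> = (LINT x|MO. u x * v x * \<phi> x)"

lemma T_eq_inner: "T u v \<phi> = inner u (\<lambda>x. v x * \<phi> x)"
  by (simp add: T_def L2_inner_def mult.assoc)

lemma T_commute: "T u v \<phi> = T v u \<phi>"
  by (simp add: T_def mult_ac)

lemma T_sum_left:
  assumes "\<And>i. i \<in> I \<Longrightarrow> u i \<in> L2 \<Omega>" "v \<in> L2 \<Omega>" "\<phi> \<in> test_functions \<Omega>"
  shows "T (\<lambda>x. \<Sum>i\<in>I. c i * u i x) v \<phi> = (\<Sum>i\<in>I. c i * T (u i) v \<phi>)"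
  unfolding T_eq_inner using assms by (intro L2_inner_sum_left L2_mult_test)

lemma T_diff_left:
  assumes "u \<in> L2 \<Omega>" "u' \<in> L2 \<Omega>" "v \<in> L2 \<Omega>" "\<phi> \<in> test_functions \<Omega>"
  shows "T (\<lambda>x. u x - u' x) v \<phi> = T u v \<phi> - T u' v \<phi>"
  unfolding T_eq_inner by (rule L2_inner_diff_left[OF assms(1,2) L2_mult_test[OF assms(3,4)]])

lemma T_diff_right:
  assumes "u \<in> L2 \<Omega>" "u' \<in> L2 \<Omega>" "v \<in> L2 \<Omega>" "\<phi> \<in> test_functions \<Omega>"
  shows "T v (\<lambda>x. u x - u' x) \<phi> = T v u \<phi> - T v u' \<phi>"
  using T_diff_left[OF assms] by (simp add: T_commute[of _ v])

lemma T_sum: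
  assumes "\<And>i. i \<in> I \<Longrightarrow> u i \<in> L2 \<Omega>" "\<And>k. k \<in> K \<Longrightarrow> v k \<in> L2 \<Omega>" "\<phi> \<in> test_functions \<Omega>"
  shows "T (\<lambda>x. \<Sum>i\<in>I. c i * u i x) (\<lambda>x. \<Sum>k\<in>K. d k * v k x) \<phi> = (\<Sum>i\<in>I. \<Sum>k\<in>K. c i * d k * T (u i) (v k) \<phi>)"
proof -
  have "T (\<lambda>x. \<Sum>i\<in>I. c i * u i x) (\<lambda>x. \<Sum>k\<in>K. d k * v k x) \<phi>
      = (\<Sum>i\<in>I. c i * T (\<lambda>x. \<Sum>k\<in>K. d k * v k x) (u i) \<phi>)"
    using assms by (subst T_sum_left) (auto intro: L2_sum_cmult simp: T_commute)
  also have "\<dots> = (\<Sum>i\<in>I. c i * (\<Sum>k\<in>K. d k * T (v k) (u i) \<phi>))"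
    using assms by (intro sum.cong refl arg_cong2[where f="(*)"] T_sum_left) auto
  finally show ?thesis by (simp add: sum_distrib_left mult.assoc T_commute[of "v _"])
qed

lemma T_bound:
  assumes "u \<in> L2 \<Omega>" "v \<in> L2 \<Omega>" "\<phi> \<in> test_functions \<Omega>" "\<And>x. \<bar>\<phi> x\<bar> \<le> B" "B \<ge> 0"
  shows "\<bar>T u v \<phi>\<bar> \<le> B * (nrm u * nrm v)"
proof -
  have "\<bar>T u v \<phi>\<bar> \<le> nrm u * nrm (\<lambda>x. v x * \<phi> x)"
    unfolding T_eq_inner by (rule L2_Cauchy_Schwarz[OF assms(1) L2_mult_test[OF assms(2,3)]])
  also have "nrm (\<lambda>x. v x * \<phi> x) \<le> B * nrm v"
  proof -
    have "(LINT x|MO. (v x * \<phi> x)\<^sup>2) \<le> (LINT x|MO. B\<^sup>2 * (v x)\<^sup>2)"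
    proof (rule integral_mono)
      show "integrable MO (\<lambda>x. (v x * \<phi> x)\<^sup>2)" by (rule L2_integrable_square[OF L2_mult_test[OF assms(2,3)]])
      show "integrable MO (\<lambda>x. B\<^sup>2 * (v x)\<^sup>2)" using L2_integrable_square[OF assms(2)] by simp
      show "(v x * \<phi> x)\<^sup>2 \<le> B\<^sup>2 * (v x)\<^sup>2" for x
        using power_mono[OF assms(4)[of x], of 2] by (simp add: power_mult_distrib mult.commute mult_right_mono)
    qed
    then have "sqrt (LINT x|MO. (v x * \<phi> x)\<^sup>2) \<le> sqrt (B\<^sup>2 * (LINT x|MO. (v x)\<^sup>2))"
      by (intro real_sqrt_le_mono) simp
    then show ?thesis using assms(5) by (simp add: L2_norm_def real_sqrt_mult)
  qed
  then have "nrm u * nrm (\<lambda>x. v x * \<phi> x) \<le> nrm u * (B * nrm v)" by (rule mult_left_mono) simp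
  finally show ?thesis by (simp add: mult_ac)
qed

lemma T_tendsto:
  assumes u: "\<And>n. u n \<in> L2 \<Omega>" "u' \<in> L2 \<Omega>" "(\<lambda>n. nrm (\<lambda>x. u n x - u' x)) \<longlonglongrightarrow> 0"
    and v: "\<And>n. v n \<in> L2 \<Omega>" "v' \<in> L2 \<Omega>" "(\<lambda>n. nrm (\<lambda>x. v n x - v' x)) \<longlonglongrightarrow> 0"
    and \<phi>: "\<phi> \<in> test_functions \<Omega>"
  shows "(\<lambda>n. T (u n) (v n) \<phi>) \<longlonglongrightarrow> T u' v' \<phi>"
proof -
  obtain B where B: "B \<ge> 0" "\<And>x. \<bar>\<phi> x\<bar> \<le> B" using test_functions_bounded[OF \<phi>] by blast
  have bd: "\<bar>T (u n) (v n) \<phi> - T u' v' \<phi>\<bar>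
      \<le> B * (nrm (\<lambda>x. u n x - u' x) * nrm (v n)) + B * (nrm u' * nrm (\<lambda>x. v n x - v' x))" for n
  proof -
    have "T (u n) (v n) \<phi> - T u' v' \<phi> = T (\<lambda>x. u n x - u' x) (v n) \<phi> + T u' (\<lambda>x. v n x - v' x) \<phi>"
      by (simp add: T_diff_left T_diff_right u v \<phi>)
    then show ?thesis
      using T_bound[OF L2_diff[OF u(1)[of n] u(2)] v(1)[of n] \<phi> B(2,1)] T_bound[OF u(2) L2_diff[OF v(1)[of n] v(2)] \<phi> B(2,1)]
      by linarith
  qed
  have "(\<lambda>n. B * (nrm (\<lambda>x. u n x - u' x) * nrm (v n)) + B * (nrm u' * nrm (\<lambda>x. v n x - v' x)))
      \<longlonglongrightarrow> B * (0 * nrm v') + B * (nrm u' * 0)"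
    by (intro tendsto_intros u v L2_norm_diff_tendsto)
  then have lim: "(\<lambda>n. B * (nrm (\<lambda>x. u n x - u' x) * nrm (v n)) + B * (nrm u' * nrm (\<lambda>x. v n x - v' x))) \<longlonglongrightarrow> 0"
    by simp
  have "(\<lambda>n. T (u n) (v n) \<phi> - T u' v' \<phi>) \<longlonglongrightarrow> 0"
    by (rule Lim_null_comparison[OF _ lim], intro always_eventually allI) (simp only: real_norm_def bd)
  then show ?thesis by (simp add: LIM_zero_iff)
qed

lemma T_cong_AE:
  assumes "u \<in> L2 \<Omega>" "u' \<in> L2 \<Omega>" "v \<in> L2 \<Omega>" "AE x in MO. u x = u' x" "\<phi> \<in> test_functions \<Omega>"
  shows "T u v \<phi> = T u' v \<phi>"
  unfolding T_eq_inner by (rule L2_inner_cong_AE) (use assms L2_mult_test in auto)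

lemma T_product_rule:
  assumes "wd i F F'" "wd i G G'" "\<phi> \<in> test_functions \<Omega>"
  shows "T F' G \<phi> + T F G' \<phi> = - T F G (pd (ex i) \<phi>)"
  unfolding T_eq_inner by (rule weak_product_rule[OF assms])

text \<open>\<open>bw \<phi> j k = \<integral>w\<^sub>j \<nabla>\<^sup>\<bottom>w\<^sub>k \<cdot> \<nabla>\<phi>\<close>, and \<open>Ew \<phi> j k\<close> is the form in the gradients which it becomes after
  multiplication with \<open>\<lambda>\<^sub>j - \<lambda>\<^sub>k\<close>, as in the weak formulation of the Euler equations in terms of
  \<open>u \<otimes> u\<close>.\<close>

definition bw :: "(real^2 \<Rightarrow> real) \<Rightarrow> nat \<Rightarrow> nat \<Rightarrow> real" where
  "bw \<phi> j k = T (w j) (gw 1 k) (pd (ex 2) \<phi>) - T (w j) (gw 2 k) (pd (ex 1) \<phi>)"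

definition Ew :: "(real^2 \<Rightarrow> real) \<Rightarrow> nat \<Rightarrow> nat \<Rightarrow> real" where
  "Ew \<phi> j k = 2 * T (gw 1 j) (gw 1 k) (pd (ex 1) (pd (ex 2) \<phi>)) - 2 * T (gw 2 j) (gw 2 k) (pd (ex 1) (pd (ex 2) \<phi>))
    + T (gw 1 j) (gw 2 k) (pd (ex 2) (pd (ex 2) \<phi>)) + T (gw 2 j) (gw 1 k) (pd (ex 2) (pd (ex 2) \<phi>))
    - T (gw 1 j) (gw 2 k) (pd (ex 1) (pd (ex 1) \<phi>)) - T (gw 2 j) (gw 1 k) (pd (ex 1) (pd (ex 1) \<phi>))"

lemma pd_commute_ex:
  assumes "\<phi> \<in> test_functions \<Omega>"
  shows "pd (ex 2) (pd (ex 1) \<phi>) = pd (ex 1) (pd (ex 2) \<phi>)"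
  using pd_commute_test[OF test_functions_mono[OF assms] ex_Basis ex_Basis] by auto

text \<open>The sum of the two coefficients integrates the gradient of the product of
  \<open>w j\<close> and \<open>w k\<close> against the rotated gradient of the test function.
  Integration by parts leaves the difference of its two mixed derivatives, which is zero.\<close>

lemma bw_antisym:
  assumes \<phi>: "\<phi> \<in> test_functions \<Omega>"
  shows "bw \<phi> j k = - bw \<phi> k j"
proof -
  note d = test_functions_pd[OF \<phi> ex_Basis]
  show ?thesis
    using T_product_rule[OF wd_w[of 1 j] wd_w[of 1 k] d[of 2]] T_product_rule[OF wd_w[of 2 j] wd_w[of 2 k] d[of 1]]
    unfolding bw_def pd_commute_ex[OF \<phi>] T_commute[of "gw 1 j" "w k"] T_commute[of "gw 2 j" "w k"] by linarith
qed

lemma lam_T: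
  assumes v: "v \<in> L2 \<Omega>" and \<phi>: "\<phi> \<in> test_functions \<Omega>"
  shows "lam j * T (w j) v \<phi> = - T (hw 1 1 j) v \<phi> - T (hw 2 2 j) v \<phi>"
proof -
  note vp = L2_mult_test[OF v \<phi>]
  have "lam j * T (w j) v \<phi> = inner (\<lambda>x. lam j * w j x) (\<lambda>x. v x * \<phi> x)"
    by (simp add: T_eq_inner L2_inner_cmult_left)
  also have "\<dots> = inner (\<lambda>x. - 1 * (hw 1 1 j x + hw 2 2 j x)) (\<lambda>x. v x * \<phi> x)"
  proof (rule L2_inner_cong_AE)
    show "(\<lambda>x. lam j * w j x) \<in> L2 \<Omega>" "(\<lambda>x. - 1 * (hw 1 1 j x + hw 2 2 j x)) \<in> L2 \<Omega>"
      by (intro L2_cmult w_L2) (intro L2_cmult L2_add hw_L2)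
    show "AE x in MO. lam j * w j x = - 1 * (hw 1 1 j x + hw 2 2 j x)"
      using eigen_equation[of j] by eventually_elim simp
  qed (use vp in auto)
  also have "\<dots> = - inner (hw 1 1 j) (\<lambda>x. v x * \<phi> x) - inner (hw 2 2 j) (\<lambda>x. v x * \<phi> x)"
    unfolding L2_inner_cmult_left by (simp add: L2_inner_add_left vp)
  finally show ?thesis by (simp add: T_eq_inner)
qed

text \<open>By antisymmetry the left side is lambda_j b_jk + lambda_k b_kj. The eigenvalue equation
  turns each summand into second derivatives of one eigenfunction times first derivatives of the
  other, and the product rule \<open>PR\<close> pairs every such term with its mirror image under
  exchange of \<open>j\<close> and \<open>k\<close>. The derivatives then fall on the test
  function.\<close>

lemma bw_eq_Ew:
  assumes \<phi>: "\<phi> \<in> test_functions \<Omega>"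
  shows "(lam j - lam k) * bw \<phi> j k = Ew \<phi> j k"
proof -
  let ?p1 = "pd (ex 1) \<phi>" and ?p2 = "pd (ex 2) \<phi>"
  note d = test_functions_pd[OF \<phi> ex_Basis]
  have c: "T (hw 2 1 a) v \<psi> = T (hw 1 2 a) v \<psi>" if "v \<in> L2 \<Omega>" "\<psi> \<in> test_functions \<Omega>" for a v \<psi>
    by (rule T_cong_AE) (use that hw_commute in auto)
  have l: "lam a * bw \<phi> a b = - T (hw 1 1 a) (gw 1 b) ?p2 - T (hw 2 2 a) (gw 1 b) ?p2
      + T (hw 1 1 a) (gw 2 b) ?p1 + T (hw 2 2 a) (gw 2 b) ?p1" for a b
    unfolding bw_def right_diff_distrib lam_T[OF gw_L2 d] by simp
  have PR: "T (hw i p j) (gw q k) \<psi> + T (hw i q k) (gw p j) \<psi> = - T (gw p j) (gw q k) (pd (ex i) \<psi>)"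
    if "\<psi> \<in> test_functions \<Omega>" for i p q \<psi>
    using T_product_rule[OF wd_gw[of i p j] wd_gw[of i q k] that] by (simp add: T_commute[of "gw p j"])
  have "(lam j - lam k) * bw \<phi> j k = lam j * bw \<phi> j k + lam k * bw \<phi> k j"
    using bw_antisym[OF \<phi>, of j k] by (simp add: left_diff_distrib)
  \<comment> \<open>For each of the two weights, three instances of \<open>PR\<close> remove the
    pure second derivatives. Where the pure derivative and the gradient have different indices,
    mixed second derivatives are left over, and the fourth instance removes them.\<close>
  also have "\<dots> = Ew \<phi> j k"
    using PR[OF d[of 2], of 1 1 1] PR[OF d[of 2], of 2 2 1] PR[OF d[of 2], of 2 1 2] PR[OF d[of 2], of 1 2 2]
      PR[OF d[of 1], of 2 2 2] PR[OF d[of 1], of 1 1 2] PR[OF d[of 1], of 1 2 1] PR[OF d[of 1], of 2 1 1]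
    unfolding l Ew_def pd_commute_ex[OF \<phi>] c[OF gw_L2 d] by linarith
  finally show ?thesis .
qed

text \<open>The double sum is a form in the gradient \<open>(?U 1, ?U 2)\<close> of one function,
  the combination of the eigenfunctions with coefficients \<open>c\<close>. The six terms contribute
  2 p^2 + 2 q^2 + 4 p q with p, q the norms of the two components; this is at most 4 (p^2 + q^2),
  and p^2 + q^2 is the Dirichlet energy.\<close>

lemma Ew_quadratic_bound:
  assumes \<phi>: "\<phi> \<in> test_functions \<Omega>"
    and B: "\<And>a b x. \<bar>pd (ex a) (pd (ex b) \<phi>) x\<bar> \<le> B" "B \<ge> 0" and A: "finite A"
  shows "\<bar>\<Sum>j\<in>A. \<Sum>k\<in>A. c j * c k * Ew \<phi> j k\<bar> \<le> 4 * B * (\<Sum>j\<in>A. lam j * (c j)\<^sup>2)"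
proof -
  let ?U = "\<lambda>i x. \<Sum>j\<in>A. c j * gw i j x"
  note d = test_functions_pd[OF test_functions_pd[OF \<phi> ex_Basis] ex_Basis]
  have S: "(\<Sum>j\<in>A. \<Sum>k\<in>A. c j * c k * T (gw p j) (gw q k) \<psi>) = T (?U p) (?U q) \<psi>"
    if "\<psi> \<in> test_functions \<Omega>" for p q \<psi>
    by (rule T_sum[symmetric]) (use that in auto)
  have eq: "(\<Sum>j\<in>A. \<Sum>k\<in>A. c j * c k * Ew \<phi> j k) =
      2 * T (?U 1) (?U 1) (pd (ex 1) (pd (ex 2) \<phi>)) - 2 * T (?U 2) (?U 2) (pd (ex 1) (pd (ex 2) \<phi>))
    + T (?U 1) (?U 2) (pd (ex 2) (pd (ex 2) \<phi>)) + T (?U 2) (?U 1) (pd (ex 2) (pd (ex 2) \<phi>))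
    - T (?U 1) (?U 2) (pd (ex 1) (pd (ex 1) \<phi>)) - T (?U 2) (?U 1) (pd (ex 1) (pd (ex 1) \<phi>))"
    unfolding S[OF d, symmetric] Ew_def
    by (simp add: sum.distrib sum_subtractf distrib_left right_diff_distrib sum_distrib_left mult_ac)
  have bd: "\<bar>T (?U p) (?U q) (pd (ex a) (pd (ex b) \<phi>))\<bar> \<le> B * (nrm (?U p) * nrm (?U q))" for p q a b
    by (rule T_bound[OF gsum_L2 gsum_L2 d B])
  have arith: "\<bar>2 * x1 - 2 * x2 + x3 + x4 - x5 - x6\<bar> \<le> 2 * p + 2 * q + 4 * r"
    if "\<bar>x1\<bar> \<le> p" "\<bar>x2\<bar> \<le> q" "\<bar>x3\<bar> \<le> r" "\<bar>x4\<bar> \<le> r" "\<bar>x5\<bar> \<le> r" "\<bar>x6\<bar> \<le> r"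
    for x1 x2 x3 x4 x5 x6 p q r :: real
    using that by linarith
  have "\<bar>\<Sum>j\<in>A. \<Sum>k\<in>A. c j * c k * Ew \<phi> j k\<bar> \<le>
      2 * (B * (nrm (?U 1) * nrm (?U 1))) + 2 * (B * (nrm (?U 2) * nrm (?U 2))) + 4 * (B * (nrm (?U 1) * nrm (?U 2)))"
    unfolding eq by (rule arith) (rule bd bd[where p=2 and q=1, unfolded mult.commute[of "nrm (?U 2)"]])+
  also have "\<dots> = B * (2 * (nrm (?U 1) * nrm (?U 1)) + 2 * (nrm (?U 2) * nrm (?U 2)) + 4 * (nrm (?U 1) * nrm (?U 2)))"
    by (simp add: algebra_simps)
  also have "\<dots> \<le> B * (4 * ((nrm (?U 1))\<^sup>2 + (nrm (?U 2))\<^sup>2))"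
  proof (rule mult_left_mono[OF _ B(2)])
    have "0 \<le> (nrm (?U 1) - nrm (?U 2))\<^sup>2" by simp
    then show "2 * (nrm (?U 1) * nrm (?U 1)) + 2 * (nrm (?U 2) * nrm (?U 2)) + 4 * (nrm (?U 1) * nrm (?U 2))
        \<le> 4 * ((nrm (?U 1))\<^sup>2 + (nrm (?U 2))\<^sup>2)"
      unfolding power2_eq_square by (simp add: algebra_simps)
  qed
  finally show ?thesis by (simp add: nrm_gsum_square[OF A])
qed

section \<open>The nonlinear term in coefficients\<close>

definition \<mu> :: "nat \<Rightarrow> real" where "\<mu> j = sqrt (lam j)"

lemma \<mu>_pos: "\<mu> j > 0" and \<mu>_square: "(\<mu> j)\<^sup>2 = lam j"
  using lam_pos[of j] by (auto simp: \<mu>_def)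

text \<open>The integral of theta u . grad phi for theta the combination of the first
  \<open>n\<close> eigenfunctions with coefficients \<open>a\<close>: division by
  \<open>\<mu> k\<close> passes from theta to its stream function.\<close>

definition Q :: "(real^2 \<Rightarrow> real) \<Rightarrow> nat \<Rightarrow> (nat \<Rightarrow> real) \<Rightarrow> real" where
  "Q \<phi> n a = (\<Sum>j<n. \<Sum>k<n. a j * a k * (bw \<phi> j k / \<mu> k))"

text \<open>Adding the sum with \<open>j\<close> and \<open>k\<close> exchanged and using
  antisymmetry produces the factor 1 / mu_k - 1 / mu_j, that is (mu_j - mu_k) / (mu_j mu_k).
  Multiplied and divided by mu_j + mu_k it contains lambda_j - lambda_k, which
  \<open>bw_eq_Ew\<close> absorbs. No division by mu_j - mu_k occurs, so equal eigenvalues are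
  covered.\<close>

lemma Q_symmetrized:
  assumes \<phi>: "\<phi> \<in> test_functions \<Omega>"
  shows "2 * Q \<phi> n a = (\<Sum>j<n. \<Sum>k<n. a j * a k * Ew \<phi> j k / (\<mu> j * \<mu> k * (\<mu> j + \<mu> k)))"
proof -
  have e: "a j * a k * Ew \<phi> j k / (\<mu> j * \<mu> k * (\<mu> j + \<mu> k)) = a j * a k * (bw \<phi> j k / \<mu> k) + a k * a j * (bw \<phi> k j / \<mu> j)" for j k
  proof -
    have p: "\<mu> j > 0" "\<mu> k > 0" "\<mu> j + \<mu> k \<noteq> 0" using \<mu>_pos[of j] \<mu>_pos[of k] by auto
    have "Ew \<phi> j k = (\<mu> j + \<mu> k) * ((\<mu> j - \<mu> k) * bw \<phi> j k)"
    proof -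
      have "lam j - lam k = \<mu> j * \<mu> j - \<mu> k * \<mu> k"
        using \<mu>_square[of j] \<mu>_square[of k] by (simp add: power2_eq_square)
      also have "\<dots> = (\<mu> j + \<mu> k) * (\<mu> j - \<mu> k)" by (rule square_diff_square_factored)
      finally have "lam j - lam k = (\<mu> j + \<mu> k) * (\<mu> j - \<mu> k)" .
      then show ?thesis unfolding bw_eq_Ew[OF \<phi>, symmetric] by (simp only: mult.assoc)
    qed
    then have "Ew \<phi> j k / (\<mu> j * \<mu> k * (\<mu> j + \<mu> k)) = (\<mu> j - \<mu> k) * bw \<phi> j k / (\<mu> j * \<mu> k)"
      using p by simp
    also have "\<dots> = bw \<phi> j k / \<mu> k - bw \<phi> j k / \<mu> j"
      using p by (simp add: field_simps)
    also have "\<dots> = bw \<phi> j k / \<mu> k + bw \<phi> k j / \<mu> j"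
      using bw_antisym[OF \<phi>, of j k] by simp
    finally have "a j * a k * (Ew \<phi> j k / (\<mu> j * \<mu> k * (\<mu> j + \<mu> k))) = a j * a k * (bw \<phi> j k / \<mu> k + bw \<phi> k j / \<mu> j)"
      by simp
    then show ?thesis by (simp add: distrib_left mult_ac)
  qed
  have "(\<Sum>j<n. \<Sum>k<n. a k * a j * (bw \<phi> k j / \<mu> j)) = Q \<phi> n a"
    unfolding Q_def by (rule sum.swap)
  then show ?thesis unfolding e sum.distrib by (simp add: Q_def)
qed

text \<open>Writing \<open>1 / (\<mu>\<^sub>j + \<mu>\<^sub>k)\<close> as the integral of \<open>exp (- (\<mu>\<^sub>j + \<mu>\<^sub>k) z)\<close> over \<open>z > 0\<close> turns the symmetrized
  form into an integral of Euler forms of the harmonic extension \<open>exp (- z \<Lambda>) (\<Lambda>\<^sup>-\<^sup>1 \<theta>)\<close>, whose Dirichlet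
  energy over the half cylinder is the squared norm of \<open>\<theta>\<close> in \<open>D(\<Lambda>\<^sup>-\<^sup>1\<^sup>/\<^sup>2)\<close>.\<close>

lemma Q_bound:
  assumes \<phi>: "\<phi> \<in> test_functions \<Omega>"
    and B: "\<And>a b x. \<bar>pd (ex a) (pd (ex b) \<phi>) x\<bar> \<le> B" "B \<ge> 0"
  shows "\<bar>Q \<phi> n a\<bar> \<le> B * (\<Sum>j<n. (a j)\<^sup>2 / \<mu> j)"
proof -
  define c where "c z j = a j / \<mu> j * exp (- \<mu> j * z)" for z j
  let ?f = "\<lambda>z. \<Sum>j<n. \<Sum>k<n. c z j * c z k * Ew \<phi> j k"
  let ?g = "\<lambda>z. 4 * B * (\<Sum>j<n. lam j * (c z j)\<^sup>2)"
  have hi: "((\<lambda>z. C * exp (- m * z)) has_integral C / m) {0..}" if "m > 0" for C m :: real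
    using has_integral_mult_right[OF has_integral_exp_minus_to_infinity[OF that, of 0], of C] by simp
  have f: "(?f has_integral 2 * Q \<phi> n a) {0..}"
    unfolding Q_symmetrized[OF \<phi>]
  proof (intro has_integral_sum finite_lessThan)
    fix j k
    have p: "\<mu> j + \<mu> k > 0" using \<mu>_pos[of j] \<mu>_pos[of k] by auto
    have "((\<lambda>z. (a j * a k * Ew \<phi> j k / (\<mu> j * \<mu> k)) * exp (- (\<mu> j + \<mu> k) * z)) has_integral
        (a j * a k * Ew \<phi> j k / (\<mu> j * \<mu> k)) / (\<mu> j + \<mu> k)) {0..}"
      by (rule hi[OF p])
    moreover have "c z j * c z k * Ew \<phi> j k = (a j * a k * Ew \<phi> j k / (\<mu> j * \<mu> k)) * exp (- (\<mu> j + \<mu> k) * z)" for z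
      by (simp add: c_def distrib_right exp_diff exp_minus field_simps exp_add)
    ultimately show "((\<lambda>z. c z j * c z k * Ew \<phi> j k) has_integral a j * a k * Ew \<phi> j k / (\<mu> j * \<mu> k * (\<mu> j + \<mu> k))) {0..}"
      by simp
  qed
  have g: "(?g has_integral 4 * B * (\<Sum>j<n. (a j)\<^sup>2 / (2 * \<mu> j))) {0..}"
  proof (intro has_integral_mult_right has_integral_sum finite_lessThan)
    fix j
    have p: "2 * \<mu> j > 0" using \<mu>_pos[of j] by auto
    have "lam j * (c z j)\<^sup>2 = (a j)\<^sup>2 * exp (- (2 * \<mu> j) * z)" for z
    proof -
      have "lam j * (c z j)\<^sup>2 = (a j)\<^sup>2 * (exp (- \<mu> j * z))\<^sup>2"
        using \<mu>_pos[of j] by (simp add: c_def power_mult_distrib power_divide flip: \<mu>_square)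
      also have "(exp (- \<mu> j * z))\<^sup>2 = exp (- (2 * \<mu> j) * z)"
        by (simp add: exp_double[symmetric] mult.assoc)
      finally show ?thesis .
    qed
    then show "((\<lambda>z. lam j * (c z j)\<^sup>2) has_integral (a j)\<^sup>2 / (2 * \<mu> j)) {0..}"
      using hi[OF p, of "(a j)\<^sup>2"] by simp
  qed
  have le: "\<bar>?f z\<bar> \<le> ?g z" for z by (rule Ew_quadratic_bound[OF \<phi> B]) simp
  have "2 * Q \<phi> n a \<le> 4 * B * (\<Sum>j<n. (a j)\<^sup>2 / (2 * \<mu> j))"
    by (rule has_integral_le[OF f g]) (use le in \<open>auto simp: abs_le_iff\<close>)
  moreover have "- (2 * Q \<phi> n a) \<le> 4 * B * (\<Sum>j<n. (a j)\<^sup>2 / (2 * \<mu> j))"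
    by (rule has_integral_le[OF has_integral_neg[OF f] g]) (use le in \<open>auto simp: abs_le_iff\<close>)
  moreover have "4 * B * (\<Sum>j<n. (a j)\<^sup>2 / (2 * \<mu> j)) = 2 * (B * (\<Sum>j<n. (a j)\<^sup>2 / \<mu> j))"
    by (simp add: sum_distrib_left)
  ultimately show ?thesis by linarith
qed

text \<open>Polarisation, so that the bound on the quadratic form suffices. With d = a - b and s = a
  + b, the vectors \<open>x\<close> = d / t + t s and \<open>y\<close> = d / t - t s satisfy x x^T -
  y y^T = 4 (a a^T - b b^T). The parameter \<open>t\<close> serves to weigh a small difference
  against a merely bounded sum.\<close>

lemma Q_diff_bound:
  assumes \<phi>: "\<phi> \<in> test_functions \<Omega>"
    and B: "\<And>a b x. \<bar>pd (ex a) (pd (ex b) \<phi>) x\<bar> \<le> B" "B \<ge> 0" and t: "t > 0"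
  shows "\<bar>Q \<phi> n a - Q \<phi> n b\<bar> \<le> B / 2 * ((\<Sum>j<n. (a j - b j)\<^sup>2 / \<mu> j) / t\<^sup>2 + t\<^sup>2 * (\<Sum>j<n. (a j + b j)\<^sup>2 / \<mu> j))"
proof -
  define x y where "x j = (a j - b j) / t + t * (a j + b j)" and "y j = (a j - b j) / t - t * (a j + b j)" for j
  have "4 * (Q \<phi> n a - Q \<phi> n b) = Q \<phi> n x - Q \<phi> n y"
    unfolding Q_def sum_subtractf[symmetric] sum_distrib_left
  proof (intro sum.cong refl)
    fix j k
    have "x j * x k - y j * y k = 4 * (a j * a k - b j * b k)"
      using t by (simp add: x_def y_def field_simps)
    then have "(x j * x k - y j * y k) * (bw \<phi> j k / \<mu> k) = 4 * (a j * a k - b j * b k) * (bw \<phi> j k / \<mu> k)" by simp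
    then show "4 * (a j * a k * (bw \<phi> j k / \<mu> k) - b j * b k * (bw \<phi> j k / \<mu> k))
        = x j * x k * (bw \<phi> j k / \<mu> k) - y j * y k * (bw \<phi> j k / \<mu> k)"
      by (simp only: left_diff_distrib right_diff_distrib mult.assoc)
  qed
  then have "4 * \<bar>Q \<phi> n a - Q \<phi> n b\<bar> \<le> \<bar>Q \<phi> n x\<bar> + \<bar>Q \<phi> n y\<bar>" by linarith
  also have "\<dots> \<le> B * ((\<Sum>j<n. (x j)\<^sup>2 / \<mu> j) + (\<Sum>j<n. (y j)\<^sup>2 / \<mu> j))"
    unfolding distrib_left by (intro add_mono Q_bound[OF \<phi> B])
  also have "(\<Sum>j<n. (x j)\<^sup>2 / \<mu> j) + (\<Sum>j<n. (y j)\<^sup>2 / \<mu> j)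
      = 2 * ((\<Sum>j<n. (a j - b j)\<^sup>2 / \<mu> j) / t\<^sup>2 + t\<^sup>2 * (\<Sum>j<n. (a j + b j)\<^sup>2 / \<mu> j))"
    unfolding sum_distrib_left sum_divide_distrib sum.distrib[symmetric]
  proof (intro sum.cong refl)
    fix j
    have "(x j)\<^sup>2 + (y j)\<^sup>2 = 2 * ((a j - b j)\<^sup>2 / t\<^sup>2 + t\<^sup>2 * (a j + b j)\<^sup>2)"
      by (simp add: x_def y_def power2_sum power2_diff power_divide power_mult_distrib)
    then have "((x j)\<^sup>2 + (y j)\<^sup>2) / \<mu> j = 2 * ((a j - b j)\<^sup>2 / t\<^sup>2 + t\<^sup>2 * (a j + b j)\<^sup>2) / \<mu> j" by simp
    then show "(x j)\<^sup>2 / \<mu> j + (y j)\<^sup>2 / \<mu> j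
        = 2 * ((a j - b j)\<^sup>2 / \<mu> j / t\<^sup>2 + t\<^sup>2 * ((a j + b j)\<^sup>2 / \<mu> j))"
      by (simp add: add_divide_distrib distrib_left mult.commute divide_divide_eq_left)
  qed
  finally have *: "4 * \<bar>Q \<phi> n a - Q \<phi> n b\<bar>
      \<le> B * (2 * ((\<Sum>j<n. (a j - b j)\<^sup>2 / \<mu> j) / t\<^sup>2 + t\<^sup>2 * (\<Sum>j<n. (a j + b j)\<^sup>2 / \<mu> j)))" .
  have 4: "B * (2 * Y) = 4 * (B / 2 * Y)" for Y by simp
  show ?thesis using *[unfolded 4] by (rule mult_left_le_imp_le) simp
qed

section \<open>The Hamiltonian under coefficientwise convergence\<close>

definition Hn :: "(nat \<Rightarrow> real) \<Rightarrow> real" where "Hn a = (D_norm lam (- 1 / 2) a)\<^sup>2"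

text \<open>The exponent is left unevaluated, in the shape in which \<open>D_norm\<close> and
  \<open>Lam\<close> with index -1/2 unfold.\<close>

lemma powr_quarter: "(lam j powr (- 1 / 2 / 2) * x)\<^sup>2 = x\<^sup>2 / \<mu> j"
proof -
  have "(lam j powr (- 1 / 2 / 2))\<^sup>2 = lam j powr (- (1 / 2))" by (simp add: power2_eq_square flip: powr_add)
  also have "\<dots> = 1 / \<mu> j" using lam_pos[of j] by (simp add: powr_minus powr_half_sqrt \<mu>_def field_simps)
  finally show ?thesis by (simp add: power_mult_distrib)
qed

lemma Hn_sums:
  assumes "summable (\<lambda>j. (a j)\<^sup>2)"
  shows "(\<lambda>j. (a j)\<^sup>2 / \<mu> j) sums Hn a"
proof -
  have sm: "summable (\<lambda>j. (lam j powr (- 1 / 2 / 2) * a j)\<^sup>2)"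
    using summable_powr_negative(1)[of "- 1 / 2" a] assms by simp
  then have "Hn a = (\<Sum>j. (lam j powr (- 1 / 2 / 2) * a j)\<^sup>2)"
    unfolding Hn_def D_norm_def by (intro real_sqrt_pow2 suminf_nonneg) auto
  then have "Hn a = (\<Sum>j. (a j)\<^sup>2 / \<mu> j)" unfolding powr_quarter .
  with summable_sums[OF sm[unfolded powr_quarter]] show ?thesis by simp
qed

lemma Hn_le:
  assumes "summable (\<lambda>j. (a j)\<^sup>2)"
  shows "Hn a \<le> (\<Sum>j. (a j)\<^sup>2) / \<mu> 0"
proof -
  have "(\<lambda>j. (a j)\<^sup>2 / \<mu> 0) sums ((\<Sum>j. (a j)\<^sup>2) / \<mu> 0)" by (intro sums_divide summable_sums assms)
  moreover have "(a j)\<^sup>2 / \<mu> j \<le> (a j)\<^sup>2 / \<mu> 0" for j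
    using lam_ge_0[of j] \<mu>_pos[of 0] \<mu>_pos[of j] by (intro divide_left_mono) (auto simp: \<mu>_def)
  ultimately show ?thesis by (rule sums_le[OF _ Hn_sums[OF assms], rotated])
qed

lemma Hn_tendsto_0:
  assumes "\<And>n. summable (\<lambda>j. (a n j)\<^sup>2)" "\<And>n. (\<Sum>j. (a n j)\<^sup>2) \<le> C" "\<And>j. (\<lambda>n. a n j) \<longlonglongrightarrow> 0"
  shows "(\<lambda>n. Hn (a n)) \<longlonglongrightarrow> 0"
proof -
  have "(\<lambda>n. D_norm lam (- (1 / 2)) (a n)) \<longlonglongrightarrow> 0" by (rule D_norm_tendsto_0[OF _ assms]) auto
  then have "(\<lambda>n. (D_norm lam (- (1 / 2)) (a n))\<^sup>2) \<longlonglongrightarrow> 0\<^sup>2" by (rule tendsto_power)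
  then show ?thesis by (simp add: Hn_def)
qed

lemma summable_square_diff:
  fixes a b :: "nat \<Rightarrow> real"
  assumes "summable (\<lambda>j. (a j)\<^sup>2)" "summable (\<lambda>j. (b j)\<^sup>2)"
  shows "summable (\<lambda>j. (a j - b j)\<^sup>2)" "(\<Sum>j. (a j - b j)\<^sup>2) \<le> 2 * (\<Sum>j. (a j)\<^sup>2) + 2 * (\<Sum>j. (b j)\<^sup>2)"
    "summable (\<lambda>j. (a j + b j)\<^sup>2)" "(\<Sum>j. (a j + b j)\<^sup>2) \<le> 2 * (\<Sum>j. (a j)\<^sup>2) + 2 * (\<Sum>j. (b j)\<^sup>2)"
proof -
  have sm: "summable (\<lambda>j. 2 * (a j)\<^sup>2 + 2 * (b j)\<^sup>2)" by (intro summable_add summable_mult assms)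
  have eq: "(\<Sum>j. 2 * (a j)\<^sup>2 + 2 * (b j)\<^sup>2) = 2 * (\<Sum>j. (a j)\<^sup>2) + 2 * (\<Sum>j. (b j)\<^sup>2)"
    using assms by (subst suminf_add[symmetric]) (auto simp: suminf_mult intro: summable_mult)
  have 1: "(a j - b j)\<^sup>2 \<le> 2 * (a j)\<^sup>2 + 2 * (b j)\<^sup>2" "(a j + b j)\<^sup>2 \<le> 2 * (a j)\<^sup>2 + 2 * (b j)\<^sup>2" for j
    using zero_le_power2[of "a j + b j"] zero_le_power2[of "a j - b j"]
    unfolding power2_sum power2_diff by linarith+
  show s1: "summable (\<lambda>j. (a j - b j)\<^sup>2)" by (rule summable_comparison_test'[OF sm, of 0]) (use 1 in auto)
  show s2: "summable (\<lambda>j. (a j + b j)\<^sup>2)" by (rule summable_comparison_test'[OF sm, of 0]) (use 1 in auto)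
  show "(\<Sum>j. (a j - b j)\<^sup>2) \<le> 2 * (\<Sum>j. (a j)\<^sup>2) + 2 * (\<Sum>j. (b j)\<^sup>2)"
    using suminf_le[OF 1(1) s1 sm] eq by simp
  show "(\<Sum>j. (a j + b j)\<^sup>2) \<le> 2 * (\<Sum>j. (a j)\<^sup>2) + 2 * (\<Sum>j. (b j)\<^sup>2)"
    using suminf_le[OF 1(2) s2 sm] eq by simp
qed

definition stream :: "(real^2 \<Rightarrow> real) \<Rightarrow> real^2 \<Rightarrow> real" where "stream f = Lam \<Omega> w lam (- 1) f"

text \<open>The integral of f u . grad phi with u the perpendicular gradient (- d_2, d_1) of the
  stream function, written out in components.\<close>

definition NL :: "(real^2 \<Rightarrow> real) \<Rightarrow> (real^2 \<Rightarrow> real) \<Rightarrow> real" where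
  "NL f \<phi> = T f (weak_pderiv \<Omega> 1 (stream f)) (pd (ex 2) \<phi>) - T f (weak_pderiv \<Omega> 2 (stream f)) (pd (ex 1) \<phi>)"

text \<open>The inverse of Lambda gains exactly one derivative: the Dirichlet energy of the stream
  function has the terms lambda_j (f_j / mu_j)^2 = f_j^2, so it is finite for every \<open>f\<close>
  in L^2 and \<open>gradient_expansion\<close> applies.\<close>

lemma stream:
  assumes f: "f \<in> L2 \<Omega>"
  shows "stream f \<in> L2 \<Omega>" "cf (stream f) = (\<lambda>j. cf f j / \<mu> j)"
    "wd i (stream f) (weak_pderiv \<Omega> i (stream f))"
    "(\<lambda>N. nrm (\<lambda>x. (\<Sum>j<N. cf f j / \<mu> j * gw i j x) - weak_pderiv \<Omega> i (stream f) x)) \<longlonglongrightarrow> 0"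
proof -
  have half: "lam j powr (- 1 / 2) = 1 / \<mu> j" for j
    using lam_pos[of j] powr_minus[of "lam j" "1/2"] by (simp add: powr_half_sqrt \<mu>_def field_simps)
  have sm: "summable (\<lambda>j. (lam j powr (- 1 / 2) * cf f j)\<^sup>2)"
    by (rule summable_powr_negative(1)) (use summable_cf_square[OF f] in auto)
  show s: "stream f \<in> L2 \<Omega>" unfolding stream_def by (rule Lam(1)[OF sm])
  show c: "cf (stream f) = (\<lambda>j. cf f j / \<mu> j)" unfolding stream_def Lam(2)[OF sm] half by simp
  have "lam j * (cf f j / \<mu> j)\<^sup>2 = (cf f j)\<^sup>2" for j
    using \<mu>_pos[of j] by (simp add: power_divide flip: \<mu>_square)
  then have "summable (\<lambda>j. lam j * (cf f j / \<mu> j)\<^sup>2)" using summable_cf_square[OF f] by simp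
  from gradient_expansion[OF this s c]
  show "wd i (stream f) (weak_pderiv \<Omega> i (stream f))"
    "(\<lambda>N. nrm (\<lambda>x. (\<Sum>j<N. cf f j / \<mu> j * gw i j x) - weak_pderiv \<Omega> i (stream f) x)) \<longlonglongrightarrow> 0" by auto
qed

text \<open>Both truncations, of \<open>f\<close> and of the gradient of its stream function,
  converge strongly in L^2, and \<open>T\<close> is continuous in this sense. Bounds for
  \<open>NL\<close> thus follow from bounds for \<open>Q\<close> uniform in
  \<open>n\<close>.\<close>

lemma Q_tendsto_NL:
  assumes f: "f \<in> L2 \<Omega>" and \<phi>: "\<phi> \<in> test_functions \<Omega>"
  shows "(\<lambda>n. Q \<phi> n (cf f)) \<longlonglongrightarrow> NL f \<phi>"
proof -
  note d = test_functions_pd[OF \<phi> ex_Basis]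
  have e: "(\<lambda>N. nrm (\<lambda>x. (\<Sum>j<N. cf f j * w j x) - f x)) \<longlonglongrightarrow> 0"
    using expansion_tendsto[OF f] by (simp add: L2_norm_minus_commute)
  have t: "(\<lambda>n. T (\<lambda>x. \<Sum>j<n. cf f j * w j x) (\<lambda>x. \<Sum>k<n. cf f k / \<mu> k * gw i k x) \<psi>)
      \<longlonglongrightarrow> T f (weak_pderiv \<Omega> i (stream f)) \<psi>" if "\<psi> \<in> test_functions \<Omega>" for i \<psi>
    by (rule T_tendsto[OF wsum_L2 f e gsum_L2 wd_L2(2)[OF stream(3)[OF f]] stream(4)[OF f] that])
  have "Q \<phi> n (cf f) = T (\<lambda>x. \<Sum>j<n. cf f j * w j x) (\<lambda>x. \<Sum>k<n. cf f k / \<mu> k * gw 1 k x) (pd (ex 2) \<phi>)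
      - T (\<lambda>x. \<Sum>j<n. cf f j * w j x) (\<lambda>x. \<Sum>k<n. cf f k / \<mu> k * gw 2 k x) (pd (ex 1) \<phi>)" for n
  proof -
    have "T (\<lambda>x. \<Sum>j<n. cf f j * w j x) (\<lambda>x. \<Sum>k<n. cf f k / \<mu> k * gw i k x) \<psi>
        = (\<Sum>j<n. \<Sum>k<n. cf f j * (cf f k / \<mu> k) * T (w j) (gw i k) \<psi>)" if "\<psi> \<in> test_functions \<Omega>" for i \<psi>
      by (rule T_sum) (use that in auto)
    note this[OF d]
    then show ?thesis
      by (simp add: Q_def bw_def sum_subtractf[symmetric] right_diff_distrib diff_divide_distrib)
  qed
  then show ?thesis unfolding NL_def using tendsto_diff[OF t[OF d] t[OF d]] by simp
qed

lemma second_derivatives_bounded: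
  assumes \<phi>: "\<phi> \<in> test_functions \<Omega>"
  obtains B where "B \<ge> 0" "\<And>a b x. \<bar>pd (ex a) (pd (ex b) \<phi>) x\<bar> \<le> B"
proof -
  have ex: "\<exists>B. B \<ge> 0 \<and> (\<forall>x. \<bar>pd (ex a) (pd (ex b) \<phi>) x\<bar> \<le> B)" for a b :: 2
    by (rule test_functions_bounded[OF test_functions_pd[OF test_functions_pd[OF \<phi> ex_Basis[of b]] ex_Basis[of a]]]) blast
  define C where "C a b = (SOME B. B \<ge> 0 \<and> (\<forall>x. \<bar>pd (ex a) (pd (ex b) \<phi>) x\<bar> \<le> B))" for a b
  have "C a b \<ge> 0 \<and> (\<forall>x. \<bar>pd (ex a) (pd (ex b) \<phi>) x\<bar> \<le> C a b)" for a b
    unfolding C_def by (rule someI_ex[OF ex])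
  then have C: "\<And>a b. C a b \<ge> 0" "\<And>a b x. \<bar>pd (ex a) (pd (ex b) \<phi>) x\<bar> \<le> C a b" by auto
  show thesis
  proof (rule that[of "\<Sum>a\<in>UNIV. \<Sum>b\<in>UNIV. C a b"])
    show "0 \<le> (\<Sum>a\<in>UNIV. \<Sum>b\<in>UNIV. C a b)" by (intro sum_nonneg C)
    fix a b x
    have "C a b \<le> (\<Sum>b\<in>UNIV. C a b)" by (rule member_le_sum) (auto simp: C)
    also have "\<dots> \<le> (\<Sum>a\<in>UNIV. \<Sum>b\<in>UNIV. C a b)"
      by (rule member_le_sum[of a UNIV "\<lambda>a. \<Sum>b\<in>UNIV. C a b"]) (auto intro: sum_nonneg C)
    finally show "\<bar>pd (ex a) (pd (ex b) \<phi>) x\<bar> \<le> (\<Sum>a\<in>UNIV. \<Sum>b\<in>UNIV. C a b)" using C(2) order_trans by blast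
  qed
qed

lemma NL_bound:
  assumes f: "f \<in> L2 \<Omega>" and \<phi>: "\<phi> \<in> test_functions \<Omega>"
    and B: "\<And>a b x. \<bar>pd (ex a) (pd (ex b) \<phi>) x\<bar> \<le> B" "B \<ge> 0"
  shows "\<bar>NL f \<phi>\<bar> \<le> B * ((nrm f)\<^sup>2 / \<mu> 0)"
proof -
  note sm = summable_cf_square[OF f]
  have "\<bar>Q \<phi> n (cf f)\<bar> \<le> B * ((nrm f)\<^sup>2 / \<mu> 0)" for n
  proof -
    have "(\<Sum>j<n. (cf f j)\<^sup>2 / \<mu> j) \<le> (\<Sum>j. (cf f j)\<^sup>2 / \<mu> j)"
      by (rule sum_le_suminf) (use Hn_sums[OF sm] \<mu>_pos in \<open>auto intro: sums_summable divide_nonneg_pos\<close>)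
    also have "\<dots> \<le> (nrm f)\<^sup>2 / \<mu> 0"
      using Hn_le[OF sm] Hn_sums[OF sm] Parseval_square[OF f] by (simp add: sums_iff)
    finally show ?thesis using Q_bound[OF \<phi> B, of n "cf f"] mult_left_mono[OF _ B(2)] by (meson order_trans)
  qed
  then show ?thesis
    by (intro LIMSEQ_le_const2[OF tendsto_rabs[OF Q_tendsto_NL[OF f \<phi>]]]) auto
qed

lemma NL_diff_bound:
  assumes f: "f \<in> L2 \<Omega>" and g: "g \<in> L2 \<Omega>" and \<phi>: "\<phi> \<in> test_functions \<Omega>"
    and B: "\<And>a b x. \<bar>pd (ex a) (pd (ex b) \<phi>) x\<bar> \<le> B" "B \<ge> 0" and t: "t > 0"
  shows "\<bar>NL f \<phi> - NL g \<phi>\<bar> \<le> B / 2 * (Hn (\<lambda>j. cf f j - cf g j) / t\<^sup>2 + t\<^sup>2 * Hn (\<lambda>j. cf f j + cf g j))"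
proof (rule LIMSEQ_le)
  note sm = summable_square_diff[OF summable_cf_square[OF f] summable_cf_square[OF g]]
  show "(\<lambda>n. \<bar>Q \<phi> n (cf f) - Q \<phi> n (cf g)\<bar>) \<longlonglongrightarrow> \<bar>NL f \<phi> - NL g \<phi>\<bar>"
    by (intro tendsto_intros Q_tendsto_NL f g \<phi>)
  have "(\<lambda>n. \<Sum>j<n. (cf f j - cf g j)\<^sup>2 / \<mu> j) \<longlonglongrightarrow> Hn (\<lambda>j. cf f j - cf g j)"
    "(\<lambda>n. \<Sum>j<n. (cf f j + cf g j)\<^sup>2 / \<mu> j) \<longlonglongrightarrow> Hn (\<lambda>j. cf f j + cf g j)"
    using Hn_sums[OF sm(1)] Hn_sums[OF sm(3)] by (auto simp: sums_def)
  then show "(\<lambda>n. B / 2 * ((\<Sum>j<n. (cf f j - cf g j)\<^sup>2 / \<mu> j) / t\<^sup>2 + t\<^sup>2 * (\<Sum>j<n. (cf f j + cf g j)\<^sup>2 / \<mu> j)))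
      \<longlonglongrightarrow> B / 2 * (Hn (\<lambda>j. cf f j - cf g j) / t\<^sup>2 + t\<^sup>2 * Hn (\<lambda>j. cf f j + cf g j))"
    using t by (intro tendsto_intros) auto
  show "\<exists>N. \<forall>n\<ge>N. \<bar>Q \<phi> n (cf f) - Q \<phi> n (cf g)\<bar>
      \<le> B / 2 * ((\<Sum>j<n. (cf f j - cf g j)\<^sup>2 / \<mu> j) / t\<^sup>2 + t\<^sup>2 * (\<Sum>j<n. (cf f j + cf g j)\<^sup>2 / \<mu> j))"
    using Q_diff_bound[OF \<phi> B t] by blast
qed

lemma Hn_cf_diff_tendsto:
  assumes f: "\<And>n. f n \<in> L2 \<Omega>" "\<And>n. nrm (f n) \<le> C" and g: "g \<in> L2 \<Omega>"
    and lim: "\<And>j. (\<lambda>n. cf (f n) j) \<longlonglongrightarrow> cf g j"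
  shows "(\<lambda>n. Hn (\<lambda>j. cf (f n) j - cf g j)) \<longlonglongrightarrow> 0"
proof (rule Hn_tendsto_0)
  note sm = summable_square_diff[OF summable_cf_square[OF f(1)] summable_cf_square[OF g]]
  show "summable (\<lambda>j. (cf (f n) j - cf g j)\<^sup>2)" for n by (rule sm)
  have bd: "2 * (\<Sum>j. (cf (f n) j)\<^sup>2) + 2 * (\<Sum>j. (cf g j)\<^sup>2) \<le> 2 * C\<^sup>2 + 2 * (nrm g)\<^sup>2" for n
    using Parseval_square[OF f(1)[of n]] Parseval_square[OF g] power_mono[OF f(2)[of n], of 2]
    by (simp add: sums_iff)
  show "(\<Sum>j. (cf (f n) j - cf g j)\<^sup>2) \<le> 2 * C\<^sup>2 + 2 * (nrm g)\<^sup>2" for n by (rule order_trans[OF sm(2) bd])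
  show "(\<lambda>n. cf (f n) j - cf g j) \<longlonglongrightarrow> 0" for j using lim[of j] by (simp add: LIM_zero_iff)
qed

text \<open>The quadratic term is continuous along bounded sequences that converge only weakly: the
  difference tends to zero in D(Lambda^(-1/2)) by compactness, while the sum stays bounded
  there.\<close>

lemma NL_tendsto:
  assumes f: "\<And>n. f n \<in> L2 \<Omega>" "\<And>n. nrm (f n) \<le> C" and g: "g \<in> L2 \<Omega>"
    and lim: "\<And>j. (\<lambda>n. cf (f n) j) \<longlonglongrightarrow> cf g j" and \<phi>: "\<phi> \<in> test_functions \<Omega>"
  shows "(\<lambda>n. NL (f n) \<phi>) \<longlonglongrightarrow> NL g \<phi>"
proof -
  obtain B where B: "B \<ge> 0" "\<And>a b x. \<bar>pd (ex a) (pd (ex b) \<phi>) x\<bar> \<le> B"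
    using second_derivatives_bounded[OF \<phi>] by blast
  note sm = summable_square_diff[OF summable_cf_square[OF f(1)] summable_cf_square[OF g]]
  define K where "K = 2 * C\<^sup>2 + 2 * (nrm g)\<^sup>2"
  have K: "2 * (\<Sum>j. (cf (f n) j)\<^sup>2) + 2 * (\<Sum>j. (cf g j)\<^sup>2) \<le> K" for n
    using Parseval_square[OF f(1)[of n]] Parseval_square[OF g] power_mono[OF f(2)[of n], of 2]
    by (simp add: K_def sums_iff)
  note H0 = Hn_cf_diff_tendsto[OF f g lim]
  have Hs: "Hn (\<lambda>j. cf (f n) j + cf g j) \<le> K / \<mu> 0" for n
  proof -
    have "(\<Sum>j. (cf (f n) j + cf g j)\<^sup>2) / \<mu> 0 \<le> K / \<mu> 0"
      using order_trans[OF sm(4) K] \<mu>_pos[of 0] by (simp add: divide_right_mono)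
    then show ?thesis using Hn_le[OF sm(3)] order_trans by blast
  qed
  have K0: "K \<ge> 0" by (simp add: K_def)
  have "(\<lambda>n. NL (f n) \<phi> - NL g \<phi>) \<longlonglongrightarrow> 0"
  proof (rule LIMSEQ_I)
    fix e :: real assume e: "e > 0"
    define L where "L = B / 2 * (K / \<mu> 0)"
    have L: "L \<ge> 0" using B(1) K0 \<mu>_pos[of 0] by (simp add: L_def)
    \<comment> \<open>Chosen first, so that the term with the bounded sum stays below e/2 for all
      \<open>n\<close>; with \<open>t\<close> fixed, the term with the difference then tends to
      zero.\<close>
    define t where "t = sqrt (e / (2 * (L + 1)))"
    have t: "t > 0" "t\<^sup>2 = e / (2 * (L + 1))" using e L by (auto simp: t_def)
    have tL: "t\<^sup>2 * L < e / 2" using e L by (simp add: t field_simps)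
    have "(\<lambda>n. B / 2 * (Hn (\<lambda>j. cf (f n) j - cf g j) / t\<^sup>2)) \<longlonglongrightarrow> B / 2 * (0 / t\<^sup>2)"
      using t by (intro tendsto_intros H0) auto
    then have "\<forall>\<^sub>F n in sequentially. B / 2 * (Hn (\<lambda>j. cf (f n) j - cf g j) / t\<^sup>2) < e / 2"
      using e by (intro order_tendstoD(2)) auto
    then obtain N where N: "\<And>n. n \<ge> N \<Longrightarrow> B / 2 * (Hn (\<lambda>j. cf (f n) j - cf g j) / t\<^sup>2) < e / 2"
      by (auto simp: eventually_sequentially)
    have "\<bar>NL (f n) \<phi> - NL g \<phi>\<bar> < e" if "n \<ge> N" for n
    proof -
      have "\<bar>NL (f n) \<phi> - NL g \<phi>\<bar> \<le> B / 2 * (Hn (\<lambda>j. cf (f n) j - cf g j) / t\<^sup>2) + t\<^sup>2 * (B / 2 * Hn (\<lambda>j. cf (f n) j + cf g j))"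
        using NL_diff_bound[OF f(1)[of n] g \<phi> B(2,1) t(1)] by (simp add: algebra_simps)
      also have "t\<^sup>2 * (B / 2 * Hn (\<lambda>j. cf (f n) j + cf g j)) \<le> t\<^sup>2 * L"
        unfolding L_def using B(1) by (intro mult_left_mono Hs) auto
      finally show ?thesis using N[OF that] tL by linarith
    qed
    then show "\<exists>N. \<forall>n\<ge>N. norm (NL (f n) \<phi> - NL g \<phi> - 0) < e" by auto
  qed
  then show ?thesis by (simp add: LIM_zero_iff)
qed

end

section \<open>Weak formulations in time\<close>

text \<open>An interval of positive length cannot lie in a null set. It supplies times at which an
  almost everywhere valid balance holds, arbitrarily close to a given time.\<close>

lemma AE_interval_witness:
  fixes a b :: real
  assumes "AE t in lebesgue_on S. P t" "S \<in> sets lebesgue" "{a<..<b} \<subseteq> S" "a < b"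
  obtains t where "t \<in> {a<..<b}" "P t"
proof (rule ccontr)
  assume "\<not> thesis"
  then have n: "\<not> P t" if "t \<in> {a<..<b}" for t using that \<open>\<And>t. t \<in> {a<..<b} \<Longrightarrow> P t \<Longrightarrow> thesis\<close> by blast
  have "AE t in lebesgue. t \<in> S \<longrightarrow> P t"
    using assms(1,2) by (simp add: AE_restrict_space_iff)
  then have "AE t in lebesgue. t \<notin> {a<..<b}"
    by eventually_elim (use n assms(3) in auto)
  then have "emeasure lebesgue {a<..<b} = 0"
    by (subst (asm) AE_iff_measurable[of "{a<..<b}"]) auto
  then show False using assms(4) by simp
qed

text \<open>Passes from the Lebesgue integrals of the weak formulation to integrals over a compact
  interval, which can be split at interior points.\<close>

lemma integral_lebesgue_on_compact_support:
  fixes F :: "real \<Rightarrow> real"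
  assumes F: "continuous_on {c..e} F" "\<And>t. t \<in> S \<Longrightarrow> t \<notin> {c..e} \<Longrightarrow> F t = 0" and S: "{c..e} \<subseteq> S" "S \<in> sets lebesgue"
  shows "integrable (lebesgue_on S) F" "(LINT t|lebesgue_on S. F t) = integral {c..e} F"
proof -
  have eq: "(\<lambda>t. indicator S t *\<^sub>R F t) = (\<lambda>t. indicator {c..e} t *\<^sub>R F t)"
    using F(2) S(1) by (intro ext) (auto simp: indicator_def)
  have i: "integrable (lebesgue_on {c..e}) F" by (rule continuous_imp_integrable_real[OF F(1)])
  then have "integrable lebesgue (\<lambda>t. indicator {c..e} t *\<^sub>R F t)" by (subst (asm) integrable_restrict_space) auto
  then show "integrable (lebesgue_on S) F" unfolding eq[symmetric] using S(2) by (subst integrable_restrict_space) auto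
  have "(LINT t|lebesgue_on S. F t) = (LINT t|lebesgue. indicator S t *\<^sub>R F t)"
    by (rule integral_restrict_space) (use S(2) in simp)
  also have "\<dots> = (LINT t|lebesgue_on {c..e}. F t)"
    unfolding eq by (rule integral_restrict_space[symmetric]) simp
  also have "\<dots> = integral {c..e} F" by (rule lebesgue_integral_eq_integral[OF i]) simp
  finally show "(LINT t|lebesgue_on S. F t) = integral {c..e} F" .
qed

lemma integral_abs_le_const:
  fixes f :: "real \<Rightarrow> real"
  assumes "continuous_on {c..e} f" "\<And>t. t \<in> {c..e} \<Longrightarrow> \<bar>f t\<bar> \<le> M" "c \<le> e"
  shows "\<bar>integral {c..e} f\<bar> \<le> M * (e - c)"
  using integral_bound[OF assms(3,1), of M] assms(2) by simp

lemma test_functions_real_deriv: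
  fixes \<phi> :: "real \<Rightarrow> real"
  assumes "smooth_on UNIV \<rho>" "\<And>t. (\<phi> has_real_derivative \<rho> t) (at t)"
  shows "smooth_on UNIV \<phi>" "deriv \<phi> = \<rho>"
proof -
  have D: "(\<phi> has_derivative (\<lambda>h. \<rho> t * h)) (at t)" for t
    using assms(2)[of t] by (simp add: has_field_derivative_def)
  have "pd 1 \<phi> = \<rho>" using has_derivative_imp_pd[OF D] by (intro ext) simp
  then show "smooth_on UNIV \<phi>"
    using D assms(1) by (subst smooth_on_UNIV_iff) (auto simp: differentiable_def)
  show "deriv \<phi> = \<rho>" using DERIV_imp_deriv[OF assms(2)] by (intro ext)
qed

context dirichlet
begin

text \<open>Restricting a planar test function to a line through a point where it does not vanish
  gives a nonzero test function of one variable, the input of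
  \<open>mollifier_exists\<close>.\<close>

lemma real_mollifier:
  assumes "d > 0"
  obtains \<rho> where "\<rho> \<in> test_functions (ball (0::real) d)" "\<And>t. \<rho> t \<ge> 0" "(LINT t|lborel. \<rho> t) = 1"
proof -
  obtain \<eta> x where \<eta>: "\<eta> \<in> test_functions \<Omega>" "\<eta> x \<noteq> 0" using test_function_nonzero by auto
  obtain K where K: "compact K" "K \<subseteq> \<Omega>" "\<And>x. x \<notin> K \<Longrightarrow> \<eta> x = 0" using test_functionsE[OF \<eta>(1)] by blast
  obtain R where R: "\<And>y. y \<in> K \<Longrightarrow> norm y \<le> R"
    using compact_imp_bounded[OF K(1)] unfolding bounded_iff by auto
  let ?f = "\<lambda>t::real. \<eta> (x + t *\<^sub>R ex 1)"
  have "smooth_on UNIV ?f"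
    by (rule smooth_on_affine[OF test_functions_smooth[OF \<eta>(1)], of "\<lambda>t. t *\<^sub>R ex 1" x])
       (auto simp: linear_iff algebra_simps intro!: exI[of _ 1] bexI[of _ "ex 1"])
  moreover have "?f t = 0" if "t \<notin> cball 0 (R + norm x)" for t
  proof -
    have "norm (t *\<^sub>R ex 1) \<le> norm (x + t *\<^sub>R ex 1) + norm x"
      using norm_triangle_ineq4[of "x + t *\<^sub>R ex 1" x] by simp
    then have "x + t *\<^sub>R ex 1 \<notin> K" using R[of "x + t *\<^sub>R ex 1"] that by auto
    then show ?thesis by (rule K(3))
  qed
  ultimately have f: "?f \<in> test_functions UNIV"
    unfolding test_functions_def by (auto intro!: exI[of _ "cball 0 (R + norm x)"])
  show thesis
    by (rule mollifier_exists[OF f _ assms, of 0]) (use \<eta>(2) that in auto)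
qed

text \<open>A smoothed indicator of the interval from \<open>a\<close> to \<open>b\<close>: with
  \<open>F\<close> a primitive of the bump \<open>\<rho>\<close>, constant on both sides of the bump
  and rising by 1, take F(t - a) - F(t - b). Its derivative is one unit bump at \<open>a\<close>
  minus one at \<open>b\<close>.\<close>

lemma time_cutoff:
  assumes d: "d > 0" "a + d \<le> b - d"
  obtains \<phi> \<rho> :: "real \<Rightarrow> real" where
    "smooth_on UNIV \<phi>" "deriv \<phi> = (\<lambda>t. \<rho> (t - a) - \<rho> (t - b))"
    "\<And>t. \<phi> t \<ge> 0" "\<And>t. \<phi> t \<le> 1" "\<And>t. t \<notin> {a-d..b+d} \<Longrightarrow> \<phi> t = 0" "\<And>t. t \<in> {a+d..b-d} \<Longrightarrow> \<phi> t = 1"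
    "smooth_on UNIV \<rho>" "\<And>t. \<rho> t \<ge> 0" "\<And>t. t \<notin> {-d..d} \<Longrightarrow> \<rho> t = 0" "(\<rho> has_integral 1) {-d..d}"
proof -
  obtain \<rho> where \<rho>: "\<rho> \<in> test_functions (ball (0::real) d)" "\<And>t. \<rho> t \<ge> 0" "(LINT t|lborel. \<rho> t) = 1"
    using real_mollifier[OF d(1)] by blast
  note s = test_functions_smooth[OF \<rho>(1)]
  have c: "continuous_on A \<rho>" for A by (rule smooth_on_continuous[OF s])
  have z: "\<rho> t = 0" if "t \<notin> {-d..d}" for t
    by (rule test_functions_eq_0[OF \<rho>(1)]) (use that in \<open>auto simp: dist_real_def\<close>)
  have "integrable (lebesgue_on {-d..d}) \<rho>" by (rule continuous_imp_integrable_real[OF c])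
  then have "(\<rho> has_integral (LINT t|lebesgue_on {-d..d}. \<rho> t)) {-d..d}"
    by (rule has_integral_integral_lebesgue_on) simp
  also have "(LINT t|lebesgue_on {-d..d}. \<rho> t) = (LINT t|lebesgue. indicator {-d..d} t *\<^sub>R \<rho> t)"
    by (rule integral_restrict_space) simp
  also have "(\<lambda>t. indicator {-d..d} t *\<^sub>R \<rho> t) = \<rho>" using z by (intro ext) (auto simp: indicator_def)
  also have "(LINT t|lebesgue. \<rho> t) = 1"
    using \<rho>(3) test_functions_borel[OF \<rho>(1)] by (subst integral_completion) auto
  finally have int1: "(\<rho> has_integral 1) {-d..d}" .
  have "\<exists>F. \<forall>x :: real. - \<infinity> < ereal x \<longrightarrow> ereal x < \<infinity> \<longrightarrow> (F has_vector_derivative \<rho> x) (at x)"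
    by (rule einterval_antiderivative) (use c[of UNIV] in \<open>auto simp: continuous_on_eq_continuous_at\<close>)
  then obtain F where "\<And>x. (F has_vector_derivative \<rho> x) (at x)" by auto
  then have F: "(F has_real_derivative \<rho> t) (at t)" for t
    by (simp add: has_real_derivative_iff_has_vector_derivative)
  have mono: "F x \<le> F y" if "x \<le> y" for x y
    by (rule DERIV_nonneg_imp_nondecreasing[OF that]) (use F \<rho>(2) in blast)
  have "(\<rho> has_integral (F d - F (- d))) {-d..d}"
    by (rule fundamental_theorem_of_calculus)
       (use d F in \<open>auto simp: has_real_derivative_iff_has_vector_derivative[symmetric] intro: has_field_derivative_at_within\<close>)
  from has_integral_unique[OF this int1] have F1: "F d = F (- d) + 1" by simp
  have cst: "F x = F y" if "x \<le> y" "\<And>t. t \<in> {x<..<y} \<Longrightarrow> t \<notin> {-d..d}" for x y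
  proof (cases "x = y")
    case False
    then have "x < y" using that(1) by simp
    have "continuous_on {x..y} F"
      using F by (auto intro!: continuous_at_imp_continuous_on DERIV_isCont)
    moreover have "(F has_real_derivative 0) (at t)" if "x < t" "t < y" for t
      using F[of t] z[of t] \<open>\<And>t. t \<in> {x<..<y} \<Longrightarrow> t \<notin> {-d..d}\<close>[of t] that by simp
    ultimately have "F y = F x" by (rule DERIV_isconst_end[OF \<open>x < y\<close>])
    then show ?thesis by simp
  qed simp
  have lo: "F t = F (- d)" if "t \<le> - d" for t by (rule cst[OF that]) auto
  have hi: "F t = F d" if "t \<ge> d" for t by (rule cst[OF that, symmetric]) auto
  let ?\<phi> = "\<lambda>t. F (t - a) - F (t - b)"
  have D: "(?\<phi> has_real_derivative \<rho> (t - a) - \<rho> (t - b)) (at t)" for t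
  proof -
    have "((\<lambda>t. F (t - c)) has_real_derivative \<rho> (t - c) * 1) (at t)" for c
      by (rule DERIV_chain2[OF F]) (auto intro!: derivative_eq_intros)
    from DERIV_diff[OF this[of a] this[of b]] show ?thesis by simp
  qed
  have sr: "smooth_on UNIV (\<lambda>t. \<rho> (t - a) - \<rho> (t - b))"
    using smooth_on_diff[OF smooth_on_translate[OF s, of "-a"] smooth_on_translate[OF s, of "-b"]] by simp
  have ab: "a < b" using d by simp
  show thesis
  proof (rule that[of ?\<phi> \<rho>])
    show "smooth_on UNIV ?\<phi>" "deriv ?\<phi> = (\<lambda>t. \<rho> (t - a) - \<rho> (t - b))"
      using test_functions_real_deriv[OF sr D] by auto
    show "?\<phi> t \<ge> 0" for t using mono[of "t - b" "t - a"] ab by simp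
    show "?\<phi> t \<le> 1" for t
    proof -
      have "F (t - a) \<le> F d" using mono[of "t - a" d] hi[of "t - a"] by linarith
      moreover have "F (- d) \<le> F (t - b)" using mono[of "- d" "t - b"] lo[of "t - b"] by linarith
      ultimately show ?thesis using F1 by linarith
    qed
    show "?\<phi> t = 0" if "t \<notin> {a-d..b+d}" for t
    proof (cases "t < a - d")
      case True
      then show ?thesis using lo[of "t - a"] lo[of "t - b"] ab by simp
    next
      case False
      then show ?thesis using hi[of "t - a"] hi[of "t - b"] ab that by simp
    qed
    show "?\<phi> t = 1" if "t \<in> {a+d..b-d}" for t
      using hi[of "t - a"] lo[of "t - b"] F1 that by simp
  qed (use s \<rho>(2) z int1 in auto)
qed

lemma mollifier_average:
  fixes f \<rho> :: "real \<Rightarrow> real"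
  assumes f: "continuous_on {a-d..a+d} f" and \<rho>: "continuous_on UNIV \<rho>" "\<And>t. \<rho> t \<ge> 0" "(\<rho> has_integral 1) {-d..d}"
    and e: "\<And>t. t \<in> {a-d..a+d} \<Longrightarrow> \<bar>f t - f a\<bar> \<le> e"
  shows "\<bar>integral {a-d..a+d} (\<lambda>t. f t * \<rho> (t - a)) - f a\<bar> \<le> e"
proof -
  have c: "continuous_on A (\<lambda>t. \<rho> (t - a))" for A
    by (rule continuous_on_compose2[OF \<rho>(1)]) (auto intro: continuous_intros)
  have "(\<rho> has_integral 1) (cbox (-d) d)" using \<rho>(3) by simp
  from has_integral_affinity[OF this, of 1 "- a"]
  have "((\<lambda>t. \<rho> (t - a)) has_integral 1) ((\<lambda>x. x + a) ` cbox (-d) d)" by simp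
  moreover have "(\<lambda>x. x + a) ` cbox (-d) d = {a-d..a+d}" by (auto simp: image_iff intro!: bexI[of _ "_ - a"])
  ultimately have 1: "((\<lambda>t. \<rho> (t - a)) has_integral 1) {a-d..a+d}" by (simp only:)
  have "integral {a-d..a+d} (\<lambda>t. f t * \<rho> (t - a)) - f a = integral {a-d..a+d} (\<lambda>t. (f t - f a) * \<rho> (t - a))"
  proof -
    have "((\<lambda>t. f t * \<rho> (t - a) - f a * \<rho> (t - a)) has_integral
        (integral {a-d..a+d} (\<lambda>t. f t * \<rho> (t - a)) - f a * 1)) {a-d..a+d}"
      by (intro has_integral_diff has_integral_mult_right 1 integrable_integral integrable_continuous_real
          continuous_intros f c)
    then show ?thesis by (simp add: left_diff_distrib integral_unique)
  qed
  also have "\<bar>\<dots>\<bar> \<le> integral {a-d..a+d} (\<lambda>t. e * \<rho> (t - a))"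
    unfolding real_norm_def[symmetric]
  proof (rule Henstock_Kurzweil_Integration.integral_norm_bound_integral)
    show "norm ((f t - f a) * \<rho> (t - a)) \<le> e * \<rho> (t - a)" if "t \<in> {a-d..a+d}" for t
      using e[OF that] \<rho>(2)[of "t - a"] by (simp add: abs_mult mult_right_mono)
  qed (intro integrable_continuous_real continuous_intros f c)+
  also have "\<dots> = e" using integral_unique[OF has_integral_mult_right[OF 1, of e]] by simp
  finally show ?thesis .
qed

text \<open>Testing with the cutoffs of \<open>time_cutoff\<close> produces averages of
  \<open>f\<close> near \<open>a\<close> and \<open>b\<close>, and the integral of \<open>h\<close>
  up to short transition layers. The viscous term is to enter only as an error of size
  \<open>K\<close>; hence the assumption is an inequality, for nonnegative test functions.\<close>

lemma weak_time_integral: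
  fixes f h :: "real \<Rightarrow> real"
  assumes f: "continuous_on {0..} f" and h: "continuous_on {0..} h"
    and weak: "\<And>\<phi>. \<phi> \<in> test_functions {0<..} \<Longrightarrow> (\<And>t. \<phi> t \<ge> 0) \<Longrightarrow>
      \<bar>(LINT t|lebesgue_on {0<..}. f t * deriv \<phi> t) + (LINT t|lebesgue_on {0<..}. h t * \<phi> t)\<bar>
        \<le> K * (LINT t|lebesgue_on {0<..}. \<phi> t)"
    and K: "K \<ge> 0" and ab: "0 < a" "a < b"
  shows "\<bar>f b - f a - integral {a..b} h\<bar> \<le> K * (b - a)"
proof (rule field_le_epsilon)
  fix \<epsilon> :: real assume \<epsilon>: "\<epsilon> > 0"
  have cpt: "compact (h ` {0..b+1})"
    by (intro compact_continuous_image compact_Icc continuous_on_subset[OF h]) auto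
  obtain M where M: "\<And>t. t \<in> {0..b+1} \<Longrightarrow> \<bar>h t\<bar> \<le> M" "M \<ge> 0"
  proof -
    obtain M where M: "\<forall>y\<in>h ` {0..b+1}. norm y \<le> M"
      using compact_imp_bounded[OF cpt] unfolding bounded_iff by blast
    have "\<bar>h t\<bar> \<le> max M 0" if "t \<in> {0..b+1}" for t
      using M[rule_format, OF imageI[OF that]] by simp
    then show thesis by (intro that[of "max M 0"]) auto
  qed
  have near: "\<exists>\<delta>>0. \<forall>t\<ge>0. \<bar>t - c\<bar> < \<delta> \<longrightarrow> \<bar>f t - f c\<bar> < \<epsilon> / 4" if "c > 0" for c
    using f[unfolded continuous_on_iff, rule_format, of c "\<epsilon> / 4"] \<epsilon> that by (auto simp: dist_real_def)
  obtain \<delta>1 \<delta>2 where \<delta>: "\<delta>1 > 0" "\<And>t. t \<ge> 0 \<Longrightarrow> \<bar>t - a\<bar> < \<delta>1 \<Longrightarrow> \<bar>f t - f a\<bar> < \<epsilon> / 4"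
    "\<delta>2 > 0" "\<And>t. t \<ge> 0 \<Longrightarrow> \<bar>t - b\<bar> < \<delta>2 \<Longrightarrow> \<bar>f t - f b\<bar> < \<epsilon> / 4"
    using near[of a] near[of b] ab by auto
  \<comment> \<open>The first two entries control the oscillation of \<open>f\<close> at
    \<open>a\<close> and \<open>b\<close>; \<open>a / 2\<close> keeps the support in positive times;
    \<open>(b - a) / 2\<close> separates the two bumps; 1 keeps everything where \<open>M\<close>
    bounds \<open>h\<close>; the last makes the remaining error \<open>d * (6 * M + 2 * K)\<close>
    at most half of \<open>\<epsilon>\<close>.\<close>
  define d where "d = Min {\<delta>1 / 2, \<delta>2 / 2, a / 2, (b - a) / 2, 1, \<epsilon> / (4 * (3 * M + K + 1))}"
  have MK: "3 * M + K + 1 > 0" using M(2) K by linarith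
  have d0: "d > 0" unfolding d_def using \<delta> ab \<epsilon> MK by (subst Min_gr_iff) auto
  have dle: "d \<le> \<delta>1 / 2" "d \<le> \<delta>2 / 2" "d \<le> a / 2" "d \<le> (b - a) / 2" "d \<le> 1" "d \<le> \<epsilon> / (4 * (3 * M + K + 1))"
    unfolding d_def by (rule Min_le, simp, simp)+
  have dMK: "d * (6 * M + 2 * K) \<le> \<epsilon> / 2"
  proof -
    have "d * (6 * M + 2 * K) \<le> d * (2 * (3 * M + K + 1))" using d0 by (intro mult_left_mono) auto
    also have "\<dots> \<le> \<epsilon> / (4 * (3 * M + K + 1)) * (2 * (3 * M + K + 1))" using dle(6) MK by (intro mult_right_mono) auto
    also have "\<dots> = \<epsilon> / 2" using MK by (simp add: field_simps)
    finally show ?thesis .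
  qed
  have dab: "a + d \<le> b - d" using dle(4) by (simp add: field_simps)
  obtain \<phi> \<rho> where \<phi>: "smooth_on UNIV \<phi>" "deriv \<phi> = (\<lambda>t. \<rho> (t - a) - \<rho> (t - b))"
    "\<And>t. \<phi> t \<ge> 0" "\<And>t. \<phi> t \<le> 1" "\<And>t. t \<notin> {a-d..b+d} \<Longrightarrow> \<phi> t = 0" "\<And>t. t \<in> {a+d..b-d} \<Longrightarrow> \<phi> t = 1"
    and \<rho>: "smooth_on UNIV \<rho>" "\<And>t. \<rho> t \<ge> 0" "\<And>t. t \<notin> {-d..d} \<Longrightarrow> \<rho> t = 0" "(\<rho> has_integral 1) {-d..d}"
    by (rule time_cutoff[OF d0 dab]) (rule that, assumption+)
  let ?c = "a - d" and ?e = "b + d"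
  have ce: "0 < ?c" "?c \<le> ?e" "{?c..?e} \<subseteq> {0<..}" "{?c..?e} \<subseteq> {0..}" "{?c..?e} \<subseteq> {0..b+1}" using dle d0 ab by auto
  have \<phi>t: "\<phi> \<in> test_functions {0<..}"
    unfolding test_functions_def using \<phi>(1,5) ce by (auto intro!: exI[of _ "{?c..?e}"])
  have c\<rho>: "continuous_on A (\<lambda>t. \<rho> (t - x))" for A x
    using smooth_on_continuous[OF smooth_on_translate[OF \<rho>(1), of "- x"]] by simp
  have cf: "continuous_on {x..y} f" if "x \<ge> 0" for x y by (rule continuous_on_subset[OF f]) (use that in auto)
  have ch: "continuous_on {x..y} h" if "x \<ge> 0" for x y by (rule continuous_on_subset[OF h]) (use that in auto)
  have c\<phi>: "continuous_on A \<phi>" for A by (rule smooth_on_continuous[OF \<phi>(1)])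
  have I1: "(LINT t|lebesgue_on {0<..}. f t * deriv \<phi> t) = integral {?c..?e} (\<lambda>t. f t * (\<rho> (t - a) - \<rho> (t - b)))"
    unfolding \<phi>(2)
  proof (rule integral_lebesgue_on_compact_support(2)[OF _ _ ce(3)])
    show "continuous_on {?c..?e} (\<lambda>t. f t * (\<rho> (t - a) - \<rho> (t - b)))" using ce by (intro continuous_intros cf c\<rho>) auto
    show "f t * (\<rho> (t - a) - \<rho> (t - b)) = 0" if "t \<notin> {?c..?e}" for t
      using that \<rho>(3)[of "t - a"] \<rho>(3)[of "t - b"] ab by auto
  qed simp
  have I2: "(LINT t|lebesgue_on {0<..}. h t * \<phi> t) = integral {?c..?e} (\<lambda>t. h t * \<phi> t)"
    by (rule integral_lebesgue_on_compact_support(2)[OF _ _ ce(3)])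
       (use ce in \<open>auto intro!: continuous_intros ch c\<phi> \<phi>(5)\<close>)
  have I3: "(LINT t|lebesgue_on {0<..}. \<phi> t) = integral {?c..?e} \<phi>"
    by (rule integral_lebesgue_on_compact_support(2)[OF c\<phi> _ ce(3)]) (auto intro: \<phi>(5))
  have A: "integral {?c..?e} (\<lambda>t. f t * \<rho> (t - a)) = integral {a-d..a+d} (\<lambda>t. f t * \<rho> (t - a))"
  proof -
    have i: "(\<lambda>t. f t * \<rho> (t - a)) integrable_on {?c..?e}"
      using ce by (intro integrable_continuous_real continuous_intros cf c\<rho>) auto
    have "integral {a-d..a+d} (\<lambda>t. f t * \<rho> (t - a)) + integral {a+d..?e} (\<lambda>t. f t * \<rho> (t - a)) = integral {?c..?e} (\<lambda>t. f t * \<rho> (t - a))"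
      using d0 ab by (intro Henstock_Kurzweil_Integration.integral_combine i) auto
    moreover have "integral {a+d..?e} (\<lambda>t. f t * \<rho> (t - a)) = 0"
    proof -
      have "((\<lambda>t. f t * \<rho> (t - a)) has_integral 0) {a+d<..<?e}"
        by (rule has_integral_is_0) (use \<rho>(3) in auto)
      then show ?thesis unfolding has_integral_Icc_iff_Ioo[symmetric] by (rule integral_unique)
    qed
    ultimately show ?thesis by simp
  qed
  have B: "integral {?c..?e} (\<lambda>t. f t * \<rho> (t - b)) = integral {b-d..b+d} (\<lambda>t. f t * \<rho> (t - b))"
  proof -
    have i: "(\<lambda>t. f t * \<rho> (t - b)) integrable_on {?c..?e}"
      using ce by (intro integrable_continuous_real continuous_intros cf c\<rho>) auto
    have "integral {?c..b-d} (\<lambda>t. f t * \<rho> (t - b)) + integral {b-d..?e} (\<lambda>t. f t * \<rho> (t - b)) = integral {?c..?e} (\<lambda>t. f t * \<rho> (t - b))"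
      using d0 ab by (intro Henstock_Kurzweil_Integration.integral_combine i) auto
    moreover have "integral {?c..b-d} (\<lambda>t. f t * \<rho> (t - b)) = 0"
    proof -
      have "((\<lambda>t. f t * \<rho> (t - b)) has_integral 0) {?c<..<b-d}"
        by (rule has_integral_is_0) (use \<rho>(3) in auto)
      then show ?thesis unfolding has_integral_Icc_iff_Ioo[symmetric] by (rule integral_unique)
    qed
    ultimately show ?thesis by simp
  qed
  have AB: "integral {?c..?e} (\<lambda>t. f t * (\<rho> (t - a) - \<rho> (t - b)))
      = integral {a-d..a+d} (\<lambda>t. f t * \<rho> (t - a)) - integral {b-d..b+d} (\<lambda>t. f t * \<rho> (t - b))"
    unfolding A[symmetric] B[symmetric] right_diff_distrib
    using ce by (intro Henstock_Kurzweil_Integration.integral_diff integrable_continuous_real continuous_intros cf c\<rho>) auto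
  have na: "\<bar>f t - f a\<bar> \<le> \<epsilon> / 4" if "t \<in> {a-d..a+d}" for t
  proof -
    have "t \<ge> 0" "\<bar>t - a\<bar> < \<delta>1" using that dle(1,3) d0 \<delta>(1) ab by auto
    from \<delta>(2)[OF this] show ?thesis by simp
  qed
  have nb: "\<bar>f t - f b\<bar> \<le> \<epsilon> / 4" if "t \<in> {b-d..b+d}" for t
  proof -
    have "t \<ge> 0" "\<bar>t - b\<bar> < \<delta>2" using that dle(2,3) d0 \<delta>(3) ab by auto
    from \<delta>(4)[OF this] show ?thesis by simp
  qed
  have fa: "\<bar>integral {a-d..a+d} (\<lambda>t. f t * \<rho> (t - a)) - f a\<bar> \<le> \<epsilon> / 4"
    by (rule mollifier_average[OF _ smooth_on_continuous[OF \<rho>(1)] \<rho>(2,4)])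
       (use ce na in \<open>auto intro!: cf\<close>)
  have fb: "\<bar>integral {b-d..b+d} (\<lambda>t. f t * \<rho> (t - b)) - f b\<bar> \<le> \<epsilon> / 4"
    by (rule mollifier_average[OF _ smooth_on_continuous[OF \<rho>(1)] \<rho>(2,4)])
       (use dab d0 ab nb in \<open>auto intro!: cf\<close>)
  \<comment> \<open>Away from the ends the cutoff is 1. The end pieces have lengths 2d and 2d for
    the integral with the cutoff, and d and d for the one without.\<close>
  have H: "\<bar>integral {?c..?e} (\<lambda>t. h t * \<phi> t) - integral {a..b} h\<bar> \<le> 6 * M * d"
  proof -
    have ih: "(\<lambda>t. h t * \<phi> t) integrable_on {x..y}" if "x \<ge> 0" for x y
      using that by (intro integrable_continuous_real continuous_intros ch c\<phi>)
    have ih': "h integrable_on {x..y}" if "x \<ge> 0" for x y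
      using that by (intro integrable_continuous_real ch)
    have s1: "integral {?c..a+d} (\<lambda>t. h t * \<phi> t) + integral {a+d..?e} (\<lambda>t. h t * \<phi> t) = integral {?c..?e} (\<lambda>t. h t * \<phi> t)"
      using d0 ab ce by (intro Henstock_Kurzweil_Integration.integral_combine ih) auto
    have s2: "integral {a+d..b-d} (\<lambda>t. h t * \<phi> t) + integral {b-d..?e} (\<lambda>t. h t * \<phi> t) = integral {a+d..?e} (\<lambda>t. h t * \<phi> t)"
      using d0 ab dab ce by (intro Henstock_Kurzweil_Integration.integral_combine ih) auto
    have s3: "integral {a..a+d} h + integral {a+d..b} h = integral {a..b} h"
      using d0 ab dab by (intro Henstock_Kurzweil_Integration.integral_combine ih') auto
    have s4: "integral {a+d..b-d} h + integral {b-d..b} h = integral {a+d..b} h"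
      using d0 ab dab by (intro Henstock_Kurzweil_Integration.integral_combine ih') auto
    have mid: "integral {a+d..b-d} (\<lambda>t. h t * \<phi> t) = integral {a+d..b-d} h"
      by (rule Henstock_Kurzweil_Integration.integral_cong) (simp add: \<phi>(6))
    have le: "\<bar>h t * \<phi> t\<bar> \<le> M" if "t \<in> {0..b+1}" for t
      using mult_mono[OF M(1)[OF that] \<phi>(4)[of t] M(2)] \<phi>(3)[of t] by (simp add: abs_mult)
    have b1: "\<bar>integral {?c..a+d} (\<lambda>t. h t * \<phi> t)\<bar> \<le> M * ((a + d) - ?c)"
      by (rule integral_abs_le_const) (use d0 ab dab dle ce in \<open>auto intro!: continuous_intros ch c\<phi> le\<close>)
    have b2: "\<bar>integral {b-d..?e} (\<lambda>t. h t * \<phi> t)\<bar> \<le> M * (?e - (b - d))"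
      by (rule integral_abs_le_const) (use d0 ab dab dle ce in \<open>auto intro!: continuous_intros ch c\<phi> le\<close>)
    have b3: "\<bar>integral {a..a+d} h\<bar> \<le> M * ((a + d) - a)"
      by (rule integral_abs_le_const) (use d0 ab dab dle ce in \<open>auto intro!: ch M\<close>)
    have b4: "\<bar>integral {b-d..b} h\<bar> \<le> M * (b - (b - d))"
      by (rule integral_abs_le_const) (use d0 ab dab dle ce in \<open>auto intro!: ch M\<close>)
    show ?thesis using s1 s2 s3 s4 mid b1 b2 b3 b4 by (simp add: algebra_simps)
  qed
  have P: "integral {?c..?e} \<phi> \<le> (b - a) + 2 * d"
    using integral_abs_le_const[OF c\<phi> _ ce(2), of 1] \<phi>(3,4) by (auto simp: abs_le_iff)
  have "\<bar>(integral {a-d..a+d} (\<lambda>t. f t * \<rho> (t - a)) - integral {b-d..b+d} (\<lambda>t. f t * \<rho> (t - b)))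
      + integral {?c..?e} (\<lambda>t. h t * \<phi> t)\<bar> \<le> K * integral {?c..?e} \<phi>"
    using weak[OF \<phi>t \<phi>(3)] unfolding I1 I2 I3 AB .
  also have "\<dots> \<le> K * ((b - a) + 2 * d)" using P K by (rule mult_left_mono)
  finally have "\<bar>f b - f a - integral {a..b} h\<bar> \<le> K * ((b - a) + 2 * d) + \<epsilon> / 4 + \<epsilon> / 4 + 6 * M * d"
    using fa fb H by linarith
  also have "\<dots> = K * (b - a) + \<epsilon> / 2 + d * (6 * M + 2 * K)" by (simp add: algebra_simps)
  finally show "\<bar>f b - f a - integral {a..b} h\<bar> \<le> K * (b - a) + \<epsilon>" using dMK by linarith
qed

end

text \<open>By equicontinuity the value at \<open>t\<close> is within a fixed error of the average
  over a short interval near \<open>t\<close>, uniformly in \<open>n\<close>, and these averages are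
  Cauchy. The whole sequence converges, so no Arzela-Ascoli extraction is involved.\<close>

lemma convergent_of_averages:
  fixes c :: "nat \<Rightarrow> real \<Rightarrow> real"
  assumes cont: "\<And>n. continuous_on {0..T} (c n)"
    and equi: "\<And>e. e > 0 \<Longrightarrow> \<exists>\<delta>>0. \<forall>n. \<forall>s\<in>{0..T}. \<forall>t\<in>{0..T}. \<bar>s - t\<bar> < \<delta> \<longrightarrow> \<bar>c n s - c n t\<bar> < e"
    and avg: "\<And>a b. 0 < a \<Longrightarrow> a < b \<Longrightarrow> b < T \<Longrightarrow> convergent (\<lambda>n. integral {a..b} (c n))"
    and t: "t \<in> {0..T}" and T: "0 < T"
  shows "convergent (\<lambda>n. c n t)"
proof -
  have "Cauchy (\<lambda>n. c n t)"
  proof (rule metric_CauchyI)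
    fix e :: real assume e: "e > 0"
    obtain \<delta> where \<delta>: "\<delta> > 0" "\<And>n s t. s \<in> {0..T} \<Longrightarrow> t \<in> {0..T} \<Longrightarrow> \<bar>s - t\<bar> < \<delta> \<Longrightarrow> \<bar>c n s - c n t\<bar> < e / 4"
      using equi[of "e / 4"] e by auto
    obtain a b where ab: "0 < a" "a < b" "b < T" "\<And>s. s \<in> {a..b} \<Longrightarrow> \<bar>s - t\<bar> < \<delta>"
    proof -
      \<comment> \<open>Averages are controlled only over intervals strictly between 0 and
        \<open>T\<close>, so the interval is placed on the side of \<open>t\<close> with more
        room.\<close>
      define \<eta> where "\<eta> = min (\<delta> / 2) (T / 4)"
      have \<eta>: "\<eta> > 0" "\<eta> \<le> \<delta> / 2" "\<eta> \<le> T / 4" using \<delta>(1) T by (auto simp: \<eta>_def)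
      show thesis
      proof (cases "t \<le> T / 2")
        case True
        show thesis by (rule that[of "t + \<eta> / 2" "t + \<eta>"]) (use True \<eta> \<delta>(1) t T in auto)
      next
        case False
        show thesis by (rule that[of "t - \<eta>" "t - \<eta> / 2"]) (use False \<eta> \<delta>(1) t T in auto)
      qed
    qed
    have ci: "c n integrable_on {a..b}" for n
      by (intro integrable_continuous_real continuous_on_subset[OF cont]) (use ab in auto)
    have near: "\<bar>integral {a..b} (c n) - (b - a) * c n t\<bar> \<le> e / 4 * (b - a)" for n
    proof -
      have "integral {a..b} (\<lambda>s. c n s - c n t) = integral {a..b} (c n) - (b - a) * c n t"
        using ab ci by (subst Henstock_Kurzweil_Integration.integral_diff) auto
      moreover have "\<bar>integral {a..b} (\<lambda>s. c n s - c n t)\<bar> \<le> e / 4 * (b - a)"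
      proof (rule integral_abs_le_const)
        show "continuous_on {a..b} (\<lambda>s. c n s - c n t)"
          by (intro continuous_intros continuous_on_subset[OF cont]) (use ab in auto)
        show "\<bar>c n s - c n t\<bar> \<le> e / 4" if "s \<in> {a..b}" for s
          using \<delta>(2)[of s t n] ab(1,2,3) ab(4)[OF that] that t by auto
      qed (use ab in auto)
      ultimately show ?thesis by simp
    qed
    have "Cauchy (\<lambda>n. integral {a..b} (c n))" using avg[OF ab(1,2,3)] by (simp add: Cauchy_convergent_iff)
    moreover have "e / 4 * (b - a) > 0" using e ab by simp
    ultimately obtain N where N: "\<And>m n. m \<ge> N \<Longrightarrow> n \<ge> N \<Longrightarrow>
        norm (integral {a..b} (c m) - integral {a..b} (c n)) < e / 4 * (b - a)"
      using CauchyD by meson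
    show "\<exists>M. \<forall>m\<ge>M. \<forall>n\<ge>M. dist (c m t) (c n t) < e"
    proof (intro exI[of _ N] allI impI)
      fix m n assume mn: "m \<ge> N" "n \<ge> N"
      have "\<bar>(b - a) * c m t - (b - a) * c n t\<bar> < 3 * (e / 4 * (b - a))"
        using near[of m] near[of n] N[OF mn] unfolding real_norm_def by linarith
      also have "(b - a) * c m t - (b - a) * c n t = (b - a) * (c m t - c n t)" by (simp add: algebra_simps)
      finally have "(b - a) * \<bar>c m t - c n t\<bar> < (b - a) * (3 * (e / 4))"
        using ab by (simp add: abs_mult mult_ac)
      then have "\<bar>c m t - c n t\<bar> < 3 * (e / 4)" using ab by (simp only: mult_less_cancel_left_pos)
      then show "dist (c m t) (c n t) < e" using e by (simp add: dist_real_def)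
    qed
  qed
  then show ?thesis by (simp add: Cauchy_convergent_iff)
qed

section \<open>Leray-Hopf solutions\<close>

text \<open>Completeness of Lebesgue measure transfers measurability from \<open>g\<close> to
  \<open>f\<close>. This matters for integrands built from \<open>\<theta> t\<close>, about which
  almost everywhere information is all there is.\<close>

lemma integral_cong_AE_lebesgue_on:
  fixes f g :: "real \<Rightarrow> real"
  assumes g: "g \<in> borel_measurable (lebesgue_on S)" and S: "S \<in> sets lebesgue"
    and eq: "AE t in lebesgue_on S. f t = g t"
  shows "(LINT t|lebesgue_on S. f t) = (LINT t|lebesgue_on S. g t)"
proof (rule integral_cong_AE)
  have "(\<lambda>t. if t \<in> S then g t else 0) \<in> borel_measurable lebesgue"
    by (rule borel_measurable_if_I[OF g S])
  moreover have "AE t in lebesgue. (if t \<in> S then g t else 0) = (if t \<in> S then f t else 0)"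
    using eq S by (subst (asm) AE_restrict_space_iff) (auto elim: eventually_mono)
  ultimately have "(\<lambda>t. if t \<in> S then f t else 0) \<in> borel_measurable lebesgue"
    by (rule borel_measurable_AE)
  then show "f \<in> borel_measurable (lebesgue_on S)" by (rule borel_measurable_if_D)
qed (use g eq in auto)

text \<open>Nothing is asked of \<open>f\<close>: if it fails to be integrable its integral is 0 by
  convention, and \<open>g\<close> is nonnegative almost everywhere.\<close>

lemma abs_integral_le_AE:
  fixes f g :: "'a \<Rightarrow> real"
  assumes "integrable M g" "AE t in M. \<bar>f t\<bar> \<le> g t"
  shows "\<bar>integral\<^sup>L M f\<bar> \<le> integral\<^sup>L M g"
proof (cases "integrable M f")
  case True
  have "\<bar>integral\<^sup>L M f\<bar> \<le> integral\<^sup>L M (\<lambda>t. \<bar>f t\<bar>)" by simp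
  also have "\<dots> \<le> integral\<^sup>L M g" by (rule integral_mono_AE) (use True assms in auto)
  finally show ?thesis .
next
  case False
  have "AE t in M. 0 \<le> g t" using assms(2) by eventually_elim simp
  then show ?thesis using False by (simp add: not_integrable_integral_eq integral_nonneg_AE)
qed

context dirichlet
begin

text \<open>The vector field \<open>v\<close> need only agree almost everywhere with the gradient,
  so that both the chosen \<open>weak_grad\<close> of the dissipative equation and the classical
  gradient of a time slice fit.\<close>

lemma NL_integral:
  assumes f: "f \<in> L2 \<Omega>" and \<phi>: "\<phi> \<in> test_functions \<Omega>"
    and v: "\<And>i. (\<lambda>x. v x $ i) \<in> borel_measurable MO" "\<And>i. AE x in MO. v x $ i = pd (ex i) \<phi> x"
  shows "(LINT x|MO. (f x *\<^sub>R sqg_velocity \<Omega> w lam f x) \<bullet> v x) = NL f \<phi>"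
proof -
  let ?g = "\<lambda>i. weak_pderiv \<Omega> i (stream f)"
  note d = test_functions_pd[OF \<phi> ex_Basis]
  have gL: "?g i \<in> L2 \<Omega>" for i by (rule wd_L2(2)[OF stream(3)[OF f]])
  have p: "(f x *\<^sub>R sqg_velocity \<Omega> w lam f x) \<bullet> v x = f x * ?g 1 x * v x $ 2 - f x * ?g 2 x * v x $ 1" for x
    unfolding sqg_velocity_def weak_perp_grad_def stream_def[symmetric]
    by (simp add: inner_vec_def sum_2 algebra_simps)
  have [measurable]: "f \<in> borel_measurable MO" "?g i \<in> borel_measurable MO" "(\<lambda>x. v x $ i) \<in> borel_measurable MO"
    "pd (ex i) \<phi> \<in> borel_measurable MO" for i
    using L2_measurable[OF f] L2_measurable[OF gL] v(1) test_measurable[OF d] by auto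
  have "(LINT x|MO. (f x *\<^sub>R sqg_velocity \<Omega> w lam f x) \<bullet> v x)
      = (LINT x|MO. f x * ?g 1 x * pd (ex 2) \<phi> x - f x * ?g 2 x * pd (ex 1) \<phi> x)"
    unfolding p
  proof (rule integral_cong_AE)
    show "AE x in MO. f x * ?g 1 x * v x $ 2 - f x * ?g 2 x * v x $ 1
        = f x * ?g 1 x * pd (ex 2) \<phi> x - f x * ?g 2 x * pd (ex 1) \<phi> x"
      using v(2)[of 1] v(2)[of 2] by eventually_elim simp
  qed measurable
  also have "\<dots> = NL f \<phi>"
    unfolding NL_def T_def
    using L2_mult_integrable[OF f L2_mult_test[OF gL d]]
    by (intro Bochner_Integration.integral_diff) (simp_all add: mult.assoc)
  finally show ?thesis .
qed

lemma NL_weak_grad: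
  assumes f: "f \<in> L2 \<Omega>" and \<phi>: "\<phi> \<in> test_functions \<Omega>"
  shows "(LINT x|MO. (f x *\<^sub>R sqg_velocity \<Omega> w lam f x) \<bullet> weak_grad \<Omega> \<phi> x) = NL f \<phi>"
proof (rule NL_integral[OF f \<phi>])
  fix i
  note wp = wd_weak_pderiv[OF wd_test[OF \<phi>, of i]]
  show "(\<lambda>x. weak_grad \<Omega> \<phi> x $ i) \<in> borel_measurable MO"
    using L2_measurable[OF wd_L2(2)[OF wp(2)]] by (simp add: weak_grad_def)
  show "AE x in MO. weak_grad \<Omega> \<phi> x $ i = pd (ex i) \<phi> x" using wp(1) by (simp add: weak_grad_def)
qed

lemma inner_cong_cf:
  assumes "f \<in> L2 \<Omega>" "g \<in> L2 \<Omega>" "h \<in> L2 \<Omega>" "cf f = cf g"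
  shows "inner f h = inner g h"
  using Parseval[OF assms(1,3)] Parseval[OF assms(2,3)] assms(4) sums_unique2 by metis

lemma NL_cong_cf:
  assumes "f \<in> L2 \<Omega>" "g \<in> L2 \<Omega>" "\<phi> \<in> test_functions \<Omega>" "cf f = cf g"
  shows "NL f \<phi> = NL g \<phi>"
  using Q_tendsto_NL[OF assms(1,3)] Q_tendsto_NL[OF assms(2,3)] assms(4) LIMSEQ_unique by metis

text \<open>Two integrations by parts show that lambda_j phi_j are the coefficients of minus the
  Laplacian of \<open>\<phi>\<close>, a function in L^2. Test functions are thereby admissible in
  the dissipative equation.\<close>

lemma lam_cf_test:
  assumes \<phi>: "\<phi> \<in> test_functions \<Omega>"
  shows "summable (\<lambda>j. (lam j * cf \<phi> j)\<^sup>2)"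
proof -
  note d = test_functions_pd[OF \<phi> ex_Basis]
  let ?g = "\<lambda>x. pd (ex 1) (pd (ex 1) \<phi>) x + pd (ex 2) (pd (ex 2) \<phi>) x"
  have dd: "pd (ex i) (pd (ex i) \<phi>) \<in> L2 \<Omega>" for i by (rule test_in_L2[OF test_functions_pd[OF d ex_Basis]])
  have g: "?g \<in> L2 \<Omega>" by (intro L2_add dd)
  have "lam j * cf \<phi> j = - cf ?g j" for j
  proof -
    have "lam j * cf \<phi> j = inner (gw 1 j) (pd (ex 1) \<phi>) + inner (gw 2 j) (pd (ex 2) \<phi>)"
      using gw_test[OF \<phi>, of j] by (simp add: coef_def L2_inner_commute[of _ \<phi>])
    also have "\<dots> = - inner (w j) (pd (ex 1) (pd (ex 1) \<phi>)) - inner (w j) (pd (ex 2) (pd (ex 2) \<phi>))"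
      using wdD[OF wd_w[of 1 j] d[of 1]] wdD[OF wd_w[of 2 j] d[of 2]] by simp
    also have "\<dots> = - cf ?g j"
      by (simp add: coef_def L2_inner_add_left dd L2_inner_commute[of _ "w j"])
    finally show ?thesis .
  qed
  then show ?thesis using summable_cf_square[OF g] by simp
qed

lemma powr_cf_test:
  assumes \<phi>: "\<phi> \<in> test_functions \<Omega>" and \<sigma>: "\<sigma> \<le> 2"
  shows "summable (\<lambda>j. (lam j powr (\<sigma> / 2) * cf \<phi> j)\<^sup>2)"
proof -
  have eq: "lam j powr (\<sigma> / 2) * cf \<phi> j = lam j powr ((\<sigma> - 2) / 2) * (lam j * cf \<phi> j)" for j
  proof -
    have "lam j powr (\<sigma> / 2) = lam j powr ((\<sigma> - 2) / 2 + 1)" by (simp add: diff_divide_distrib)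
    also have "\<dots> = lam j powr ((\<sigma> - 2) / 2) * lam j" using lam_pos[of j] by (simp add: powr_add)
    finally show ?thesis by (simp add: mult.assoc)
  qed
  show ?thesis
    unfolding eq by (rule summable_powr_negative(1)[OF _ lam_cf_test[OF \<phi>]]) (use \<sigma> in simp)
qed

lemma test_in_D_fun: "\<phi> \<in> test_functions \<Omega> \<Longrightarrow> \<psi> = \<phi> \<Longrightarrow> \<sigma> \<le> 2 \<Longrightarrow> \<psi> \<in> D_fun \<Omega> w lam \<sigma>"
  unfolding D_fun_def D_seq_def using powr_cf_test test_in_L2 by auto

text \<open>All of Lambda^s is moved onto the test function, which admits it because
  \<open>s \<le> 2\<close>. The viscous term is then controlled by the L^2 norm of the solution
  alone, hence of order \<open>\<nu>\<close> uniformly.\<close>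

lemma Lam_self_adjoint_bound:
  assumes f: "f \<in> D_fun \<Omega> w lam (s / 2)" and \<phi>: "\<phi> \<in> test_functions \<Omega>" and s: "0 < s" "s \<le> 2"
  shows "\<bar>LINT x|MO. Lam \<Omega> w lam (s / 2) f x * Lam \<Omega> w lam (s / 2) \<phi> x\<bar> \<le> nrm f * nrm (Lam \<Omega> w lam s \<phi>)"
proof -
  have fL: "f \<in> L2 \<Omega>" and sf: "summable (\<lambda>j. (lam j powr (s / 2 / 2) * cf f j)\<^sup>2)"
    using f by (auto simp: D_fun_def D_seq_def)
  have s1: "summable (\<lambda>j. (lam j powr (s / 2 / 2) * cf \<phi> j)\<^sup>2)" by (rule powr_cf_test[OF \<phi>]) (use s in simp)
  have s2: "summable (\<lambda>j. (lam j powr (s / 2) * cf \<phi> j)\<^sup>2)" by (rule powr_cf_test[OF \<phi> s(2)])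
  note A = Lam[OF sf] and B = Lam[OF s1] and C = Lam[OF s2]
  have eq: "lam j powr (s / 2 / 2) * cf f j * (lam j powr (s / 2 / 2) * cf \<phi> j) = cf f j * (lam j powr (s / 2) * cf \<phi> j)" for j
  proof -
    have "lam j powr (s / 2 / 2) * lam j powr (s / 2 / 2) = lam j powr (s / 2)" by (simp flip: powr_add)
    then show ?thesis by (simp add: mult_ac)
  qed
  have "inner (Lam \<Omega> w lam (s / 2) f) (Lam \<Omega> w lam (s / 2) \<phi>) = inner f (Lam \<Omega> w lam s \<phi>)"
    using Parseval[OF A(1) B(1)] Parseval[OF fL C(1)] unfolding A(2) B(2) C(2) eq by (rule sums_unique2)
  then show ?thesis using L2_Cauchy_Schwarz[OF fL C(1)] by (simp add: L2_inner_def)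
qed

lemma weakly_continuous_cf_tendsto:
  assumes "weakly_continuous_L2 \<Omega> \<theta>" "\<And>n. t n \<ge> 0" "t0 \<ge> 0" "t \<longlonglongrightarrow> t0" "g \<in> L2 \<Omega>"
  shows "(\<lambda>n. inner (\<theta> (t n)) g) \<longlonglongrightarrow> inner (\<theta> t0) g"
proof -
  have "continuous_on {0..} (\<lambda>t. inner (\<theta> t) g)" using assms(1,5) by (simp add: weakly_continuous_L2_def)
  then show ?thesis using assms(2-4) by (auto simp: continuous_on_sequentially o_def)
qed

text \<open>Bounded sequences whose coefficients converge are weakly convergent: truncate the fixed
  function in the eigenbasis and bound the remainder by \<open>C\<close>. The strongly convergent
  factor changes the pairing by at most \<open>C\<close> times its error.\<close>

lemma weak_strong:
  assumes u: "\<And>n. u n \<in> L2 \<Omega>" "\<And>n. nrm (u n) \<le> C" and u': "u' \<in> L2 \<Omega>"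
    and lim: "\<And>j. (\<lambda>n. cf (u n) j) \<longlonglongrightarrow> cf u' j"
    and v: "\<And>n. v n \<in> L2 \<Omega>" "v' \<in> L2 \<Omega>" "(\<lambda>n. nrm (\<lambda>x. v n x - v' x)) \<longlonglongrightarrow> 0"
  shows "(\<lambda>n. inner (u n) (v n)) \<longlonglongrightarrow> inner u' v'"
proof -
  have C: "C \<ge> 0" using u(2)[of 0] L2_norm_nonneg[of \<Omega> "u 0"] by linarith
  have wk: "(\<lambda>n. inner (u n) v') \<longlonglongrightarrow> inner u' v'"
  proof (rule LIMSEQ_I)
    fix e :: real assume e: "e > 0"
    define M where "M = C + nrm u' + 1"
    have M: "M > 0" using add_nonneg_nonneg[OF C L2_norm_nonneg[of \<Omega> u']] unfolding M_def by linarith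
    let ?S = "\<lambda>N x. \<Sum>j<N. cf v' j * w j x"
    have "\<forall>\<^sub>F N in sequentially. nrm (\<lambda>x. v' x - ?S N x) < e / (2 * M)"
      using expansion_tendsto[OF v(2)] e M by (intro order_tendstoD(2)) auto
    then obtain N where N: "nrm (\<lambda>x. v' x - ?S N x) < e / (2 * M)" by (auto simp: eventually_sequentially)
    have S: "inner g (?S N) = (\<Sum>j<N. cf v' j * cf g j)" if "g \<in> L2 \<Omega>" for g
      unfolding L2_inner_commute[of _ g] using that
      by (subst L2_inner_sum_left) (auto simp: coef_def L2_inner_commute[of _ g])
    have "(\<lambda>n. \<Sum>j<N. cf v' j * cf (u n) j) \<longlonglongrightarrow> (\<Sum>j<N. cf v' j * cf u' j)"
      by (intro tendsto_intros lim)
    then have "(\<lambda>n. inner (u n) (?S N)) \<longlonglongrightarrow> inner u' (?S N)" by (simp add: S u u')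
    then have "\<forall>\<^sub>F n in sequentially. dist (inner (u n) (?S N)) (inner u' (?S N)) < e / 2"
      using e by (intro tendstoD) auto
    then obtain n0 where n0: "\<And>n. n \<ge> n0 \<Longrightarrow> \<bar>inner (u n) (?S N) - inner u' (?S N)\<bar> < e / 2"
      by (auto simp: eventually_sequentially dist_real_def)
    have "\<bar>inner (u n) v' - inner u' v'\<bar> < e" if "n \<ge> n0" for n
    proof -
      have vs: "(\<lambda>x. v' x - ?S N x) \<in> L2 \<Omega>" by (intro L2_diff v wsum_L2)
      have d: "inner g v' = inner g (?S N) + inner g (\<lambda>x. v' x - ?S N x)" if "g \<in> L2 \<Omega>" for g
        using L2_inner_diff_right[OF v(2) wsum_L2 that] by simp
      have "\<bar>inner (u n) (\<lambda>x. v' x - ?S N x)\<bar> \<le> C * (e / (2 * M))"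
        using L2_Cauchy_Schwarz[OF u(1)[of n] vs] mult_mono[OF u(2)[of n] less_imp_le[OF N] C] by simp
      moreover have "\<bar>inner u' (\<lambda>x. v' x - ?S N x)\<bar> \<le> nrm u' * (e / (2 * M))"
        using L2_Cauchy_Schwarz[OF u' vs] mult_left_mono[OF less_imp_le[OF N], of "nrm u'"] by simp
      moreover have "C * (e / (2 * M)) + nrm u' * (e / (2 * M)) \<le> e / 2"
      proof -
        have "C * (e / (2 * M)) + nrm u' * (e / (2 * M)) = (C + nrm u') * (e / (2 * M))" by (simp only: distrib_right)
        also have "\<dots> \<le> M * (e / (2 * M))" using e M by (intro mult_right_mono) (auto simp: M_def)
        also have "\<dots> = e / 2" using M by simp
        finally show ?thesis .
      qed
      ultimately show ?thesis using n0[OF that] unfolding d[OF u(1)] d[OF u'] by linarith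
    qed
    then show "\<exists>no. \<forall>n\<ge>no. norm (inner (u n) v' - inner u' v') < e" by auto
  qed
  have "(\<lambda>n. inner (u n) (\<lambda>x. v n x - v' x)) \<longlonglongrightarrow> 0"
  proof (rule Lim_null_comparison)
    show "(\<lambda>n. C * nrm (\<lambda>x. v n x - v' x)) \<longlonglongrightarrow> 0" using tendsto_mult_left[OF v(3), of C] by simp
    show "\<forall>\<^sub>F n in sequentially. norm (inner (u n) (\<lambda>x. v n x - v' x)) \<le> C * nrm (\<lambda>x. v n x - v' x)"
    proof (intro always_eventually allI)
      fix n
      show "norm (inner (u n) (\<lambda>x. v n x - v' x)) \<le> C * nrm (\<lambda>x. v n x - v' x)"
        using L2_Cauchy_Schwarz[OF u(1) L2_diff[OF v(1) v(2)], of n n] mult_right_mono[OF u(2)[of n], of "nrm (\<lambda>x. v n x - v' x)"]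
        by simp
    qed
  qed
  from tendsto_add[OF this wk] show ?thesis by (simp add: L2_inner_diff_right u v)
qed

lemma cf_tendsto_of_weakly_continuous:
  assumes "weakly_continuous_L2 \<Omega> \<theta>" "\<And>n. t n \<ge> 0" "t0 \<ge> 0" "t \<longlonglongrightarrow> t0"
  shows "(\<lambda>n. cf (\<theta> (t n)) j) \<longlonglongrightarrow> cf (\<theta> t0) j"
  unfolding coef_def by (rule weakly_continuous_cf_tendsto[OF assms w_L2])

section \<open>Estimates for a single Leray-Hopf solution\<close>

context
  fixes s \<nu> \<theta>0 \<theta>
  assumes s: "0 < s" "s \<le> 2" and \<nu>: "0 < \<nu>" and LH: "leray_hopf_solution \<Omega> w lam s \<nu> \<theta>0 \<theta>"
begin

lemma LH_weakly_continuous: "weakly_continuous_L2 \<Omega> \<theta>"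
  using LH by (simp add: leray_hopf_solution_def)

lemma LH_L2: "t \<ge> 0 \<Longrightarrow> \<theta> t \<in> L2 \<Omega>"
  using LH_weakly_continuous by (simp add: weakly_continuous_L2_def)

lemma LH_continuous: "g \<in> L2 \<Omega> \<Longrightarrow> continuous_on {0..} (\<lambda>t. inner (\<theta> t) g)"
  using LH_weakly_continuous by (simp add: weakly_continuous_L2_def)

text \<open>The energy inequality holds only at almost every time. It reaches every
  \<open>t\<close>, including 0, through good times decreasing to \<open>t\<close>, because the norm
  is lower semicontinuous under weak convergence.\<close>

lemma LH_bound:
  assumes t: "t \<ge> 0"
  shows "nrm (\<theta> t) \<le> nrm \<theta>0"
proof -
  have th0: "\<theta>0 \<in> L2 \<Omega>" using LH by (simp add: leray_hopf_solution_def)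
  have "AE t in lebesgue_on {0<..}. (nrm (\<theta> t))\<^sup>2 / 2
        + \<nu> * (LINT r|lebesgue_on {0<..<t}. LINT x|MO. (Lam \<Omega> w lam (s / 2) (\<theta> r) x)\<^sup>2) \<le> (nrm \<theta>0)\<^sup>2 / 2"
    using LH by (simp add: leray_hopf_solution_def)
  then have ae: "AE t in lebesgue_on {0<..}. nrm (\<theta> t) \<le> nrm \<theta>0"
  proof eventually_elim
    case (elim t)
    have "0 \<le> \<nu> * (LINT r|lebesgue_on {0<..<t}. LINT x|MO. (Lam \<Omega> w lam (s / 2) (\<theta> r) x)\<^sup>2)"
      using \<nu> by (intro mult_nonneg_nonneg integral_nonneg_AE AE_I2) auto
    with elim have "(nrm (\<theta> t))\<^sup>2 \<le> (nrm \<theta>0)\<^sup>2" by linarith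
    then show ?case by (rule power2_le_imp_le) simp
  qed
  have "\<exists>t'. t < t' \<and> t' < t + 1 / Suc n \<and> nrm (\<theta> t') \<le> nrm \<theta>0" for n
  proof -
    have sub: "{t<..<t + 1 / Suc n} \<subseteq> {0<..}" and lt: "t < t + 1 / Suc n" using t by auto
    obtain t' where "t' \<in> {t<..<t + 1 / Suc n}" "nrm (\<theta> t') \<le> nrm \<theta>0"
      by (rule AE_interval_witness[OF ae _ sub lt]) auto
    then show ?thesis by (intro exI[of _ t']) auto
  qed
  then obtain \<tau> where \<tau>: "\<And>n. t < \<tau> n" "\<And>n. \<tau> n < t + 1 / Suc n" "\<And>n. nrm (\<theta> (\<tau> n)) \<le> nrm \<theta>0" by metis
  have "\<tau> \<longlonglongrightarrow> t"
  proof (rule tendsto_sandwich)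
    show "\<forall>\<^sub>F n in sequentially. t \<le> \<tau> n" "\<forall>\<^sub>F n in sequentially. \<tau> n \<le> t + 1 / real (Suc n)"
      using \<tau>(1,2) by (auto intro!: always_eventually less_imp_le)
    show "(\<lambda>n. t + 1 / real (Suc n)) \<longlonglongrightarrow> t"
      using tendsto_add[OF tendsto_const LIMSEQ_inverse_real_of_nat, of t] by (simp add: divide_inverse)
  qed simp
  then have lim: "(\<lambda>n. inner (\<theta> (\<tau> n)) (\<theta> t)) \<longlonglongrightarrow> inner (\<theta> t) (\<theta> t)"
    by (intro weakly_continuous_cf_tendsto[OF LH_weakly_continuous _ t _ LH_L2[OF t]])
       (use \<tau>(1) t in \<open>auto intro: less_imp_le order_trans\<close>)
  have le: "inner (\<theta> (\<tau> n)) (\<theta> t) \<le> nrm \<theta>0 * nrm (\<theta> t)" for n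
  proof -
    have "\<tau> n \<ge> 0" using \<tau>(1)[of n] t by linarith
    then show ?thesis
      using L2_Cauchy_Schwarz[OF LH_L2 LH_L2[OF t], of "\<tau> n"] mult_right_mono[OF \<tau>(3)[of n], of "nrm (\<theta> t)"] by simp
  qed
  have "nrm (\<theta> t) * nrm (\<theta> t) \<le> nrm \<theta>0 * nrm (\<theta> t)"
    using LIMSEQ_le_const2[OF lim] le by (simp add: L2_norm_square[symmetric] power2_eq_square)
  then show ?thesis
    by (cases "nrm (\<theta> t) = 0") (auto simp: mult_le_cancel_right L2_norm_nonneg less_le)
qed

lemma LH_NL_continuous:
  assumes \<psi>: "\<psi> \<in> test_functions \<Omega>"
  shows "continuous_on {0..} (\<lambda>t. NL (\<theta> t) \<psi>)"
  unfolding continuous_on_sequentially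
proof (intro allI ballI impI)
  fix t :: "nat \<Rightarrow> real" and t0 assume t: "t0 \<in> {0..}" "(\<forall>n. t n \<in> {0..}) \<and> t \<longlonglongrightarrow> t0"
  then have t': "\<And>n. t n \<ge> 0" "t0 \<ge> 0" "t \<longlonglongrightarrow> t0" by auto
  show "((\<lambda>t. NL (\<theta> t) \<psi>) \<circ> t) \<longlonglongrightarrow> NL (\<theta> t0) \<psi>"
    unfolding o_def
    by (rule NL_tendsto[OF LH_L2 LH_bound LH_L2 cf_tendsto_of_weakly_continuous[OF LH_weakly_continuous] \<psi>])
       (use t' in auto)
qed

text \<open>The equation integrated in time against a fixed test function, with the viscous term as
  the error: \<open>Lam_self_adjoint_bound\<close> and \<open>LH_bound\<close> make it at most
  \<open>\<nu>\<close> times a constant, at almost every time.\<close>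

lemma LH_increment:
  assumes \<psi>: "\<psi> \<in> test_functions \<Omega>" and ab: "0 < a" "a < b"
  shows "\<bar>inner (\<theta> b) \<psi> - inner (\<theta> a) \<psi> - integral {a..b} (\<lambda>t. NL (\<theta> t) \<psi>)\<bar>
    \<le> \<nu> * (nrm \<theta>0 * nrm (Lam \<Omega> w lam s \<psi>)) * (b - a)"
proof (rule weak_time_integral[OF LH_continuous[OF test_in_L2[OF \<psi>]] LH_NL_continuous[OF \<psi>] _ _ ab])
  let ?K = "nrm \<theta>0 * nrm (Lam \<Omega> w lam s \<psi>)"
  show "0 \<le> \<nu> * ?K" using \<nu> by simp
  fix \<phi> :: "real \<Rightarrow> real" assume \<phi>: "\<phi> \<in> test_functions {0<..}" "\<And>t. \<phi> t \<ge> 0"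
  let ?V = "\<lambda>t. LINT x|MO. Lam \<Omega> w lam (s / 2) (\<theta> t) x * Lam \<Omega> w lam (s / 2) \<psi> x"
  have eq: "(LINT t|lebesgue_on {0<..}. (LINT x|MO. \<theta> t x * \<psi> x) * deriv \<phi> t)
        + (LINT t|lebesgue_on {0<..}. (LINT x|MO. (\<theta> t x *\<^sub>R sqg_velocity \<Omega> w lam (\<theta> t) x) \<bullet> weak_grad \<Omega> \<psi> x) * \<phi> t)
        - \<nu> * (LINT t|lebesgue_on {0<..}. ?V t * \<phi> t) = 0"
    using LH \<phi>(1) test_in_D_fun[OF \<psi> refl, of 2] unfolding leray_hopf_solution_def by blast
  have Y: "(LINT t|lebesgue_on {0<..}. (LINT x|MO. (\<theta> t x *\<^sub>R sqg_velocity \<Omega> w lam (\<theta> t) x) \<bullet> weak_grad \<Omega> \<psi> x) * \<phi> t)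
      = (LINT t|lebesgue_on {0<..}. NL (\<theta> t) \<psi> * \<phi> t)"
  proof (rule Bochner_Integration.integral_cong[OF refl])
    fix t :: real assume "t \<in> space (lebesgue_on {0<..})"
    then have "t \<ge> 0" by simp
    from NL_weak_grad[OF LH_L2[OF this] \<psi>]
    show "(LINT x|MO. (\<theta> t x *\<^sub>R sqg_velocity \<Omega> w lam (\<theta> t) x) \<bullet> weak_grad \<Omega> \<psi> x) * \<phi> t = NL (\<theta> t) \<psi> * \<phi> t"
      by (simp only:)
  qed
  have int: "integrable (lebesgue_on {0<..}) \<phi>"
  proof -
    have "integrable lebesgue \<phi>"
      using test_functions_integrable[OF \<phi>(1)] test_functions_borel[OF \<phi>(1)] by (subst integrable_completion) auto
    then have "integrable lebesgue (\<lambda>t. indicator {0<..} t *\<^sub>R \<phi> t)" by (rule integrable_mult_indicator[rotated]) simp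
    then show ?thesis by (subst integrable_restrict_space) auto
  qed
  have "AE t in lebesgue_on {0<..}. \<theta> t \<in> D_fun \<Omega> w lam (s / 2)"
    using LH by (simp add: leray_hopf_solution_def bochner_L2_def)
  then have ae: "AE t in lebesgue_on {0<..}. \<bar>?V t * \<phi> t\<bar> \<le> ?K * \<phi> t"
  proof (rule AE_mp, intro AE_I2 impI)
    fix t assume t: "t \<in> space (lebesgue_on {0<..})" "\<theta> t \<in> D_fun \<Omega> w lam (s / 2)"
    have "\<bar>?V t\<bar> \<le> nrm (\<theta> t) * nrm (Lam \<Omega> w lam s \<psi>)" by (rule Lam_self_adjoint_bound[OF t(2) \<psi> s])
    also have "\<dots> \<le> ?K" using t(1) by (intro mult_right_mono LH_bound) auto
    finally show "\<bar>?V t * \<phi> t\<bar> \<le> ?K * \<phi> t" using \<phi>(2)[of t] by (simp add: abs_mult mult_right_mono)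
  qed
  have "\<bar>LINT t|lebesgue_on {0<..}. ?V t * \<phi> t\<bar> \<le> (LINT t|lebesgue_on {0<..}. ?K * \<phi> t)"
    by (rule abs_integral_le_AE[OF _ ae]) (use int in simp)
  then have "\<nu> * \<bar>LINT t|lebesgue_on {0<..}. ?V t * \<phi> t\<bar> \<le> \<nu> * ?K * (LINT t|lebesgue_on {0<..}. \<phi> t)"
    using \<nu> by (simp add: mult.assoc mult_left_mono)
  moreover have "(LINT t|lebesgue_on {0<..}. inner (\<theta> t) \<psi> * deriv \<phi> t) + (LINT t|lebesgue_on {0<..}. NL (\<theta> t) \<psi> * \<phi> t)
      = \<nu> * (LINT t|lebesgue_on {0<..}. ?V t * \<phi> t)"
    using eq unfolding Y by (simp add: L2_inner_def)
  ultimately show "\<bar>(LINT t|lebesgue_on {0<..}. inner (\<theta> t) \<psi> * deriv \<phi> t) + (LINT t|lebesgue_on {0<..}. NL (\<theta> t) \<psi> * \<phi> t)\<bar>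
      \<le> \<nu> * ?K * (LINT t|lebesgue_on {0<..}. \<phi> t)"
    using \<nu> by (simp add: abs_mult)
qed

text \<open>For \<open>s \<le> 1\<close> the exponent (s - 1)/2 is nonpositive, so the operator in
  the dissipation is bounded on L^2 and its norm is governed by the lowest eigenvalue. The
  dissipation up to time \<open>t\<close> is then at most a constant times \<open>t\<close>; the
  factor 2 undoes the halves in the balance.\<close>

lemma LH_Hamiltonian:
  assumes s1: "s \<le> 1"
  shows "AE t in lebesgue_on {0<..}.
    \<bar>Hn (cf (\<theta> t)) - Hn (cf \<theta>0)\<bar> \<le> 2 * \<nu> * ((lam 0 powr ((s - 1) / 2 / 2))\<^sup>2 * (nrm \<theta>0)\<^sup>2 * t)"
proof -
  let ?\<sigma> = "(s - 1) / 2"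
  let ?K = "(lam 0 powr (?\<sigma> / 2))\<^sup>2 * (nrm \<theta>0)\<^sup>2"
  let ?E = "\<lambda>t. LINT r|lebesgue_on {0<..<t}. LINT x|MO. (Lam \<Omega> w lam ?\<sigma> (\<theta> r) x)\<^sup>2"
  have le: "(LINT x|MO. (Lam \<Omega> w lam ?\<sigma> (\<theta> r) x)\<^sup>2) \<le> ?K" if "r \<ge> 0" for r
  proof -
    note sm = summable_cf_square[OF LH_L2[OF that]]
    note p = summable_powr_negative[of ?\<sigma>, OF _ sm]
    have \<sigma>0: "?\<sigma> \<le> 0" using s1 by simp
    note L = Lam[OF p(1)[OF \<sigma>0]]
    have "(LINT x|MO. (Lam \<Omega> w lam ?\<sigma> (\<theta> r) x)\<^sup>2) = (nrm (Lam \<Omega> w lam ?\<sigma> (\<theta> r)))\<^sup>2"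
      by (simp add: L2_norm_square_integral)
    also have "\<dots> = (\<Sum>j. (lam j powr (?\<sigma> / 2) * cf (\<theta> r) j)\<^sup>2)"
      using sums_unique[OF Parseval_square[OF L(1)]] unfolding L(2) by simp
    also have "\<dots> \<le> (lam 0 powr (?\<sigma> / 2))\<^sup>2 * (nrm (\<theta> r))\<^sup>2"
      using p(2)[OF \<sigma>0] Parseval_square[OF LH_L2[OF that]] by (simp add: sums_iff)
    also have "\<dots> \<le> ?K" by (intro mult_left_mono power_mono LH_bound that) auto
    finally show ?thesis .
  qed
  have E: "0 \<le> ?E t \<and> ?E t \<le> ?K * t" if t: "t > 0" for t
  proof
    show "0 \<le> ?E t" by (intro integral_nonneg_AE AE_I2) auto
    have fin: "{0<..<t} \<in> lmeasurable" by (intro lmeasurable_open) auto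
    have "\<bar>?E t\<bar> \<le> (LINT r|lebesgue_on {0<..<t}. ?K)"
    proof (rule abs_integral_le_AE)
      show "integrable (lebesgue_on {0<..<t}) (\<lambda>r. ?K)"
        by (rule finite_measure.integrable_const[OF finite_measure_lebesgue_on[OF fin]])
      show "AE r in lebesgue_on {0<..<t}. \<bar>LINT x|MO. (Lam \<Omega> w lam ?\<sigma> (\<theta> r) x)\<^sup>2\<bar> \<le> ?K"
        using le by (intro AE_I2) auto
    qed
    also have "\<dots> = ?K * t" using t by (simp add: measure_restrict_space mult.commute)
    finally show "?E t \<le> ?K * t" by linarith
  qed
  have "AE t in lebesgue_on {0<..}. (D_norm lam (- 1 / 2) (cf (\<theta> t)))\<^sup>2 / 2 + \<nu> * ?E t = (D_norm lam (- 1 / 2) (cf \<theta>0))\<^sup>2 / 2"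
    using LH by (simp add: leray_hopf_solution_def)
  then show ?thesis
  proof (rule AE_mp, intro AE_I2 impI)
    fix t assume "t \<in> space (lebesgue_on {0<..})" and
      eq: "(D_norm lam (- 1 / 2) (cf (\<theta> t)))\<^sup>2 / 2 + \<nu> * ?E t = (D_norm lam (- 1 / 2) (cf \<theta>0))\<^sup>2 / 2"
    then have "t > 0" by simp
    from E[OF this] have "0 \<le> \<nu> * ?E t" "\<nu> * ?E t \<le> \<nu> * (?K * t)" using \<nu> by (auto intro: mult_left_mono)
    moreover have "Hn (cf (\<theta> t)) = Hn (cf \<theta>0) - 2 * (\<nu> * ?E t)" using eq unfolding Hn_def by linarith
    ultimately show "\<bar>Hn (cf (\<theta> t)) - Hn (cf \<theta>0)\<bar> \<le> 2 * \<nu> * (?K * t)" by (simp only: mult.assoc)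
  qed
qed

end

end

section \<open>The inviscid limit\<close>

text \<open>The bounds \<open>C\<close> and \<open>V\<close> are parameters, so that the constants
  below can be chosen independently of the index of the sequence.\<close>

locale inviscid_limit = dirichlet \<Omega> w lam for \<Omega> w lam +
  fixes s T :: real and \<nu> :: "nat \<Rightarrow> real" and \<theta>0 :: "nat \<Rightarrow> real^2 \<Rightarrow> real"
    and \<theta>\<nu> :: "nat \<Rightarrow> real \<Rightarrow> real^2 \<Rightarrow> real" and \<theta> :: "real \<Rightarrow> real^2 \<Rightarrow> real" and r :: "nat \<Rightarrow> nat"
    and C V :: real
  assumes s: "0 < s" "s \<le> 2"
    and \<nu>_pos: "\<And>n. 0 < \<nu> n" and \<nu>_lim: "\<nu> \<longlonglongrightarrow> 0" and \<nu>_le: "\<And>n. \<nu> n \<le> V"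
    and \<theta>0_bound: "\<And>n. L2_norm \<Omega> (\<theta>0 n) \<le> C"
    and LH: "\<And>n. leray_hopf_solution \<Omega> w lam s (\<nu> n) (\<theta>0 n) (\<theta>\<nu> n)"
    and T: "0 < T"
    and r: "strict_mono r"
    and weak_limit: "weakly_converges_L2_L2 T \<Omega> (\<lambda>k. \<theta>\<nu> (r k)) \<theta>"
begin

section \<open>Uniform estimates in time\<close>

abbreviation u where "u k \<equiv> \<theta>\<nu> (r k)"

lemma C_nonneg: "C \<ge> 0"
  using \<theta>0_bound[of 0] L2_norm_nonneg[of \<Omega> "\<theta>0 0"] by linarith

lemma u_L2: "t \<ge> 0 \<Longrightarrow> u n t \<in> L2 \<Omega>"
  by (rule LH_L2[OF s \<nu>_pos LH])

lemma u_bound: "t \<ge> 0 \<Longrightarrow> nrm (u n t) \<le> C"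
  using LH_bound[OF s \<nu>_pos LH, of t "r n"] \<theta>0_bound[of "r n"] by linarith

lemma u_continuous: "g \<in> L2 \<Omega> \<Longrightarrow> continuous_on {0..} (\<lambda>t. inner (u n t) g)"
  by (rule LH_continuous[OF s \<nu>_pos LH])

lemma u_NL_continuous: "\<psi> \<in> test_functions \<Omega> \<Longrightarrow> continuous_on {0..} (\<lambda>t. NL (u n t) \<psi>)"
  by (rule LH_NL_continuous[OF s \<nu>_pos LH])

lemma u_increment:
  assumes "\<psi> \<in> test_functions \<Omega>" "0 < a" "a < b"
  shows "\<bar>inner (u n b) \<psi> - inner (u n a) \<psi> - integral {a..b} (\<lambda>t. NL (u n t) \<psi>)\<bar>
    \<le> \<nu> (r n) * (C * nrm (Lam \<Omega> w lam s \<psi>)) * (b - a)"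
proof -
  have "\<nu> (r n) * (nrm (\<theta>0 (r n)) * nrm (Lam \<Omega> w lam s \<psi>)) * (b - a) \<le> \<nu> (r n) * (C * nrm (Lam \<Omega> w lam s \<psi>)) * (b - a)"
    using assms(3) less_imp_le[OF \<nu>_pos[of "r n"]] by (intro mult_right_mono mult_left_mono \<theta>0_bound) auto
  then show ?thesis using LH_increment[OF s \<nu>_pos LH assms, of "r n"] by linarith
qed

lemma u_NL_bound:
  assumes "\<psi> \<in> test_functions \<Omega>"
  obtains M where "M \<ge> 0" "\<And>n t. t \<ge> 0 \<Longrightarrow> \<bar>NL (u n t) \<psi>\<bar> \<le> M"
proof -
  obtain B where B: "B \<ge> 0" "\<And>a b x. \<bar>pd (ex a) (pd (ex b) \<psi>) x\<bar> \<le> B"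
    using second_derivatives_bounded[OF assms] by blast
  show thesis
  proof (rule that[of "B * (C\<^sup>2 / \<mu> 0)"])
    show "B * (C\<^sup>2 / \<mu> 0) \<ge> 0" using B(1) \<mu>_pos[of 0] by simp
    show "\<bar>NL (u n t) \<psi>\<bar> \<le> B * (C\<^sup>2 / \<mu> 0)" if "t \<ge> 0" for n t
    proof -
      have "\<bar>NL (u n t) \<psi>\<bar> \<le> B * ((nrm (u n t))\<^sup>2 / \<mu> 0)" by (rule NL_bound[OF u_L2[OF that] assms B(2,1)])
      also have "\<dots> \<le> B * (C\<^sup>2 / \<mu> 0)"
        using \<mu>_pos[of 0] by (intro mult_left_mono divide_right_mono power_mono u_bound that B) auto
      finally show ?thesis .
    qed
  qed
qed

text \<open>The nonlinear term is bounded uniformly in \<open>n\<close> and \<open>t\<close>, and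
  the viscous error is at most \<open>V\<close> times a constant; together they give one Lipschitz
  constant for all \<open>n\<close>.\<close>

lemma u_Lipschitz:
  assumes \<psi>: "\<psi> \<in> test_functions \<Omega>"
  obtains L where "L \<ge> 0" "\<And>n a b. a \<ge> 0 \<Longrightarrow> b \<ge> 0 \<Longrightarrow> \<bar>inner (u n b) \<psi> - inner (u n a) \<psi>\<bar> \<le> L * \<bar>b - a\<bar>"
proof -
  obtain M where M: "M \<ge> 0" "\<And>n t. t \<ge> 0 \<Longrightarrow> \<bar>NL (u n t) \<psi>\<bar> \<le> M" using u_NL_bound[OF \<psi>] by blast
  define K where "K = C * nrm (Lam \<Omega> w lam s \<psi>)"
  have K: "K \<ge> 0" using C_nonneg by (simp add: K_def)
  define L where "L = M + V * K"
  have V: "V \<ge> 0" using \<nu>_le[of 0] \<nu>_pos[of 0] by linarith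
  have L: "L \<ge> 0" using M(1) V K by (simp add: L_def)
  have 1: "\<bar>inner (u n b) \<psi> - inner (u n a) \<psi>\<bar> \<le> L * (b - a)" if "0 < a" "a < b" for n a b
  proof -
    have "\<bar>integral {a..b} (\<lambda>t. NL (u n t) \<psi>)\<bar> \<le> M * (b - a)"
      by (rule integral_abs_le_const[OF continuous_on_subset[OF u_NL_continuous[OF \<psi>]]]) (use that M in auto)
    moreover have "\<nu> (r n) * K * (b - a) \<le> V * K * (b - a)"
      using K \<nu>_le that by (intro mult_right_mono) auto
    ultimately show ?thesis
      using u_increment[OF \<psi> that, of n] unfolding K_def[symmetric] L_def distrib_right by linarith
  qed
  \<comment> \<open>Time 0 is reached from positive times by weak continuity.\<close>
  have 2: "\<bar>inner (u n b) \<psi> - inner (u n a) \<psi>\<bar> \<le> L * (b - a)" if ab: "0 \<le> a" "a < b" for n a b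
  proof -
    have cl: "closure {0<..<b} = {0..b}" using ab by (intro closure_greaterThanLessThan) auto
    let ?f = "\<lambda>a. \<bar>inner (u n b) \<psi> - inner (u n a) \<psi>\<bar> - L * (b - a)"
    have "continuous_on (closure {0<..<b}) ?f"
      unfolding cl by (intro continuous_intros continuous_on_subset[OF u_continuous[OF test_in_L2[OF \<psi>]]]) auto
    then have "?f a \<le> 0"
      by (rule continuous_le_on_closure) (use cl ab 1 in auto)
    then show ?thesis by simp
  qed
  show thesis
  proof (rule that[OF L])
    fix n a b assume "(a::real) \<ge> 0" "(b::real) \<ge> 0"
    then show "\<bar>inner (u n b) \<psi> - inner (u n a) \<psi>\<bar> \<le> L * \<bar>b - a\<bar>"
      using 2[of a b n] 2[of b a n] by (cases a b rule: linorder_cases) auto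
  qed
qed

text \<open>The eigenfunctions need not be regular enough to serve as test functions in a uniform way;
  density of \<open>C\<^sub>c\<^sup>\<infinity>(\<Omega>)\<close> in \<open>L\<^sup>2(\<Omega>)\<close> is enough for equicontinuity of their coefficients.\<close>

lemma u_equicontinuous:
  assumes e: "e > 0"
  obtains \<delta> where "\<delta> > 0" "\<And>n a b. a \<ge> 0 \<Longrightarrow> b \<ge> 0 \<Longrightarrow> \<bar>a - b\<bar> < \<delta> \<Longrightarrow> \<bar>cf (u n a) j - cf (u n b) j\<bar> < e"
proof -
  define e' where "e' = e / (4 * (C + 1))"
  have e': "e' > 0" "C * e' \<le> e / 4" using e C_nonneg by (auto simp: e'_def field_simps)
  obtain \<psi> where \<psi>: "\<psi> \<in> test_functions \<Omega>" "nrm (\<lambda>x. \<psi> x - w j x) < e'"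
    using L2_approx_test[OF w_L2 e'(1)] by blast
  obtain L where L: "L \<ge> 0" "\<And>n a b. a \<ge> 0 \<Longrightarrow> b \<ge> 0 \<Longrightarrow> \<bar>inner (u n b) \<psi> - inner (u n a) \<psi>\<bar> \<le> L * \<bar>b - a\<bar>"
    using u_Lipschitz[OF \<psi>(1)] by blast
  define \<delta> where "\<delta> = e / (4 * (L + 1))"
  have \<delta>: "\<delta> > 0" "L * \<delta> \<le> e / 4" using e L(1) by (auto simp: \<delta>_def field_simps)
  show thesis
  proof (rule that[OF \<delta>(1)])
    fix n a b assume ab: "(a::real) \<ge> 0" "(b::real) \<ge> 0" "\<bar>a - b\<bar> < \<delta>"
    have near: "\<bar>inner (u n t) \<psi> - cf (u n t) j\<bar> \<le> e / 4" if "t \<ge> 0" for t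
    proof -
      have "inner (u n t) \<psi> - cf (u n t) j = inner (u n t) (\<lambda>x. \<psi> x - w j x)"
        by (simp add: coef_def L2_inner_diff_right u_L2[OF that] test_in_L2[OF \<psi>(1)])
      also have "\<bar>\<dots>\<bar> \<le> nrm (u n t) * nrm (\<lambda>x. \<psi> x - w j x)"
        by (rule L2_Cauchy_Schwarz[OF u_L2[OF that] L2_diff[OF test_in_L2[OF \<psi>(1)] w_L2]])
      also have "\<dots> \<le> C * e'" by (intro mult_mono u_bound that less_imp_le[OF \<psi>(2)] C_nonneg) simp
      finally show ?thesis using e'(2) by linarith
    qed
    have "L * \<bar>b - a\<bar> \<le> L * \<delta>" using ab(3) L(1) by (intro mult_left_mono) auto
    then show "\<bar>cf (u n a) j - cf (u n b) j\<bar> < e"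
      using near[OF ab(1)] near[OF ab(2)] L(2)[OF ab(1,2), of n] \<delta>(2) e by linarith
  qed
qed

text \<open>Test elements for the weak convergence. Since \<open>a\<close> takes finitely many
  values, the function is its own constant sequence of finitely valued approximants. Indicators of
  intervals and signs are the two uses.\<close>

lemma simple_in_L2_L2:
  assumes a: "a \<in> borel_measurable (lebesgue_on {0<..<T})" "finite (a ` {0<..<T})"
  shows "(\<lambda>t x. a t * w j x) \<in> L2_L2 T \<Omega>"
  unfolding bochner_L2_def
proof (intro CollectI conjI)
  let ?f = "\<lambda>t x. a t * w j x"
  have fin: "{0<..<T} \<in> lmeasurable" by (intro lmeasurable_open) auto
  show "AE t in lebesgue_on {0<..<T}. ?f t \<in> L2 \<Omega>" by (intro AE_I2 L2_cmult w_L2)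
  show "\<exists>\<sigma>. (\<forall>k::nat. finite (\<sigma> k ` {0<..<T}) \<and> \<sigma> k ` {0<..<T} \<subseteq> L2 \<Omega> \<and>
             (\<forall>v. {t \<in> {0<..<T}. \<sigma> k t = v} \<in> sets (lebesgue_on {0<..<T}))) \<and>
        (AE t in lebesgue_on {0<..<T}. (\<lambda>k. nrm (\<lambda>x. \<sigma> k t x - ?f t x)) \<longlonglongrightarrow> 0)"
  proof (intro exI[of _ "\<lambda>_. ?f"] conjI allI)
    have "?f ` {0<..<T} = (\<lambda>c x. c * w j x) ` (a ` {0<..<T})" by (simp add: image_image)
    then show "finite (?f ` {0<..<T})" using a(2) by simp
    show "?f ` {0<..<T} \<subseteq> L2 \<Omega>" by (auto intro: L2_cmult)
    fix v
    define D where "D = {c \<in> a ` {0<..<T}. (\<lambda>x. c * w j x) = v}"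
    have "finite D" using a(2) by (simp add: D_def)
    then have "D \<in> sets borel" by (intro borel_closed finite_imp_closed)
    then have "a -` D \<inter> space (lebesgue_on {0<..<T}) \<in> sets (lebesgue_on {0<..<T})"
      by (rule measurable_sets[OF a(1)])
    also have "a -` D \<inter> space (lebesgue_on {0<..<T}) = {t \<in> {0<..<T}. ?f t = v}" by (auto simp: D_def)
    finally show "{t \<in> {0<..<T}. ?f t = v} \<in> sets (lebesgue_on {0<..<T})" .
  qed (simp add: L2_norm_def)
  obtain M where M0: "\<forall>y\<in>a ` {0<..<T}. norm y \<le> M"
    using finite_imp_bounded[OF a(2)] unfolding bounded_iff by blast
  have M: "\<bar>a t\<bar> \<le> M" if "t \<in> {0<..<T}" for t
    using M0[rule_format, OF imageI[OF that]] by simp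
  have "(\<integral>\<^sup>+t. ennreal ((nrm (?f t))\<^sup>2) \<partial>lebesgue_on {0<..<T}) \<le> (\<integral>\<^sup>+t. ennreal ((M * nrm (w j))\<^sup>2) \<partial>lebesgue_on {0<..<T})"
  proof (rule nn_integral_mono)
    fix t assume "t \<in> space (lebesgue_on {0<..<T})"
    then have "\<bar>a t\<bar> * nrm (w j) \<le> M * nrm (w j)" using M by (intro mult_right_mono) auto
    then show "ennreal ((nrm (?f t))\<^sup>2) \<le> ennreal ((M * nrm (w j))\<^sup>2)"
      by (intro ennreal_leI power_mono) (auto simp: L2_norm_cmult)
  qed
  also have "\<dots> = ennreal ((M * nrm (w j))\<^sup>2) * emeasure (lebesgue_on {0<..<T}) {0<..<T}"
    by (simp add: nn_integral_const)
  also have "\<dots> < \<infinity>"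
    using T by (simp add: emeasure_restrict_space ennreal_mult_less_top)
  finally show "(\<integral>\<^sup>+t. ennreal ((nrm (?f t))\<^sup>2) \<partial>lebesgue_on {0<..<T}) < \<infinity>" .
qed

lemma averages_converge:
  assumes "a \<in> borel_measurable (lebesgue_on {0<..<T})" "finite (a ` {0<..<T})"
  shows "(\<lambda>n. LINT t|lebesgue_on {0<..<T}. a t * cf (u n t) j) \<longlonglongrightarrow> (LINT t|lebesgue_on {0<..<T}. a t * cf (\<theta> t) j)"
proof -
  have eq: "inner f (\<lambda>x. a t * w j x) = a t * cf f j" for f t
    by (simp add: L2_inner_cmult_right coef_def)
  have "\<forall>h\<in>L2_L2 T \<Omega>. (\<lambda>n. LINT t|lebesgue_on {0<..<T}. inner (u n t) (h t))
      \<longlonglongrightarrow> (LINT t|lebesgue_on {0<..<T}. inner (\<theta> t) (h t))"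
    using weak_limit by (simp add: weakly_converges_L2_L2_def)
  from bspec[OF this simple_in_L2_L2[OF assms, of j]] show ?thesis unfolding eq .
qed

section \<open>Convergence at every time\<close>

lemma cf_u_continuous: "A \<subseteq> {0..} \<Longrightarrow> continuous_on A (\<lambda>t. cf (u n t) j)"
  unfolding coef_def by (rule continuous_on_subset[OF u_continuous[OF w_L2]])

definition \<Theta> :: "real \<Rightarrow> nat \<Rightarrow> real" where "\<Theta> t j = lim (\<lambda>n. cf (u n t) j)"

text \<open>Weak convergence tested with the indicator of an interval times \<open>w j\<close> gives
  convergence of the averages, and equicontinuity turns this into convergence at each time,
  endpoints included.\<close>

lemma \<Theta>_limit:
  assumes t: "t \<in> {0..T}"
  shows "(\<lambda>n. cf (u n t) j) \<longlonglongrightarrow> \<Theta> t j"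
proof -
  have "convergent (\<lambda>n. cf (u n t) j)"
  proof (rule convergent_of_averages[OF cf_u_continuous _ _ t T])
    show "\<exists>\<delta>>0. \<forall>n. \<forall>s\<in>{0..T}. \<forall>t\<in>{0..T}. \<bar>s - t\<bar> < \<delta> \<longrightarrow> \<bar>cf (u n s) j - cf (u n t) j\<bar> < e" if "e > 0" for e
      by (rule u_equicontinuous[OF that, of j]) (auto intro!: exI)
    fix a b assume ab: "0 < a" "a < b" "b < T"
    let ?I = "\<lambda>t. indicator {a..b} t :: real"
    have "?I \<in> borel_measurable (lebesgue_on {0<..<T})" by (intro measurable_restrict_space1 measurable_completion) simp
    moreover have "finite (?I ` {0<..<T})" by (rule finite_subset[of _ "{0, 1}"]) (auto simp: indicator_def)
    moreover have "(LINT t|lebesgue_on {0<..<T}. ?I t * cf (u n t) j) = integral {a..b} (\<lambda>t. cf (u n t) j)" for n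
    proof -
      have "continuous_on {a..b} (\<lambda>t. cf (u n t) j)" by (rule cf_u_continuous) (use ab in auto)
      then have "continuous_on {a..b} (\<lambda>t. ?I t * cf (u n t) j)" by (rule continuous_on_eq) simp
      then have "(LINT t|lebesgue_on {0<..<T}. ?I t * cf (u n t) j) = integral {a..b} (\<lambda>t. ?I t * cf (u n t) j)"
        by (rule integral_lebesgue_on_compact_support(2)) (use ab in auto)
      also have "\<dots> = integral {a..b} (\<lambda>t. cf (u n t) j)"
        by (rule Henstock_Kurzweil_Integration.integral_cong) simp
      finally show ?thesis .
    qed
    ultimately show "convergent (\<lambda>n. integral {a..b} (\<lambda>t. cf (u n t) j))"
      using averages_converge[of ?I j] by (auto simp: convergent_def)
  qed auto
  then show ?thesis unfolding \<Theta>_def by (simp add: convergent_LIMSEQ_iff)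
qed

lemma \<Theta>_square:
  assumes t: "t \<in> {0..T}"
  shows "summable (\<lambda>j. (\<Theta> t j)\<^sup>2)" "(\<Sum>j. (\<Theta> t j)\<^sup>2) \<le> C\<^sup>2"
proof -
  have le: "(\<Sum>j<N. (\<Theta> t j)\<^sup>2) \<le> C\<^sup>2" for N
  proof (rule LIMSEQ_le_const2)
    show "(\<lambda>n. \<Sum>j<N. (cf (u n t) j)\<^sup>2) \<longlonglongrightarrow> (\<Sum>j<N. (\<Theta> t j)\<^sup>2)"
      by (intro tendsto_intros \<Theta>_limit t)
    have "(\<Sum>j<N. (cf (u n t) j)\<^sup>2) \<le> C\<^sup>2" for n
    proof -
      have t0: "t \<ge> 0" using t by simp
      note P = Parseval_square[OF u_L2[OF t0, of n]]
      have "(\<Sum>j<N. (cf (u n t) j)\<^sup>2) \<le> (nrm (u n t))\<^sup>2"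
        using sum_le_suminf[OF sums_summable[OF P], of "{..<N}"] sums_unique[OF P] by simp
      also have "\<dots> \<le> C\<^sup>2" by (intro power_mono u_bound t0) simp
      finally show ?thesis .
    qed
    then show "\<exists>k. \<forall>n\<ge>k. (\<Sum>j<N. (cf (u n t) j)\<^sup>2) \<le> C\<^sup>2" by blast
  qed
  show sm: "summable (\<lambda>j. (\<Theta> t j)\<^sup>2)" by (rule summableI_nonneg_bounded[OF _ le]) simp
  show "(\<Sum>j. (\<Theta> t j)\<^sup>2) \<le> C\<^sup>2" by (rule suminf_le_const[OF sm le])
qed

text \<open>The limit as an L^2 function at every time of the closed interval, whereas
  \<open>\<theta>\<close> is determined only almost everywhere in time.\<close>

definition \<xi> :: "real \<Rightarrow> real^2 \<Rightarrow> real" where "\<xi> t = (SOME f. f \<in> L2 \<Omega> \<and> cf f = \<Theta> t)"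

lemma \<xi>:
  assumes t: "t \<in> {0..T}"
  shows "\<xi> t \<in> L2 \<Omega>" "cf (\<xi> t) = \<Theta> t" "nrm (\<xi> t) \<le> C"
proof -
  obtain f where "f \<in> L2 \<Omega> \<and> cf f = \<Theta> t" using Riesz_Fischer_cf[OF \<Theta>_square(1)[OF t]] by blast
  then have "\<xi> t \<in> L2 \<Omega> \<and> cf (\<xi> t) = \<Theta> t" unfolding \<xi>_def by (rule someI[where P="\<lambda>f. f \<in> L2 \<Omega> \<and> cf f = \<Theta> t"])
  then show L: "\<xi> t \<in> L2 \<Omega>" and c: "cf (\<xi> t) = \<Theta> t" by auto
  have "(nrm (\<xi> t))\<^sup>2 \<le> C\<^sup>2"
    using sums_unique[OF Parseval_square[OF L]] \<Theta>_square(2)[OF t] by (simp add: c)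
  then show "nrm (\<xi> t) \<le> C" using C_nonneg by (rule power2_le_imp_le)
qed

lemma \<Theta>_continuous:
  assumes t: "\<And>n. t n \<in> {0..T}" "t0 \<in> {0..T}" "t \<longlonglongrightarrow> t0"
  shows "(\<lambda>n. \<Theta> (t n) j) \<longlonglongrightarrow> \<Theta> t0 j"
proof (rule LIMSEQ_I)
  fix e :: real assume e: "e > 0"
  obtain \<delta> where \<delta>: "\<delta> > 0" "\<And>n a b. a \<ge> 0 \<Longrightarrow> b \<ge> 0 \<Longrightarrow> \<bar>a - b\<bar> < \<delta> \<Longrightarrow> \<bar>cf (u n a) j - cf (u n b) j\<bar> < e / 2"
    using u_equicontinuous[of "e / 2" j] e by auto
  have le: "\<bar>\<Theta> a j - \<Theta> b j\<bar> \<le> e / 2" if "a \<in> {0..T}" "b \<in> {0..T}" "\<bar>a - b\<bar> < \<delta>" for a b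
  proof (rule LIMSEQ_le_const2)
    show "(\<lambda>n. \<bar>cf (u n a) j - cf (u n b) j\<bar>) \<longlonglongrightarrow> \<bar>\<Theta> a j - \<Theta> b j\<bar>"
      by (intro tendsto_intros \<Theta>_limit that)
    show "\<exists>N. \<forall>n\<ge>N. \<bar>cf (u n a) j - cf (u n b) j\<bar> \<le> e / 2"
      using \<delta>(2)[of a b] that by (auto intro!: exI[of _ 0] less_imp_le)
  qed
  obtain N where "\<And>n. n \<ge> N \<Longrightarrow> norm (t n - t0) < \<delta>" using LIMSEQ_D[OF t(3) \<delta>(1)] by auto
  then have "\<bar>\<Theta> (t n) j - \<Theta> t0 j\<bar> < e" if "n \<ge> N" for n
    using le[OF t(1)[of n] t(2)] that e by fastforce
  then show "\<exists>no. \<forall>n\<ge>no. norm (\<Theta> (t n) j - \<Theta> t0 j) < e" by auto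
qed

lemma \<xi>_inner_tendsto:
  assumes t: "\<And>n. t n \<in> {0..T}" "t0 \<in> {0..T}" "t \<longlonglongrightarrow> t0"
    and v: "\<And>n. v n \<in> L2 \<Omega>" "v' \<in> L2 \<Omega>" "(\<lambda>n. nrm (\<lambda>x. v n x - v' x)) \<longlonglongrightarrow> 0"
  shows "(\<lambda>n. inner (\<xi> (t n)) (v n)) \<longlonglongrightarrow> inner (\<xi> t0) v'"
  by (rule weak_strong[OF \<xi>(1)[OF t(1)] \<xi>(3)[OF t(1)] \<xi>(1)[OF t(2)] _ v])
     (use \<Theta>_continuous[OF t] \<xi>(2) t in simp)

lemma \<xi>_NL_continuous:
  assumes \<psi>: "\<psi> \<in> test_functions \<Omega>"
  shows "continuous_on {0..T} (\<lambda>t. NL (\<xi> t) \<psi>)"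
  unfolding continuous_on_sequentially
proof (intro allI ballI impI)
  fix t :: "nat \<Rightarrow> real" and t0 assume t0: "t0 \<in> {0..T}" and "(\<forall>n. t n \<in> {0..T}) \<and> t \<longlonglongrightarrow> t0"
  then have t: "\<And>n. t n \<in> {0..T}" "t \<longlonglongrightarrow> t0" by auto
  have "(\<lambda>n. NL (\<xi> (t n)) \<psi>) \<longlonglongrightarrow> NL (\<xi> t0) \<psi>"
    by (rule NL_tendsto[OF \<xi>(1)[OF t(1)] \<xi>(3)[OF t(1)] \<xi>(1)[OF t0] _ \<psi>])
       (use \<Theta>_continuous[OF t(1) t0 t(2)] \<xi>(2) t t0 in simp)
  then show "((\<lambda>t. NL (\<xi> t) \<psi>) \<circ> t) \<longlonglongrightarrow> NL (\<xi> t0) \<psi>" by (simp add: o_def)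
qed

lemma u_NL_tendsto:
  assumes "\<psi> \<in> test_functions \<Omega>" "t \<in> {0..T}"
  shows "(\<lambda>n. NL (u n t) \<psi>) \<longlonglongrightarrow> NL (\<xi> t) \<psi>"
  by (rule NL_tendsto[OF u_L2 u_bound \<xi>(1)[OF assms(2)] _ assms(1)])
     (use assms(2) \<Theta>_limit \<xi>(2) in auto)

lemma u_inner_tendsto:
  assumes "g \<in> L2 \<Omega>" "t \<in> {0..T}"
  shows "(\<lambda>n. inner (u n t) g) \<longlonglongrightarrow> inner (\<xi> t) g"
  by (rule weak_strong[OF u_L2 u_bound \<xi>(1)[OF assms(2)] _ assms(1) assms(1)])
     (use assms(2) \<Theta>_limit \<xi>(2) in \<open>auto simp: L2_norm_def\<close>)

text \<open>In \<open>u_increment\<close> the viscous error vanishes with the viscosity. The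
  nonlinear terms converge at each time by \<open>NL_tendsto\<close> and are uniformly bounded, so
  their time integrals converge.\<close>

lemma \<xi>_increment:
  assumes \<psi>: "\<psi> \<in> test_functions \<Omega>" and ab: "0 < a" "a < b" "b \<le> T"
  shows "inner (\<xi> b) \<psi> - inner (\<xi> a) \<psi> = integral {a..b} (\<lambda>t. NL (\<xi> t) \<psi>)"
proof -
  obtain M where M: "M \<ge> 0" "\<And>n t. t \<ge> 0 \<Longrightarrow> \<bar>NL (u n t) \<psi>\<bar> \<le> M" using u_NL_bound[OF \<psi>] by blast
  have l1: "(\<lambda>n. integral {a..b} (\<lambda>t. NL (u n t) \<psi>)) \<longlonglongrightarrow> integral {a..b} (\<lambda>t. NL (\<xi> t) \<psi>)"
  proof (rule dominated_convergence(2))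
    show "(\<lambda>t. NL (u n t) \<psi>) integrable_on {a..b}" for n
      by (intro integrable_continuous_real continuous_on_subset[OF u_NL_continuous[OF \<psi>]]) (use ab in auto)
    show "(\<lambda>t. M) integrable_on {a..b}" by (rule integrable_const_ivl)
    show "norm (NL (u n t) \<psi>) \<le> M" if "t \<in> {a..b}" for n t using M(2)[of t n] that ab by auto
    show "(\<lambda>n. NL (u n t) \<psi>) \<longlonglongrightarrow> NL (\<xi> t) \<psi>" if "t \<in> {a..b}" for t
      by (rule u_NL_tendsto[OF \<psi>]) (use that ab in auto)
  qed
  have l2: "(\<lambda>n. inner (u n b) \<psi> - inner (u n a) \<psi>) \<longlonglongrightarrow> inner (\<xi> b) \<psi> - inner (\<xi> a) \<psi>"
    by (intro tendsto_diff u_inner_tendsto test_in_L2[OF \<psi>]) (use ab in auto)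
  have "(\<lambda>n. inner (u n b) \<psi> - inner (u n a) \<psi> - integral {a..b} (\<lambda>t. NL (u n t) \<psi>))
      \<longlonglongrightarrow> inner (\<xi> b) \<psi> - inner (\<xi> a) \<psi> - integral {a..b} (\<lambda>t. NL (\<xi> t) \<psi>)"
    by (rule tendsto_diff[OF l2 l1])
  moreover have "(\<lambda>n. inner (u n b) \<psi> - inner (u n a) \<psi> - integral {a..b} (\<lambda>t. NL (u n t) \<psi>)) \<longlonglongrightarrow> 0"
  proof (rule Lim_null_comparison)
    have "(\<lambda>n. \<nu> (r n)) \<longlonglongrightarrow> 0" using LIMSEQ_subseq_LIMSEQ[OF \<nu>_lim r] by (simp add: o_def)
    then have "(\<lambda>n. \<nu> (r n) * (C * nrm (Lam \<Omega> w lam s \<psi>)) * (b - a)) \<longlonglongrightarrow> 0 * (C * nrm (Lam \<Omega> w lam s \<psi>)) * (b - a)"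
      by (intro tendsto_intros)
    then show "(\<lambda>n. \<nu> (r n) * (C * nrm (Lam \<Omega> w lam s \<psi>)) * (b - a)) \<longlonglongrightarrow> 0" by simp
    show "\<forall>\<^sub>F n in sequentially. norm (inner (u n b) \<psi> - inner (u n a) \<psi> - integral {a..b} (\<lambda>t. NL (u n t) \<psi>))
        \<le> \<nu> (r n) * (C * nrm (Lam \<Omega> w lam s \<psi>)) * (b - a)"
      using u_increment[OF \<psi> ab(1,2)] by (auto intro!: always_eventually)
  qed
  ultimately show ?thesis using LIMSEQ_unique by fastforce
qed

lemma \<xi>_derivative:
  assumes \<psi>: "\<psi> \<in> test_functions \<Omega>" and t: "0 < t" "t < T"
  shows "((\<lambda>\<tau>. inner (\<xi> \<tau>) \<psi>) has_real_derivative NL (\<xi> t) \<psi>) (at t)"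
proof -
  define a where "a = t / 2"
  have a: "0 < a" "a < t" using t by (auto simp: a_def)
  have "((\<lambda>x. integral {a..x} (\<lambda>t. NL (\<xi> t) \<psi>)) has_real_derivative NL (\<xi> t) \<psi>) (at t within {a..T})"
    by (rule integral_has_real_derivative[OF continuous_on_subset[OF \<xi>_NL_continuous[OF \<psi>]]]) (use a t in auto)
  then have "((\<lambda>x. integral {a..x} (\<lambda>t. NL (\<xi> t) \<psi>)) has_real_derivative NL (\<xi> t) \<psi>) (at t)"
    using a t by (subst (asm) at_within_interior) auto
  then have D: "((\<lambda>x. inner (\<xi> a) \<psi> + integral {a..x} (\<lambda>t. NL (\<xi> t) \<psi>)) has_real_derivative NL (\<xi> t) \<psi>) (at t)"
    by (auto intro!: derivative_eq_intros)
  show ?thesis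
  proof (rule has_field_derivative_transform_within_open[OF D, of "{a<..<T}"])
    show "inner (\<xi> a) \<psi> + integral {a..x} (\<lambda>t. NL (\<xi> t) \<psi>) = inner (\<xi> x) \<psi>" if "x \<in> {a<..<T}" for x
      using \<xi>_increment[OF \<psi> a(1), of x] that by auto
  qed (use a t in auto)
qed

end

context inviscid_limit
begin

section \<open>Identification with the given weak limit\<close>

lemma \<theta>_L2: "AE t in lebesgue_on {0<..<T}. \<theta> t \<in> L2 \<Omega>"
  using weak_limit by (simp add: weakly_converges_L2_L2_def bochner_L2_def)

text \<open>Measurability in time has to be extracted from strong measurability: any functional of a
  finitely valued approximant is a simple function, and the coefficients and the norm of
  \<open>\<theta> t\<close> are almost everywhere limits of such functions. Integrability follows
  from the square integrable norm.\<close>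

lemma cf_\<theta>_integrable: "integrable (lebesgue_on {0<..<T}) (\<lambda>t. cf (\<theta> t) j)"
proof -
  let ?M = "lebesgue_on {0<..<T}"
  have "\<theta> \<in> L2_L2 T \<Omega>" using weak_limit by (simp add: weakly_converges_L2_L2_def)
  then obtain \<sigma> :: "nat \<Rightarrow> real \<Rightarrow> real^2 \<Rightarrow> real" where \<sigma>: "\<And>k. finite (\<sigma> k ` {0<..<T})" "\<And>k. \<sigma> k ` {0<..<T} \<subseteq> L2 \<Omega>"
    "\<And>k v. {t \<in> {0<..<T}. \<sigma> k t = v} \<in> sets ?M"
    "AE t in ?M. (\<lambda>k. nrm (\<lambda>x. \<sigma> k t x - \<theta> t x)) \<longlonglongrightarrow> 0"
    and fin: "(\<integral>\<^sup>+t. ennreal ((nrm (\<theta> t))\<^sup>2) \<partial>?M) < \<infinity>"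
    unfolding bochner_L2_def mem_Collect_eq by blast
  have \<sigma>m: "(\<lambda>t. F (\<sigma> k t)) \<in> borel_measurable ?M" for k and F :: "(real^2 \<Rightarrow> real) \<Rightarrow> real"
  proof -
    have "simple_function ?M (\<lambda>t. F (\<sigma> k t))"
      unfolding simple_function_def
    proof
      have "(\<lambda>t. F (\<sigma> k t)) ` space ?M = F ` (\<sigma> k ` {0<..<T})" by (simp add: image_image)
      then show "finite ((\<lambda>t. F (\<sigma> k t)) ` space ?M)" using \<sigma>(1) by simp
      show "\<forall>y\<in>(\<lambda>t. F (\<sigma> k t)) ` space ?M. (\<lambda>t. F (\<sigma> k t)) -` {y} \<inter> space ?M \<in> sets ?M"
      proof
        fix y
        have "(\<lambda>t. F (\<sigma> k t)) -` {y} \<inter> space ?M = (\<Union>v\<in>{v \<in> \<sigma> k ` {0<..<T}. F v = y}. {t \<in> {0<..<T}. \<sigma> k t = v})"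
          by auto
        also have "\<dots> \<in> sets ?M" by (rule sets.finite_UN) (use \<sigma>(1,3) in auto)
        finally show "(\<lambda>t. F (\<sigma> k t)) -` {y} \<inter> space ?M \<in> sets ?M" .
      qed
    qed
    then show ?thesis by (rule borel_measurable_simple_function)
  qed
  have lim: "AE t in ?M. \<theta> t \<in> L2 \<Omega> \<and> (\<lambda>k. cf (\<sigma> k t) j) \<longlonglongrightarrow> cf (\<theta> t) j \<and> (\<lambda>k. nrm (\<sigma> k t)) \<longlonglongrightarrow> nrm (\<theta> t)"
    using \<sigma>(4) \<theta>_L2
  proof (rule AE_mp[OF AE_conjI], intro AE_I2 impI conjI)
    fix t assume t: "t \<in> space ?M" and A: "(\<lambda>k. nrm (\<lambda>x. \<sigma> k t x - \<theta> t x)) \<longlonglongrightarrow> 0 \<and> \<theta> t \<in> L2 \<Omega>"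
    then have L: "\<theta> t \<in> L2 \<Omega>" "\<And>k. \<sigma> k t \<in> L2 \<Omega>"
      using subsetD[OF \<sigma>(2) imageI[of t]] by simp_all
    show "\<theta> t \<in> L2 \<Omega>" by fact
    show "(\<lambda>k. cf (\<sigma> k t) j) \<longlonglongrightarrow> cf (\<theta> t) j"
      unfolding coef_def by (rule L2_inner_tendsto_left[OF L(2,1) _ w_L2]) (use A in auto)
    show "(\<lambda>k. nrm (\<sigma> k t)) \<longlonglongrightarrow> nrm (\<theta> t)"
      by (rule L2_norm_diff_tendsto[OF L(2,1)]) (use A in auto)
  qed
  \<comment> \<open>The pointwise limit \<open>?l\<close> is measurable and differs from
    \<open>g\<close> only on a null set, which completeness of Lebesgue measure forgives.\<close>
  have AEm: "g \<in> borel_measurable ?M" if "\<And>k. f k \<in> borel_measurable ?M" "AE t in ?M. (\<lambda>k. f k t) \<longlonglongrightarrow> g t"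
    for f :: "nat \<Rightarrow> real \<Rightarrow> real" and g
  proof -
    let ?l = "\<lambda>t. lim (\<lambda>k. f k t)"
    have lm: "?l \<in> borel_measurable ?M" using that(1) by measurable
    have "AE t in ?M. ?l t = g t" using that(2) by eventually_elim (rule limI)
    then have "AE t in lebesgue. (if t \<in> {0<..<T} then ?l t else 0) = (if t \<in> {0<..<T} then g t else 0)"
      by (subst (asm) AE_restrict_space_iff) (auto elim: eventually_mono)
    moreover have "(\<lambda>t. if t \<in> {0<..<T} then ?l t else 0) \<in> borel_measurable lebesgue"
      by (rule borel_measurable_if_I[OF lm]) simp
    ultimately have "(\<lambda>t. if t \<in> {0<..<T} then g t else 0) \<in> borel_measurable lebesgue"
      by (rule borel_measurable_AE[rotated])
    then show ?thesis by (rule borel_measurable_if_D)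
  qed
  have m1: "(\<lambda>t. cf (\<theta> t) j) \<in> borel_measurable ?M"
    by (rule AEm[OF \<sigma>m[of "\<lambda>v. cf v j"]]) (use lim in \<open>auto elim: eventually_mono\<close>)
  have m2: "(\<lambda>t. nrm (\<theta> t)) \<in> borel_measurable ?M"
    by (rule AEm[OF \<sigma>m[of nrm]]) (use lim in \<open>auto elim: eventually_mono\<close>)
  have i2: "integrable ?M (\<lambda>t. (nrm (\<theta> t))\<^sup>2)"
    using m2 fin by (intro integrableI_bounded) auto
  have fm: "{0<..<T} \<in> lmeasurable" by (intro lmeasurable_open) auto
  show ?thesis
  proof (rule Bochner_Integration.integrable_bound[OF _ m1])
    show "integrable ?M (\<lambda>t. 1 + (nrm (\<theta> t))\<^sup>2)"
      using i2 finite_measure.integrable_const[OF finite_measure_lebesgue_on[OF fm], of "1::real"]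
      by (intro Bochner_Integration.integrable_add) auto
    show "AE t in ?M. norm (cf (\<theta> t) j) \<le> norm (1 + (nrm (\<theta> t))\<^sup>2)"
      using \<theta>_L2
    proof eventually_elim
      case (elim t)
      have "nrm (w j) = 1"
      proof -
        have "(nrm (w j))\<^sup>2 = 1" using w_orthonormal[of j j] by (simp add: L2_norm_square)
        then show ?thesis using L2_norm_nonneg[of \<Omega> "w j"] by (simp add: power2_eq_1_iff)
      qed
      then have "\<bar>cf (\<theta> t) j\<bar> \<le> nrm (\<theta> t)"
        using L2_Cauchy_Schwarz[OF elim w_L2, of j] by (simp add: coef_def)
      moreover have "0 \<le> (nrm (\<theta> t) - 1)\<^sup>2" by simp
      then have "2 * nrm (\<theta> t) \<le> (nrm (\<theta> t))\<^sup>2 + 1" by (simp add: power2_diff)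
      then have "nrm (\<theta> t) \<le> 1 + (nrm (\<theta> t))\<^sup>2"
        using L2_norm_nonneg[of \<Omega> "\<theta> t"] by linarith
      ultimately show ?case by simp
    qed
  qed
qed

lemma \<Theta>_measurable: "(\<lambda>t. \<Theta> t j) \<in> borel_measurable (lebesgue_on {0<..<T})"
proof -
  have "continuous_on {0..T} (\<lambda>t. \<Theta> t j)"
    unfolding continuous_on_sequentially o_def using \<Theta>_continuous by blast
  then have "continuous_on {0<..<T} (\<lambda>t. \<Theta> t j)" by (rule continuous_on_subset) auto
  then show ?thesis by (rule continuous_imp_measurable_on_sets_lebesgue) simp
qed

text \<open>Test the weak convergence with \<open>sgn (\<theta>\<^sub>j - \<Theta>\<^sub>j) w\<^sub>j\<close>.\<close>

lemma \<Theta>_eq_cf: "AE t in lebesgue_on {0<..<T}. \<Theta> t = cf (\<theta> t)"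
proof -
  let ?M = "lebesgue_on {0<..<T}"
  have fm: "{0<..<T} \<in> lmeasurable" by (intro lmeasurable_open) auto
  have "AE t in ?M. \<Theta> t j = cf (\<theta> t) j" for j
  proof -
    define a where "a t = sgn (cf (\<theta> t) j - \<Theta> t j)" for t
    note [measurable] = borel_measurable_integrable[OF cf_\<theta>_integrable[of j]] \<Theta>_measurable[of j]
    have am[measurable]: "a \<in> borel_measurable ?M" unfolding a_def by measurable
    have af: "finite (a ` {0<..<T})"
      by (rule finite_subset[of _ "{-1, 0, 1}"]) (auto simp: a_def sgn_if)
    have a1: "\<bar>a t\<bar> \<le> 1" for t by (simp add: a_def sgn_if)
    have cb: "\<bar>cf (u n t) j\<bar> \<le> C * nrm (w j)" if "t \<in> {0<..<T}" for n t
    proof -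
      have "t \<ge> 0" using that by simp
      then have "\<bar>cf (u n t) j\<bar> \<le> nrm (u n t) * nrm (w j)"
        unfolding coef_def by (intro L2_Cauchy_Schwarz u_L2 w_L2)
      also have "\<dots> \<le> C * nrm (w j)" by (intro mult_right_mono u_bound \<open>t \<ge> 0\<close>) simp
      finally show ?thesis .
    qed
    have um: "(\<lambda>t. cf (u n t) j) \<in> borel_measurable ?M" for n
      by (rule continuous_imp_measurable_on_sets_lebesgue[OF cf_u_continuous]) auto
    have ci: "integrable ?M (\<lambda>t. C * nrm (w j))"
      by (rule finite_measure.integrable_const[OF finite_measure_lebesgue_on[OF fm]])
    have dom: "(\<lambda>n. LINT t|?M. a t * cf (u n t) j) \<longlonglongrightarrow> (LINT t|?M. a t * \<Theta> t j)"
    proof (rule integral_dominated_convergence[OF _ _ ci])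
      show "AE t in ?M. (\<lambda>n. a t * cf (u n t) j) \<longlonglongrightarrow> a t * \<Theta> t j"
        by (intro AE_I2 tendsto_intros \<Theta>_limit) auto
      show "AE t in ?M. norm (a t * cf (u n t) j) \<le> C * nrm (w j)" for n
      proof (intro AE_I2)
        fix t assume "t \<in> space ?M"
        then have "\<bar>a t\<bar> * \<bar>cf (u n t) j\<bar> \<le> 1 * (C * nrm (w j))" by (intro mult_mono a1 cb) auto
        then show "norm (a t * cf (u n t) j) \<le> C * nrm (w j)" by (simp add: abs_mult)
      qed
    qed (use um in measurable)
    have eq: "(LINT t|?M. a t * \<Theta> t j) = (LINT t|?M. a t * cf (\<theta> t) j)"
      by (rule LIMSEQ_unique[OF dom averages_converge[OF am af]])
    have i1: "integrable ?M (\<lambda>t. a t * cf (\<theta> t) j)"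
    proof (rule Bochner_Integration.integrable_bound[OF cf_\<theta>_integrable[of j]])
      show "AE t in ?M. norm (a t * cf (\<theta> t) j) \<le> norm (cf (\<theta> t) j)"
        using a1 by (intro AE_I2) (simp add: abs_mult mult_left_le_one_le)
    qed measurable
    have i2: "integrable ?M (\<lambda>t. a t * \<Theta> t j)"
    proof (rule Bochner_Integration.integrable_bound[OF ci])
      show "AE t in ?M. norm (a t * \<Theta> t j) \<le> norm (C * nrm (w j))"
      proof (intro AE_I2)
        fix t assume t: "t \<in> space ?M"
        have "\<bar>\<Theta> t j\<bar> \<le> C * nrm (w j)"
          by (rule LIMSEQ_le_const2[OF tendsto_rabs[OF \<Theta>_limit]]) (use t cb in auto)
        then have "\<bar>a t\<bar> * \<bar>\<Theta> t j\<bar> \<le> 1 * (C * nrm (w j))" by (intro mult_mono a1) auto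
        then show "norm (a t * \<Theta> t j) \<le> norm (C * nrm (w j))" using C_nonneg by (simp add: abs_mult)
      qed
    qed measurable
    have ab: "a t * cf (\<theta> t) j - a t * \<Theta> t j = \<bar>cf (\<theta> t) j - \<Theta> t j\<bar>" for t
      by (simp add: a_def sgn_if abs_if algebra_simps)
    have "integrable ?M (\<lambda>t. \<bar>cf (\<theta> t) j - \<Theta> t j\<bar>)"
      using Bochner_Integration.integrable_diff[OF i1 i2] unfolding ab .
    moreover have "(LINT t|?M. \<bar>cf (\<theta> t) j - \<Theta> t j\<bar>) = 0"
      using Bochner_Integration.integral_diff[OF i1 i2] eq unfolding ab by simp
    ultimately have "AE t in ?M. \<bar>cf (\<theta> t) j - \<Theta> t j\<bar> = 0"
      by (subst (asm) integral_nonneg_eq_0_iff_AE) auto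
    then show ?thesis by eventually_elim simp
  qed
  then have "AE t in ?M. \<forall>j. \<Theta> t j = cf (\<theta> t) j" by (simp add: AE_all_countable)
  then show ?thesis by eventually_elim auto
qed

section \<open>Test functions on space-time\<close>

lemma slice_test:
  assumes \<phi>: "\<phi> \<in> test_functions (\<Omega> \<times> {0<..<T})"
  shows "(\<lambda>x. \<phi> (x, t)) \<in> test_functions \<Omega>"
proof -
  obtain K where K: "compact K" "K \<subseteq> \<Omega> \<times> {0<..<T}" "\<And>p. p \<notin> K \<Longrightarrow> \<phi> p = 0" using test_functionsE[OF \<phi>] by blast
  have "smooth_on UNIV (\<lambda>x. \<phi> ((0, t) + (x, 0)))"
    by (rule smooth_on_affine[OF test_functions_smooth[OF \<phi>]])
       (auto simp: linear_iff Basis_prod_def intro!: exI[of _ 1] bexI)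
  then have "smooth_on UNIV (\<lambda>x. \<phi> (x, t))" by simp
  moreover have "compact (fst ` K)" by (intro compact_continuous_image continuous_intros K)
  moreover have "fst ` K \<subseteq> \<Omega>" using K(2) by auto
  moreover have "\<phi> (x, t) = 0" if "x \<notin> fst ` K" for x by (rule K(3)) (use that in force)
  ultimately show ?thesis unfolding test_functions_def by blast
qed

lemma pd_slice:
  assumes "\<And>p. \<phi> differentiable (at p)"
  shows "pd b (\<lambda>x. \<phi> (x, t)) x = pd (b, 0) \<phi> (x, t)"
proof (rule has_derivative_imp_pd)
  have "(\<phi> has_derivative frechet_derivative \<phi> (at (x, t))) (at (x, t))"
    using assms frechet_derivative_works by blast
  moreover have "((\<lambda>x. (x, t)) has_derivative (\<lambda>h. (h, 0))) (at x)"
    by (intro has_derivative_Pair has_derivative_ident has_derivative_const)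
  ultimately show "((\<lambda>x. \<phi> (x, t)) has_derivative (\<lambda>h. frechet_derivative \<phi> (at (x, t)) (h, 0))) (at x)"
    by (rule has_derivative_compose[rotated])
qed

lemma slice_tendsto:
  assumes \<phi>: "\<phi> \<in> test_functions (\<Omega> \<times> {0<..<T})" and t: "t \<longlonglongrightarrow> t0"
  shows "(\<lambda>n. nrm (\<lambda>x. \<phi> (x, t n) - \<phi> (x, t0))) \<longlonglongrightarrow> 0"
proof (rule LIMSEQ_I)
  fix e :: real assume e: "e > 0"
  let ?m = "sqrt (measure lebesgue \<Omega>)"
  define e' where "e' = e / (?m + 1)"
  have m: "?m + 1 > 0" by (intro add_nonneg_pos real_sqrt_ge_zero) auto
  have "e' > 0" "e' * (?m + 1) = e" using e m by (auto simp: e'_def)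
  then have e': "e' > 0" "e' * ?m < e" by (auto simp: distrib_left)
  obtain d where d: "d > 0" "\<And>p q. norm (p - q) < d \<Longrightarrow> \<bar>\<phi> p - \<phi> q\<bar> < e'"
    using test_functions_uniformly_continuous[OF \<phi> e'(1)] by blast
  obtain N where N: "\<And>n. n \<ge> N \<Longrightarrow> norm (t n - t0) < d" using LIMSEQ_D[OF t d(1)] by auto
  have "nrm (\<lambda>x. \<phi> (x, t n) - \<phi> (x, t0)) < e" if "n \<ge> N" for n
  proof -
    have "\<bar>\<phi> (x, t n) - \<phi> (x, t0)\<bar> \<le> e'" for x
      by (rule less_imp_le[OF d(2)]) (use N[OF that] in \<open>simp add: norm_Pair\<close>)
    then have "nrm (\<lambda>x. \<phi> (x, t n) - \<phi> (x, t0)) \<le> e' * ?m"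
      using e' by (intro nrm_bounded_le L2_measurable L2_diff test_in_L2[OF slice_test[OF \<phi>]]) auto
    with e'(2) show ?thesis by linarith
  qed
  then show "\<exists>N. \<forall>n\<ge>N. norm (nrm (\<lambda>x. \<phi> (x, t n) - \<phi> (x, t0)) - 0) < e" by auto
qed

lemma slice_diffquot_tendsto:
  assumes \<phi>: "\<phi> \<in> test_functions (\<Omega> \<times> {0<..<T})" and t: "t \<longlonglongrightarrow> t0" "\<And>n. t n \<noteq> t0"
  shows "(\<lambda>n. nrm (\<lambda>x. 1 / (t n - t0) * (\<phi> (x, t n) - \<phi> (x, t0)) - pd (0, 1) \<phi> (x, t0))) \<longlonglongrightarrow> 0"
proof (rule LIMSEQ_I)
  fix e :: real assume e: "e > 0"
  let ?m = "sqrt (measure lebesgue \<Omega>)"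
  define e' where "e' = e / (?m + 1)"
  have m: "?m + 1 > 0" by (intro add_nonneg_pos real_sqrt_ge_zero) auto
  have "e' > 0" "e' * (?m + 1) = e" using e m by (auto simp: e'_def)
  then have e': "e' > 0" "e' * ?m < e" by (auto simp: distrib_left)
  obtain d where d: "d > 0" "\<And>p v. norm v < d \<Longrightarrow> \<bar>\<phi> (p + v) - \<phi> p - frechet_derivative \<phi> (at p) v\<bar> \<le> e' * norm v"
    using test_functions_linearization[OF \<phi> e'(1)] by blast
  obtain N where N: "\<And>n. n \<ge> N \<Longrightarrow> norm (t n - t0) < d" using LIMSEQ_D[OF t(1) d(1)] by auto
  have dt: "pd (0, 1) \<phi> \<in> test_functions (\<Omega> \<times> {0<..<T})"
    by (rule test_functions_pd[OF \<phi>]) (simp add: Basis_prod_def)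
  have "nrm (\<lambda>x. 1 / (t n - t0) * (\<phi> (x, t n) - \<phi> (x, t0)) - pd (0, 1) \<phi> (x, t0)) < e" if "n \<ge> N" for n
  proof -
    let ?h = "t n - t0"
    have h: "?h \<noteq> 0" using t(2)[of n] by simp
    have "\<bar>1 / ?h * (\<phi> (x, t n) - \<phi> (x, t0)) - pd (0, 1) \<phi> (x, t0)\<bar> \<le> e'" for x
    proof -
      have "frechet_derivative \<phi> (at (x, t0)) (?h *\<^sub>R (0, 1)) = ?h * pd (0, 1) \<phi> (x, t0)"
        by (subst linear_cmul[OF linear_frechet_derivative[OF test_functions_differentiable[OF \<phi>]]]) simp
      then have "frechet_derivative \<phi> (at (x, t0)) (0, ?h) = ?h * pd (0, 1) \<phi> (x, t0)" by simp
      then have "\<bar>\<phi> (x, t n) - \<phi> (x, t0) - ?h * pd (0, 1) \<phi> (x, t0)\<bar> \<le> e' * \<bar>?h\<bar>"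
        using d(2)[of "(0, ?h)" "(x, t0)"] N[OF that] by (simp add: norm_Pair)
      moreover have "1 / ?h * (\<phi> (x, t n) - \<phi> (x, t0)) - pd (0, 1) \<phi> (x, t0)
          = (\<phi> (x, t n) - \<phi> (x, t0) - ?h * pd (0, 1) \<phi> (x, t0)) / ?h"
        using h by (simp add: field_simps)
      ultimately show ?thesis using h by (simp add: abs_divide divide_le_eq)
    qed
    then have "nrm (\<lambda>x. 1 / ?h * (\<phi> (x, t n) - \<phi> (x, t0)) - pd (0, 1) \<phi> (x, t0)) \<le> e' * ?m"
      using e' by (intro nrm_bounded_le L2_measurable L2_diff L2_cmult test_in_L2[OF slice_test[OF \<phi>]]
          test_in_L2[OF slice_test[OF dt]]) auto
    with e'(2) show ?thesis by linarith
  qed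
  then show "\<exists>N. \<forall>n\<ge>N. norm (nrm (\<lambda>x. 1 / (t n - t0) * (\<phi> (x, t n) - \<phi> (x, t0)) - pd (0, 1) \<phi> (x, t0)) - 0) < e" by auto
qed

lemma \<xi>_slice_continuous:
  assumes \<phi>: "\<phi> \<in> test_functions (\<Omega> \<times> {0<..<T})"
  shows "continuous_on {0..T} (\<lambda>t. inner (\<xi> t) (\<lambda>x. \<phi> (x, t)))"
  unfolding continuous_on_sequentially o_def
  by (intro allI ballI impI \<xi>_inner_tendsto test_in_L2[OF slice_test[OF \<phi>]] slice_tendsto[OF \<phi>]) auto

text \<open>Product rule with one weak factor. The difference quotient splits into
  \<open>\<xi>\<close> at the moving time paired with the quotient of \<open>\<phi>\<close>, a
  weakly times a strongly convergent sequence, and the quotient of \<open>\<xi>\<close> paired with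
  the fixed slice at \<open>t0\<close>, handled by \<open>\<xi>_derivative\<close>.\<close>

lemma \<xi>_slice_derivative:
  assumes \<phi>: "\<phi> \<in> test_functions (\<Omega> \<times> {0<..<T})" and t0: "0 < t0" "t0 < T"
  shows "((\<lambda>t. inner (\<xi> t) (\<lambda>x. \<phi> (x, t))) has_real_derivative
    inner (\<xi> t0) (\<lambda>x. pd (0, 1) \<phi> (x, t0)) + NL (\<xi> t0) (\<lambda>x. \<phi> (x, t0))) (at t0)"
proof -
  let ?G = "\<lambda>t. inner (\<xi> t) (\<lambda>x. \<phi> (x, t))"
  let ?D = "inner (\<xi> t0) (\<lambda>x. pd (0, 1) \<phi> (x, t0)) + NL (\<xi> t0) (\<lambda>x. \<phi> (x, t0))"
  note sl = slice_test[OF \<phi>] and slL = test_in_L2[OF slice_test[OF \<phi>]]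
  have dt: "pd (0, 1) \<phi> \<in> test_functions (\<Omega> \<times> {0<..<T})"
    by (rule test_functions_pd[OF \<phi>]) (simp add: Basis_prod_def)
  have "((\<lambda>y. (?G y - ?G t0) / (y - t0)) \<longlongrightarrow> ?D) (at t0 within {0<..<T})"
    unfolding tendsto_at_iff_sequentially
  proof (intro allI impI)
    fix X assume X0: "\<forall>i. X i \<in> {0<..<T} - {t0}" and X: "X \<longlonglongrightarrow> t0"
    have Xi: "X i \<in> {0..T}" "X i \<noteq> t0" for i using X0[rule_format, of i] by auto
    have L0: "\<xi> t0 \<in> L2 \<Omega>" by (rule \<xi>(1)) (use t0 in auto)
    have 1: "(\<lambda>i. inner (\<xi> (X i)) (\<lambda>x. 1 / (X i - t0) * (\<phi> (x, X i) - \<phi> (x, t0)))) \<longlonglongrightarrow> inner (\<xi> t0) (\<lambda>x. pd (0, 1) \<phi> (x, t0))"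
      by (rule \<xi>_inner_tendsto[OF Xi(1) _ X L2_cmult[OF L2_diff[OF slL slL]] test_in_L2[OF slice_test[OF dt]]
            slice_diffquot_tendsto[OF \<phi> X Xi(2)]]) (use t0 in auto)
    have "((\<lambda>y. (inner (\<xi> y) (\<lambda>x. \<phi> (x, t0)) - inner (\<xi> t0) (\<lambda>x. \<phi> (x, t0))) / (y - t0)) \<longlongrightarrow> NL (\<xi> t0) (\<lambda>x. \<phi> (x, t0))) (at t0)"
      using \<xi>_derivative[OF sl t0] by (simp add: has_field_derivative_iff)
    then have 2: "(\<lambda>i. (inner (\<xi> (X i)) (\<lambda>x. \<phi> (x, t0)) - inner (\<xi> t0) (\<lambda>x. \<phi> (x, t0))) / (X i - t0)) \<longlonglongrightarrow> NL (\<xi> t0) (\<lambda>x. \<phi> (x, t0))"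
      unfolding tendsto_at_iff_sequentially o_def using Xi(2) X by auto
    have "(?G (X i) - ?G t0) / (X i - t0) = inner (\<xi> (X i)) (\<lambda>x. 1 / (X i - t0) * (\<phi> (x, X i) - \<phi> (x, t0)))
        + (inner (\<xi> (X i)) (\<lambda>x. \<phi> (x, t0)) - inner (\<xi> t0) (\<lambda>x. \<phi> (x, t0))) / (X i - t0)" for i
      unfolding L2_inner_cmult_right L2_inner_diff_right[OF slL slL \<xi>(1)[OF Xi(1)]]
      by (simp add: diff_divide_distrib)
    then show "((\<lambda>y. (?G y - ?G t0) / (y - t0)) \<circ> X) \<longlonglongrightarrow> ?D"
      unfolding o_def using tendsto_add[OF 1 2] by simp
  qed
  then have "((\<lambda>y. (?G y - ?G t0) / (y - t0)) \<longlongrightarrow> ?D) (at t0)"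
    using t0 by (subst (asm) at_within_open) auto
  then show ?thesis by (simp add: has_field_derivative_iff)
qed

lemma slice_second_derivatives_bounded:
  assumes \<phi>: "\<phi> \<in> test_functions (\<Omega> \<times> {0<..<T})"
  obtains B where "B \<ge> 0" "\<And>a b t x. \<bar>pd (ex a) (pd (ex b) (\<lambda>x. \<phi> (x, t))) x\<bar> \<le> B"
proof -
  have b0: "(ex i, 0::real) \<in> Basis" for i by (simp add: Basis_prod_def)
  note d = test_functions_pd[OF \<phi> b0]
  have eq: "pd (ex a) (pd (ex b) (\<lambda>x. \<phi> (x, t))) x = pd (ex a, 0) (pd (ex b, 0) \<phi>) (x, t)" for a b t x
  proof -
    have "pd (ex b) (\<lambda>x. \<phi> (x, t)) = (\<lambda>x. pd (ex b, 0) \<phi> (x, t))"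
      using pd_slice[OF test_functions_differentiable[OF \<phi>]] by (intro ext)
    then show ?thesis using pd_slice[OF test_functions_differentiable[OF d[of b]]] by simp
  qed
  have "\<exists>B. B \<ge> 0 \<and> (\<forall>p. \<bar>pd (ex a, 0) (pd (ex b, 0) \<phi>) p\<bar> \<le> B)" for a b
    by (rule test_functions_bounded[OF test_functions_pd[OF d[of b] b0[of a]]]) blast
  then have ex: "\<exists>B. B \<ge> 0 \<and> (\<forall>t x. \<bar>pd (ex a) (pd (ex b) (\<lambda>x. \<phi> (x, t))) x\<bar> \<le> B)" for a b
    unfolding eq by blast
  define M where "M a b = (SOME B. B \<ge> 0 \<and> (\<forall>t x. \<bar>pd (ex a) (pd (ex b) (\<lambda>x. \<phi> (x, t))) x\<bar> \<le> B))" for a b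
  have "M a b \<ge> 0 \<and> (\<forall>t x. \<bar>pd (ex a) (pd (ex b) (\<lambda>x. \<phi> (x, t))) x\<bar> \<le> M a b)" for a b
    unfolding M_def by (rule someI_ex[OF ex])
  then have M: "\<And>a b. M a b \<ge> 0" "\<And>a b t x. \<bar>pd (ex a) (pd (ex b) (\<lambda>x. \<phi> (x, t))) x\<bar> \<le> M a b" by auto
  show thesis
  proof (rule that[of "\<Sum>a\<in>UNIV. \<Sum>b\<in>UNIV. M a b"])
    show "0 \<le> (\<Sum>a\<in>UNIV. \<Sum>b\<in>UNIV. M a b)" by (intro sum_nonneg M)
    fix a b t x
    have "M a b \<le> (\<Sum>b\<in>UNIV. M a b)" by (rule member_le_sum) (auto simp: M)
    also have "\<dots> \<le> (\<Sum>a\<in>UNIV. \<Sum>b\<in>UNIV. M a b)"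
      by (rule member_le_sum[of a UNIV "\<lambda>a. \<Sum>b\<in>UNIV. M a b"]) (auto intro: sum_nonneg M)
    finally show "\<bar>pd (ex a) (pd (ex b) (\<lambda>x. \<phi> (x, t))) x\<bar> \<le> (\<Sum>a\<in>UNIV. \<Sum>b\<in>UNIV. M a b)" using M(2) order_trans by blast
  qed
qed

text \<open>The sum of both integrands is the classical derivative of the pairing of
  \<open>\<xi>\<close> with the time slices of \<open>\<phi>\<close>, which vanishes at 0 and
  \<open>T\<close>; the fundamental theorem of calculus gives zero. Convergence at every single time
  makes this direct argument possible.\<close>

lemma \<xi>_weak_solution:
  assumes \<phi>: "\<phi> \<in> test_functions (\<Omega> \<times> {0<..<T})"
  shows "(\<lambda>t. inner (\<xi> t) (\<lambda>x. pd (0, 1) \<phi> (x, t))) \<in> borel_measurable (lebesgue_on {0<..<T})"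
    "(\<lambda>t. NL (\<xi> t) (\<lambda>x. \<phi> (x, t))) \<in> borel_measurable (lebesgue_on {0<..<T})"
    "(LINT t|lebesgue_on {0<..<T}. inner (\<xi> t) (\<lambda>x. pd (0, 1) \<phi> (x, t)))
      + (LINT t|lebesgue_on {0<..<T}. NL (\<xi> t) (\<lambda>x. \<phi> (x, t))) = 0"
proof -
  let ?M = "lebesgue_on {0<..<T}"
  let ?I1 = "\<lambda>t. inner (\<xi> t) (\<lambda>x. pd (0, 1) \<phi> (x, t))" and ?I2 = "\<lambda>t. NL (\<xi> t) (\<lambda>x. \<phi> (x, t))"
  let ?G = "\<lambda>t. inner (\<xi> t) (\<lambda>x. \<phi> (x, t))"
  have dt: "pd (0, 1) \<phi> \<in> test_functions (\<Omega> \<times> {0<..<T})"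
    by (rule test_functions_pd[OF \<phi>]) (simp add: Basis_prod_def)
  have G0: "?G 0 = 0" "?G T = 0"
    using test_functions_eq_0[OF \<phi>, of "(_, 0)"] test_functions_eq_0[OF \<phi>, of "(_, T)"] by (auto simp: L2_inner_def)
  have "((\<lambda>t. ?I1 t + ?I2 t) has_integral (?G T - ?G 0)) {0..T}"
  proof (rule fundamental_theorem_of_calculus_interior)
    show "continuous_on {0..T} ?G" by (rule \<xi>_slice_continuous[OF \<phi>])
    show "(?G has_vector_derivative ?I1 t + ?I2 t) (at t)" if "t \<in> {0<..<T}" for t
      using \<xi>_slice_derivative[OF \<phi>, of t] that by (simp add: has_real_derivative_iff_has_vector_derivative)
  qed (use T in simp)
  then have H: "((\<lambda>t. ?I1 t + ?I2 t) has_integral 0) {0<..<T}" unfolding G0 has_integral_Icc_iff_Ioo by simp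
  have c1: "continuous_on {0..T} ?I1" by (rule \<xi>_slice_continuous[OF dt])
  have h1: "?I1 integrable_on {0<..<T}"
    unfolding integrable_on_Icc_iff_Ioo[symmetric] by (rule integrable_continuous_real[OF c1])
  \<comment> \<open>Here \<open>NL\<close> depends on \<open>t\<close> through both arguments. Its
    integrability is read off as the sum minus \<open>?I1\<close>, and the uniform bound then yields
    Lebesgue integrability.\<close>
  have h2: "?I2 integrable_on {0<..<T}"
    using integrable_diff[OF has_integral_integrable[OF H] h1] by simp
  show m1: "?I1 \<in> borel_measurable ?M" by (rule integrable_imp_measurable[OF h1])
  show m2: "?I2 \<in> borel_measurable ?M" by (rule integrable_imp_measurable[OF h2])
  have fm: "{0<..<T} \<in> lmeasurable" by (intro lmeasurable_open) auto
  have bi: "integrable ?M f" if "f \<in> borel_measurable ?M" "\<And>t. t \<in> {0<..<T} \<Longrightarrow> \<bar>f t\<bar> \<le> K" for f and K :: real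
    by (rule Bochner_Integration.integrable_bound[OF finite_measure.integrable_const[OF finite_measure_lebesgue_on[OF fm], of K] that(1)])
       (use that(2) in \<open>auto intro!: AE_I2 order_trans[OF that(2) abs_ge_self]\<close>)
  obtain B1 where B1: "\<forall>y\<in>?I1 ` {0..T}. norm y \<le> B1"
    using compact_imp_bounded[OF compact_continuous_image[OF c1 compact_Icc]] unfolding bounded_iff by blast
  have i1: "integrable ?M ?I1"
    by (rule bi[OF m1, of B1]) (use B1 in force)
  obtain B where B: "B \<ge> 0" "\<And>a b t x. \<bar>pd (ex a) (pd (ex b) (\<lambda>x. \<phi> (x, t))) x\<bar> \<le> B"
    using slice_second_derivatives_bounded[OF \<phi>] by blast
  have i2: "integrable ?M ?I2"
  proof (rule bi[OF m2])
    fix t assume t: "t \<in> {0<..<T}"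
    then have t': "t \<in> {0..T}" by auto
    have "\<bar>?I2 t\<bar> \<le> B * ((nrm (\<xi> t))\<^sup>2 / \<mu> 0)" by (rule NL_bound[OF \<xi>(1)[OF t'] slice_test[OF \<phi>] B(2,1)])
    also have "\<dots> \<le> B * (C\<^sup>2 / \<mu> 0)"
      using \<mu>_pos[of 0] by (intro mult_left_mono divide_right_mono power_mono \<xi>(3)[OF t'] B) auto
    finally show "\<bar>?I2 t\<bar> \<le> B * (C\<^sup>2 / \<mu> 0)" .
  qed
  have "(LINT t|?M. ?I1 t) + (LINT t|?M. ?I2 t) = (LINT t|?M. ?I1 t + ?I2 t)"
    using i1 i2 by simp
  also have "\<dots> = integral {0<..<T} (\<lambda>t. ?I1 t + ?I2 t)"
    by (rule lebesgue_integral_eq_integral) (use i1 i2 in auto)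
  also have "\<dots> = 0" using H by (rule integral_unique)
  finally show "(LINT t|?M. ?I1 t) + (LINT t|?M. ?I2 t) = 0" .
qed

text \<open>Both integrals depend on \<open>\<theta> t\<close> only through its coefficients, which
  agree with those of \<open>\<xi> t\<close> for almost every \<open>t\<close>; the equation for
  \<open>\<xi>\<close> carries over.\<close>

lemma limit_weak_solution: "inviscid_weak_solution \<Omega> w lam T \<theta>"
  unfolding inviscid_weak_solution_def
proof
  fix \<phi> :: "(real^2) \<times> real \<Rightarrow> real" assume \<phi>: "\<phi> \<in> test_functions (\<Omega> \<times> {0<..<T})"
  let ?M = "lebesgue_on {0<..<T}"
  have dt: "pd (0, 1) \<phi> \<in> test_functions (\<Omega> \<times> {0<..<T})"
    by (rule test_functions_pd[OF \<phi>]) (simp add: Basis_prod_def)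
  have ae: "AE t in ?M. t \<in> {0..T} \<and> \<theta> t \<in> L2 \<Omega> \<and> cf (\<theta> t) = cf (\<xi> t)"
    using \<theta>_L2 \<Theta>_eq_cf
  proof (rule AE_mp[OF AE_conjI], intro AE_I2 impI)
    fix t assume "t \<in> space ?M" "\<theta> t \<in> L2 \<Omega> \<and> \<Theta> t = cf (\<theta> t)"
    then show "t \<in> {0..T} \<and> \<theta> t \<in> L2 \<Omega> \<and> cf (\<theta> t) = cf (\<xi> t)" using \<xi>(2)[of t] by simp
  qed
  have "(LINT t|?M. LINT x|MO. \<theta> t x * frechet_derivative \<phi> (at (x, t)) (0, 1))
      = (LINT t|?M. inner (\<xi> t) (\<lambda>x. pd (0, 1) \<phi> (x, t)))"
  proof (rule integral_cong_AE_lebesgue_on[OF \<xi>_weak_solution(1)[OF \<phi>]])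
    show "AE t in ?M. (LINT x|MO. \<theta> t x * frechet_derivative \<phi> (at (x, t)) (0, 1)) = inner (\<xi> t) (\<lambda>x. pd (0, 1) \<phi> (x, t))"
      using ae
    proof eventually_elim
      case (elim t)
      then show ?case
        using inner_cong_cf[OF _ \<xi>(1) test_in_L2[OF slice_test[OF dt]], of "\<theta> t" t t] by (simp add: L2_inner_def)
    qed
  qed simp
  moreover have "(LINT t|?M. LINT x|MO. (\<theta> t x *\<^sub>R sqg_velocity \<Omega> w lam (\<theta> t) x)
        \<bullet> (\<chi> i. frechet_derivative \<phi> (at (x, t)) (axis i 1, 0)))
      = (LINT t|?M. NL (\<xi> t) (\<lambda>x. \<phi> (x, t)))"
  proof (rule integral_cong_AE_lebesgue_on[OF \<xi>_weak_solution(2)[OF \<phi>]])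
    show "AE t in ?M. (LINT x|MO. (\<theta> t x *\<^sub>R sqg_velocity \<Omega> w lam (\<theta> t) x)
        \<bullet> (\<chi> i. frechet_derivative \<phi> (at (x, t)) (axis i 1, 0))) = NL (\<xi> t) (\<lambda>x. \<phi> (x, t))"
      using ae
    proof eventually_elim
      case (elim t)
      note sl = slice_test[OF \<phi>, of t]
      have p: "pd (ex i) (\<lambda>x. \<phi> (x, t)) = (\<lambda>x. frechet_derivative \<phi> (at (x, t)) (axis i 1, 0))" for i
        using pd_slice[OF test_functions_differentiable[OF \<phi>]] by (intro ext)
      have "(LINT x|MO. (\<theta> t x *\<^sub>R sqg_velocity \<Omega> w lam (\<theta> t) x)
          \<bullet> (\<chi> i. frechet_derivative \<phi> (at (x, t)) (axis i 1, 0))) = NL (\<theta> t) (\<lambda>x. \<phi> (x, t))"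
      proof (rule NL_integral[OF _ sl])
        fix i
        show "(\<lambda>x. (\<chi> i. frechet_derivative \<phi> (at (x, t)) (axis i 1, 0)) $ i) \<in> borel_measurable MO"
          using test_measurable[OF test_functions_pd[OF sl ex_Basis[of i]]] by (simp add: p)
        show "AE x in MO. (\<chi> i. frechet_derivative \<phi> (at (x, t)) (axis i 1, 0)) $ i = pd (ex i) (\<lambda>x. \<phi> (x, t)) x"
          by (simp add: fun_cong[OF p, simplified])
      qed (use elim in simp)
      also have "\<dots> = NL (\<xi> t) (\<lambda>x. \<phi> (x, t))" by (rule NL_cong_cf[OF _ \<xi>(1) sl]) (use elim in auto)
      finally show ?case .
    qed
  qed simp
  ultimately show "(LINT t|?M. LINT x|MO. \<theta> t x * frechet_derivative \<phi> (at (x, t)) (0, 1))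
      + (LINT t|?M. LINT x|MO. (\<theta> t x *\<^sub>R sqg_velocity \<Omega> w lam (\<theta> t) x)
        \<bullet> (\<chi> i. frechet_derivative \<phi> (at (x, t)) (axis i 1, 0))) = 0"
    using \<xi>_weak_solution(3)[OF \<phi>] by simp
qed

section \<open>Continuity in time and conservation of the Hamiltonian\<close>

lemma \<Theta>_continuous_D:
  assumes "\<epsilon> > 0"
  shows "continuous_D lam (- \<epsilon>) T \<Theta>"
  unfolding continuous_D_def
proof (intro conjI ballI)
  fix t assume t: "t \<in> {0..T}"
  show "\<Theta> t \<in> D_seq lam (- \<epsilon>)"
    unfolding D_seq_def using summable_powr_negative(1)[OF _ \<Theta>_square(1)[OF t], of "- \<epsilon>"] assms by simp
  show "((\<lambda>r. D_norm lam (- \<epsilon>) (\<lambda>j. \<Theta> r j - \<Theta> t j)) \<longlongrightarrow> 0) (at t within {0..T})"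
    unfolding tendsto_at_iff_sequentially o_def
  proof (intro allI impI)
    fix X assume "\<forall>i. X i \<in> {0..T} - {t}" and X: "X \<longlonglongrightarrow> t"
    then have Xi: "X i \<in> {0..T}" for i by auto
    note sq = summable_square_diff[OF \<Theta>_square(1)[OF Xi] \<Theta>_square(1)[OF t]]
    show "(\<lambda>i. D_norm lam (- \<epsilon>) (\<lambda>j. \<Theta> (X i) j - \<Theta> t j)) \<longlonglongrightarrow> 0"
    proof (rule D_norm_tendsto_0[OF assms sq(1)])
      show "(\<Sum>j. (\<Theta> (X i) j - \<Theta> t j)\<^sup>2) \<le> 4 * C\<^sup>2" for i
        using sq(2)[of i] \<Theta>_square(2)[OF Xi[of i]] \<Theta>_square(2)[OF t] by linarith
      show "(\<lambda>i. \<Theta> (X i) j - \<Theta> t j) \<longlonglongrightarrow> 0" for j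
        using \<Theta>_continuous[OF Xi t X, of j] by (simp add: LIM_zero_iff)
    qed
  qed
qed

text \<open>Convergence of the differences in D(Lambda^(-1/2)) forces convergence of the norms.
  \<open>Hn\<close> is rewritten as the squared L^2 norm of Lambda^(-1/2) applied to the function,
  so that continuity of the L^2 norm does the work.\<close>

lemma Hn_tendsto:
  assumes f: "\<And>n. f n \<in> L2 \<Omega>" "\<And>n. nrm (f n) \<le> C'" and g: "g \<in> L2 \<Omega>"
    and lim: "\<And>j. (\<lambda>n. cf (f n) j) \<longlonglongrightarrow> cf g j"
  shows "(\<lambda>n. Hn (cf (f n))) \<longlonglongrightarrow> Hn (cf g)"
proof -
  let ?L = "Lam \<Omega> w lam (- 1 / 2)"
  have sm: "summable (\<lambda>j. (lam j powr (- 1 / 2 / 2) * cf h j)\<^sup>2)" if "h \<in> L2 \<Omega>" for h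
    using summable_powr_negative(1)[OF _ summable_cf_square[OF that], of "- 1 / 2"] by simp
  note L = Lam[OF sm]
  have H: "Hn (cf h) = (nrm (?L h))\<^sup>2" if "h \<in> L2 \<Omega>" for h
  proof -
    have "(\<lambda>j. (cf h j)\<^sup>2 / \<mu> j) sums (nrm (?L h))\<^sup>2"
      using Parseval_square[OF L(1)[OF that]] unfolding L(2)[OF that] powr_quarter .
    then show ?thesis using Hn_sums[OF summable_cf_square[OF that]] by (rule sums_unique2[rotated])
  qed
  have D: "Hn (\<lambda>j. cf (f n) j - cf g j) = (nrm (\<lambda>x. ?L (f n) x - ?L g x))\<^sup>2" for n
  proof -
    note d = L2_diff[OF L(1)[OF f(1)[of n]] L(1)[OF g]]
    have "cf (\<lambda>x. ?L (f n) x - ?L g x) j = lam j powr (- 1 / 2 / 2) * (cf (f n) j - cf g j)" for j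
      by (simp only: cf_diff[OF L(1)[OF f(1)[of n]] L(1)[OF g]] L(2)[OF f(1)[of n]] L(2)[OF g] right_diff_distrib)
    then have "(\<lambda>j. (cf (f n) j - cf g j)\<^sup>2 / \<mu> j) sums (nrm (\<lambda>x. ?L (f n) x - ?L g x))\<^sup>2"
      using Parseval_square[OF d] by (simp only: powr_quarter)
    then show ?thesis
      using Hn_sums[OF summable_square_diff(1)[OF summable_cf_square[OF f(1)[of n]] summable_cf_square[OF g]]]
      by (rule sums_unique2[rotated])
  qed
  have "(\<lambda>n. sqrt (Hn (\<lambda>j. cf (f n) j - cf g j))) \<longlonglongrightarrow> sqrt 0"
    by (intro tendsto_real_sqrt Hn_cf_diff_tendsto[OF f g lim])
  then have "(\<lambda>n. nrm (\<lambda>x. ?L (f n) x - ?L g x)) \<longlonglongrightarrow> 0" by (simp add: D)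
  from tendsto_power[OF L2_norm_diff_tendsto[OF L(1)[OF f(1)] L(1)[OF g] this], of 2]
  show ?thesis by (simp add: H f g)
qed

text \<open>The Hamiltonians of the initial data may fail to converge, so the limit is compared with
  itself at two good times; each deviates from the initial value by O(\<open>\<nu>\<close>), which
  cancels in the limit. Good times are dense, and continuity of \<open>Hn\<close> along
  \<open>\<xi>\<close> gives all times.\<close>

lemma Hamiltonian_constant:
  assumes s1: "s \<le> 1"
  shows "\<exists>c. \<forall>t\<in>{0..T}. (D_norm lam (- 1 / 2) (\<Theta> t))\<^sup>2 = c"
proof -
  define K where "K = (lam 0 powr ((s - 1) / 2 / 2))\<^sup>2 * C\<^sup>2"
  let ?P = "\<lambda>t. \<forall>n. \<bar>Hn (cf (u n t)) - Hn (cf (\<theta>0 (r n)))\<bar> \<le> 2 * \<nu> (r n) * (K * t)"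
  have "AE t in lebesgue_on {0<..}. \<bar>Hn (cf (u n t)) - Hn (cf (\<theta>0 (r n)))\<bar> \<le> 2 * \<nu> (r n) * (K * t)" for n
    using LH_Hamiltonian[OF s \<nu>_pos LH s1, of "r n"]
  proof (rule AE_mp, intro AE_I2 impI)
    fix t assume t: "t \<in> space (lebesgue_on {0<..})"
      and le: "\<bar>Hn (cf (u n t)) - Hn (cf (\<theta>0 (r n)))\<bar> \<le> 2 * \<nu> (r n) * ((lam 0 powr ((s - 1) / 2 / 2))\<^sup>2 * (nrm (\<theta>0 (r n)))\<^sup>2 * t)"
    have "2 * \<nu> (r n) * ((lam 0 powr ((s - 1) / 2 / 2))\<^sup>2 * (nrm (\<theta>0 (r n)))\<^sup>2 * t) \<le> 2 * \<nu> (r n) * (K * t)"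
      unfolding K_def using t less_imp_le[OF \<nu>_pos[of "r n"]]
      by (intro mult_left_mono mult_right_mono power_mono \<theta>0_bound) auto
    with le show "\<bar>Hn (cf (u n t)) - Hn (cf (\<theta>0 (r n)))\<bar> \<le> 2 * \<nu> (r n) * (K * t)" by linarith
  qed
  \<comment> \<open>Countably many exceptional null sets are united, so that one set of good times
    serves all \<open>n\<close>.\<close>
  then have ae: "AE t in lebesgue_on {0<..}. ?P t" by (simp add: AE_all_countable)
  have lim: "(\<lambda>n. Hn (cf (u n t))) \<longlonglongrightarrow> Hn (\<Theta> t)" if t: "t \<in> {0..T}" for t
    using Hn_tendsto[OF u_L2 u_bound \<xi>(1)[OF t], of "\<lambda>_. t"] \<Theta>_limit[OF t] \<xi>(2)[OF t] t by simp
  have eq: "Hn (\<Theta> a) = Hn (\<Theta> b)" if "a \<in> {0<..<T}" "b \<in> {0<..<T}" "?P a" "?P b" for a b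
  proof -
    have "(\<lambda>n. Hn (cf (u n a)) - Hn (cf (u n b))) \<longlonglongrightarrow> 0"
    proof (rule Lim_null_comparison)
      have "(\<lambda>n. \<nu> (r n)) \<longlonglongrightarrow> 0" using LIMSEQ_subseq_LIMSEQ[OF \<nu>_lim r] by (simp add: o_def)
      then have "(\<lambda>n. 2 * \<nu> (r n) * (K * a) + 2 * \<nu> (r n) * (K * b)) \<longlonglongrightarrow> 2 * 0 * (K * a) + 2 * 0 * (K * b)"
        by (intro tendsto_intros)
      then show "(\<lambda>n. 2 * \<nu> (r n) * (K * a) + 2 * \<nu> (r n) * (K * b)) \<longlonglongrightarrow> 0" by simp
      show "\<forall>\<^sub>F n in sequentially. norm (Hn (cf (u n a)) - Hn (cf (u n b))) \<le> 2 * \<nu> (r n) * (K * a) + 2 * \<nu> (r n) * (K * b)"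
      proof (intro always_eventually allI)
        fix n
        show "norm (Hn (cf (u n a)) - Hn (cf (u n b))) \<le> 2 * \<nu> (r n) * (K * a) + 2 * \<nu> (r n) * (K * b)"
          using that(3)[rule_format, of n] that(4)[rule_format, of n] unfolding real_norm_def by linarith
      qed
    qed
    moreover have "(\<lambda>n. Hn (cf (u n a)) - Hn (cf (u n b))) \<longlonglongrightarrow> Hn (\<Theta> a) - Hn (\<Theta> b)"
      by (intro tendsto_diff lim) (use that in auto)
    ultimately show ?thesis using LIMSEQ_unique by fastforce
  qed
  have dense: "\<exists>t\<in>{0<..<T}. ?P t \<and> \<bar>t - t0\<bar> < e" if t0: "t0 \<in> {0..T}" and e: "e > 0" for t0 e
  proof -
    define a b where "a = max 0 (t0 - e)" and "b = min T (t0 + e)"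
    have ab: "a < b" "0 \<le> a" "b \<le> T" using t0 e T by (auto simp: a_def b_def)
    obtain t where "t \<in> {a<..<b}" "?P t"
      by (rule AE_interval_witness[OF ae _ _ ab(1)]) (use ab in auto)
    then show ?thesis using ab by (intro bexI[of _ t]) (auto simp: a_def b_def)
  qed
  obtain a where a: "a \<in> {0<..<T}" "?P a" using dense[of 0 1] T by auto
  have "Hn (\<Theta> t0) = Hn (\<Theta> a)" if t0: "t0 \<in> {0..T}" for t0
  proof -
    have "\<forall>n. \<exists>t. t \<in> {0<..<T} \<and> ?P t \<and> \<bar>t - t0\<bar> < 1 / Suc n" using dense[OF t0] by (metis of_nat_0_less_iff zero_less_Suc zero_less_divide_1_iff)
    then obtain \<tau> where \<tau>: "\<And>n. \<tau> n \<in> {0<..<T}" "\<And>n. ?P (\<tau> n)" "\<And>n. \<bar>\<tau> n - t0\<bar> < 1 / Suc n"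
      by (auto dest!: choice)
    have \<tau>': "\<tau> n \<in> {0..T}" for n using \<tau>(1)[of n] by auto
    have "(\<lambda>n. \<tau> n - t0) \<longlonglongrightarrow> 0"
    proof (rule Lim_null_comparison)
      show "(\<lambda>n. 1 / real (Suc n)) \<longlonglongrightarrow> 0" using LIMSEQ_inverse_real_of_nat by (simp add: divide_inverse)
      show "\<forall>\<^sub>F n in sequentially. norm (\<tau> n - t0) \<le> 1 / real (Suc n)"
        using \<tau>(3) by (intro always_eventually) (auto intro: less_imp_le)
    qed
    then have "\<tau> \<longlonglongrightarrow> t0" by (simp add: LIM_zero_iff)
    then have "(\<lambda>n. Hn (cf (\<xi> (\<tau> n)))) \<longlonglongrightarrow> Hn (cf (\<xi> t0))"
      using \<Theta>_continuous[OF \<tau>' t0] \<xi>(2)[OF t0] \<xi>(2)[OF \<tau>']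
      by (intro Hn_tendsto[OF \<xi>(1)[OF \<tau>'] \<xi>(3)[OF \<tau>'] \<xi>(1)[OF t0]]) simp
    then have "(\<lambda>n. Hn (\<Theta> a)) \<longlonglongrightarrow> Hn (\<Theta> t0)"
      using eq[OF a(1) \<tau>(1) a(2) \<tau>(2)] \<xi>(2)[OF t0] \<xi>(2)[OF \<tau>'] by simp
    then show ?thesis by (simp add: LIMSEQ_const_iff)
  qed
  then show ?thesis unfolding Hn_def by blast
qed

end

theorem theorem1p4:
  fixes \<Omega> :: "(real^2) set"
    and w :: "nat \<Rightarrow> real^2 \<Rightarrow> real" and lam :: "nat \<Rightarrow> real"
    and s T :: real and \<nu> :: "nat \<Rightarrow> real"
    and \<theta>0 :: "nat \<Rightarrow> real^2 \<Rightarrow> real"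
    and \<theta>\<nu> :: "nat \<Rightarrow> real \<Rightarrow> real^2 \<Rightarrow> real"
    and \<theta> :: "real \<Rightarrow> real^2 \<Rightarrow> real"
    and r :: "nat \<Rightarrow> nat"
  assumes "smooth_bounded_domain \<Omega>"
    and "dirichlet_eigenbasis \<Omega> w lam"
    and "0 < s" and "s \<le> 2"
    and "\<And>n. 0 < \<nu> n" and "\<nu> \<longlonglongrightarrow> 0"
    and "\<And>n. \<theta>0 n \<in> L2 \<Omega>" and "\<exists>C. \<forall>n. L2_norm \<Omega> (\<theta>0 n) \<le> C"
    and "\<And>n. leray_hopf_solution \<Omega> w lam s (\<nu> n) (\<theta>0 n) (\<theta>\<nu> n)"
    and "0 < T"
    and "strict_mono r" and "weakly_converges_L2_L2 T \<Omega> (\<lambda>k. \<theta>\<nu> (r k)) \<theta>"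
  shows "inviscid_weak_solution \<Omega> w lam T \<theta> \<and>
    (\<exists>\<Theta> :: real \<Rightarrow> nat \<Rightarrow> real.
       (AE t in lebesgue_on {0<..<T}. \<Theta> t = coef \<Omega> w (\<theta> t)) \<and>
       (\<forall>\<epsilon>>0. continuous_D lam (- \<epsilon>) T \<Theta>) \<and>
       (s \<le> 1 \<longrightarrow> (\<exists>c. \<forall>t\<in>{0..T}. (D_norm lam (- 1 / 2) (\<Theta> t))\<^sup>2 = c)))"
proof -
  obtain C where C: "\<And>n. L2_norm \<Omega> (\<theta>0 n) \<le> C" using assms(8) by blast
  \<comment> \<open>A convergent sequence is bounded; \<open>V\<close> enters the Lipschitz constant
    in time.\<close>
  obtain V where "\<And>n. norm (\<nu> n) \<le> V"
    using convergent_imp_Bseq[of \<nu>] assms(6) BseqE[of \<nu>] by (auto simp: convergent_def)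
  then have V: "\<nu> n \<le> V" for n by (metis abs_le_D1 real_norm_def)
  interpret inviscid_limit \<Omega> w lam s T \<nu> \<theta>0 \<theta>\<nu> \<theta> r C V
    by unfold_locales (fact assms C V)+
  show ?thesis
    using limit_weak_solution \<Theta>_eq_cf \<Theta>_continuous_D Hamiltonian_constant by blast
qed

end
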